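(* Let $g>0$ be a constant and let $F:\mathbb{R}\to\mathbb{R}$ be a continuously differentiable function with $F(0)=F(a)=F(1)=0$ for some $a\in\,]0,1[$, such that $F(s)>0$ for $s\in(-\infty,0[\,\cup\,]a,1[$ and $F(s)<0$ for $s\in\,]0,a[\,\cup\,]1,+\infty)$. Assume that \[F'(a)>0.\] Let $\beta>0$. Then, for every integer $m\ge 2$ and each integer $K\ge1$, there is a value $\mu=\mu_K>0$ such that for each $\mu_2\ge\mu_1>\mu$ there is a value $\varepsilon=\varepsilon_{K,\mu_1,\mu_2}>0$ such that the following holds: for every $\beta$-periodic, locally integrable function $n:\mathbb{R}\to\mathbb{R}^+$ which can be written as $n(x)=\bar n+\tilde n(x)$ with $\bar n$ a constant and $\tilde n$ a $\beta$-periodic function satisfying \[\bar n\in[\mu_1,\mu_2]\quad\text{and}\quad |\tilde n|_1<\varepsilon,\] the equation \[v''-g\,v+n(x)F(v)=0\] has at least $2K$ solutions which are $m\beta$-periodic and take values in $\,]0,1[$. Moreover, no two of these solutions belong to the same periodicity class, and none of them is $i\beta$-periodic for any $i=1,2,\dots,m-1$, so that $m\beta$ is their minimal period.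
   Context: $|\tilde n|_1$ denotes the $L^1$-norm of $\tilde n$ over a period interval (the quantities $\mu,\varepsilon$ may depend on $m$ as well). Solutions are understood in the Carathéodory sense. Two $m\beta$-periodic solutions $u,w$ belong to the same periodicity class if $w(\cdot)=u(\cdot+j\beta)$ for some integer $j\in\{0,1,\dots,m-1\}$ (since the equation is $\beta$-periodic in $x$, each such shift of a solution is again an $m\beta$-periodic solution). *)

theory Defs
  imports "HOL-Analysis.Analysis"
begin

definition periodic_fun :: "real \<Rightarrow> (real \<Rightarrow> real) \<Rightarrow> bool" where
  "periodic_fun p u \<longleftrightarrow> (\<forall>x. u (x + p) = u x)"

text \<open>Carath\'eodory solution of  v'' - g v + n(x) F(v) = 0  on the whole real line:
  v is differentiable with derivative w, and w is locally absolutely continuous with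
  w' = g v - n F(v) almost everywhere, i.e. w(y) - w(x) is the integral of
  g v - n F(v) over [x,y].\<close>
definition caratheodory_sol ::
  "real \<Rightarrow> (real \<Rightarrow> real) \<Rightarrow> (real \<Rightarrow> real) \<Rightarrow> (real \<Rightarrow> real) \<Rightarrow> bool" where
  "caratheodory_sol g n F v \<longleftrightarrow>
     (\<exists>w. (\<forall>x. (v has_real_derivative w x) (at x)) \<and>
          (\<forall>x y. x \<le> y \<longrightarrow>
             ((\<lambda>t. g * v t - n t * F (v t)) has_integral (w y - w x)) {x..y}))"

definition same_periodicity_class :: "real \<Rightarrow> nat \<Rightarrow> (real \<Rightarrow> real) \<Rightarrow> (real \<Rightarrow> real) \<Rightarrow> bool" where
  "same_periodicity_class \<beta> m u w \<longleftrightarrow> (\<exists>j<m. w = (\<lambda>x. u (x + real j * \<beta>)))"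

end

theory Submission
  imports Defs "HOL-Complex_Analysis.Complex_Analysis"
begin

text \<open>
For a constant weight \<open>n = \<nu>\<close> the equation is a Hamiltonian system with one degree of freedom. For large \<open>\<nu>\<close> it
has a center near \<open>a\<close>, surrounded by periodic orbits whose period goes from about \<open>2 * pi / sqrt (\<nu> * F' a)\<close> at the
center to infinity at the separatrix, so the orbits realise every winding number \<open>j\<close> up to order \<open>sqrt \<nu>\<close> over the
time \<open>L = m * \<beta>\<close>. One solution for each of the winding numbers \<open>j = 1 + m * k\<close> with \<open>k < 2 * K\<close> suffices: winding
numbers are invariant under time shifts, and \<open>j\<close> is coprime to \<open>m\<close>, which forces the minimal period \<open>m * \<beta>\<close>.

For a weight that is \<open>L\<^sup>1\<close>-close to \<open>\<nu>\<close>, the map over the time \<open>L\<close> is an area preserving perturbation of a shear in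
action-angle coordinates \<open>(\<Theta>, A)\<close>. It therefore has a mixed generating function on the annulus, with
\<open>dW = (A\<^sub>0 - A\<^sub>L) d\<Theta>\<^sub>L + (\<Theta>\<^sub>L - \<Theta>\<^sub>0 - j) dA\<^sub>0\<close>. On the inner boundary the orbits turn more than \<open>j\<close> times and on the
outer boundary less, so the maximum of \<open>W\<close> is attained in the interior, at a closed orbit with winding number \<open>j\<close>.
This replaces the Poincare-Birkhoff theorem and needs no monotonicity of the period.

The argument is carried out for symplectic Euler discretizations, which are compositions of explicit shears and hence
differentiable in the initial data even though \<open>n\<close> is merely integrable. The closed discrete orbits converge to a
Caratheodory solution by the Arzela-Ascoli theorem, and the winding number survives the limit.
\<close>


section \<open>The potential well in Morse coordinates\<close>

text \<open>A critical point of \<open>W\<close> is a closed orbit only if the final angle variable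
  has nonzero derivative along the initial angle. For a constant weight this holds because an
  angular displacement is a multiple of the vector field and is carried along by the flow. For the
  kicked scheme the displacement stays close to that multiple by a Gronwall estimate that involves
  the number of steps only through the total time and the sum of the kicks. Hence the smallness of
  the perturbation is uniform in the number of steps, and the grid can be refined with the weight
  held fixed. A second obstacle is low regularity: the coordinates that turn energy levels into
  circles are only C^1 at the center. The annulus avoids the center, and derivatives of the angle
  variable are computed along rays. The threshold for the weight ensures that
  \<open>\<nu> * F q - g * q\<close> has a zero near \<open>a\<close> with steep slope and that the
  period of small oscillations is below \<open>\<beta> / (2 * K)\<close>, so that more than
  \<open>2 * K * m\<close> turns fit into \<open>m * \<beta>\<close>. The factor \<open>m\<close>
  cancels in this condition.\<close>

lemma has_field_derivative_cong_nhds: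
  assumes "(f has_real_derivative d) (at x)" "\<forall>\<^sub>F z in nhds x. f z = g z"
  shows "(g has_real_derivative d) (at x)"
  using DERIV_cong_ev[OF refl assms(2) refl, of d] assms(1) by simp

text \<open>The equation of motion is q'' = - f q, so \<open>V\<close> is the potential energy and
  the sign conditions place its bottom at \<open>c\<close>. That the ends are equilibria is imposed
  only where the period is shown to diverge.\<close>

locale potential_well =
  fixes f f' V :: "real \<Rightarrow> real" and l c b :: real
  assumes l_less_c: "l < c" and c_less_b: "c < b"
    and f_deriv: "\<And>x. (f has_real_derivative f' x) (at x)"
    and f'_cont: "continuous_on UNIV f'"
    and V_deriv: "\<And>x. (V has_real_derivative f x) (at x)"
    and V_c: "V c = 0"
    and f_neg: "\<And>x. l < x \<Longrightarrow> x < c \<Longrightarrow> f x < 0"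
    and f_pos: "\<And>x. c < x \<Longrightarrow> x < b \<Longrightarrow> f x > 0"
    and f_c: "f c = 0" and f'_c: "f' c > 0"
begin

text \<open>The Morse coordinate \<open>yc\<close> turns the energy \<open>p\<^sup>2 / 2 + V q\<close> into \<open>(p\<^sup>2 + (yc q)\<^sup>2) / 2\<close>,
  so that energy levels become circles; \<open>R\<close> is the radius of the largest level that stays inside the well.\<close>
definition yc :: "real \<Rightarrow> real" where
  "yc q = sgn (q - c) * sqrt (2 * V q)"

text \<open>Differentiating \<open>yc^2 = 2 * V\<close> gives \<open>yc * yc' = f\<close>. At
  \<open>c\<close>, where this reads 0 = 0, the value is the limit of the difference quotient of
  \<open>yc\<close>.\<close>

definition yc' :: "real \<Rightarrow> real" where
  "yc' q = (if q = c then sqrt (f' c) else f q / yc q)"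

definition R :: real where
  "R = sqrt (2 * min (V l) (V b))"

lemma f_cont: "continuous_on S f"
  by (rule DERIV_continuous_on[OF has_field_derivative_at_within[OF f_deriv]])

lemma V_cont: "continuous_on S V"
  by (rule DERIV_continuous_on[OF has_field_derivative_at_within[OF V_deriv]])

lemma V_pos_right:
  assumes "c < q" "q \<le> b" shows "V q > 0"
proof -
  have "V c < V q"
  proof (rule DERIV_pos_imp_increasing_open[OF assms(1)])
    show "\<exists>y. (V has_real_derivative y) (at x) \<and> y > 0" if "c < x" "x < q" for x
      using V_deriv f_pos[of x] that assms by (intro exI[of _ "f x"]) auto
  qed (rule V_cont)
  then show ?thesis by (simp add: V_c)
qed

lemma V_pos_left:
  assumes "l \<le> q" "q < c" shows "V q > 0"
proof -
  have "V q > V c"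
  proof (rule DERIV_neg_imp_decreasing_open[OF assms(2)])
    show "\<exists>y. (V has_real_derivative y) (at x) \<and> y < 0" if "q < x" "x < c" for x
      using V_deriv f_neg[of x] that assms by (intro exI[of _ "f x"]) auto
  qed (rule V_cont)
  then show ?thesis by (simp add: V_c)
qed

lemma V_pos: "l \<le> q \<Longrightarrow> q \<le> b \<Longrightarrow> q \<noteq> c \<Longrightarrow> V q > 0"
  using V_pos_left V_pos_right by (metis linorder_less_linear)

lemma V_nonneg: "l \<le> q \<Longrightarrow> q \<le> b \<Longrightarrow> V q \<ge> 0"
  using V_pos V_c by (metis order.strict_implies_order order_refl)

lemma R_pos: "R > 0"
  using V_pos_left[of l] V_pos_right[of b] l_less_c c_less_b by (simp add: R_def)

lemma yc_c [simp]: "yc c = 0"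
  by (simp add: yc_def)

lemma yc_sq: "l \<le> q \<Longrightarrow> q \<le> b \<Longrightarrow> (yc q)\<^sup>2 = 2 * V q"
  using V_nonneg[of q] V_c by (cases "q = c") (auto simp: yc_def power_mult_distrib sgn_if)

lemma yc_pos: "c < q \<Longrightarrow> q \<le> b \<Longrightarrow> yc q > 0"
  using V_pos_right[of q] by (simp add: yc_def)

lemma yc_neg: "l \<le> q \<Longrightarrow> q < c \<Longrightarrow> yc q < 0"
  using V_pos_left[of q] by (simp add: yc_def)

text \<open>L'Hopital's rule leaves \<open>f x / (2 * (x - c))\<close>, which is half a difference
  quotient of \<open>f\<close> because \<open>f c = 0\<close>.\<close>

lemma tendsto_V_quot: "((\<lambda>q. V q / (q - c)\<^sup>2) \<longlongrightarrow> f' c / 2) (at c)"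
proof (rule lhopital)
  show "(V \<longlongrightarrow> 0) (at c)"
    using V_cont[of UNIV] V_c by (metis UNIV_I continuous_on_def at_within_open open_UNIV)
  show "((\<lambda>q. (q - c)\<^sup>2) \<longlongrightarrow> 0) (at c)"
    by (rule tendsto_eq_intros refl | simp)+
  show "\<forall>\<^sub>F x in at c. (x - c)\<^sup>2 \<noteq> 0" "\<forall>\<^sub>F x in at c. 2 * (x - c) \<noteq> 0"
    by (auto simp: eventually_at intro!: exI[of _ 1])
  show "\<forall>\<^sub>F x in at c. (V has_real_derivative f x) (at x)"
    using V_deriv by simp
  show "\<forall>\<^sub>F x in at c. ((\<lambda>q. (q - c)\<^sup>2) has_real_derivative 2 * (x - c)) (at x)"
    by (intro always_eventually allI) (auto intro!: derivative_eq_intros)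
  have "((\<lambda>q. (f q - f c) / (q - c)) \<longlongrightarrow> f' c) (at c)"
    using f_deriv[of c] by (simp add: has_field_derivative_iff)
  then have "((\<lambda>q. ((f q - f c) / (q - c)) / 2) \<longlongrightarrow> f' c / 2) (at c)"
    by (intro tendsto_divide) auto
  then show "((\<lambda>x. f x / (2 * (x - c))) \<longlongrightarrow> f' c / 2) (at c)"
    by (simp add: f_c mult.commute)
qed

lemma near_c: "\<forall>\<^sub>F q in at c. l < q \<and> q < b \<and> q \<noteq> c"
proof -
  have "\<forall>\<^sub>F q in at c. l < q" "\<forall>\<^sub>F q in at c. q < b"
    using l_less_c c_less_b by (auto intro: order_tendstoD[OF tendsto_ident_at])
  then show ?thesis
    using eventually_neq_at_within[of c c UNIV] by eventually_elim auto
qed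

text \<open>The factor \<open>sgn\<close> gives \<open>yc\<close> the sign of \<open>q - c\<close>,
  so the quotient is the positive square root of \<open>2 * V q / (q - c)^2\<close> on both sides of
  \<open>c\<close>.\<close>

lemma tendsto_yc_quot: "((\<lambda>q. yc q / (q - c)) \<longlongrightarrow> sqrt (f' c)) (at c)"
proof -
  have "((\<lambda>q. sqrt (2 * (V q / (q - c)\<^sup>2))) \<longlongrightarrow> sqrt (2 * (f' c / 2))) (at c)"
    by (intro tendsto_intros tendsto_V_quot)
  moreover have "\<forall>\<^sub>F q in at c. sqrt (2 * (V q / (q - c)\<^sup>2)) = yc q / (q - c)"
    using near_c
  proof eventually_elim
    case (elim q)
    then show ?case
      by (auto simp: yc_def real_sqrt_divide real_sqrt_mult sgn_if field_simps)
  qed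
  ultimately show ?thesis
    using tendsto_cong by force
qed

lemma yc_deriv:
  assumes "l < q" "q < b"
  shows "(yc has_real_derivative yc' q) (at q)"
proof (cases "q = c")
  case True
  then show ?thesis
    using tendsto_yc_quot by (simp add: has_field_derivative_iff yc'_def)
next
  case False
  have V: "V q > 0" using V_pos assms False by simp
  have "((\<lambda>x. sgn (q - c) * sqrt (2 * V x)) has_real_derivative yc' q) (at q)"
  proof -
    have s: "sgn (q - c) = 1 \<or> sgn (q - c) = -1" using False by (auto simp: sgn_if)
    have "((\<lambda>x. 2 * V x) has_real_derivative 2 * f q) (at q)"
      by (rule DERIV_cmult[OF V_deriv])
    then have "((\<lambda>x. sqrt (2 * V x)) has_real_derivative (inverse (sqrt (2 * V q)) / 2) * (2 * f q)) (at q)"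
      using V by (intro DERIV_chain2[OF DERIV_real_sqrt]) auto
    then have "((\<lambda>x. sgn (q - c) * sqrt (2 * V x)) has_real_derivative
        sgn (q - c) * ((inverse (sqrt (2 * V q)) / 2) * (2 * f q))) (at q)"
      by (rule DERIV_cmult)
    moreover have "sgn (q - c) * ((inverse (sqrt (2 * V q)) / 2) * (2 * f q)) = yc' q"
      using s False by (auto simp: yc'_def yc_def divide_simps)
    ultimately show ?thesis by simp
  qed
  moreover have "\<forall>\<^sub>F x in nhds q. sgn (q - c) * sqrt (2 * V x) = yc x"
  proof -
    have "\<forall>\<^sub>F x in nhds q. sgn (x - c) = sgn (q - c)"
    proof (cases "q > c")
      case True
      then have "\<forall>\<^sub>F x in nhds q. x > c" using eventually_nhds_in_open[of "{c<..}" q] by simp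
      then show ?thesis by eventually_elim (use True in auto)
    next
      case False
      with \<open>q \<noteq> c\<close> have "q < c" by simp
      then have "\<forall>\<^sub>F x in nhds q. x < c" using eventually_nhds_in_open[of "{..<c}" q] by simp
      then show ?thesis by eventually_elim (use \<open>q < c\<close> in auto)
    qed
    then show ?thesis by eventually_elim (simp add: yc_def)
  qed
  ultimately show ?thesis
    by (rule has_field_derivative_cong_nhds)
qed

lemma yc'_pos:
  assumes "l < q" "q < b" shows "yc' q > 0"
  using assms yc_pos[of q] yc_neg[of q] f_pos[of q] f_neg[of q] f'_c
  by (cases "q < c"; cases "q = c") (auto simp: yc'_def divide_neg_neg)

lemma yc_isCont: "l < q \<Longrightarrow> q < b \<Longrightarrow> isCont yc q"
  using yc_deriv DERIV_isCont by blast

text \<open>At \<open>c\<close>, numerator and denominator of \<open>f / yc\<close> are both divided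
  by \<open>q - c\<close>; the resulting quotients tend to \<open>f' c\<close> and
  \<open>sqrt (f' c)\<close>.\<close>

lemma yc'_isCont:
  assumes "l < q" "q < b" shows "isCont yc' q"
proof (cases "q = c")
  case True
  have "((\<lambda>q. (f q - f c) / (q - c)) \<longlongrightarrow> f' c) (at c)"
    using f_deriv[of c] by (simp add: has_field_derivative_iff)
  then have "((\<lambda>q. ((f q - f c) / (q - c)) / (yc q / (q - c))) \<longlongrightarrow> f' c / sqrt (f' c)) (at c)"
    by (intro tendsto_divide tendsto_yc_quot) (use f'_c in auto)
  moreover have "\<forall>\<^sub>F q in at c. ((f q - f c) / (q - c)) / (yc q / (q - c)) = yc' q"
    using near_c by eventually_elim (auto simp: yc'_def f_c)
  ultimately have "(yc' \<longlongrightarrow> f' c / sqrt (f' c)) (at c)"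
    using tendsto_cong by force
  then show ?thesis
    using f'_c True by (simp add: isCont_def yc'_def real_div_sqrt)
next
  case False
  have "isCont (\<lambda>x. f x / yc x) q"
    using yc_pos[of q] yc_neg[of q] False assms DERIV_isCont[OF f_deriv] yc_isCont
    by (intro continuous_intros) fastforce+
  moreover have "\<forall>\<^sub>F x in nhds q. f x / yc x = yc' x"
    using False by (auto simp: yc'_def eventually_nhds intro!: exI[of _ "-{c}"])
  ultimately show ?thesis
    using isCont_cong[of "\<lambda>x. f x / yc x" yc' q] by simp
qed

lemma yc_strict_mono:
  assumes "l < x" "x < y" "y < b" shows "yc x < yc y"
proof (rule DERIV_pos_imp_increasing[OF assms(2)])
  show "\<exists>d. (yc has_real_derivative d) (at z) \<and> d > 0" if "x \<le> z" "z \<le> y" for z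
    using yc_deriv[of z] yc'_pos[of z] that assms by (intro exI[of _ "yc' z"]) auto
qed

lemma yc_inj: "l < x \<Longrightarrow> x < b \<Longrightarrow> l < y \<Longrightarrow> y < b \<Longrightarrow> yc x = yc y \<Longrightarrow> x = y"
  using yc_strict_mono by (metis linorder_neqE_linordered_idom order_less_irrefl)

text \<open>\<open>R\<close> is governed by the lower of the two ends, so the potential takes the
  value \<open>y^2 / 2\<close> on either side of the well; the sign of \<open>y\<close> selects the
  side.\<close>

lemma yc_surj:
  assumes "\<bar>y\<bar> < R" shows "\<exists>q. l < q \<and> q < b \<and> yc q = y"
proof -
  have R2: "R\<^sup>2 = 2 * min (V l) (V b)"
    using R_pos by (simp add: R_def real_sqrt_gt_0_iff)
  have y2: "y\<^sup>2 < R\<^sup>2"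
    using assms R_pos by (metis abs_ge_zero power2_abs power_strict_mono zero_less_numeral)
  have cont: "\<forall>x. p \<le> x \<and> x \<le> q \<longrightarrow> isCont V x" for p q
    using DERIV_isCont[OF V_deriv] by blast
  consider "y = 0" | "y > 0" | "y < 0" by linarith
  then show ?thesis
  proof cases
    case 1 then show ?thesis using l_less_c c_less_b by (intro exI[of _ c]) auto
  next
    case 2
    obtain q where q: "c \<le> q" "q \<le> b" "V q = y\<^sup>2/2"
      using IVT[of V c "y\<^sup>2/2" b] cont V_c y2 R2 c_less_b by (auto simp: min_def split: if_splits)
    have "q \<noteq> c" "q \<noteq> b" using q V_c 2 y2 R2 by auto
    then show ?thesis using q 2 l_less_c by (intro exI[of _ q]) (auto simp: yc_def mult.commute)
  next
    case 3
    obtain q where q: "l \<le> q" "q \<le> c" "V q = y\<^sup>2/2"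
      using IVT2[of V c "y\<^sup>2/2" l] cont V_c y2 R2 l_less_c by (auto simp: min_def split: if_splits)
    have "q \<noteq> c" "q \<noteq> l" using q V_c 3 y2 R2 by auto
    then show ?thesis using q 3 c_less_b by (intro exI[of _ q]) (auto simp: yc_def mult.commute)
  qed
qed

definition Q :: "real \<Rightarrow> real" where
  "Q y = (THE q. l < q \<and> q < b \<and> yc q = y)"

text \<open>Besides being the derivative of \<open>Q\<close>, this is the reciprocal angular speed:
  in the coordinates \<open>p\<close> and \<open>y = yc q\<close> the motion reads p' = - y / Y y,
  y' = p / Y y. The radius is constant and the polar angle grows at the rate
  \<open>1 / Y y\<close>.\<close>

definition Y :: "real \<Rightarrow> real" where
  "Y y = 1 / yc' (Q y)"

lemma Q_props: "\<bar>y\<bar> < R \<Longrightarrow> l < Q y \<and> Q y < b \<and> yc (Q y) = y"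
  unfolding Q_def by (rule theI') (use yc_surj[of y] yc_inj in blast)

lemma yc_Q: "\<bar>y\<bar> < R \<Longrightarrow> yc (Q y) = y"
  using Q_props by auto

lemma Q_mono: "\<bar>x\<bar> < R \<Longrightarrow> \<bar>y\<bar> < R \<Longrightarrow> x \<le> y \<Longrightarrow> Q x \<le> Q y"
  using yc_strict_mono[of "Q y" "Q x"] Q_props[of x] Q_props[of y] by (metis not_le)

lemma Q_yc: "l < q \<Longrightarrow> q < b \<Longrightarrow> \<bar>yc q\<bar> < R \<Longrightarrow> Q (yc q) = q"
  using Q_props[of "yc q"] yc_inj[of "Q (yc q)" q] by simp

lemma Q_0 [simp]: "Q 0 = c"
  using Q_yc[of c] l_less_c c_less_b R_pos by simp

lemma Q_deriv:
  assumes "\<bar>y\<bar> < R" shows "(Q has_real_derivative Y y) (at y)"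
proof -
  let ?q = "Q y"
  have q: "l < ?q" "?q < b" using Q_props assms by auto
  have "isCont yc ?q" using yc_isCont q by simp
  then have "\<forall>\<^sub>F x in nhds ?q. \<bar>yc x\<bar> < R"
  proof -
    have "(yc \<longlongrightarrow> yc ?q) (nhds ?q)"
      using \<open>isCont yc ?q\<close> by (simp add: isCont_def tendsto_nhds_iff)
    from order_tendstoD(2)[OF tendsto_rabs[OF this], of R] show ?thesis
      using assms yc_Q[OF assms] by simp
  qed
  then obtain e where e: "e > 0" "\<And>x. \<bar>x - ?q\<bar> < e \<Longrightarrow> \<bar>yc x\<bar> < R"
    by (auto simp: eventually_nhds_metric dist_real_def)
  define d where "d = min (e/2) (min ((?q - l)/2) ((b - ?q)/2))"
  have "d \<le> e/2" unfolding d_def by linarith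
  moreover have "d \<le> (?q - l)/2" unfolding d_def by linarith
  moreover have "d \<le> (b - ?q)/2" unfolding d_def by linarith
  moreover have "d > 0" using e q by (simp add: d_def)
  ultimately have d: "d > 0" "d < e" "l < ?q - d" "?q + d < b" using e(1) by simp_all
  have "isCont Q (yc ?q)"
  proof (rule isCont_inverse_function2[where f = yc and a = "?q - d" and b = "?q + d"])
    show "Q (yc z) = z" "isCont yc z" if "?q - d \<le> z" "z \<le> ?q + d" for z
      using that d e(2)[of z] by (auto intro!: Q_yc yc_isCont)
  qed (use d in auto)
  then have cont: "isCont Q y" using yc_Q assms by simp
  have "(Q has_real_derivative inverse (yc' ?q)) (at y)"
  proof (rule DERIV_inverse_function[where f = yc and a = "-R" and b = R])
    show "(yc has_real_derivative yc' ?q) (at ?q)" using yc_deriv q by simp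
    show "yc' ?q \<noteq> 0" using yc'_pos q by force
  qed (use assms cont yc_Q in auto)
  then show ?thesis by (simp add: Y_def inverse_eq_divide)
qed

lemma Q_isCont: "\<bar>y\<bar> < R \<Longrightarrow> isCont Q y"
  using Q_deriv DERIV_isCont by blast

lemma Y_pos: "\<bar>y\<bar> < R \<Longrightarrow> Y y > 0"
  using Q_props yc'_pos by (simp add: Y_def)

lemma Y_isCont: "\<bar>y\<bar> < R \<Longrightarrow> isCont Y y"
  unfolding Y_def using Q_props[of y] yc'_pos[of "Q y"] yc'_isCont[of "Q y"] Q_isCont[of y]
  by (intro continuous_intros) (auto intro: continuous_at_compose[of _ Q yc', unfolded o_def])

lemma f_Q: "\<bar>y\<bar> < R \<Longrightarrow> Y y * f (Q y) = y"
proof (cases "y = 0")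
  case False
  assume y: "\<bar>y\<bar> < R"
  then have "Q y \<noteq> c" using False yc_Q[of y] by auto
  then show ?thesis using Q_props[OF y] f_neg[of "Q y"] f_pos[of "Q y"] by (force simp: Y_def yc'_def)
qed (simp add: f_c)

lemma Y_0: "Y 0 = 1 / sqrt (f' c)"
  by (simp add: Y_def yc'_def)

text \<open>\<open>Z y\<close> stands for \<open>y * Y' y\<close>; although \<open>Y\<close> need not be differentiable at 0, this product extends continuously.\<close>
definition Z :: "real \<Rightarrow> real" where
  "Z y = Y y * (1 - (Y y)\<^sup>2 * f' (Q y))"

lemma Z_isCont: "\<bar>y\<bar> < R \<Longrightarrow> isCont Z y"
proof -
  assume y: "\<bar>y\<bar> < R"
  have "isCont (\<lambda>x. f' (Q x)) y"
    using continuous_at_compose[OF Q_isCont[OF y], of f'] f'_cont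
    by (simp add: o_def continuous_on_eq_continuous_at)
  then show ?thesis
    unfolding Z_def using Y_isCont[OF y] by (intro continuous_intros)
qed

text \<open>Away from 0, \<open>Y y = y / f (Q y)\<close> has derivative \<open>Z y / y\<close>, and
  the chain rule along the ray contributes the factor \<open>s = y / r\<close>, which cancels the
  singular \<open>1 / y\<close>. For \<open>s = 0\<close> the function is constant, and
  \<open>Z 0 = 0\<close> because \<open>(Y 0)^2 * f' c = 1\<close>.\<close>

lemma Y_scaled_deriv:
  assumes "r > 0" "\<bar>r * s\<bar> < R"
  shows "((\<lambda>r. Y (r * s)) has_real_derivative Z (r * s) / r) (at r)"
proof (cases "s = 0")
  case True
  then show ?thesis using f'_c by (simp add: Z_def Y_0 power_divide)
next
  case False
  let ?y = "r * s"
  have y0: "?y \<noteq> 0" using assms False by simp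
  have f0: "f (Q ?y) \<noteq> 0" using f_Q[OF assms(2)] y0 by auto
  have Yy: "Y ?y = ?y / f (Q ?y)" using f_Q[OF assms(2)] f0 by (simp add: field_simps)
  have "((\<lambda>y. y / f (Q y)) has_real_derivative (1 * f (Q ?y) - ?y * (f' (Q ?y) * Y ?y)) / (f (Q ?y) * f (Q ?y))) (at ?y)"
    by (rule DERIV_divide) (use f0 in \<open>auto intro!: derivative_eq_intros DERIV_chain2[OF f_deriv] Q_deriv[OF assms(2)]\<close>)
  also have "(1 * f (Q ?y) - ?y * (f' (Q ?y) * Y ?y)) / (f (Q ?y) * f (Q ?y)) = Z ?y / ?y"
    using f0 y0 by (simp add: Z_def Yy field_simps power2_eq_square)
  finally have "((\<lambda>y. y / f (Q y)) has_real_derivative Z ?y / ?y) (at ?y)" .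
  moreover have "\<forall>\<^sub>F y in nhds ?y. y / f (Q y) = Y y"
  proof -
    have "\<forall>\<^sub>F y in nhds ?y. y \<in> {-R<..<R} - {0}"
      using assms y0 by (intro eventually_nhds_in_open) (auto simp: open_delete)
    then show ?thesis
    proof eventually_elim
      case (elim y)
      then have y: "\<bar>y\<bar> < R" "y \<noteq> 0" by auto
      have "f (Q y) \<noteq> 0" using f_Q[OF y(1)] y(2) by auto
      then show ?case using f_Q[OF y(1)] by (simp add: field_simps)
    qed
  qed
  ultimately have D: "(Y has_real_derivative Z ?y / ?y) (at ?y)"
    by (rule has_field_derivative_cong_nhds)
  have "((\<lambda>r. Y (r * s)) has_real_derivative (Z ?y / ?y) * s) (at r)"
    by (rule DERIV_chain2[where f = Y and g = "\<lambda>r. r * s", OF D]) (auto intro!: derivative_eq_intros)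
  then show ?thesis using False assms by simp
qed

end

section \<open>Indefinite integrals with an upper limit of either sign\<close>

definition signed_integral :: "(real \<Rightarrow> real) \<Rightarrow> real \<Rightarrow> real" where
  "signed_integral k t = integral {0..t} k - integral {t..0} k"

lemma signed_integral_0 [simp]: "signed_integral k 0 = 0"
  by (simp add: signed_integral_def)

lemma signed_integral_nonneg: "t \<ge> 0 \<Longrightarrow> signed_integral k t = integral {0..t} k"
  by (cases "t = 0") (auto simp: signed_integral_def)

text \<open>Anchoring at a point \<open>s\<close> to the left of both 0 and \<open>t\<close>
  replaces the two cases of the definition by one ordinary indefinite integral. On a bounded window
  a single \<open>s\<close> serves all \<open>t\<close>.\<close>

lemma signed_integral_eq:
  assumes "\<And>x y. k integrable_on {x..y}" "s \<le> 0" "s \<le> t"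
  shows "signed_integral k t = integral {s..t} k - integral {s..0} k"
proof (cases "t \<ge> 0")
  case True
  have "integral {s..0} k + integral {0..t} k = integral {s..t} k"
    by (rule Henstock_Kurzweil_Integration.integral_combine) (use assms True in auto)
  with True show ?thesis by (simp add: signed_integral_nonneg)
next
  case False
  have "integral {s..t} k + integral {t..0} k = integral {s..0} k"
    by (rule Henstock_Kurzweil_Integration.integral_combine) (use assms False in auto)
  with False show ?thesis by (simp add: signed_integral_def)
qed

lemma signed_integral_diff:
  assumes "\<And>x y. k integrable_on {x..y}" "s \<le> t"
  shows "signed_integral k t - signed_integral k s = integral {s..t} k"
proof -
  define m where "m = min s 0"
  have m: "m \<le> 0" "m \<le> s" "m \<le> t" using assms(2) by (auto simp: m_def)
  have "integral {m..s} k + integral {s..t} k = integral {m..t} k"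
    by (rule Henstock_Kurzweil_Integration.integral_combine) (use assms m in auto)
  then show ?thesis
    using signed_integral_eq[OF assms(1) m(1) m(2)] signed_integral_eq[OF assms(1) m(1) m(3)] by simp
qed

lemma signed_integral_deriv:
  assumes "continuous_on UNIV k"
  shows "(signed_integral k has_real_derivative k t) (at t)"
proof -
  define B where "B = \<bar>t\<bar> + 1"
  have int: "k integrable_on {x..y}" for x y
    by (rule integrable_continuous_real) (rule continuous_on_subset[OF assms], simp)
  have t: "t \<in> {-B<..<B}" by (auto simp: B_def)
  have "((\<lambda>x. integral {-B..x} k) has_real_derivative k t) (at t within {-B..B})"
    by (rule integral_has_real_derivative) (use t continuous_on_subset[OF assms] in auto)
  then have "((\<lambda>x. integral {-B..x} k) has_real_derivative k t) (at t)"
    using t at_within_Icc_at[of "-B" t B] by simp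
  then have "((\<lambda>x. integral {-B..x} k - integral {-B..0} k) has_real_derivative k t - 0) (at t)"
    by (intro DERIV_diff DERIV_const)
  moreover have "\<forall>\<^sub>F x in nhds t. integral {-B..x} k - integral {-B..0} k = signed_integral k x"
  proof -
    have "\<forall>\<^sub>F x in nhds t. x \<in> {-B<..<B}" using t by (intro eventually_nhds_in_open) auto
    then show ?thesis
      by eventually_elim (subst signed_integral_eq[OF int, of "-B"], auto simp: B_def)
  qed
  ultimately show ?thesis
    using has_field_derivative_cong_nhds by force
qed

lemma signed_integral_eqI:
  assumes "\<And>t. (K has_real_derivative k t) (at t)" "K 0 = 0" "continuous_on UNIV k"
  shows "signed_integral k t = K t"
proof -
  have "((\<lambda>t. signed_integral k t - K t) has_real_derivative k x - k x) (at x)" for x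
    by (intro DERIV_diff signed_integral_deriv assms)
  then have "signed_integral k t - K t = signed_integral k 0 - K 0"
    by (intro DERIV_isconst_all) simp
  then show ?thesis by (simp add: assms)
qed

text \<open>Shifting an interval by \<open>L\<close> preserves the integral over it, so the
  increment from \<open>t\<close> to \<open>t + L\<close> does not depend on \<open>t\<close>; its
  value is read off at \<open>t = 0\<close>.\<close>

lemma signed_integral_periodic:
  assumes k: "\<And>x y. k integrable_on {x..y}" and per: "\<And>x. k (x + L) = k x"
  shows "signed_integral k (t + L) = signed_integral k t + signed_integral k L"
proof -
  have shift: "integral {x + L..y + L} k = integral {x..y} k" for x y
  proof -
    have "(k has_integral integral {x..y} k) {x..y}" using k by (rule integrable_integral)
    moreover have "k \<circ> (+) L = k" using per by (auto simp: fun_eq_iff add.commute)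
    ultimately have "(k has_integral integral {x..y} k) {x + L..y + L}"
      using has_integral_shift_Icc_real[of k L "integral {x..y} k" x y] by simp
    then show ?thesis by (rule integral_unique)
  qed
  have c: "signed_integral k (y + L) - signed_integral k y = signed_integral k (x + L) - signed_integral k x" if "x \<le> y" for x y
    using signed_integral_diff[OF k that] signed_integral_diff[OF k, of "x + L" "y + L"] shift[of x y] that by simp
  have "signed_integral k (t + L) - signed_integral k t = signed_integral k (0 + L) - signed_integral k 0"
    using c[of 0 t] c[of t 0] by (cases "t \<ge> 0") auto
  then show ?thesis by simp
qed

lemma continuous_on_section:
  assumes "continuous_on (U \<times> UNIV) (\<lambda>(r, t). k r t)" "r \<in> U"
  shows "continuous_on S (k r)"
  using continuous_on_compose2[OF assms(1) continuous_on_Pair[OF continuous_on_const continuous_on_id], of r S] assms(2)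
  by auto

lemma signed_integral_param_deriv:
  fixes k k' :: "real \<Rightarrow> real \<Rightarrow> real"
  assumes U: "open U" "convex U" "r \<in> U"
    and k: "\<And>r t. r \<in> U \<Longrightarrow> ((\<lambda>r. k r t) has_real_derivative k' r t) (at r)"
    and cont: "continuous_on (U \<times> UNIV) (\<lambda>(r, t). k r t)"
    and cont': "continuous_on (U \<times> UNIV) (\<lambda>(r, t). k' r t)"
  shows "((\<lambda>r. signed_integral (k r) t) has_real_derivative signed_integral (k' r) t) (at r)"
proof -
  note kc = continuous_on_section[OF cont]
  have "((\<lambda>r. integral (cbox x y) (k r)) has_real_derivative integral (cbox x y) (k' r)) (at r within U)" for x y
  proof (rule leibniz_rule_field_derivative)
    show "k r integrable_on cbox x y" if "r \<in> U" for r
      using kc[OF that] by (intro integrable_continuous)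
    show "continuous_on (U \<times> cbox x y) (\<lambda>(r, t). k' r t)"
      by (rule continuous_on_subset[OF cont']) auto
  qed (use U k in \<open>auto intro: has_field_derivative_at_within\<close>)
  then have "((\<lambda>r. integral {x..y} (k r)) has_real_derivative integral {x..y} (k' r)) (at r)" for x y
    using at_within_open[OF U(3,1)] by simp
  then show ?thesis unfolding signed_integral_def by (intro DERIV_diff)
qed

text \<open>The parameter derivative comes from the Leibniz rule, the derivative in the upper limit
  from the fundamental theorem. The latter is \<open>k\<close> itself, and its joint continuity lets
  the partial derivatives combine into a total one. Radius and angle are arbitrary functions on a
  normed space so that the rule applies along orbits.\<close>

lemma signed_integral_has_derivative:
  fixes k k' :: "real \<Rightarrow> real \<Rightarrow> real" and \<rho> \<phi> :: "'a::real_normed_vector \<Rightarrow> real"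
  assumes U: "open U" "convex U" "\<rho> x \<in> U"
    and k: "\<And>r t. r \<in> U \<Longrightarrow> ((\<lambda>r. k r t) has_real_derivative k' r t) (at r)"
    and cont: "continuous_on (U \<times> UNIV) (\<lambda>(r, t). k r t)"
    and cont': "continuous_on (U \<times> UNIV) (\<lambda>(r, t). k' r t)"
    and \<rho>: "(\<rho> has_derivative d\<rho>) (at x)" and \<phi>: "(\<phi> has_derivative d\<phi>) (at x)"
  shows "((\<lambda>x. signed_integral (k (\<rho> x)) (\<phi> x)) has_derivative
     (\<lambda>h. signed_integral (k' (\<rho> x)) (\<phi> x) * d\<rho> h + k (\<rho> x) (\<phi> x) * d\<phi> h)) (at x)"
proof -
  let ?r = "\<rho> x" and ?t = "\<phi> x"
  note kc = continuous_on_section[OF cont]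
  have "((\<lambda>(r, t). signed_integral (k r) t) has_derivative
      (\<lambda>(u, v). (*) (signed_integral (k' ?r) ?t) u + blinfun_apply (k ?r ?t *\<^sub>R id_blinfun) v)) (at (?r, ?t) within U \<times> UNIV)"
  proof (rule has_derivative_partialsI)
    show "((\<lambda>r. signed_integral (k r) ?t) has_derivative (*) (signed_integral (k' ?r) ?t)) (at ?r within U)"
      using signed_integral_param_deriv[OF U k cont cont']
      by (simp add: has_field_derivative_def has_derivative_at_withinI)
    show "((\<lambda>t. signed_integral (k r) t) has_derivative blinfun_apply (k r t *\<^sub>R id_blinfun)) (at t within UNIV)"
      if "r \<in> U" for r t
      using signed_integral_deriv[OF kc[OF that], of t]
      by (simp add: has_field_derivative_def scaleR_blinfun.rep_eq id_blinfun.rep_eq)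
    have "continuous_on (U \<times> UNIV) (\<lambda>z. (case z of (r, t) \<Rightarrow> k r t) *\<^sub>R (id_blinfun :: real \<Rightarrow>\<^sub>L real))"
      by (intro continuous_intros cont)
    then show "continuous (at (?r, ?t) within U \<times> UNIV) (\<lambda>(r, t). k r t *\<^sub>R (id_blinfun :: real \<Rightarrow>\<^sub>L real))"
      using U(3) by (auto simp: continuous_on_eq_continuous_within case_prod_unfold)
  qed auto
  then have D: "((\<lambda>(r, t). signed_integral (k r) t) has_derivative
      (\<lambda>(u, v). signed_integral (k' ?r) ?t * u + k ?r ?t * v)) (at (?r, ?t))"
    using at_within_open[of "(?r, ?t)" "U \<times> UNIV"] U
    by (simp add: open_Times scaleR_blinfun.rep_eq id_blinfun.rep_eq)
  have "((\<lambda>x. (\<rho> x, \<phi> x)) has_derivative (\<lambda>h. (d\<rho> h, d\<phi> h))) (at x)"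
    by (intro has_derivative_Pair \<rho> \<phi>)
  from has_derivative_compose[OF this D] show ?thesis by simp
qed

section \<open>Action-angle coordinates\<close>

lemma polar_le: "0 < r \<Longrightarrow> \<bar>r * sin t\<bar> \<le> r" for r t :: real
  by (simp add: abs_mult mult_left_le)

context potential_well
begin

text \<open>On the level of radius \<open>r\<close>, \<open>\<tau> r t\<close> is the time needed to reach the angle \<open>t\<close>, \<open>T r\<close> the period,
  \<open>A r\<close> the enclosed area and \<open>\<Theta>\<close> the angle variable conjugate to \<open>A\<close>, counted in turns. The function \<open>M\<close>
  compares two primitives of the area form: \<open>dM = - (q - c) dp + \<Theta> dA\<close>.\<close>

definition \<tau> :: "real \<Rightarrow> real \<Rightarrow> real" where
  "\<tau> r t = signed_integral (\<lambda>s. Y (r * sin s)) t"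

definition \<tau>\<^sub>r :: "real \<Rightarrow> real \<Rightarrow> real" where
  "\<tau>\<^sub>r r t = signed_integral (\<lambda>s. Z (r * sin s) / r) t"

definition T :: "real \<Rightarrow> real" where
  "T r = \<tau> r (2 * pi)"

definition M :: "real \<Rightarrow> real \<Rightarrow> real" where
  "M r t = signed_integral (\<lambda>s. r * sin s * (Q (r * sin s) - c)) t"

definition A :: "real \<Rightarrow> real" where
  "A r = M r (2 * pi)"

definition \<Theta> :: "real \<Rightarrow> real \<Rightarrow> real" where
  "\<Theta> r t = \<tau> r t / T r"

definition \<Theta>\<^sub>r :: "real \<Rightarrow> real \<Rightarrow> real" where
  "\<Theta>\<^sub>r r t = \<tau>\<^sub>r r t / T r - \<tau> r t * \<tau>\<^sub>r r (2 * pi) / (T r)\<^sup>2"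

lemma polar_less_R: "0 < r \<Longrightarrow> r < R \<Longrightarrow> \<bar>r * sin t\<bar> < R"
  using polar_le[of r t] by simp

lemma polar_cont:
  assumes "\<And>y. \<bar>y\<bar> < R \<Longrightarrow> isCont k y"
  shows "continuous_on ({0<..<R} \<times> UNIV) (\<lambda>(r, t). k (r * sin t))"
proof -
  have "continuous_on {-R<..<R} k"
    using assms by (intro continuous_at_imp_continuous_on) auto
  then have "continuous_on ({0<..<R} \<times> UNIV) (\<lambda>z. k (fst z * sin (snd z)))"
    by (rule continuous_on_compose2)
       (use polar_less_R[unfolded abs_less_iff] in \<open>auto intro!: continuous_intros simp: minus_less_iff\<close>)
  then show ?thesis by (simp add: case_prod_unfold)
qed

lemma polar_cont_snd:
  assumes "\<And>y. \<bar>y\<bar> < R \<Longrightarrow> isCont k y" "0 < r" "r < R"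
  shows "continuous_on UNIV (\<lambda>t. k (r * sin t))"
  using continuous_on_section[OF polar_cont[OF assms(1)], of r] assms(2,3) by simp

lemma \<tau>_has_derivative:
  fixes \<rho> \<phi> :: "'a::real_normed_vector \<Rightarrow> real"
  assumes "0 < \<rho> x" "\<rho> x < R" "(\<rho> has_derivative d\<rho>) (at x)" "(\<phi> has_derivative d\<phi>) (at x)"
  shows "((\<lambda>x. \<tau> (\<rho> x) (\<phi> x)) has_derivative
     (\<lambda>h. \<tau>\<^sub>r (\<rho> x) (\<phi> x) * d\<rho> h + Y (\<rho> x * sin (\<phi> x)) * d\<phi> h)) (at x)"
  unfolding \<tau>_def \<tau>\<^sub>r_def
proof (rule signed_integral_has_derivative[where U = "{0<..<R}" and k = "\<lambda>r s. Y (r * sin s)" and k' = "\<lambda>r s. Z (r * sin s) / r"])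
  show "((\<lambda>r. Y (r * sin t)) has_real_derivative Z (r * sin t) / r) (at r)" if "r \<in> {0<..<R}" for r t
    using that polar_less_R by (intro Y_scaled_deriv) auto
  have "continuous_on ({0<..<R} \<times> UNIV) (\<lambda>z. (case z of (r, t) \<Rightarrow> Z (r * sin t)) / fst z)"
    by (intro continuous_intros polar_cont Z_isCont) auto
  then show "continuous_on ({0<..<R} \<times> UNIV) (\<lambda>(r, t). Z (r * sin t) / r)"
    by (simp add: case_prod_unfold)
qed (use assms polar_cont[OF Y_isCont] in auto)

lemma \<tau>_deriv:
  assumes "0 < r" "r < R" shows "(\<tau> r has_real_derivative Y (r * sin t)) (at t)"
  unfolding \<tau>_def using signed_integral_deriv[OF polar_cont_snd[OF Y_isCont assms]] by simp

lemma \<tau>_0 [simp]: "\<tau> r 0 = 0" by (simp add: \<tau>_def)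

lemma \<tau>_strict_mono:
  assumes "0 < r" "r < R" "s < t" shows "\<tau> r s < \<tau> r t"
  by (rule DERIV_pos_imp_increasing[OF assms(3)])
     (use \<tau>_deriv[OF assms(1,2)] Y_pos polar_less_R[OF assms(1,2)] in blast)

lemma T_pos: "0 < r \<Longrightarrow> r < R \<Longrightarrow> T r > 0"
  using \<tau>_strict_mono[of r 0 "2 * pi"] by (simp add: T_def)

lemma \<tau>_periodic: "0 < r \<Longrightarrow> r < R \<Longrightarrow> \<tau> r (t + 2 * pi) = \<tau> r t + T r"
  unfolding T_def \<tau>_def
  by (intro signed_integral_periodic integrable_continuous_real continuous_on_subset[OF polar_cont_snd[OF Y_isCont]]) auto

lemma \<tau>_periodic_nat: "0 < r \<Longrightarrow> r < R \<Longrightarrow> \<tau> r (t + 2 * pi * real j) = \<tau> r t + real j * T r"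
proof (induction j)
  case (Suc j)
  have "\<tau> r (t + 2 * pi * real (Suc j)) = \<tau> r ((t + 2 * pi * real j) + 2 * pi)" by (simp add: algebra_simps)
  then show ?case using Suc \<tau>_periodic[of r "t + 2 * pi * real j"] by (simp add: algebra_simps)
qed simp

lemma M_cont: "0 < r \<Longrightarrow> r < R \<Longrightarrow> continuous_on UNIV (\<lambda>s. r * sin s * (Q (r * sin s) - c))"
  by (intro continuous_intros polar_cont_snd Q_isCont) auto

lemma M_periodic: "0 < r \<Longrightarrow> r < R \<Longrightarrow> M r (t + 2 * pi) = M r t + A r"
  unfolding A_def M_def
  by (intro signed_integral_periodic integrable_continuous_real continuous_on_subset[OF M_cont]) auto

text \<open>The integrand is the \<open>r\<close>-derivative of the integrand of \<open>M\<close>,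
  and it has an explicit primitive: differentiating \<open>cos t * (Q (r * sin t) - c)\<close>
  produces a term with \<open>(cos t)^2 = 1 - (sin t)^2\<close>, and the 1 is accounted for by
  \<open>r * \<tau>\<close>. With \<open>p = r * cos t\<close> and dA/dr = r T this is the radial
  part of the formula for \<open>dM\<close>.\<close>

lemma M_r_eq:
  assumes r: "0 < r" "r < R"
  shows "signed_integral (\<lambda>s. sin s * (Q (r * sin s) - c) + r * sin s * (Y (r * sin s) * sin s)) t
     = r * \<tau> r t - cos t * (Q (r * sin t) - c)"
proof (rule signed_integral_eqI)
  show "((\<lambda>t. r * \<tau> r t - cos t * (Q (r * sin t) - c)) has_real_derivative
      sin t * (Q (r * sin t) - c) + r * sin t * (Y (r * sin t) * sin t)) (at t)" for t
  proof -
    have DQ: "((\<lambda>t. Q (r * sin t)) has_real_derivative Y (r * sin t) * (r * cos t)) (at t)"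
      by (rule DERIV_chain2[where f = Q and g = "\<lambda>t. r * sin t", OF Q_deriv[OF polar_less_R[OF r]]])
        (auto intro!: derivative_eq_intros)
    have "r * Y (r * sin t) - (- sin t * (Q (r * sin t) - c) + cos t * (Y (r * sin t) * (r * cos t)))
       = sin t * (Q (r * sin t) - c) + r * Y (r * sin t) * (1 - (cos t)\<^sup>2)"
      by (simp add: algebra_simps power2_eq_square)
    also have "1 - (cos t)\<^sup>2 = (sin t)\<^sup>2" by (simp add: sin_squared_eq)
    finally show ?thesis
      by (auto intro!: derivative_eq_intros \<tau>_deriv r DQ simp: algebra_simps power2_eq_square)
  qed
  show "continuous_on UNIV (\<lambda>s. sin s * (Q (r * sin s) - c) + r * sin s * (Y (r * sin s) * sin s))"
    by (intro continuous_intros polar_cont_snd Q_isCont Y_isCont r)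
qed simp

lemma M_has_derivative:
  fixes \<rho> \<phi> :: "'a::real_normed_vector \<Rightarrow> real"
  assumes r: "0 < \<rho> x" "\<rho> x < R" and "(\<rho> has_derivative d\<rho>) (at x)" "(\<phi> has_derivative d\<phi>) (at x)"
  shows "((\<lambda>x. M (\<rho> x) (\<phi> x)) has_derivative
     (\<lambda>h. (\<rho> x * \<tau> (\<rho> x) (\<phi> x) - cos (\<phi> x) * (Q (\<rho> x * sin (\<phi> x)) - c)) * d\<rho> h
        + \<rho> x * sin (\<phi> x) * (Q (\<rho> x * sin (\<phi> x)) - c) * d\<phi> h)) (at x)"
  unfolding M_def M_r_eq[OF r, symmetric]
proof (rule signed_integral_has_derivative[where U = "{0<..<R}" and k = "\<lambda>r s. r * sin s * (Q (r * sin s) - c)"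
      and k' = "\<lambda>r s. sin s * (Q (r * sin s) - c) + r * sin s * (Y (r * sin s) * sin s)"])
  show "((\<lambda>r. r * sin t * (Q (r * sin t) - c)) has_real_derivative
     sin t * (Q (r * sin t) - c) + r * sin t * (Y (r * sin t) * sin t)) (at r)" if "r \<in> {0<..<R}" for r t
  proof -
    have "((\<lambda>r. Q (r * sin t)) has_real_derivative Y (r * sin t) * sin t) (at r)"
      using that polar_less_R
      by (intro DERIV_chain2[where f = Q and g = "\<lambda>r. r * sin t"] Q_deriv) (auto intro!: derivative_eq_intros)
    then show ?thesis by (auto intro!: derivative_eq_intros)
  qed
  have "continuous_on ({0<..<R} \<times> UNIV) (\<lambda>z. fst z * sin (snd z) * ((case z of (r, t) \<Rightarrow> Q (r * sin t)) - c))"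
    by (intro continuous_intros polar_cont Q_isCont) auto
  then show "continuous_on ({0<..<R} \<times> UNIV) (\<lambda>(r, t). r * sin t * (Q (r * sin t) - c))"
    by (simp add: case_prod_unfold)
  have "continuous_on ({0<..<R} \<times> UNIV) (\<lambda>z. sin (snd z) * ((case z of (r, t) \<Rightarrow> Q (r * sin t)) - c)
      + fst z * sin (snd z) * ((case z of (r, t) \<Rightarrow> Y (r * sin t)) * sin (snd z)))"
    by (intro continuous_intros polar_cont Q_isCont Y_isCont) auto
  then show "continuous_on ({0<..<R} \<times> UNIV) (\<lambda>(r, t). sin t * (Q (r * sin t) - c) + r * sin t * (Y (r * sin t) * sin t))"
    by (simp add: case_prod_unfold)
qed (use assms in auto)

text \<open>At the angle \<open>2 * pi\<close> the boundary term in the derivative of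
  \<open>M\<close> vanishes because \<open>Q 0 = c\<close>, leaving
  \<open>r * \<tau> r (2 * pi)\<close>. In terms of the energy \<open>r^2 / 2\<close> this is the
  classical fact that the derivative of the area is the period.\<close>

lemma A_deriv:
  assumes r: "0 < r" "r < R" shows "(A has_real_derivative r * T r) (at r)"
  using M_has_derivative[of "\<lambda>r. r" r "\<lambda>h. h" "\<lambda>_. 2 * pi" "\<lambda>_. 0"] r
  by (simp add: A_def[abs_def] T_def has_field_derivative_def)

lemma A_strict_mono:
  assumes "0 < r" "r < s" "s < R" shows "A r < A s"
proof (rule DERIV_pos_imp_increasing[OF assms(2)])
  show "\<exists>d. (A has_real_derivative d) (at z) \<and> d > 0" if "r \<le> z" "z \<le> s" for z
    using A_deriv[of z] T_pos[of z] that assms by (intro exI[of _ "z * T z"]) auto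
qed

lemma A_inj: "0 < r \<Longrightarrow> r < R \<Longrightarrow> 0 < s \<Longrightarrow> s < R \<Longrightarrow> A r = A s \<Longrightarrow> r = s"
  using A_strict_mono by (metis linorder_neqE_linordered_idom order_less_irrefl)

lemma \<Theta>_has_derivative:
  fixes \<rho> \<phi> :: "'a::real_normed_vector \<Rightarrow> real"
  assumes r: "0 < \<rho> x" "\<rho> x < R" and \<rho>: "(\<rho> has_derivative d\<rho>) (at x)" and \<phi>: "(\<phi> has_derivative d\<phi>) (at x)"
  shows "((\<lambda>x. \<Theta> (\<rho> x) (\<phi> x)) has_derivative
     (\<lambda>h. \<Theta>\<^sub>r (\<rho> x) (\<phi> x) * d\<rho> h + Y (\<rho> x * sin (\<phi> x)) / T (\<rho> x) * d\<phi> h)) (at x)"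
proof -
  have T0: "T (\<rho> x) \<noteq> 0" using T_pos r by force
  have DT: "((\<lambda>x. T (\<rho> x)) has_derivative (\<lambda>h. \<tau>\<^sub>r (\<rho> x) (2 * pi) * d\<rho> h)) (at x)"
    unfolding T_def using \<tau>_has_derivative[OF r \<rho>, of "\<lambda>_. 2 * pi" "\<lambda>_. 0"] by simp
  show ?thesis unfolding \<Theta>_def
    by (rule has_derivative_eq_rhs[OF has_derivative_divide[OF \<tau>_has_derivative[OF r \<rho> \<phi>] DT T0]])
       (use T0 in \<open>auto simp: \<Theta>\<^sub>r_def fun_eq_iff field_simps power2_eq_square\<close>)
qed

lemma \<Theta>_periodic: "0 < r \<Longrightarrow> r < R \<Longrightarrow> \<Theta> r (t + 2 * pi) = \<Theta> r t + 1"
  using T_pos[of r] by (simp add: \<Theta>_def \<tau>_periodic add_divide_distrib)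

end

section \<open>The period near the center and near the separatrix\<close>

context potential_well
begin

text \<open>By the mean value theorem \<open>T r\<close> equals \<open>2 * pi * Y y\<close> for some
  \<open>y\<close> with \<open>\<bar>y\<bar> \<le> r\<close>, and \<open>2 * pi * Y 0\<close> is the
  period of the linearised oscillation.\<close>

lemma T_near_center:
  assumes "B > 2 * pi / sqrt (f' c)"
  shows "\<exists>r. 0 < r \<and> r < R \<and> T r < B"
proof -
  have "Y 0 < B / (2 * pi)"
    using assms by (simp add: Y_0 field_simps)
  moreover have "(Y \<longlongrightarrow> Y 0) (nhds 0)"
    using Y_isCont[of 0] R_pos by (simp add: isCont_def tendsto_nhds_iff)
  ultimately have "\<forall>\<^sub>F y in nhds 0. Y y < B / (2 * pi)"
    by (rule order_tendstoD(2)[rotated])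
  then obtain e where e: "e > 0" "\<And>y. \<bar>y\<bar> < e \<Longrightarrow> Y y < B / (2 * pi)"
    by (auto simp: eventually_nhds_metric dist_real_def)
  define r where "r = min (e/2) (R/2)"
  have r: "0 < r" "r < R" "r < e" using e R_pos by (auto simp: r_def)
  obtain z where "T r = 2 * pi * Y (r * sin z)"
    using MVT2[of 0 "2 * pi" "\<tau> r" "\<lambda>t. Y (r * sin t)"] \<tau>_deriv[OF r(1,2)]
    by (auto simp: T_def)
  moreover have "\<bar>r * sin z\<bar> < e"
    using polar_le[of r z] r by simp
  ultimately have "T r < B"
    using e(2)[of "r * sin z"] by (simp add: field_simps)
  with r show ?thesis by blast
qed

text \<open>At an end of the well where the force vanishes, \<open>f\<^sup>2\<close> is bounded by the energy deficit; hence the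
  integrand of the period is at least \<open>c\<^sub>0 / (\<eta> + s)\<close> near the turning point and the period diverges logarithmically.\<close>
lemma f_sq_le_left:
  assumes "f l = 0" and k: "\<And>x. l \<le> x \<Longrightarrow> x \<le> b \<Longrightarrow> \<bar>f' x\<bar> \<le> k" and q: "l < q" "q \<le> c"
  shows "(f q)\<^sup>2 \<le> k * (2 * V l - 2 * V q)"
proof -
  have "k * (2 * V l - 2 * V l) - (f l)\<^sup>2 \<le> k * (2 * V l - 2 * V q) - (f q)\<^sup>2"
  proof (rule DERIV_nonneg_imp_nondecreasing[where f = "\<lambda>q. k * (2 * V l - 2 * V q) - (f q)\<^sup>2"])
    fix x assume x: "l \<le> x" "x \<le> q"
    have fx: "f x \<le> 0" using f_neg[of x] assms(1) f_c x q by (cases "x = l \<or> x = c") auto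
    have "((\<lambda>q. k * (2 * V l - 2 * V q) - (f q)\<^sup>2) has_real_derivative (- 2 * f x) * (k + f' x)) (at x)"
      by (auto intro!: derivative_eq_intros V_deriv f_deriv simp: algebra_simps)
    moreover have "(- 2 * f x) * (k + f' x) \<ge> 0"
      using fx k[of x] x q c_less_b by (simp add: mult_nonpos_nonneg)
    ultimately show "\<exists>y. ((\<lambda>q. k * (2 * V l - 2 * V q) - (f q)\<^sup>2) has_real_derivative y) (at x) \<and> 0 \<le> y"
      by blast
  qed (use q in auto)
  then show ?thesis using assms(1) by simp
qed

lemma f_sq_le_right:
  assumes "f b = 0" and k: "\<And>x. l \<le> x \<Longrightarrow> x \<le> b \<Longrightarrow> \<bar>f' x\<bar> \<le> k" and q: "c \<le> q" "q < b"
  shows "(f q)\<^sup>2 \<le> k * (2 * V b - 2 * V q)"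
proof -
  have "k * (2 * V b - 2 * V q) - (f q)\<^sup>2 \<ge> k * (2 * V b - 2 * V b) - (f b)\<^sup>2"
  proof (rule DERIV_nonpos_imp_nonincreasing[where f = "\<lambda>q. k * (2 * V b - 2 * V q) - (f q)\<^sup>2"])
    fix x assume x: "q \<le> x" "x \<le> b"
    have fx: "f x \<ge> 0" using f_pos[of x] assms(1) f_c x q by (cases "x = b \<or> x = c") auto
    have "((\<lambda>q. k * (2 * V b - 2 * V q) - (f q)\<^sup>2) has_real_derivative (- 2 * f x) * (k + f' x)) (at x)"
      by (auto intro!: derivative_eq_intros V_deriv f_deriv simp: algebra_simps)
    moreover have "(- 2 * f x) * (k + f' x) \<le> 0"
      using fx k[of x] x q l_less_c by (intro mult_nonpos_nonneg) auto
    ultimately show "\<exists>y. ((\<lambda>q. k * (2 * V b - 2 * V q) - (f q)\<^sup>2) has_real_derivative y) (at x) \<and> y \<le> 0"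
      by blast
  qed (use q in auto)
  then show ?thesis using assms(1) by simp
qed

lemma R_sq: "R\<^sup>2 = 2 * min (V l) (V b)"
  using R_pos by (simp add: R_def real_sqrt_gt_0_iff)

lemma Q_sign: "\<bar>y\<bar> < R \<Longrightarrow> 0 \<le> y \<Longrightarrow> c \<le> Q y" "\<bar>y\<bar> < R \<Longrightarrow> y \<le> 0 \<Longrightarrow> Q y \<le> c"
  using yc_pos[of "Q y"] yc_neg[of "Q y"] Q_props[of y] by force+

text \<open>\<open>R\<close> is determined by the lower end of the well, so only on that side is
  \<open>R^2 - y^2\<close> twice the energy deficit to the saddle. The sign \<open>\<sigma>\<close>
  records the side: -1 for the left end, 1 for the right end.\<close>

lemma f_sq_le_side:
  assumes "f l = 0" "f b = 0" and k: "\<And>x. l \<le> x \<Longrightarrow> x \<le> b \<Longrightarrow> \<bar>f' x\<bar> \<le> k" "k > 0"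
  obtains \<sigma> :: real where "\<sigma> = 1 \<or> \<sigma> = -1"
    "\<And>y. \<bar>y\<bar> < R \<Longrightarrow> \<sigma> * y \<ge> 0 \<Longrightarrow> (f (Q y))\<^sup>2 \<le> k * (R\<^sup>2 - y\<^sup>2)"
proof (cases "V l \<le> V b")
  case True
  have "(f (Q y))\<^sup>2 \<le> k * (R\<^sup>2 - y\<^sup>2)" if "\<bar>y\<bar> < R" "- 1 * y \<ge> 0" for y
    using f_sq_le_left[OF assms(1) k(1), of "Q y"] Q_props[OF that(1)] Q_sign(2)[OF that(1)] that(2) True
      yc_sq[of "Q y"] by (simp add: R_sq)
  then show ?thesis using that[of "-1"] by blast
next
  case False
  have "(f (Q y))\<^sup>2 \<le> k * (R\<^sup>2 - y\<^sup>2)" if "\<bar>y\<bar> < R" "1 * y \<ge> 0" for y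
    using f_sq_le_right[OF assms(2) k(1), of "Q y"] Q_props[OF that(1)] Q_sign(1)[OF that(1)] that(2) False
      yc_sq[of "Q y"] by (simp add: R_sq)
  then show ?thesis using that[of 1] by blast
qed

lemma T_near_separatrix:
  assumes ends: "f l = 0" "f b = 0" and "r0 < R"
  shows "\<exists>r. r0 < r \<and> 0 < r \<and> r < R \<and> T r > B"
proof -
  obtain k where k: "\<And>x. l \<le> x \<Longrightarrow> x \<le> b \<Longrightarrow> \<bar>f' x\<bar> \<le> k" "k > 0"
  proof -
    have "compact (f' ` {l..b})"
      by (intro compact_continuous_image continuous_on_subset[OF f'_cont]) auto
    then obtain k where "\<forall>x\<in>f' ` {l..b}. norm x \<le> k"
      using compact_imp_bounded bounded_iff by blast
    then show ?thesis by (intro that[of "max k 1"]) (auto simp: max_def intro: order_trans)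
  qed
  obtain \<sigma> where \<sigma>: "\<sigma> = 1 \<or> \<sigma> = -1"
    and fs: "\<And>y. \<bar>y\<bar> < R \<Longrightarrow> \<sigma> * y \<ge> 0 \<Longrightarrow> (f (Q y))\<^sup>2 \<le> k * (R\<^sup>2 - y\<^sup>2)"
    using f_sq_le_side[OF ends k] by metis
  \<comment> \<open>From \<open>Y = r * cos s / \<bar>f\<bar>\<close> with
    \<open>r * cos s \<ge> R / 4\<close> and
    \<open>\<bar>f\<bar> \<le> sqrt k * R * (\<eta> + s)\<close>.\<close>
  define c0 where "c0 = 1 / (4 * sqrt k)"
  have c0: "c0 > 0" using k by (simp add: c0_def)
  \<comment> \<open>Chosen so that \<open>c0 * ln h0 = - B\<close>: once \<open>\<eta> < h0\<close>,
    the logarithmic lower bound for the period exceeds \<open>B\<close>.\<close>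
  define h0 where "h0 = exp (- (B / c0))"
  have "((\<lambda>r. R\<^sup>2 - r\<^sup>2) \<longlongrightarrow> R\<^sup>2 - R\<^sup>2) (at_left R)"
    by (intro tendsto_intros)
  then have "\<forall>\<^sub>F r in at_left R. R\<^sup>2 - r\<^sup>2 < (R * h0)\<^sup>2"
    using R_pos by (intro order_tendstoD) (auto simp: h0_def)
  moreover have "\<forall>\<^sub>F r in at_left R. r \<in> {max r0 (R/2)<..<R}"
    by (rule eventually_at_leftI[of "max r0 (R/2)"]) (use assms(3) R_pos in auto)
  ultimately have "\<forall>\<^sub>F r in at_left R. R\<^sup>2 - r\<^sup>2 < (R * h0)\<^sup>2 \<and> r \<in> {max r0 (R/2)<..<R}"
    by (rule eventually_conj)
  then obtain r where r: "R\<^sup>2 - r\<^sup>2 < (R * h0)\<^sup>2" "r0 < r" "R/2 < r" "r < R"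
    using eventually_happens[of _ "at_left R"] by (auto simp: trivial_limit_at_left_real)
  have r0: "r > 0" using r R_pos by linarith
  define \<eta> where "\<eta> = sqrt (R\<^sup>2 - r\<^sup>2) / R"
  have "r\<^sup>2 < R\<^sup>2" using r r0 by (simp add: power_strict_mono)
  then have \<eta>: "\<eta> > 0" using R_pos by (simp add: \<eta>_def)
  have "sqrt (R\<^sup>2 - r\<^sup>2) < R * h0"
    using r(1) R_pos by (intro real_less_lsqrt) (auto simp: h0_def)
  then have "\<eta> < h0" using R_pos by (simp add: \<eta>_def field_simps)
  have \<eta>2: "R\<^sup>2 - r\<^sup>2 = R\<^sup>2 * \<eta>\<^sup>2"
    using \<open>r\<^sup>2 < R\<^sup>2\<close> R_pos by (simp add: \<eta>_def power_divide)
  \<comment> \<open>The polar angle at which the orbit is closest to the critical end. The unit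
    interval of angles that follows it still lies within one turn.\<close>
  define s0 where "s0 = (if \<sigma> = 1 then pi/2 else 3*pi/2)"
  have sin_s0: "sin (s0 + s) = \<sigma> * cos s" for s
  proof (cases "\<sigma> = 1")
    case True then show ?thesis by (simp add: s0_def sin_add)
  next
    case False
    then show ?thesis using \<sigma> sin_3over2_pi cos_3over2_pi by (simp add: s0_def sin_add)
  qed
  have s0: "0 \<le> s0" "s0 + 1 \<le> 2 * pi"
    using pi_gt3 by (auto simp: s0_def)
  have lower: "Y (r * sin (s0 + s)) \<ge> c0 / (\<eta> + s)" if s: "0 \<le> s" "s \<le> 1" for s
  proof -
    let ?y = "r * sin (s0 + s)"
    have y: "\<bar>?y\<bar> < R" by (rule polar_less_R) (use r0 r in auto)
    have "cos s \<ge> cos (pi/3)"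
      using s pi_gt3 by (intro cos_monotone_0_pi_le) auto
    then have cs: "cos s \<ge> 1/2" by (simp add: cos_60)
    have y_abs: "\<bar>?y\<bar> = r * cos s" using \<sigma> r0 cs by (auto simp: sin_s0 abs_mult)
    have "\<sigma> * ?y = r * cos s" using \<sigma> by (auto simp: sin_s0)
    moreover have "r * cos s \<ge> 0" using r0 cs by simp
    ultimately have "\<sigma> * ?y \<ge> 0" by presburger
    then have "(f (Q ?y))\<^sup>2 \<le> k * (R\<^sup>2 - ?y\<^sup>2)"
      using fs[OF y] by blast
    also have "R\<^sup>2 - ?y\<^sup>2 = R\<^sup>2 - r\<^sup>2 + r\<^sup>2 * (sin s)\<^sup>2"
    proof -
      have "?y\<^sup>2 = r\<^sup>2 * (cos s)\<^sup>2" using \<sigma> by (auto simp: sin_s0 power_mult_distrib)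
      then show ?thesis by (simp add: cos_squared_eq algebra_simps)
    qed
    also have "\<dots> \<le> R\<^sup>2 * \<eta>\<^sup>2 + R\<^sup>2 * s\<^sup>2"
    proof -
      have "\<bar>sin s\<bar> \<le> \<bar>s\<bar>" by (rule abs_sin_x_le_abs_x)
      then have "(sin s)\<^sup>2 \<le> s\<^sup>2" by (simp add: abs_le_square_iff)
      then show ?thesis using \<open>r\<^sup>2 < R\<^sup>2\<close> by (simp add: \<eta>2 mult_mono)
    qed
    also have "\<dots> \<le> (R * (\<eta> + s))\<^sup>2"
      using \<eta> s by (simp add: power2_eq_square algebra_simps)
    finally have "(f (Q ?y))\<^sup>2 \<le> (sqrt k * (R * (\<eta> + s)))\<^sup>2"
      using k by (simp add: power_mult_distrib)
    moreover have nn: "sqrt k * (R * (\<eta> + s)) > 0"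
      using k(2) R_pos \<eta> s by simp
    ultimately have fb: "\<bar>f (Q ?y)\<bar> \<le> sqrt k * (R * (\<eta> + s))"
      using abs_le_square_iff[of "f (Q ?y)" "sqrt k * (R * (\<eta> + s))"] by linarith
    have "c0 / (\<eta> + s) * (sqrt k * (R * (\<eta> + s))) = R/4"
    proof -
      have "\<eta> + s \<noteq> 0" "sqrt k \<noteq> 0" using \<eta> s k(2) by auto
      moreover have "1 / (4 * y) / x * (y * (R * x)) = R/4" if "x \<noteq> 0" "y \<noteq> 0" for x y
        using that by simp
      ultimately show ?thesis unfolding c0_def by blast
    qed
    also have "\<dots> \<le> r * cos s"
      using mult_mono[of "R/2" r "1/2" "cos s"] r r0 cs R_pos by simp
    also have "\<dots> = Y ?y * \<bar>f (Q ?y)\<bar>"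
      using f_Q[OF y] Y_pos[OF y] y_abs by (metis abs_mult abs_of_pos)
    also have "\<dots> \<le> Y ?y * (sqrt k * (R * (\<eta> + s)))"
      using fb Y_pos[OF y] by (intro mult_left_mono) auto
    finally show ?thesis
      by (rule mult_right_le_imp_le) (rule nn)
  qed
  \<comment> \<open>The pointwise bound is integrated by monotonicity: \<open>\<tau>\<close> minus
    the primitive \<open>c0 * ln (\<eta> + s)\<close> has nonnegative derivative.\<close>
  have "\<tau> r (s0 + 0) - c0 * ln (\<eta> + 0) \<le> \<tau> r (s0 + 1) - c0 * ln (\<eta> + 1)"
  proof (rule DERIV_nonneg_imp_nondecreasing[where f = "\<lambda>s. \<tau> r (s0 + s) - c0 * ln (\<eta> + s)"])
    fix s :: real assume s: "0 \<le> s" "s \<le> 1"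
    have "((\<lambda>s. \<tau> r (s0 + s)) has_real_derivative Y (r * sin (s0 + s))) (at s)"
      using DERIV_shift[THEN iffD1, OF \<tau>_deriv[OF r0 r(4)], of s0 s] by (simp add: add.commute)
    then have "((\<lambda>s. \<tau> r (s0 + s) - c0 * ln (\<eta> + s)) has_real_derivative
        Y (r * sin (s0 + s)) - c0 / (\<eta> + s)) (at s)"
      using \<eta> s by (auto intro!: derivative_eq_intros)
    then show "\<exists>y. ((\<lambda>s. \<tau> r (s0 + s) - c0 * ln (\<eta> + s)) has_real_derivative y) (at s) \<and> 0 \<le> y"
      using lower[OF s] by (metis diff_ge_0_iff_ge)
  qed simp
  moreover have "\<tau> r s0 \<ge> 0"
    using \<tau>_strict_mono[OF r0 r(4), of 0 s0] s0 by (cases "s0 = 0") auto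
  moreover have "\<tau> r (s0 + 1) \<le> T r"
    using \<tau>_strict_mono[OF r0 r(4), of "s0 + 1" "2 * pi"] s0 by (cases "s0 + 1 = 2 * pi") (auto simp: T_def)
  ultimately have "T r \<ge> c0 * ln (\<eta> + 1) - c0 * ln \<eta>" by simp
  moreover have "c0 * ln (\<eta> + 1) > 0" using c0 \<eta> by simp
  moreover have "c0 * ln \<eta> < - B"
  proof -
    have "ln \<eta> < ln h0" using \<open>\<eta> < h0\<close> \<eta> by (intro ln_less_cancel_iff[THEN iffD2]) (auto simp: h0_def)
    then have "c0 * ln \<eta> < c0 * ln h0" using c0 by (intro mult_strict_left_mono)
    then show ?thesis using c0 by (simp add: h0_def)
  qed
  ultimately have "T r > B" by linarith
  with r r0 show ?thesis by blast
qed

end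

section \<open>Symplectic Euler steps\<close>

text \<open>For a step of length \<open>h\<close> with kick \<open>e\<close>, an error is negligible (\<open>smo\<close>) if it is at most
  \<open>\<eta> * h + C * \<bar>e\<bar>\<close> with \<open>\<eta>\<close> arbitrarily small: over a time \<open>L\<close> such errors add up to \<open>\<eta> * L + C * (\<Sum> \<bar>e\<bar>)\<close>.\<close>
locale step_errors =
  fixes Fl :: "'x filter" and h e :: "'x \<Rightarrow> real"
  assumes h_tendsto: "(h \<longlongrightarrow> 0) Fl" and e_tendsto: "(e \<longlongrightarrow> 0) Fl"
    and h_nonneg: "\<forall>\<^sub>F x in Fl. h x \<ge> 0"
begin

definition bdd :: "('x \<Rightarrow> real) \<Rightarrow> bool" where
  "bdd X \<longleftrightarrow> (\<exists>C\<ge>0. \<forall>\<^sub>F x in Fl. \<bar>X x\<bar> \<le> C)"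

definition bigo :: "('x \<Rightarrow> real) \<Rightarrow> bool" where
  "bigo X \<longleftrightarrow> (\<exists>C\<ge>0. \<forall>\<^sub>F x in Fl. \<bar>X x\<bar> \<le> C * (h x + \<bar>e x\<bar>))"

definition smo :: "('x \<Rightarrow> real) \<Rightarrow> bool" where
  "smo X \<longleftrightarrow> (\<exists>C\<ge>0. \<forall>\<eta>>0. \<forall>\<^sub>F x in Fl. \<bar>X x\<bar> \<le> \<eta> * h x + C * \<bar>e x\<bar>)"

lemma bddI: "(\<And>x. \<bar>X x\<bar> \<le> C) \<Longrightarrow> bdd X"
  unfolding bdd_def by (intro exI[of _ "\<bar>C\<bar>"]) (auto intro!: always_eventually order_trans[OF _ abs_ge_self])

lemma bddI': "\<forall>\<^sub>F x in Fl. \<bar>X x\<bar> \<le> C \<Longrightarrow> bdd X"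
  unfolding bdd_def by (intro exI[of _ "\<bar>C\<bar>"]) (auto elim!: eventually_mono intro: order_trans[OF _ abs_ge_self])

lemma bdd_const [simp]: "bdd (\<lambda>_. k)" by (rule bddI[of _ "\<bar>k\<bar>"]) simp

lemma bdd_mult: "bdd X \<Longrightarrow> bdd Y \<Longrightarrow> bdd (\<lambda>x. X x * Y x)"
proof -
  assume "bdd X" "bdd Y"
  then obtain C D where CD: "C \<ge> 0" "D \<ge> 0" "\<forall>\<^sub>F x in Fl. \<bar>X x\<bar> \<le> C" "\<forall>\<^sub>F x in Fl. \<bar>Y x\<bar> \<le> D"
    by (auto simp: bdd_def)
  from CD(3,4) have "\<forall>\<^sub>F x in Fl. \<bar>X x * Y x\<bar> \<le> C * D"
    by eventually_elim (auto simp: abs_mult CD intro!: mult_mono)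
  then show ?thesis by (rule bddI')
qed

lemma smo_add: "smo X \<Longrightarrow> smo Y \<Longrightarrow> smo (\<lambda>x. X x + Y x)"
proof -
  assume "smo X" "smo Y"
  then obtain C D where CD: "C \<ge> 0" "D \<ge> 0"
      "\<And>\<eta>. \<eta> > 0 \<Longrightarrow> \<forall>\<^sub>F x in Fl. \<bar>X x\<bar> \<le> \<eta> * h x + C * \<bar>e x\<bar>"
      "\<And>\<eta>. \<eta> > 0 \<Longrightarrow> \<forall>\<^sub>F x in Fl. \<bar>Y x\<bar> \<le> \<eta> * h x + D * \<bar>e x\<bar>"
    by (auto simp: smo_def)
  have "\<forall>\<^sub>F x in Fl. \<bar>X x + Y x\<bar> \<le> \<eta> * h x + (C + D) * \<bar>e x\<bar>" if "\<eta> > 0" for \<eta>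
    using CD(3)[OF half_gt_zero[OF that]] CD(4)[OF half_gt_zero[OF that]]
    by eventually_elim (auto simp: algebra_simps)
  then show ?thesis unfolding smo_def using CD by (intro exI[of _ "C + D"]) auto
qed

lemma smo_bdd_mult: "bdd X \<Longrightarrow> smo Y \<Longrightarrow> smo (\<lambda>x. X x * Y x)"
proof -
  assume "bdd X" "smo Y"
  then obtain C D where CD: "C \<ge> 0" "D \<ge> 0" "\<forall>\<^sub>F x in Fl. \<bar>X x\<bar> \<le> C"
      "\<And>\<eta>. \<eta> > 0 \<Longrightarrow> \<forall>\<^sub>F x in Fl. \<bar>Y x\<bar> \<le> \<eta> * h x + D * \<bar>e x\<bar>"
    by (auto simp: smo_def bdd_def)
  have "\<forall>\<^sub>F x in Fl. \<bar>X x * Y x\<bar> \<le> \<eta> * h x + ((C + 1) * D) * \<bar>e x\<bar>" if "\<eta> > 0" for \<eta>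
  proof -
    have "\<eta> / (C + 1) > 0" using that CD by simp
    from CD(4)[OF this] CD(3) show ?thesis
    proof eventually_elim
      case (elim x)
      have "\<bar>X x * Y x\<bar> \<le> (C + 1) * (\<eta> / (C + 1) * h x + D * \<bar>e x\<bar>)"
        unfolding abs_mult using elim CD by (intro mult_mono) auto
      also have "\<dots> = \<eta> * h x + ((C + 1) * D) * \<bar>e x\<bar>" using CD by (simp add: distrib_left)
      finally show ?case .
    qed
  qed
  then show ?thesis unfolding smo_def using CD by (intro exI[of _ "(C + 1) * D"]) auto
qed

lemma smo_minus: "smo X \<Longrightarrow> smo (\<lambda>x. - X x)"
  by (simp add: smo_def)

lemma smo_diff: "smo X \<Longrightarrow> smo Y \<Longrightarrow> smo (\<lambda>x. X x - Y x)"
  using smo_add[OF _ smo_minus] by simp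

lemma smo_h: "(X \<longlongrightarrow> 0) Fl \<Longrightarrow> smo (\<lambda>x. h x * X x)"
  unfolding smo_def
proof (intro exI[of _ 0] conjI allI impI)
  fix \<eta> :: real assume X: "(X \<longlongrightarrow> 0) Fl" and "\<eta> > 0"
  then have "\<forall>\<^sub>F x in Fl. \<bar>X x\<bar> < \<eta>" using tendstoD[OF X] by (simp add: dist_real_def)
  then show "\<forall>\<^sub>F x in Fl. \<bar>h x * X x\<bar> \<le> \<eta> * h x + 0 * \<bar>e x\<bar>"
    using h_nonneg by eventually_elim (auto simp: abs_mult mult.commute[of \<eta>] intro: mult_left_mono)
qed simp

lemma smo_e: "bdd X \<Longrightarrow> smo (\<lambda>x. e x * X x)"
proof -
  assume "bdd X"
  then obtain C where C: "C \<ge> 0" "\<forall>\<^sub>F x in Fl. \<bar>X x\<bar> \<le> C" by (auto simp: bdd_def)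
  have "\<forall>\<^sub>F x in Fl. \<bar>e x * X x\<bar> \<le> \<eta> * h x + C * \<bar>e x\<bar>" if "\<eta> > 0" for \<eta>
    using C(2) h_nonneg
  proof eventually_elim
    case (elim x)
    then have "\<bar>e x * X x\<bar> \<le> C * \<bar>e x\<bar>" by (auto simp: abs_mult mult.commute intro: mult_right_mono)
    moreover have "\<eta> * h x \<ge> 0" using elim that by simp
    ultimately show ?case by linarith
  qed
  then show ?thesis unfolding smo_def using C by blast
qed

lemma bigo_tendsto: assumes "bigo X" shows "(X \<longlongrightarrow> 0) Fl"
proof -
  obtain C where C: "\<forall>\<^sub>F x in Fl. \<bar>X x\<bar> \<le> C * (h x + \<bar>e x\<bar>)" using assms by (auto simp: bigo_def)
  have "((\<lambda>x. C * (h x + \<bar>e x\<bar>)) \<longlongrightarrow> C * (0 + \<bar>0\<bar>)) Fl"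
    by (intro tendsto_intros h_tendsto e_tendsto)
  then show ?thesis
    using C by (intro Lim_null_comparison[of X "\<lambda>x. C * (h x + \<bar>e x\<bar>)"]) auto
qed

lemma smo_le: assumes "smo Y" "\<forall>\<^sub>F x in Fl. \<bar>X x\<bar> \<le> \<bar>Y x\<bar>" shows "smo X"
proof -
  obtain C where C: "C \<ge> 0" "\<And>\<eta>. \<eta> > 0 \<Longrightarrow> \<forall>\<^sub>F x in Fl. \<bar>Y x\<bar> \<le> \<eta> * h x + C * \<bar>e x\<bar>"
    using assms(1) by (auto simp: smo_def)
  have "\<forall>\<^sub>F x in Fl. \<bar>X x\<bar> \<le> \<eta> * h x + C * \<bar>e x\<bar>" if "\<eta> > 0" for \<eta>
    using C(2)[OF that] assms(2) by eventually_elim simp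
  then show ?thesis unfolding smo_def using C by blast
qed

lemma smo_cong: "smo Y \<Longrightarrow> (\<And>x. X x = Y x) \<Longrightarrow> smo X"
  by (metis ext)

text \<open>A relative error in \<open>D\<close> is applied with \<open>\<eta>'\<close> small enough
  that \<open>\<eta>' * C \<le> \<eta>\<close> in front of \<open>h\<close>, but at most 1 in any
  case, so the coefficient of the kick stays at the fixed value \<open>C\<close>.\<close>

lemma smo_oI:
  assumes "bigo D" "\<And>\<eta>. \<eta> > 0 \<Longrightarrow> \<forall>\<^sub>F x in Fl. \<bar>X x\<bar> \<le> \<eta> * \<bar>D x\<bar>"
  shows "smo X"
proof -
  obtain C where C: "C \<ge> 0" "\<forall>\<^sub>F x in Fl. \<bar>D x\<bar> \<le> C * (h x + \<bar>e x\<bar>)"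
    using assms(1) by (auto simp: bigo_def)
  have "\<forall>\<^sub>F x in Fl. \<bar>X x\<bar> \<le> \<eta> * h x + C * \<bar>e x\<bar>" if "\<eta> > 0" for \<eta>
  proof -
    define \<eta>' where "\<eta>' = min 1 (\<eta> / (C + 1))"
    have \<eta>': "\<eta>' > 0" "\<eta>' \<le> 1" using that C by (auto simp: \<eta>'_def)
    have "\<eta>' * C \<le> \<eta> / (C + 1) * (C + 1)"
      using C that by (intro mult_mono) (auto simp: \<eta>'_def)
    then have \<eta>'C: "\<eta>' * C \<le> \<eta>" using C by simp
    show ?thesis using assms(2)[OF \<eta>'(1)] C(2) h_nonneg
    proof eventually_elim
      case (elim x)
      have "\<bar>X x\<bar> \<le> \<eta>' * (C * (h x + \<bar>e x\<bar>))"
        using elim \<eta>' by (meson mult_left_mono order.trans less_imp_le)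
      also have "\<dots> = (\<eta>' * C) * h x + \<eta>' * (C * \<bar>e x\<bar>)" by (simp add: algebra_simps)
      also have "\<dots> \<le> \<eta> * h x + 1 * (C * \<bar>e x\<bar>)"
        using \<eta>' \<eta>'C C elim by (intro add_mono mult_right_mono) auto
      finally show ?case by simp
    qed
  qed
  then show ?thesis unfolding smo_def using C by blast
qed

lemma smo_o_mult: assumes "(X \<longlongrightarrow> 0) Fl" "bigo D" shows "smo (\<lambda>x. X x * D x)"
proof (rule smo_oI[OF assms(2)])
  fix \<eta> :: real assume "\<eta> > 0"
  then have "\<forall>\<^sub>F x in Fl. \<bar>X x\<bar> < \<eta>" using tendstoD[OF assms(1)] by (simp add: dist_real_def)
  then show "\<forall>\<^sub>F x in Fl. \<bar>X x * D x\<bar> \<le> \<eta> * \<bar>D x\<bar>"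
    by eventually_elim (auto simp: abs_mult intro: mult_right_mono)
qed

lemma bigo_h: "bdd X \<Longrightarrow> bigo (\<lambda>x. h x * X x)"
proof -
  assume "bdd X"
  then obtain C where C: "C \<ge> 0" "\<forall>\<^sub>F x in Fl. \<bar>X x\<bar> \<le> C" by (auto simp: bdd_def)
  have "\<forall>\<^sub>F x in Fl. \<bar>h x * X x\<bar> \<le> C * (h x + \<bar>e x\<bar>)"
    using C(2) h_nonneg
  proof eventually_elim
    case (elim x)
    then have "\<bar>h x * X x\<bar> \<le> h x * C" by (auto simp: abs_mult intro: mult_left_mono)
    also have "\<dots> \<le> C * (h x + \<bar>e x\<bar>)" using C by (simp add: algebra_simps)
    finally show ?case .
  qed
  then show ?thesis unfolding bigo_def using C by blast
qed

lemma smo_imp_bigo: "smo X \<Longrightarrow> bigo X"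
proof -
  assume "smo X"
  then obtain C where C: "C \<ge> 0" "\<forall>\<^sub>F x in Fl. \<bar>X x\<bar> \<le> 1 * h x + C * \<bar>e x\<bar>" 
    unfolding smo_def by (metis zero_less_one)
  have "\<forall>\<^sub>F x in Fl. \<bar>X x\<bar> \<le> (1 + C) * (h x + \<bar>e x\<bar>)"
    using C(2) h_nonneg
  proof eventually_elim
    case (elim x)
    then have "C * h x \<ge> 0" using C by simp
    then have "1 * h x + C * \<bar>e x\<bar> \<le> (1 + C) * (h x + \<bar>e x\<bar>)" by (simp add: algebra_simps)
    with elim show ?case by linarith
  qed
  then show ?thesis unfolding bigo_def using C by (intro exI[of _ "1 + C"]) auto
qed

lemma bigo_add: "bigo X \<Longrightarrow> bigo Y \<Longrightarrow> bigo (\<lambda>x. X x + Y x)"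
proof -
  assume "bigo X" "bigo Y"
  then obtain C D where CD: "C \<ge> 0" "D \<ge> 0" "\<forall>\<^sub>F x in Fl. \<bar>X x\<bar> \<le> C * (h x + \<bar>e x\<bar>)"
      "\<forall>\<^sub>F x in Fl. \<bar>Y x\<bar> \<le> D * (h x + \<bar>e x\<bar>)"
    by (auto simp: bigo_def)
  from CD(3,4) have "\<forall>\<^sub>F x in Fl. \<bar>X x + Y x\<bar> \<le> (C + D) * (h x + \<bar>e x\<bar>)"
    by eventually_elim (auto simp: algebra_simps)
  then show ?thesis unfolding bigo_def using CD by (intro exI[of _ "C + D"]) auto
qed

lemma bigo_bdd_mult: "bdd X \<Longrightarrow> bigo Y \<Longrightarrow> bigo (\<lambda>x. X x * Y x)"
proof -
  assume "bdd X" "bigo Y"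
  then obtain C D where CD: "C \<ge> 0" "D \<ge> 0" "\<forall>\<^sub>F x in Fl. \<bar>X x\<bar> \<le> C"
      "\<forall>\<^sub>F x in Fl. \<bar>Y x\<bar> \<le> D * (h x + \<bar>e x\<bar>)"
    by (auto simp: bigo_def bdd_def)
  from CD(3,4) have "\<forall>\<^sub>F x in Fl. \<bar>X x * Y x\<bar> \<le> C * D * (h x + \<bar>e x\<bar>)"
  proof eventually_elim
    case (elim x)
    then have "\<bar>X x\<bar> * \<bar>Y x\<bar> \<le> C * (D * (h x + \<bar>e x\<bar>))" using CD by (intro mult_mono) auto
    then show ?case by (simp add: abs_mult mult.assoc)
  qed
  then show ?thesis unfolding bigo_def using CD by (intro exI[of _ "C * D"]) auto
qed

end

section \<open>First-order Taylor estimates uniform in the base point\<close>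

definition uniformly_differentiable :: "real set \<Rightarrow> (real \<Rightarrow> real) \<Rightarrow> (real \<Rightarrow> real) \<Rightarrow> bool" where
  "uniformly_differentiable S k k' \<longleftrightarrow>
     (\<forall>\<eta>>0. \<exists>\<delta>>0. \<forall>a\<in>S. \<forall>d. \<bar>d\<bar> < \<delta> \<longrightarrow> \<bar>k (a + d) - k a - k' a * d\<bar> \<le> \<eta> * \<bar>d\<bar>)"

text \<open>By the mean value theorem the remainder is \<open>(k' z - k' a) * d\<close> for some
  \<open>z\<close> between \<open>a\<close> and \<open>a + d\<close>. Uniformity in \<open>a\<close>
  is what allows the base point to vary along the filter.\<close>

lemma uniformly_differentiableI:
  assumes ud: "\<And>\<eta>. \<eta> > 0 \<Longrightarrow> \<exists>\<delta>>0. \<forall>a\<in>S. \<forall>x. \<bar>x - a\<bar> < \<delta> \<longrightarrow>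
      (k has_real_derivative k' x) (at x) \<and> \<bar>k' x - k' a\<bar> \<le> \<eta>"
  shows "uniformly_differentiable S k k'"
  unfolding uniformly_differentiable_def
proof (intro allI impI)
  fix \<eta> :: real assume "\<eta> > 0"
  then obtain \<delta> where \<delta>: "\<delta> > 0" "\<And>a x. a \<in> S \<Longrightarrow> \<bar>x - a\<bar> < \<delta> \<Longrightarrow>
      (k has_real_derivative k' x) (at x) \<and> \<bar>k' x - k' a\<bar> \<le> \<eta>"
    using ud by meson
  show "\<exists>\<delta>>0. \<forall>a\<in>S. \<forall>d. \<bar>d\<bar> < \<delta> \<longrightarrow> \<bar>k (a + d) - k a - k' a * d\<bar> \<le> \<eta> * \<bar>d\<bar>"
  proof (intro exI[of _ \<delta>] conjI ballI allI impI)
    fix a d :: real assume a: "a \<in> S" and d: "\<bar>d\<bar> < \<delta>"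
    have D: "(k has_real_derivative k' x) (at x)" if "\<bar>x - a\<bar> < \<delta>" for x
      using \<delta>(2) a that by blast
    obtain z where z: "\<bar>z - a\<bar> < \<delta>" "k (a + d) - k a = k' z * d"
    proof (cases "d > 0")
      case True
      then obtain z where "a < z" "z < a + d" "k (a + d) - k a = (a + d - a) * k' z"
        using MVT2[of a "a + d" k k'] D d by force
      then show ?thesis using that[of z] d by (auto simp: mult.commute)
    next
      case False
      show ?thesis
      proof (cases "d = 0")
        case True then show ?thesis using that[of a] \<delta> by simp
      next
        case False
        with \<open>\<not> d > 0\<close> have "d < 0" by simp
        then obtain z where "a + d < z" "z < a" "k a - k (a + d) = (a - (a + d)) * k' z"
          using MVT2[of "a + d" a k k'] D d by force
        then show ?thesis using that[of z] d by (auto simp: algebra_simps)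
      qed
    qed
    have "\<bar>k (a + d) - k a - k' a * d\<bar> = \<bar>k' z - k' a\<bar> * \<bar>d\<bar>"
      using z(2) by (simp add: abs_mult left_diff_distrib flip: abs_mult)
    also have "\<dots> \<le> \<eta> * \<bar>d\<bar>" using \<delta>(2)[OF a z(1)] by (intro mult_right_mono) auto
    finally show "\<bar>k (a + d) - k a - k' a * d\<bar> \<le> \<eta> * \<bar>d\<bar>" .
  qed (use \<delta> in auto)
qed

lemma uniformly_differentiable_C1:
  assumes "\<And>x. u < x \<Longrightarrow> x < v \<Longrightarrow> (k has_real_derivative k' x) (at x)"
    and "\<And>x. u < x \<Longrightarrow> x < v \<Longrightarrow> isCont k' x"
    and ab: "u < \<alpha>" "\<beta> < v"
  shows "uniformly_differentiable {\<alpha>..\<beta>} k k'"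
proof (rule uniformly_differentiableI)
  fix \<eta> :: real assume "\<eta> > 0"
  \<comment> \<open>Points halfway to the ends of the domain: base points and perturbed points share
    a compact interval on which \<open>k'\<close> is uniformly continuous.\<close>
  define \<alpha>' \<beta>' where "\<alpha>' = (u + \<alpha>)/2" and "\<beta>' = (\<beta> + v)/2"
  have "continuous_on {\<alpha>'..\<beta>'} k'"
    using assms by (intro continuous_at_imp_continuous_on) (auto simp: \<alpha>'_def \<beta>'_def)
  then have "uniformly_continuous_on {\<alpha>'..\<beta>'} k'"
    by (intro compact_uniformly_continuous) auto
  then obtain \<delta> where \<delta>: "\<delta> > 0" "\<And>x y. x \<in> {\<alpha>'..\<beta>'} \<Longrightarrow> y \<in> {\<alpha>'..\<beta>'} \<Longrightarrow> \<bar>y - x\<bar> < \<delta> \<Longrightarrow> \<bar>k' y - k' x\<bar> < \<eta>"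
    using \<open>\<eta> > 0\<close> unfolding uniformly_continuous_on_def dist_real_def by metis
  define d where "d = min \<delta> (min ((\<alpha> - u)/2) ((v - \<beta>)/2))"
  have "d \<le> \<delta> \<and> d \<le> (\<alpha> - u)/2 \<and> d \<le> (v - \<beta>)/2" unfolding d_def by linarith
  then have d: "d \<le> \<delta>" "d \<le> (\<alpha> - u)/2" "d \<le> (v - \<beta>)/2" by auto
  have "d > 0" using \<delta> ab by (simp add: d_def)
  have "(k has_real_derivative k' x) (at x) \<and> \<bar>k' x - k' a\<bar> \<le> \<eta>" if "a \<in> {\<alpha>..\<beta>}" "\<bar>x - a\<bar> < d" for a x
  proof -
    have "x \<in> {\<alpha>'..\<beta>'}" "a \<in> {\<alpha>'..\<beta>'}" "u < x" "x < v"
      using that d ab by (auto simp: \<alpha>'_def \<beta>'_def field_simps)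
    then show ?thesis using \<delta>(2)[of a x] that d assms(1)[of x] by simp
  qed
  then show "\<exists>\<delta>>0. \<forall>a\<in>{\<alpha>..\<beta>}. \<forall>x. \<bar>x - a\<bar> < \<delta> \<longrightarrow>
      (k has_real_derivative k' x) (at x) \<and> \<bar>k' x - k' a\<bar> \<le> \<eta>"
    using \<open>d > 0\<close> by blast
qed

context step_errors
begin

lemma smo_taylor:
  assumes "uniformly_differentiable S k k'" "\<forall>\<^sub>F x in Fl. X x \<in> S" "bigo D"
  shows "smo (\<lambda>x. k (X x + D x) - k (X x) - k' (X x) * D x)"
proof (rule smo_oI[OF assms(3)])
  fix \<eta> :: real assume "\<eta> > 0"
  then obtain \<delta> where \<delta>: "\<delta> > 0" "\<And>a d. a \<in> S \<Longrightarrow> \<bar>d\<bar> < \<delta> \<Longrightarrow> \<bar>k (a + d) - k a - k' a * d\<bar> \<le> \<eta> * \<bar>d\<bar>"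
    using assms(1) unfolding uniformly_differentiable_def by meson
  have "\<forall>\<^sub>F x in Fl. \<bar>D x\<bar> < \<delta>"
    using tendstoD[OF bigo_tendsto[OF assms(3)] \<delta>(1)] by (simp add: dist_real_def)
  with assms(2) show "\<forall>\<^sub>F x in Fl. \<bar>k (X x + D x) - k (X x) - k' (X x) * D x\<bar> \<le> \<eta> * \<bar>D x\<bar>"
    by eventually_elim (use \<delta>(2) in auto)
qed

end

text \<open>\<open>F\<close> is the nonlinearity through which a deviation of the weight acts as a
  kick. Its primitive \<open>\<Phi>\<close> is the potential of the kick and enters the action of an
  orbit.\<close>

locale kicked_well = potential_well +
  fixes F F' \<Phi> :: "real \<Rightarrow> real"
  assumes F_deriv: "\<And>x. (F has_real_derivative F' x) (at x)"
    and F'_cont: "continuous_on UNIV F'"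
    and \<Phi>_deriv: "\<And>x. (\<Phi> has_real_derivative F x) (at x)"
begin

lemma F_cont: "continuous_on S F"
  by (rule DERIV_continuous_on[OF has_field_derivative_at_within[OF F_deriv]])

text \<open>One step of the symplectic Euler scheme for \<open>q'' = - f q - (n - \<nu>) F q\<close>; the number \<open>e\<close> is the integral
  of \<open>n - \<nu>\<close> over the step. If the old point has polar angle \<open>t\<close>, then \<open>turn t q p\<close> is the increment of the
  lifted angle to the new point \<open>(q, p)\<close>.\<close>
definition kick_p :: "real \<Rightarrow> real \<Rightarrow> real \<Rightarrow> real \<Rightarrow> real" where
  "kick_p h e q p = p - h * f q - e * F q"

definition kick_q :: "real \<Rightarrow> real \<Rightarrow> real \<Rightarrow> real \<Rightarrow> real" where
  "kick_q h e q p = q + h * kick_p h e q p"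

text \<open>\<open>rot_cos\<close> and \<open>rot_sin\<close> are the coordinates of the point
  \<open>(p, yc q)\<close> rotated by \<open>- t\<close>. When the first is positive,
  \<open>arctan\<close> of the quotient is the angle of the rotated point.\<close>

definition rot_cos :: "real \<Rightarrow> real \<Rightarrow> real \<Rightarrow> real" where
  "rot_cos t q p = p * cos t + yc q * sin t"

definition rot_sin :: "real \<Rightarrow> real \<Rightarrow> real \<Rightarrow> real" where
  "rot_sin t q p = yc q * cos t - p * sin t"

definition turn :: "real \<Rightarrow> real \<Rightarrow> real \<Rightarrow> real" where
  "turn t q p = arctan (rot_sin t q p / rot_cos t q p)"

end

section \<open>One-step estimates on a compact annulus\<close>

locale kicked_annulus = kicked_well +
  fixes K :: "real \<Rightarrow> real set" and \<rho>\<^sub>1 \<rho>\<^sub>2 :: real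
  assumes \<rho>\<^sub>1_pos: "0 < \<rho>\<^sub>1" and \<rho>\<^sub>2_less: "\<rho>\<^sub>2 < R" and \<rho>_le: "\<rho>\<^sub>1 \<le> \<rho>\<^sub>2"
    and K_mono: "\<And>\<delta> \<delta>'. \<delta> \<le> \<delta>' \<Longrightarrow> K \<delta> \<subseteq> K \<delta>'" and K_sub: "\<And>\<delta>. K \<delta> \<subseteq> {\<rho>\<^sub>1..\<rho>\<^sub>2}"
begin

text \<open>The admissible radii \<open>K \<delta>\<close> may shrink with \<open>\<delta>\<close>:
  a constant interval yields estimates uniform over the annulus, an interval closing in on one
  radius yields the travel time at that radius. The angle is unrestricted, so all estimates are
  uniform in it.\<close>

definition small_steps :: "real \<Rightarrow> (real \<times> real \<times> real \<times> real) set" where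
  "small_steps \<delta> = {(r, t, h, e). r \<in> K \<delta> \<and> 0 < h \<and> h < \<delta> \<and> \<bar>e\<bar> < \<delta>}"

definition Fl :: "(real \<times> real \<times> real \<times> real) filter" where
  "Fl = (INF \<delta>\<in>{0<..}. principal (small_steps \<delta>))"

lemma eventually_Fl: "eventually P Fl \<longleftrightarrow> (\<exists>\<delta>>0. \<forall>x\<in>small_steps \<delta>. P x)"
proof -
  have "eventually P Fl \<longleftrightarrow> (\<exists>\<delta>\<in>{0<..}. eventually P (principal (small_steps \<delta>)))"
    unfolding Fl_def
  proof (rule eventually_INF_base)
    fix \<delta> \<delta>' :: real assume "\<delta> \<in> {0<..}" "\<delta>' \<in> {0<..}"
    then show "\<exists>x\<in>{0<..}. principal (small_steps x) \<le> inf (principal (small_steps \<delta>)) (principal (small_steps \<delta>'))"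
      using K_mono[of "min \<delta> \<delta>'" \<delta>] K_mono[of "min \<delta> \<delta>'" \<delta>']
      by (intro bexI[of _ "min \<delta> \<delta>'"]) (auto simp: small_steps_def)
  qed auto
  then show ?thesis by (auto simp: eventually_principal)
qed

text \<open>A step is described by \<open>x = (r, t, h, e)\<close>: polar coordinates of the old point, step length and kick.\<close>
definition "rx x = fst x" for x :: "real \<times> real \<times> real \<times> real"
definition "tx x = fst (snd x)" for x :: "real \<times> real \<times> real \<times> real"
definition "hx x = fst (snd (snd x))" for x :: "real \<times> real \<times> real \<times> real"
definition "ex x = snd (snd (snd x))" for x :: "real \<times> real \<times> real \<times> real"
definition "yx x = rx x * sin (tx x)"
definition "qx x = Q (yx x)"
definition "px x = rx x * cos (tx x)"
definition "pn x = kick_p (hx x) (ex x) (qx x) (px x)"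
definition "qn x = kick_q (hx x) (ex x) (qx x) (px x)"

lemmas coord_defs = rx_def tx_def hx_def ex_def

lemma eventually_small: "\<delta> > 0 \<Longrightarrow> \<forall>\<^sub>F x in Fl. rx x \<in> K \<delta> \<and> 0 < hx x \<and> hx x < \<delta> \<and> \<bar>ex x\<bar> < \<delta>"
  unfolding eventually_Fl by (intro exI[of _ \<delta>]) (auto simp: small_steps_def coord_defs)

lemma eventually_r: "\<forall>\<^sub>F x in Fl. \<rho>\<^sub>1 \<le> rx x \<and> rx x \<le> \<rho>\<^sub>2"
  using eventually_small[of 1, simplified] by eventually_elim (use K_sub in force)

sublocale step_errors Fl hx ex
proof
  show "\<forall>\<^sub>F x in Fl. hx x \<ge> 0" using eventually_small[of 1, simplified] by eventually_elim auto
  show "(hx \<longlongrightarrow> 0) Fl"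
  proof (rule tendstoI)
    show "\<forall>\<^sub>F x in Fl. dist (hx x) 0 < \<delta>" if "\<delta> > 0" for \<delta>
      using eventually_small[OF that] by eventually_elim auto
  qed
  show "(ex \<longlongrightarrow> 0) Fl"
  proof (rule tendstoI)
    show "\<forall>\<^sub>F x in Fl. dist (ex x) 0 < \<delta>" if "\<delta> > 0" for \<delta>
      using eventually_small[OF that] by eventually_elim auto
  qed
qed

definition q_lo :: real where "q_lo = Q (- \<rho>\<^sub>2)"
definition q_hi :: real where "q_hi = Q \<rho>\<^sub>2"

lemma \<rho>\<^sub>2_pos: "\<rho>\<^sub>2 > 0" using \<rho>\<^sub>1_pos \<rho>_le by linarith

lemma q_lo: "l < q_lo" and q_hi: "q_hi < b"
  using Q_props[of "-\<rho>\<^sub>2"] Q_props[of \<rho>\<^sub>2] \<rho>\<^sub>2_pos \<rho>\<^sub>2_less by (auto simp: q_lo_def q_hi_def)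

lemma eventually_y: "\<forall>\<^sub>F x in Fl. \<bar>yx x\<bar> \<le> \<rho>\<^sub>2 \<and> \<bar>yx x\<bar> < R"
  using eventually_r
proof eventually_elim
  case (elim x)
  then show ?case using polar_le[of "rx x" "tx x"] \<rho>\<^sub>1_pos \<rho>\<^sub>2_less by (simp add: yx_def)
qed

lemma eventually_q: "\<forall>\<^sub>F x in Fl. qx x \<in> {q_lo..q_hi}"
  using eventually_y
proof eventually_elim
  case (elim x)
  then show ?case using \<rho>\<^sub>2_pos \<rho>\<^sub>2_less
    by (auto simp: qx_def q_lo_def q_hi_def intro!: Q_mono)
qed

lemma bdd_comp_q: assumes "continuous_on {q_lo..q_hi} k" shows "bdd (\<lambda>x. k (qx x))"
proof -
  have "compact (k ` {q_lo..q_hi})" by (intro compact_continuous_image assms) auto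
  then obtain C where "\<forall>x\<in>k ` {q_lo..q_hi}. norm x \<le> C" using compact_imp_bounded bounded_iff by blast
  then show ?thesis using eventually_q by (intro bddI'[of _ C]) (auto elim!: eventually_mono)
qed

lemma bdd_comp_y: assumes "\<And>y. \<bar>y\<bar> < R \<Longrightarrow> isCont k y" shows "bdd (\<lambda>x. k (yx x))"
proof -
  have "continuous_on {-\<rho>\<^sub>2..\<rho>\<^sub>2} k"
    using assms \<rho>\<^sub>2_less by (intro continuous_at_imp_continuous_on) auto
  then have "compact (k ` {-\<rho>\<^sub>2..\<rho>\<^sub>2})" by (intro compact_continuous_image) auto
  then obtain C where "\<forall>x\<in>k ` {-\<rho>\<^sub>2..\<rho>\<^sub>2}. norm x \<le> C" using compact_imp_bounded bounded_iff by blast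
  then show ?thesis using eventually_y by (intro bddI'[of _ C]) (auto elim!: eventually_mono simp: abs_le_iff)
qed

lemma bdd_r: "bdd rx"
  using eventually_r by (intro bddI'[of _ \<rho>\<^sub>2]) (use \<rho>\<^sub>1_pos in \<open>auto elim!: eventually_mono\<close>)

lemma bdd_sin: "bdd (\<lambda>x. sin (tx x))" and bdd_cos: "bdd (\<lambda>x. cos (tx x))"
  by (auto intro: bddI[of _ 1])

lemma bdd_p: "bdd px"
  unfolding px_def[abs_def] by (intro bdd_mult bdd_r bdd_cos)

lemma bdd_f: "bdd (\<lambda>x. f (qx x))" and bdd_F: "bdd (\<lambda>x. F (qx x))"
  by (auto intro!: bdd_comp_q f_cont F_cont)

lemma bdd_inv_Y: "bdd (\<lambda>x. 1 / Y (yx x))"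
  by (intro bdd_comp_y[where k = "\<lambda>y. 1 / Y y"] continuous_intros Y_isCont) (use Y_pos in force)+

lemma smo_pn: "smo (\<lambda>x. pn x - px x + hx x * f (qx x))"
  using smo_minus[OF smo_e[OF bdd_F]] by (rule smo_cong) (simp add: pn_def kick_p_def)

lemma bigo_pn: "bigo (\<lambda>x. pn x - px x)"
proof -
  have "bigo (\<lambda>x. (pn x - px x + hx x * f (qx x)) + (-1) * (hx x * f (qx x)))"
    by (intro bigo_add smo_imp_bigo[OF smo_pn] bigo_bdd_mult bdd_const bigo_h bdd_f)
  then show ?thesis by simp
qed

text \<open>The position is advanced with the new momentum, so the error is
  \<open>h * (pn - px)\<close>, a product of \<open>h \<rightarrow> 0\<close> with a quantity of
  order \<open>h + \<bar>e\<bar>\<close>.\<close>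

lemma smo_qn: "smo (\<lambda>x. qn x - qx x - hx x * px x)"
  using smo_o_mult[OF h_tendsto bigo_pn] by (rule smo_cong) (simp add: qn_def kick_q_def pn_def algebra_simps)

lemma bigo_qn: "bigo (\<lambda>x. qn x - qx x)"
proof -
  have "bigo (\<lambda>x. (qn x - qx x - hx x * px x) + hx x * px x)"
    by (intro bigo_add smo_imp_bigo[OF smo_qn] bigo_h bdd_p)
  then show ?thesis by simp
qed

text \<open>The Taylor estimate has the increment \<open>qn - qx\<close>; replacing it by
  \<open>hx * px\<close> costs a bounded multiple of the error in \<open>smo_qn\<close>.\<close>

lemma smo_taylor_qn:
  assumes "\<And>x. l < x \<Longrightarrow> x < b \<Longrightarrow> (k has_real_derivative k' x) (at x)"
    and "\<And>x. l < x \<Longrightarrow> x < b \<Longrightarrow> isCont k' x"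
  shows "smo (\<lambda>x. k (qn x) - k (qx x) - k' (qx x) * (hx x * px x))"
proof -
  have "uniformly_differentiable {q_lo..q_hi} k k'"
    by (rule uniformly_differentiable_C1[OF assms q_lo q_hi])
  from smo_taylor[OF this eventually_q bigo_qn]
  have *: "smo (\<lambda>x. k (qn x) - k (qx x) - k' (qx x) * (qn x - qx x))" by simp
  have "continuous_on {q_lo..q_hi} k'"
    using assms(2) q_lo q_hi by (intro continuous_at_imp_continuous_on) auto
  then have "smo (\<lambda>x. (k (qn x) - k (qx x) - k' (qx x) * (qn x - qx x)) + k' (qx x) * (qn x - qx x - hx x * px x))"
    by (intro smo_add[OF *] smo_bdd_mult smo_qn bdd_comp_q)
  then show ?thesis by (rule smo_cong) (simp add: algebra_simps)
qed

lemma smo_f_qn: "smo (\<lambda>x. f (qn x) - f (qx x) - f' (qx x) * (hx x * px x))"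
  by (rule smo_taylor_qn) (use f_deriv f'_cont continuous_on_eq_continuous_at[OF open_UNIV] in auto)

lemma smo_V_qn: "smo (\<lambda>x. V (qn x) - V (qx x) - f (qx x) * (hx x * px x))"
  by (rule smo_taylor_qn) (use V_deriv DERIV_isCont[OF f_deriv] in auto)

lemma smo_yc_qn: "smo (\<lambda>x. yc (qn x) - yc (qx x) - yc' (qx x) * (hx x * px x))"
  by (rule smo_taylor_qn) (use yc_deriv yc'_isCont in auto)

text \<open>The first-order terms are \<open>- 2 * p * h * f q\<close> from the momentum and
  \<open>2 * f q * h * p\<close> from the potential, and they cancel.\<close>

lemma smo_energy: "smo (\<lambda>x. ((pn x)\<^sup>2 + 2 * V (qn x)) - ((px x)\<^sup>2 + 2 * V (qx x)))"
proof -
  have "smo (\<lambda>x. (2 * px x) * (pn x - px x + hx x * f (qx x)) + (pn x - px x) * (pn x - px x)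
     + 2 * (V (qn x) - V (qx x) - f (qx x) * (hx x * px x)))"
    by (intro smo_add smo_bdd_mult bdd_mult bdd_const bdd_p smo_pn smo_o_mult bigo_tendsto bigo_pn smo_V_qn)
  then show ?thesis by (rule smo_cong) (simp add: algebra_simps power2_eq_square)
qed

lemma eventually_qn: "\<forall>\<^sub>F x in Fl. l < qn x \<and> qn x < b"
proof -
  define d where "d = min (q_lo - l) (b - q_hi)"
  have d: "d > 0" "d \<le> q_lo - l" "d \<le> b - q_hi" using q_lo q_hi by (auto simp: d_def)
  have "\<forall>\<^sub>F x in Fl. \<bar>qn x - qx x\<bar> < d"
    using tendstoD[OF bigo_tendsto[OF bigo_qn] d(1)] by (simp add: dist_real_def)
  then show ?thesis using eventually_q
  proof eventually_elim
    case (elim x)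
    then show ?case using d unfolding atLeastAtMost_iff by linarith
  qed
qed

lemma bigo_yc: "bigo (\<lambda>x. yc (qn x) - yc (qx x))"
proof -
  have "continuous_on {q_lo..q_hi} yc'"
    using yc'_isCont q_lo q_hi by (intro continuous_at_imp_continuous_on) auto
  then have "bigo (\<lambda>x. (yc (qn x) - yc (qx x) - yc' (qx x) * (hx x * px x)) + yc' (qx x) * (hx x * px x))"
    by (intro bigo_add smo_imp_bigo[OF smo_yc_qn] bigo_bdd_mult bdd_comp_q bigo_h bdd_p)
  then show ?thesis by simp
qed

lemma eventually_basic: "\<forall>\<^sub>F x in Fl. yc (qx x) = yx x \<and> yc' (qx x) = 1 / Y (yx x) \<and> f (qx x) = yx x / Y (yx x) \<and> Y (yx x) > 0"
  using eventually_y
proof eventually_elim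
  case (elim x)
  then show ?case using f_Q[of "yx x"] Y_pos[of "yx x"] yc_Q[of "yx x"] by (simp add: qx_def Y_def field_simps)
qed

lemma rot_cos_tendsto: "((\<lambda>x. rot_cos (tx x) (qn x) (pn x) - rx x) \<longlongrightarrow> 0) Fl"
proof -
  have "bigo (\<lambda>x. cos (tx x) * (pn x - px x) + sin (tx x) * (yc (qn x) - yc (qx x)))"
    by (intro bigo_add bigo_bdd_mult bdd_cos bdd_sin bigo_pn bigo_yc)
  from bigo_tendsto[OF this] show ?thesis
  proof (rule Lim_transform_eventually)
    show "\<forall>\<^sub>F x in Fl. cos (tx x) * (pn x - px x) + sin (tx x) * (yc (qn x) - yc (qx x)) = rot_cos (tx x) (qn x) (pn x) - rx x"
      using eventually_basic
    proof eventually_elim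
      case (elim x)
      have "rx x * cos (tx x) * cos (tx x) + rx x * sin (tx x) * sin (tx x) = rx x * ((cos (tx x))\<^sup>2 + (sin (tx x))\<^sup>2)"
        by (simp only: power2_eq_square algebra_simps)
      also have "\<dots> = rx x" by simp
      finally show ?case using elim by (simp add: rot_cos_def px_def yx_def algebra_simps)
    qed
  qed
qed

lemma eventually_rot_cos: "\<forall>\<^sub>F x in Fl. rot_cos (tx x) (qn x) (pn x) > \<rho>\<^sub>1 / 2"
proof -
  have "\<forall>\<^sub>F x in Fl. \<bar>rot_cos (tx x) (qn x) (pn x) - rx x\<bar> < \<rho>\<^sub>1 / 2"
    using tendstoD[OF rot_cos_tendsto, of "\<rho>\<^sub>1 / 2"] \<rho>\<^sub>1_pos by (simp add: dist_real_def)
  then show ?thesis using eventually_r by eventually_elim linarith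
qed

text \<open>To first order \<open>yc q\<close> changes by \<open>h * p / Y\<close> and
  \<open>p\<close> by \<open>- h * y / Y\<close>. Projected on the tangent direction at angle
  \<open>t\<close>, with \<open>p = r * cos t\<close> and \<open>y = r * sin t\<close>, these add up
  to \<open>h * r / Y\<close>.\<close>

lemma smo_rot_sin: "smo (\<lambda>x. rot_sin (tx x) (qn x) (pn x) - hx x * (rx x / Y (yx x)))"
proof -
  have "smo (\<lambda>x. cos (tx x) * (yc (qn x) - yc (qx x) - yc' (qx x) * (hx x * px x))
      - sin (tx x) * (pn x - px x + hx x * f (qx x)))"
    by (intro smo_diff smo_bdd_mult bdd_cos bdd_sin smo_yc_qn smo_pn)
  then show ?thesis
  proof (rule smo_le)
    show "\<forall>\<^sub>F x in Fl. \<bar>rot_sin (tx x) (qn x) (pn x) - hx x * (rx x / Y (yx x))\<bar>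
      \<le> \<bar>cos (tx x) * (yc (qn x) - yc (qx x) - yc' (qx x) * (hx x * px x)) - sin (tx x) * (pn x - px x + hx x * f (qx x))\<bar>"
      using eventually_basic
    proof eventually_elim
      case (elim x)
      have "hx x * rx x / Y (yx x) * cos (tx x) * cos (tx x) + hx x * rx x / Y (yx x) * sin (tx x) * sin (tx x)
          = hx x * rx x / Y (yx x) * ((cos (tx x))\<^sup>2 + (sin (tx x))\<^sup>2)"
        by (simp only: power2_eq_square algebra_simps)
      also have "\<dots> = hx x * rx x / Y (yx x)" by simp
      finally have "rot_sin (tx x) (qn x) (pn x) - hx x * (rx x / Y (yx x))
        = cos (tx x) * (yc (qn x) - yc (qx x) - yc' (qx x) * (hx x * px x)) - sin (tx x) * (pn x - px x + hx x * f (qx x))"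
        using elim by (simp add: rot_sin_def px_def yx_def algebra_simps)
      then show ?case by simp
    qed
  qed
qed

lemma bdd_inv_rot_cos: "bdd (\<lambda>x. 1 / rot_cos (tx x) (qn x) (pn x))"
proof (rule bddI'[of _ "2 / \<rho>\<^sub>1"])
  show "\<forall>\<^sub>F x in Fl. \<bar>1 / rot_cos (tx x) (qn x) (pn x)\<bar> \<le> 2 / \<rho>\<^sub>1"
    using eventually_rot_cos
  proof eventually_elim
    case (elim x)
    then have "rot_cos (tx x) (qn x) (pn x) > 0" using \<rho>\<^sub>1_pos by linarith
    then show ?case using elim \<rho>\<^sub>1_pos by (simp add: field_simps)
  qed
qed

text \<open>\<open>rot_sin / rot_cos\<close> is \<open>h * r / Y\<close> divided by a quantity
  tending to \<open>r\<close>, hence \<open>h / Y\<close> up to a negligible error, and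
  \<open>arctan\<close> has derivative 1 at 0.\<close>

lemma smo_turn: "smo (\<lambda>x. turn (tx x) (qn x) (pn x) - hx x / Y (yx x))"
proof -
  let ?A = "\<lambda>x. rot_cos (tx x) (qn x) (pn x)" and ?B = "\<lambda>x. rot_sin (tx x) (qn x) (pn x)"
  define D where "D x = 1 / ?A x * ?B x" for x
  have "((\<lambda>x. (1 / Y (yx x) * (1 / ?A x)) * (?A x - rx x)) \<longlongrightarrow> 0) Fl"
  proof -
    have "bdd (\<lambda>x. 1 / Y (yx x) * (1 / ?A x))" by (intro bdd_mult bdd_inv_Y bdd_inv_rot_cos)
    then obtain C where C: "C \<ge> 0" "\<forall>\<^sub>F x in Fl. \<bar>1 / Y (yx x) * (1 / ?A x)\<bar> \<le> C" by (auto simp: bdd_def)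
    have "((\<lambda>x. C * \<bar>?A x - rx x\<bar>) \<longlongrightarrow> C * \<bar>0\<bar>) Fl"
      by (intro tendsto_intros rot_cos_tendsto)
    then have L: "((\<lambda>x. C * \<bar>?A x - rx x\<bar>) \<longlongrightarrow> 0) Fl" by simp
    show ?thesis
    proof (rule Lim_null_comparison[OF _ L])
      show "\<forall>\<^sub>F x in Fl. norm (1 / Y (yx x) * (1 / ?A x) * (?A x - rx x)) \<le> C * \<bar>?A x - rx x\<bar>"
        using C(2) by eventually_elim (auto simp only: real_norm_def abs_mult intro!: mult_right_mono)
    qed
  qed
  then have o: "smo (\<lambda>x. hx x * ((1 / Y (yx x) * (1 / ?A x)) * (?A x - rx x)))" by (rule smo_h)
  have "smo (\<lambda>x. 1 / ?A x * (?B x - hx x * (rx x / Y (yx x))) - hx x * ((1 / Y (yx x) * (1 / ?A x)) * (?A x - rx x)))"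
    by (intro smo_diff o smo_bdd_mult bdd_inv_rot_cos smo_rot_sin)
  then have DY: "smo (\<lambda>x. D x - hx x / Y (yx x))"
  proof (rule smo_le)
    show "\<forall>\<^sub>F x in Fl. \<bar>D x - hx x / Y (yx x)\<bar>
      \<le> \<bar>1 / ?A x * (?B x - hx x * (rx x / Y (yx x))) - hx x * ((1 / Y (yx x) * (1 / ?A x)) * (?A x - rx x))\<bar>"
      using eventually_rot_cos eventually_basic
    proof eventually_elim
      case (elim x)
      have "?A x \<noteq> 0" using elim \<rho>\<^sub>1_pos by linarith
      then have "1 / ?A x * (?B x - hx x * (rx x / Y (yx x))) - hx x * ((1 / Y (yx x) * (1 / ?A x)) * (?A x - rx x)) = D x - hx x / Y (yx x)"
        using elim by (simp add: D_def divide_simps) (simp add: algebra_simps)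
      then show ?case by simp
    qed
  qed
  have "bigo (\<lambda>x. (D x - hx x / Y (yx x)) + hx x * (1 / Y (yx x)))"
    by (intro bigo_add smo_imp_bigo[OF DY] bigo_h bdd_inv_Y)
  then have D: "bigo D" by simp
  have "uniformly_differentiable {0..0} arctan (\<lambda>x. inverse (1 + x\<^sup>2))"
    by (rule uniformly_differentiable_C1[of "-1" 1]) (auto intro!: DERIV_arctan continuous_intros simp: add_nonneg_eq_0_iff)
  from smo_taylor[OF this _ D, of "\<lambda>_. 0"] have "smo (\<lambda>x. arctan (D x) - D x)" by simp
  from smo_add[OF this DY] show ?thesis
    by (rule smo_cong) (simp add: turn_def D_def)
qed

text \<open>The constant \<open>C\<close> is chosen before \<open>\<eta>\<close>: later bounds such
  as the Gronwall constant are built from \<open>C\<close>, and \<open>\<eta>\<close> is then made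
  small relative to them.\<close>

lemma step_estimates:
  "\<exists>C\<ge>0. \<forall>\<eta>>0. \<exists>\<delta>>0. \<forall>x\<in>small_steps \<delta>.
     l < qn x \<and> qn x < b \<and> rot_cos (tx x) (qn x) (pn x) > 0 \<and>
     \<bar>((pn x)\<^sup>2 + 2 * V (qn x)) - ((px x)\<^sup>2 + 2 * V (qx x))\<bar> \<le> \<eta> * hx x + C * \<bar>ex x\<bar> \<and>
     \<bar>turn (tx x) (qn x) (pn x) - hx x / Y (yx x)\<bar> \<le> \<eta> * hx x + C * \<bar>ex x\<bar> \<and>
     \<bar>f (qn x) - f (qx x) - f' (qx x) * (hx x * px x)\<bar> \<le> \<eta> * hx x + C * \<bar>ex x\<bar>"
proof -
  obtain C1 where C1: "C1 \<ge> 0" "\<And>\<eta>. \<eta> > 0 \<Longrightarrow> \<forall>\<^sub>F x in Fl. \<bar>((pn x)\<^sup>2 + 2 * V (qn x)) - ((px x)\<^sup>2 + 2 * V (qx x))\<bar> \<le> \<eta> * hx x + C1 * \<bar>ex x\<bar>"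
    using smo_energy unfolding smo_def by blast
  obtain C2 where C2: "C2 \<ge> 0" "\<And>\<eta>. \<eta> > 0 \<Longrightarrow> \<forall>\<^sub>F x in Fl. \<bar>turn (tx x) (qn x) (pn x) - hx x / Y (yx x)\<bar> \<le> \<eta> * hx x + C2 * \<bar>ex x\<bar>"
    using smo_turn unfolding smo_def by blast
  obtain C3 where C3: "C3 \<ge> 0" "\<And>\<eta>. \<eta> > 0 \<Longrightarrow> \<forall>\<^sub>F x in Fl. \<bar>f (qn x) - f (qx x) - f' (qx x) * (hx x * px x)\<bar> \<le> \<eta> * hx x + C3 * \<bar>ex x\<bar>"
    using smo_f_qn unfolding smo_def by blast
  show ?thesis unfolding eventually_Fl[symmetric]
  proof (intro exI[of _ "C1 + C2 + C3"] conjI allI impI)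
    fix \<eta> :: real assume "\<eta> > 0"
    from C1(2)[OF this] C2(2)[OF this] C3(2)[OF this] eventually_qn eventually_rot_cos
    show "\<forall>\<^sub>F x in Fl. l < qn x \<and> qn x < b \<and> rot_cos (tx x) (qn x) (pn x) > 0 \<and>
     \<bar>((pn x)\<^sup>2 + 2 * V (qn x)) - ((px x)\<^sup>2 + 2 * V (qx x))\<bar> \<le> \<eta> * hx x + (C1 + C2 + C3) * \<bar>ex x\<bar> \<and>
     \<bar>turn (tx x) (qn x) (pn x) - hx x / Y (yx x)\<bar> \<le> \<eta> * hx x + (C1 + C2 + C3) * \<bar>ex x\<bar> \<and>
     \<bar>f (qn x) - f (qx x) - f' (qx x) * (hx x * px x)\<bar> \<le> \<eta> * hx x + (C1 + C2 + C3) * \<bar>ex x\<bar>"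
    proof eventually_elim
      case (elim x)
      have "C1 * \<bar>ex x\<bar> \<ge> 0" "C2 * \<bar>ex x\<bar> \<ge> 0" "C3 * \<bar>ex x\<bar> \<ge> 0" using C1 C2 C3 by auto
      then show ?case using elim \<rho>\<^sub>1_pos unfolding distrib_right by (intro conjI) linarith+
    qed
  qed (use C1 C2 C3 in auto)
qed

end


section \<open>Explicit step bounds and travel times\<close>

lemma abs_sin_diff_le: "\<bar>sin x - sin y\<bar> \<le> \<bar>x - y\<bar>" for x y :: real
proof -
  have "\<bar>sin x - sin y\<bar> = 2 * \<bar>sin ((x - y)/2)\<bar> * \<bar>cos ((x + y)/2)\<bar>"
    by (simp add: sin_diff_sin abs_mult)
  also have "\<dots> \<le> 2 * \<bar>(x - y)/2\<bar> * 1"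
    by (intro mult_mono abs_sin_x_le_abs_x) auto
  finally show ?thesis by simp
qed

context kicked_well
begin

text \<open>The estimates of \<open>step_estimates\<close> without the filter, so that
  \<open>\<eta>\<close> and \<open>\<delta>\<close> can be balanced against the other constants of
  the construction.\<close>

definition step_ok :: "real \<Rightarrow> real \<Rightarrow> real \<Rightarrow> real \<Rightarrow> real \<Rightarrow> bool" where
  "step_ok \<rho>\<^sub>1 \<rho>\<^sub>2 C \<eta> \<delta> \<longleftrightarrow> (\<forall>r t h e q p q' p'. \<rho>\<^sub>1 \<le> r \<longrightarrow> r \<le> \<rho>\<^sub>2 \<longrightarrow> 0 < h \<longrightarrow> h < \<delta> \<longrightarrow> \<bar>e\<bar> < \<delta> \<longrightarrow>
     q = Q (r * sin t) \<longrightarrow> p = r * cos t \<longrightarrow> q' = kick_q h e q p \<longrightarrow> p' = kick_p h e q p \<longrightarrow>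
     l < q' \<and> q' < b \<and> rot_cos t q' p' > 0 \<and>
     \<bar>(p'\<^sup>2 + 2 * V q') - (p\<^sup>2 + 2 * V q)\<bar> \<le> \<eta> * h + C * \<bar>e\<bar> \<and>
     \<bar>turn t q' p' - h / Y (r * sin t)\<bar> \<le> \<eta> * h + C * \<bar>e\<bar> \<and>
     \<bar>f q' - f q - f' q * (h * p)\<bar> \<le> \<eta> * h + C * \<bar>e\<bar>)"

lemma step_bounds:
  assumes "0 < \<rho>\<^sub>1" "\<rho>\<^sub>1 \<le> \<rho>\<^sub>2" "\<rho>\<^sub>2 < R"
  shows "\<exists>C\<ge>0. \<forall>\<eta>>0. \<exists>\<delta>>0. step_ok \<rho>\<^sub>1 \<rho>\<^sub>2 C \<eta> \<delta>"
proof -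
  interpret kicked_annulus f f' V l c b F F' \<Phi> "\<lambda>_. {\<rho>\<^sub>1..\<rho>\<^sub>2}" \<rho>\<^sub>1 \<rho>\<^sub>2
    by unfold_locales (use assms in auto)
  note est = step_estimates[unfolded small_steps_def pn_def qn_def px_def qx_def yx_def coord_defs]
  show ?thesis unfolding step_ok_def
    by (rule ex_forward[OF est], elim conjE, intro conjI, assumption, intro allI impI,
        drule spec, drule mp, assumption, erule exE, elim conjE, rule exI, rule conjI, assumption) fastforce
qed

text \<open>The time function of the fixed radius \<open>\<rho>\<close> is evaluated at the angles
  of an orbit whose radius \<open>r\<close> is only close to \<open>\<rho>\<close>. Summed over the
  steps this tells how far orbits started on a boundary circle turn.\<close>

definition time_ok :: "real \<Rightarrow> real \<Rightarrow> real \<Rightarrow> real \<Rightarrow> bool" where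
  "time_ok \<rho> C \<eta> \<delta> \<longleftrightarrow> (\<forall>r t h e q p q' p'. \<bar>r - \<rho>\<bar> < \<delta> \<longrightarrow> 0 < h \<longrightarrow> h < \<delta> \<longrightarrow> \<bar>e\<bar> < \<delta> \<longrightarrow>
     q = Q (r * sin t) \<longrightarrow> p = r * cos t \<longrightarrow> q' = kick_q h e q p \<longrightarrow> p' = kick_p h e q p \<longrightarrow>
     \<bar>\<tau> \<rho> (t + turn t q' p') - \<tau> \<rho> t - h\<bar> \<le> \<eta> * h + C * \<bar>e\<bar>)"

text \<open>With \<open>D\<close> the turn, \<open>\<tau> \<rho> (t + D) - \<tau> \<rho> t\<close>
  is \<open>Y (\<rho> * sin t) * D\<close> to first order, \<open>D\<close> is
  \<open>h / Y (r * sin t)\<close>, and the two values of \<open>Y\<close> merge as \<open>r\<close>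
  tends to \<open>\<rho>\<close>. The filter therefore lets the radii shrink to
  \<open>\<rho>\<close> together with the step.\<close>

lemma step_time:
  assumes \<rho>: "0 < \<rho>" "\<rho> < R"
  shows "\<exists>C\<ge>0. \<forall>\<eta>>0. \<exists>\<delta>>0. time_ok \<rho> C \<eta> \<delta>"
proof -
  define d where "d = min (\<rho>/2) ((R - \<rho>)/2)"
  have "d \<le> \<rho>/2 \<and> d \<le> (R - \<rho>)/2" unfolding d_def by linarith
  moreover have "d > 0" using \<rho> by (simp add: d_def)
  ultimately have d: "d > 0" "0 < \<rho> - d" "\<rho> + d < R" using \<rho> by auto
  interpret kicked_annulus f f' V l c b F F' \<Phi> "\<lambda>\<delta>. {\<rho> - min \<delta> d .. \<rho> + min \<delta> d}" "\<rho> - d" "\<rho> + d"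
    by unfold_locales (use d in auto)
  have "continuous_on {-(\<rho> + d)..\<rho> + d} Y"
    using d by (intro continuous_at_imp_continuous_on) (auto intro!: Y_isCont)
  then have "uniformly_continuous_on {-(\<rho> + d)..\<rho> + d} Y"
    by (intro compact_uniformly_continuous) auto
  note ucY = this
  have uc: "\<exists>\<delta>>0. \<forall>x y. \<bar>x\<bar> \<le> \<rho> + d \<longrightarrow> \<bar>y\<bar> \<le> \<rho> + d \<longrightarrow> \<bar>x - y\<bar> < \<delta> \<longrightarrow> \<bar>Y x - Y y\<bar> < \<eta>" if \<eta>: "\<eta> > 0" for \<eta>
  proof -
    obtain \<delta> where \<delta>: "\<delta> > 0" "\<And>x y. x \<in> {-(\<rho> + d)..\<rho> + d} \<Longrightarrow> y \<in> {-(\<rho> + d)..\<rho> + d} \<Longrightarrow> \<bar>y - x\<bar> < \<delta> \<Longrightarrow> \<bar>Y y - Y x\<bar> < \<eta>"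
      using ucY \<eta> unfolding uniformly_continuous_on_def dist_real_def by metis
    show ?thesis
    proof (intro exI[of _ \<delta>] conjI allI impI)
      fix x y assume "\<bar>x\<bar> \<le> \<rho> + d" "\<bar>y\<bar> \<le> \<rho> + d" "\<bar>x - y\<bar> < \<delta>"
      then show "\<bar>Y x - Y y\<bar> < \<eta>" using \<delta>(2)[of y x] by (simp add: abs_le_iff)
    qed (rule \<delta>)
  qed
  have \<rho>_sin: "\<bar>\<rho> * sin t\<bar> \<le> \<rho> + d" for t using polar_le[OF \<rho>(1), of t] d by linarith
  have ud: "uniformly_differentiable UNIV (\<tau> \<rho>) (\<lambda>t. Y (\<rho> * sin t))"
  proof (rule uniformly_differentiableI)
    fix \<eta> :: real assume "\<eta> > 0"
    then obtain \<delta> where \<delta>: "\<delta> > 0" "\<And>x y. \<bar>x\<bar> \<le> \<rho> + d \<Longrightarrow> \<bar>y\<bar> \<le> \<rho> + d \<Longrightarrow> \<bar>x - y\<bar> < \<delta> \<Longrightarrow> \<bar>Y x - Y y\<bar> < \<eta>"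
      using uc by metis
    have "(\<tau> \<rho> has_real_derivative Y (\<rho> * sin x)) (at x) \<and> \<bar>Y (\<rho> * sin x) - Y (\<rho> * sin a)\<bar> \<le> \<eta>"
      if "\<bar>x - a\<bar> < \<delta> / \<rho>" for x a
    proof -
      have "\<bar>\<rho> * sin x - \<rho> * sin a\<bar> = \<rho> * \<bar>sin x - sin a\<bar>" using \<rho> by (simp add: abs_mult flip: right_diff_distrib)
      also have "\<dots> \<le> \<rho> * \<bar>x - a\<bar>" using \<rho> by (intro mult_left_mono abs_sin_diff_le) auto
      also have "\<dots> < \<delta>" using that \<rho> by (simp add: field_simps)
      finally show ?thesis using \<delta>(2)[OF \<rho>_sin \<rho>_sin] \<tau>_deriv[OF \<rho>] by (simp add: less_imp_le)
    qed
    then show "\<exists>\<delta>>0. \<forall>a\<in>UNIV. \<forall>x. \<bar>x - a\<bar> < \<delta> \<longrightarrow> (\<tau> \<rho> has_real_derivative Y (\<rho> * sin x)) (at x)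
        \<and> \<bar>Y (\<rho> * sin x) - Y (\<rho> * sin a)\<bar> \<le> \<eta>"
      using \<delta>(1) \<rho>(1) by (intro exI[of _ "\<delta> / \<rho>"]) auto
  qed
  define D where "D x = turn (tx x) (qn x) (pn x)" for x
  have smD: "smo (\<lambda>x. D x - hx x / Y (yx x))" unfolding D_def by (rule smo_turn)
  have "bigo (\<lambda>x. (D x - hx x / Y (yx x)) + hx x * (1 / Y (yx x)))"
    by (intro bigo_add smo_imp_bigo[OF smD] bigo_h bdd_inv_Y)
  then have D: "bigo D" by simp
  have 1: "smo (\<lambda>x. \<tau> \<rho> (tx x + D x) - \<tau> \<rho> (tx x) - Y (\<rho> * sin (tx x)) * D x)"
    by (rule smo_taylor[OF ud _ D]) simp
  have b\<rho>: "bdd (\<lambda>x. Y (\<rho> * sin (tx x)))"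
  proof -
    have "compact (Y ` {-\<rho>..\<rho>})"
      using \<rho> by (intro compact_continuous_image continuous_at_imp_continuous_on) (auto intro!: Y_isCont)
    then obtain C where "\<forall>x\<in>Y ` {-\<rho>..\<rho>}. norm x \<le> C" using compact_imp_bounded bounded_iff by blast
    moreover have "\<rho> * sin t \<in> {-\<rho>..\<rho>}" for t using polar_le[OF \<rho>(1), of t] by (simp add: abs_le_iff)
    ultimately show ?thesis by (intro bddI[of _ C]) auto
  qed
  have 2: "((\<lambda>x. 1 / Y (yx x) * (Y (\<rho> * sin (tx x)) - Y (yx x))) \<longlongrightarrow> 0) Fl"
  proof -
    have t0: "((\<lambda>x. Y (\<rho> * sin (tx x)) - Y (yx x)) \<longlongrightarrow> 0) Fl"
    proof (rule tendstoI)
      fix \<eta> :: real assume "\<eta> > 0"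
      then obtain \<delta> where \<delta>: "\<delta> > 0" "\<And>x y. \<bar>x\<bar> \<le> \<rho> + d \<Longrightarrow> \<bar>y\<bar> \<le> \<rho> + d \<Longrightarrow> \<bar>x - y\<bar> < \<delta> \<Longrightarrow> \<bar>Y x - Y y\<bar> < \<eta>"
        using uc by metis
      have "\<delta>/2 > 0" using \<delta> by simp
      from eventually_small[OF this] eventually_y
      show "\<forall>\<^sub>F x in Fl. dist (Y (\<rho> * sin (tx x)) - Y (yx x)) 0 < \<eta>"
      proof eventually_elim
        case (elim x)
        have "\<bar>\<rho> * sin (tx x) - yx x\<bar> = \<bar>\<rho> - rx x\<bar> * \<bar>sin (tx x)\<bar>"
          by (simp add: yx_def flip: left_diff_distrib abs_mult)
        also have "\<dots> \<le> \<bar>\<rho> - rx x\<bar> * 1" by (intro mult_left_mono) auto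
        also have "\<dots> < \<delta>" using elim \<delta>(1) by (auto simp: min_def split: if_splits)
        finally show ?case using \<delta>(2)[OF \<rho>_sin, of "yx x"] elim by (simp add: dist_real_def)
      qed
    qed
    obtain C where C: "C \<ge> 0" "\<forall>\<^sub>F x in Fl. \<bar>1 / Y (yx x)\<bar> \<le> C" using bdd_inv_Y by (auto simp: bdd_def)
    have "((\<lambda>x. C * \<bar>Y (\<rho> * sin (tx x)) - Y (yx x)\<bar>) \<longlongrightarrow> C * \<bar>0\<bar>) Fl"
      by (intro tendsto_intros t0)
    then have L: "((\<lambda>x. C * \<bar>Y (\<rho> * sin (tx x)) - Y (yx x)\<bar>) \<longlongrightarrow> 0) Fl" by simp
    show ?thesis
    proof (rule Lim_null_comparison[OF _ L])
      show "\<forall>\<^sub>F x in Fl. norm (1 / Y (yx x) * (Y (\<rho> * sin (tx x)) - Y (yx x))) \<le> C * \<bar>Y (\<rho> * sin (tx x)) - Y (yx x)\<bar>"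
        using C(2) by eventually_elim (auto simp only: real_norm_def abs_mult intro!: mult_right_mono)
    qed
  qed
  \<comment> \<open>The three summands are the remainder in \<open>\<tau> \<rho>\<close>, the error
    of the turn, and the discrepancy between \<open>Y\<close> at radius \<open>\<rho>\<close> and at
    the radius of the point.\<close>
  have "smo (\<lambda>x. (\<tau> \<rho> (tx x + D x) - \<tau> \<rho> (tx x) - Y (\<rho> * sin (tx x)) * D x)
      + Y (\<rho> * sin (tx x)) * (D x - hx x / Y (yx x))
      + hx x * (1 / Y (yx x) * (Y (\<rho> * sin (tx x)) - Y (yx x))))"
    by (intro smo_add 1 smo_bdd_mult b\<rho> smD smo_h 2)
  then have "smo (\<lambda>x. \<tau> \<rho> (tx x + D x) - \<tau> \<rho> (tx x) - hx x)"
  proof (rule smo_le)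
    show "\<forall>\<^sub>F x in Fl. \<bar>\<tau> \<rho> (tx x + D x) - \<tau> \<rho> (tx x) - hx x\<bar> \<le>
      \<bar>(\<tau> \<rho> (tx x + D x) - \<tau> \<rho> (tx x) - Y (\<rho> * sin (tx x)) * D x)
      + Y (\<rho> * sin (tx x)) * (D x - hx x / Y (yx x))
      + hx x * (1 / Y (yx x) * (Y (\<rho> * sin (tx x)) - Y (yx x)))\<bar>"
      using eventually_basic
    proof eventually_elim
      case (elim x)
      then have "(\<tau> \<rho> (tx x + D x) - \<tau> \<rho> (tx x) - Y (\<rho> * sin (tx x)) * D x)
        + Y (\<rho> * sin (tx x)) * (D x - hx x / Y (yx x))
        + hx x * (1 / Y (yx x) * (Y (\<rho> * sin (tx x)) - Y (yx x))) = \<tau> \<rho> (tx x + D x) - \<tau> \<rho> (tx x) - hx x"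
        by (simp add: field_simps)
      then show ?case by simp
    qed
  qed
  then obtain C where C: "C \<ge> 0" "\<And>\<eta>. \<eta> > 0 \<Longrightarrow> \<exists>\<delta>>0. \<forall>x\<in>small_steps \<delta>.
      \<bar>\<tau> \<rho> (tx x + D x) - \<tau> \<rho> (tx x) - hx x\<bar> \<le> \<eta> * hx x + C * \<bar>ex x\<bar>"
    unfolding smo_def eventually_Fl by blast
  show ?thesis unfolding time_ok_def
  proof (rule exI[of _ C], intro conjI allI impI)
    fix \<eta> :: real assume "\<eta> > 0"
    then obtain \<delta> where \<delta>: "\<delta> > 0" "\<And>x. x \<in> small_steps \<delta> \<Longrightarrow>
      \<bar>\<tau> \<rho> (tx x + D x) - \<tau> \<rho> (tx x) - hx x\<bar> \<le> \<eta> * hx x + C * \<bar>ex x\<bar>" using C(2) by meson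
    show "\<exists>\<delta>>0. \<forall>r t h e q p q' p'. \<bar>r - \<rho>\<bar> < \<delta> \<longrightarrow> 0 < h \<longrightarrow> h < \<delta> \<longrightarrow> \<bar>e\<bar> < \<delta> \<longrightarrow>
     q = Q (r * sin t) \<longrightarrow> p = r * cos t \<longrightarrow> q' = kick_q h e q p \<longrightarrow> p' = kick_p h e q p \<longrightarrow>
     \<bar>\<tau> \<rho> (t + turn t q' p') - \<tau> \<rho> t - h\<bar> \<le> \<eta> * h + C * \<bar>e\<bar>"
    proof (intro exI[of _ "min \<delta> d"] conjI allI impI)
      fix r t h e q p q' p'
      assume *: "\<bar>r - \<rho>\<bar> < min \<delta> d" "0 < h" "h < min \<delta> d" "\<bar>e\<bar> < min \<delta> d"
        and qp: "q = Q (r * sin t)" "p = r * cos t" "q' = kick_q h e q p" "p' = kick_p h e q p"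
      have "(r, t, h, e) \<in> small_steps \<delta>"
        using * by (auto simp: small_steps_def)
      from \<delta>(2)[OF this] show "\<bar>\<tau> \<rho> (t + turn t q' p') - \<tau> \<rho> t - h\<bar> \<le> \<eta> * h + C * \<bar>e\<bar>"
        by (simp add: coord_defs D_def qn_def pn_def qx_def px_def yx_def qp)
    qed (use \<delta> d in auto)
  qed (rule C)
qed

end

section \<open>Closed orbits of the discretization\<close>

context kicked_well
begin

text \<open>Orbits are functions of the initial point \<open>x = (t, r)\<close>, angle first.\<close>

primrec qp :: "real \<Rightarrow> (nat \<Rightarrow> real) \<Rightarrow> nat \<Rightarrow> real \<times> real \<Rightarrow> real \<times> real" where
  "qp h e 0 x = (Q (snd x * sin (fst x)), snd x * cos (fst x))"
| "qp h e (Suc i) x = (kick_q h (e i) (fst (qp h e i x)) (snd (qp h e i x)),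
     kick_p h (e i) (fst (qp h e i x)) (snd (qp h e i x)))"

definition "qs h e i x = fst (qp h e i x)"
definition "ps h e i x = snd (qp h e i x)"

lemma qs_0: "qs h e 0 x = Q (snd x * sin (fst x))" and ps_0: "ps h e 0 x = snd x * cos (fst x)"
  and qs_Suc: "qs h e (Suc i) x = kick_q h (e i) (qs h e i x) (ps h e i x)"
  and ps_Suc: "ps h e (Suc i) x = kick_p h (e i) (qs h e i x) (ps h e i x)"
  by (simp_all add: qs_def ps_def)

primrec ts :: "real \<Rightarrow> (nat \<Rightarrow> real) \<Rightarrow> nat \<Rightarrow> real \<times> real \<Rightarrow> real" where
  "ts h e 0 x = fst x"
| "ts h e (Suc i) x = ts h e i x + turn (ts h e i x) (qs h e (Suc i) x) (ps h e (Suc i) x)"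

definition "rs h e i x = sqrt ((ps h e i x)\<^sup>2 + 2 * V (qs h e i x))"

text \<open>The derivative of the orbit at \<open>x\<close> in direction \<open>v\<close>,
  propagated by the linearised step. The recursion is kept explicit because its growth is estimated
  step by step.\<close>

primrec dqp :: "real \<Rightarrow> (nat \<Rightarrow> real) \<Rightarrow> nat \<Rightarrow> real \<times> real \<Rightarrow> real \<times> real \<Rightarrow> real \<times> real" where
  "dqp h e 0 x v = (Y (snd x * sin (fst x)) * (sin (fst x) * snd v + snd x * cos (fst x) * fst v),
      cos (fst x) * snd v - snd x * sin (fst x) * fst v)"
| "dqp h e (Suc i) x v = (let dq = fst (dqp h e i x v); dp = snd (dqp h e i x v);
      dp' = dp - h * (f' (qs h e i x) * dq) - e i * (F' (qs h e i x) * dq) in (dq + h * dp', dp'))"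

definition "dqs h e i x v = fst (dqp h e i x v)"
definition "dps h e i x v = snd (dqp h e i x v)"

lemma dps_Suc: "dps h e (Suc i) x v = dps h e i x v - h * (f' (qs h e i x) * dqs h e i x v)
    - e i * (F' (qs h e i x) * dqs h e i x v)"
  and dqs_Suc: "dqs h e (Suc i) x v = dqs h e i x v + h * dps h e (Suc i) x v"
  by (simp_all add: dqs_def dps_def Let_def)

lemma orbit_has_derivative:
  assumes "0 < snd x" "snd x < R"
  shows "(qs h e i has_derivative dqs h e i x) (at x) \<and> (ps h e i has_derivative dps h e i x) (at x)"
proof (induction i)
  case 0
  have "((\<lambda>x. snd x * sin (fst x)) has_derivative (\<lambda>v. sin (fst x) * snd v + snd x * cos (fst x) * fst v)) (at x)"
    by (auto intro!: derivative_eq_intros simp: algebra_simps)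
  moreover have "(Q has_real_derivative Y (snd x * sin (fst x))) (at (snd x * sin (fst x)))"
    by (intro Q_deriv polar_less_R assms)
  ultimately have "((\<lambda>x. Q (snd x * sin (fst x))) has_derivative dqs h e 0 x) (at x)"
    using DERIV_compose_FDERIV[where f = Q and g = "\<lambda>x. snd x * sin (fst x)"]
    by (simp add: dqs_def[abs_def] mult.commute)
  moreover have "((\<lambda>x. snd x * cos (fst x)) has_derivative dps h e 0 x) (at x)"
    unfolding dps_def[abs_def] by (auto intro!: derivative_eq_intros simp: algebra_simps)
  ultimately show ?case by (simp add: qs_0 ps_0)
next
  case (Suc i)
  have fq: "((\<lambda>x. f (qs h e i x)) has_derivative (\<lambda>v. dqs h e i x v * f' (qs h e i x))) (at x)"
    by (rule DERIV_compose_FDERIV[OF f_deriv]) (use Suc in auto)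
  have Fq: "((\<lambda>x. F (qs h e i x)) has_derivative (\<lambda>v. dqs h e i x v * F' (qs h e i x))) (at x)"
    by (rule DERIV_compose_FDERIV[OF F_deriv]) (use Suc in auto)
  have p: "((\<lambda>x. ps h e (Suc i) x) has_derivative dps h e (Suc i) x) (at x)"
    unfolding ps_Suc kick_p_def
    by (rule has_derivative_eq_rhs, (rule derivative_intros fq Fq Suc[THEN conjunct2])+)
       (auto simp: dps_Suc fun_eq_iff algebra_simps)
  moreover have "((\<lambda>x. qs h e i x + h * ps h e (Suc i) x) has_derivative dqs h e (Suc i) x) (at x)"
    by (rule has_derivative_eq_rhs, (rule derivative_intros p Suc[THEN conjunct1])+)
       (auto simp: dqs_Suc fun_eq_iff algebra_simps)
  ultimately show ?case by (simp add: qs_Suc[abs_def] kick_q_def ps_Suc)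
qed

text \<open>Both shears of a step preserve area, so the orbit has an action with
  \<open>d act = - (q\<^sub>n - c) dp\<^sub>n + (q\<^sub>0 - c) dp\<^sub>0\<close>.\<close>
definition act :: "real \<Rightarrow> (nat \<Rightarrow> real) \<Rightarrow> nat \<Rightarrow> real \<times> real \<Rightarrow> real" where
  "act h e n x = (\<Sum>i<n. h * ((qs h e i x - c) * f (qs h e i x) - V (qs h e i x))
     + e i * ((qs h e i x - c) * F (qs h e i x) - \<Phi> (qs h e i x)) - h * (ps h e (Suc i) x)\<^sup>2 / 2)"

text \<open>The new summand has derivative \<open>h * (q - c) * f' q * dq + e * (q - c) * F' q * dq
  - h * p' * dp'\<close>, since the terms with \<open>f\<close> and \<open>F\<close> cancel against
  those of \<open>V\<close> and \<open>\<Phi>\<close>. By the linearised step and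
  \<open>q' = q + h * p'\<close> this equals \<open>(q - c) * dp - (q' - c) * dp'\<close>, so the
  sum telescopes.\<close>

lemma act_has_derivative:
  assumes x: "0 < snd x" "snd x < R"
  shows "(act h e n has_derivative
     (\<lambda>v. - (qs h e n x - c) * dps h e n x v + (qs h e 0 x - c) * dps h e 0 x v)) (at x)"
proof (induction n)
  case 0
  have "((\<lambda>_. 0) has_derivative (\<lambda>v. - (qs h e 0 x - c) * dps h e 0 x v + (qs h e 0 x - c) * dps h e 0 x v)) (at x)"
    by (rule has_derivative_eq_rhs[OF has_derivative_const]) (auto simp: fun_eq_iff algebra_simps)
  then show ?case by (simp add: act_def[abs_def])
next
  case (Suc n)
  note q = orbit_has_derivative[OF x, of h e n, THEN conjunct1]
  note p = orbit_has_derivative[OF x, of h e "Suc n", THEN conjunct2]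
  have fq: "((\<lambda>x. f (qs h e n x)) has_derivative (\<lambda>v. dqs h e n x v * f' (qs h e n x))) (at x)"
    by (rule DERIV_compose_FDERIV[OF f_deriv q])
  have Fq: "((\<lambda>x. F (qs h e n x)) has_derivative (\<lambda>v. dqs h e n x v * F' (qs h e n x))) (at x)"
    by (rule DERIV_compose_FDERIV[OF F_deriv q])
  have Vq: "((\<lambda>x. V (qs h e n x)) has_derivative (\<lambda>v. dqs h e n x v * f (qs h e n x))) (at x)"
    by (rule DERIV_compose_FDERIV[OF V_deriv q])
  have \<Phi>q: "((\<lambda>x. \<Phi> (qs h e n x)) has_derivative (\<lambda>v. dqs h e n x v * F (qs h e n x))) (at x)"
    by (rule DERIV_compose_FDERIV[OF \<Phi>_deriv q])
  have p2: "((\<lambda>x. h * (ps h e (Suc n) x)\<^sup>2 / 2) has_derivative (\<lambda>v. h * ps h e (Suc n) x * dps h e (Suc n) x v)) (at x)"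
    by (auto intro!: derivative_eq_intros p)
  have "((\<lambda>x. act h e n x + (h * ((qs h e n x - c) * f (qs h e n x) - V (qs h e n x))
     + e n * ((qs h e n x - c) * F (qs h e n x) - \<Phi> (qs h e n x)) - h * (ps h e (Suc n) x)\<^sup>2 / 2)) has_derivative
     (\<lambda>v. (- (qs h e n x - c) * dps h e n x v + (qs h e 0 x - c) * dps h e 0 x v) +
       (h * ((qs h e n x - c) * (dqs h e n x v * f' (qs h e n x)))
     + e n * ((qs h e n x - c) * (dqs h e n x v * F' (qs h e n x))) - h * ps h e (Suc n) x * dps h e (Suc n) x v))) (at x)"
    by (rule has_derivative_eq_rhs, (rule has_derivative_add has_derivative_diff has_derivative_mult has_derivative_const Suc fq Fq Vq \<Phi>q p2 q)+)
       (auto simp: fun_eq_iff algebra_simps)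
  moreover have "(\<lambda>v. (- (qs h e n x - c) * dps h e n x v + (qs h e 0 x - c) * dps h e 0 x v) +
       (h * ((qs h e n x - c) * (dqs h e n x v * f' (qs h e n x)))
     + e n * ((qs h e n x - c) * (dqs h e n x v * F' (qs h e n x))) - h * ps h e (Suc n) x * dps h e (Suc n) x v))
     = (\<lambda>v. - (qs h e (Suc n) x - c) * dps h e (Suc n) x v + (qs h e 0 x - c) * dps h e 0 x v)"
    by (auto simp: fun_eq_iff qs_Suc kick_q_def dps_Suc ps_Suc algebra_simps)
  ultimately show ?case by (simp add: act_def)
qed

text \<open>Rotation preserves the norm, so \<open>rot_cos\<close> and \<open>rot_sin\<close> have
  squares summing to \<open>r^2\<close>. As \<open>rot_cos\<close> is positive,
  \<open>arctan\<close> of their quotient has exactly cosine \<open>rot_cos / r\<close> and sine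
  \<open>rot_sin / r\<close>; rotating back by \<open>t\<close> gives the claim.\<close>

lemma polar_step:
  assumes A: "rot_cos t q p > 0" and q: "l < q" "q < b" and r: "r = sqrt (p\<^sup>2 + 2 * V q)" "r > 0"
  shows "p = r * cos (t + turn t q p) \<and> yc q = r * sin (t + turn t q p)"
proof -
  let ?A = "rot_cos t q p" and ?B = "rot_sin t q p"
  have r2: "r\<^sup>2 = p\<^sup>2 + (yc q)\<^sup>2"
    using r q V_nonneg[of q] yc_sq[of q] by simp
  have "?A\<^sup>2 + ?B\<^sup>2 = (p\<^sup>2 + (yc q)\<^sup>2) * ((sin t)\<^sup>2 + (cos t)\<^sup>2)"
    unfolding rot_cos_def rot_sin_def by algebra
  then have AB: "?A\<^sup>2 + ?B\<^sup>2 = r\<^sup>2" by (simp add: r2)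
  have "sqrt (1 + (?B / ?A)\<^sup>2) = r / ?A"
  proof -
    have "1 + (?B / ?A)\<^sup>2 = (r / ?A)\<^sup>2"
      using A AB by (simp add: power_divide field_simps)
    then show ?thesis using A r(2) by simp
  qed
  then have cs: "cos (turn t q p) = ?A / r" "sin (turn t q p) = ?B / r"
    using A r(2) by (simp_all add: turn_def cos_arctan sin_arctan)
  have one: "(sin t)\<^sup>2 + (cos t)\<^sup>2 = 1" by simp
  have "r * cos (t + turn t q p) = ?A * cos t - ?B * sin t"
    using r(2) by (simp add: cos_add cs field_simps)
  also have "\<dots> = p" unfolding rot_cos_def rot_sin_def using one by algebra
  finally have 1: "r * cos (t + turn t q p) = p" .
  have "r * sin (t + turn t q p) = ?A * sin t + ?B * cos t"
    using r(2) by (simp add: sin_add cs field_simps)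
  also have "\<dots> = yc q" unfolding rot_cos_def rot_sin_def using one by algebra
  finally show ?thesis using 1 by simp
qed

lemma turn_periodic: "turn (t + 2 * pi) q p = turn t q p"
  by (simp add: turn_def rot_sin_def rot_cos_def)

lemma orbit_periodic: "qp h e i (t + 2 * pi, r) = qp h e i (t, r)"
  by (induction i) auto

lemma ts_periodic: "ts h e i (t + 2 * pi, r) = ts h e i (t, r) + 2 * pi"
  by (induction i) (auto simp: qs_def ps_def orbit_periodic turn_periodic)

end

text \<open>Conditions under which polar coordinates and the lifted angle are valid along all orbits
  started in an open annulus. Openness matters because derivatives in the initial point are needed
  up to the boundary of the smaller closed annulus on which \<open>W\<close> is maximised.\<close>

locale good_orbits = kicked_well +
  fixes h :: real and e :: "nat \<Rightarrow> real" and N :: nat and u\<^sub>1 u\<^sub>2 :: real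
  assumes u\<^sub>1_pos: "0 < u\<^sub>1" and u\<^sub>2_less: "u\<^sub>2 < R"
    and orbit_in: "\<And>x i. u\<^sub>1 < snd x \<Longrightarrow> snd x < u\<^sub>2 \<Longrightarrow> i \<le> N \<Longrightarrow>
       l < qs h e i x \<and> qs h e i x < b \<and> 0 < rs h e i x \<and> rs h e i x < R"
    and orbit_turn: "\<And>x i. u\<^sub>1 < snd x \<Longrightarrow> snd x < u\<^sub>2 \<Longrightarrow> i < N \<Longrightarrow>
       rot_cos (ts h e i x) (qs h e (Suc i) x) (ps h e (Suc i) x) > 0"
begin

abbreviation "q \<equiv> qs h e"
abbreviation "p \<equiv> ps h e"
abbreviation "\<theta> \<equiv> ts h e"
abbreviation "\<rho> \<equiv> rs h e"
abbreviation "dq \<equiv> dqs h e"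
abbreviation "dp \<equiv> dps h e"

definition U :: "(real \<times> real) set" where "U = UNIV \<times> {u\<^sub>1<..<u\<^sub>2}"

lemma open_U: "open U" by (simp add: U_def open_Times)

lemma in_U: "x \<in> U \<longleftrightarrow> u\<^sub>1 < snd x \<and> snd x < u\<^sub>2" by (cases x) (simp add: U_def)

lemma U_bounds: "x \<in> U \<Longrightarrow> 0 < snd x \<and> snd x < R"
  using u\<^sub>1_pos u\<^sub>2_less by (simp add: in_U)

lemma yc_sq_q: "x \<in> U \<Longrightarrow> i \<le> N \<Longrightarrow> (\<rho> i x)\<^sup>2 = (p i x)\<^sup>2 + (yc (q i x))\<^sup>2"
  using orbit_in[of x i] V_nonneg[of "q i x"] yc_sq[of "q i x"] by (simp add: in_U rs_def)

lemma rho_0: assumes "x \<in> U" shows "\<rho> 0 x = snd x"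
proof -
  note b = U_bounds[OF assms]
  have y: "\<bar>snd x * sin (fst x)\<bar> < R" using polar_less_R b by blast
  have "(\<rho> 0 x)\<^sup>2 = (snd x * cos (fst x))\<^sup>2 + (snd x * sin (fst x))\<^sup>2"
    using yc_sq_q[OF assms, of 0] yc_Q[OF y] by (simp add: ps_0 qs_0)
  also have "\<dots> = (snd x)\<^sup>2 * ((cos (fst x))\<^sup>2 + (sin (fst x))\<^sup>2)"
    by (simp only: power_mult_distrib distrib_left)
  finally have "(\<rho> 0 x)\<^sup>2 = (snd x)\<^sup>2" by simp
  then show ?thesis using b orbit_in[of x 0] assms by (simp add: in_U power2_eq_iff_nonneg)
qed

lemma polar_form:
  assumes "x \<in> U" "i \<le> N"
  shows "p i x = \<rho> i x * cos (\<theta> i x) \<and> yc (q i x) = \<rho> i x * sin (\<theta> i x)"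
  using assms(2)
proof (induction i)
  case 0
  then show ?case
    using rho_0[OF assms(1)] yc_Q polar_less_R U_bounds[OF assms(1)] by (simp add: ps_0 qs_0)
next
  case (Suc i)
  show ?case
    using polar_step[of "\<theta> i x" "q (Suc i) x" "p (Suc i) x"] orbit_turn[of x i] orbit_in[of x "Suc i"] assms Suc.prems
    by (simp add: in_U rs_def)
qed

lemma q_polar: "x \<in> U \<Longrightarrow> i \<le> N \<Longrightarrow> q i x = Q (\<rho> i x * sin (\<theta> i x))"
  using polar_form[of x i] orbit_in[of x i] Q_yc[of "q i x"] polar_less_R[of "\<rho> i x" "\<theta> i x"]
  by (simp add: in_U)

lemma yc_q_deriv:
  assumes "x \<in> U" "i \<le> N"
  shows "((\<lambda>x. yc (q i x)) has_derivative (\<lambda>v. yc' (q i x) * dq i x v)) (at x)"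
proof -
  have "l < q i x" "q i x < b" using orbit_in assms by (auto simp: in_U)
  from DERIV_compose_FDERIV[where f = yc and g = "q i" and x = x and s = UNIV, OF yc_deriv[OF this]]
  show ?thesis using orbit_has_derivative U_bounds[OF assms(1)] by (simp add: mult.commute)
qed

lemma rho_differentiable:
  assumes "x \<in> U" "i \<le> N"
  shows "\<exists>D. (\<rho> i has_derivative D) (at x)"
proof -
  note p = orbit_has_derivative[of x h e i, THEN conjunct2] and q = orbit_has_derivative[of x h e i, THEN conjunct1]
  note b = U_bounds[OF assms(1)]
  have Vq: "((\<lambda>x. V (q i x)) has_derivative (\<lambda>v. dq i x v * f (q i x))) (at x)"
    by (rule DERIV_compose_FDERIV[OF V_deriv q]) (use b in auto)
  have "((\<lambda>x. (p i x)\<^sup>2 + 2 * V (q i x)) has_derivative (\<lambda>v. 2 * p i x * dp i x v + 2 * (dq i x v * f (q i x)))) (at x)"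
    using p b Vq by (auto intro!: derivative_eq_intros)
  moreover have "(p i x)\<^sup>2 + 2 * V (q i x) > 0"
    using orbit_in[of x i] assms by (simp add: in_U rs_def)
  ultimately show ?thesis
    unfolding rs_def[abs_def]
    using DERIV_compose_FDERIV[where f = sqrt and g = "\<lambda>x. (p i x)\<^sup>2 + 2 * V (q i x)" and x = x and s = UNIV, OF DERIV_real_sqrt]
    by blast
qed

lemma theta_differentiable:
  assumes "x \<in> U" "i \<le> N"
  shows "\<exists>D. (\<theta> i has_derivative D) (at x)"
  using assms(2)
proof (induction i)
  case 0
  have "(fst has_derivative fst) (at x)" by (rule derivative_intros) (rule has_derivative_ident)
  then show ?case by (auto simp: fun_eq_iff[of "ts h e 0"] intro!: exI[of _ fst] has_derivative_transform[of _ UNIV _ fst])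
next
  case (Suc i)
  then obtain D where D: "(\<theta> i has_derivative D) (at x)" by auto
  note p = orbit_has_derivative[of x h e "Suc i", THEN conjunct2]
  note b = U_bounds[OF assms(1)]
  note y = yc_q_deriv[OF assms(1) Suc.prems]
  have s: "((\<lambda>x. sin (\<theta> i x)) has_derivative (\<lambda>v. D v * cos (\<theta> i x))) (at x)"
    by (rule DERIV_compose_FDERIV[OF DERIV_sin D])
  have c: "((\<lambda>x. cos (\<theta> i x)) has_derivative (\<lambda>v. D v * (- sin (\<theta> i x)))) (at x)"
    by (rule DERIV_compose_FDERIV[OF DERIV_cos D])
  obtain DA where DA: "((\<lambda>x. rot_cos (\<theta> i x) (q (Suc i) x) (p (Suc i) x)) has_derivative DA) (at x)"
    unfolding rot_cos_def using has_derivative_add[OF has_derivative_mult[OF p c] has_derivative_mult[OF y s]] b by blast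
  obtain DB where DB: "((\<lambda>x. rot_sin (\<theta> i x) (q (Suc i) x) (p (Suc i) x)) has_derivative DB) (at x)"
    unfolding rot_sin_def using has_derivative_diff[OF has_derivative_mult[OF y c] has_derivative_mult[OF p s]] b by blast
  have "rot_cos (\<theta> i x) (q (Suc i) x) (p (Suc i) x) \<noteq> 0"
    using orbit_turn[of x i] assms Suc by (simp add: in_U)
  from has_derivative_divide[OF DB DA this] obtain DC where
    "((\<lambda>x. rot_sin (\<theta> i x) (q (Suc i) x) (p (Suc i) x) / rot_cos (\<theta> i x) (q (Suc i) x) (p (Suc i) x)) has_derivative DC) (at x)"
    by blast
  from has_derivative_add[OF D DERIV_compose_FDERIV[OF DERIV_arctan this]]
  show ?case unfolding turn_def[symmetric] ts.simps(2)[symmetric] by blast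
qed

text \<open>The polar form holds on the open set \<open>U\<close>, so both of its sides have the
  same derivative. This ties the otherwise unnamed derivatives of radius and lifted angle to
  \<open>dps\<close> and \<open>dqs\<close> without differentiating a sum of \<open>arctan\<close>
  terms.\<close>

lemma polar_derivatives:
  assumes x: "x \<in> U" "i \<le> N"
    and r: "(\<rho> i has_derivative Dr) (at x)" and t: "(\<theta> i has_derivative Dt) (at x)"
  shows "dp i x v = cos (\<theta> i x) * Dr v - \<rho> i x * sin (\<theta> i x) * Dt v"
    and "yc' (q i x) * dq i x v = sin (\<theta> i x) * Dr v + \<rho> i x * cos (\<theta> i x) * Dt v"
proof -
  have s: "((\<lambda>x. sin (\<theta> i x)) has_derivative (\<lambda>v. Dt v * cos (\<theta> i x))) (at x)"
    by (rule DERIV_compose_FDERIV[OF DERIV_sin t])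
  have c: "((\<lambda>x. cos (\<theta> i x)) has_derivative (\<lambda>v. Dt v * (- sin (\<theta> i x)))) (at x)"
    by (rule DERIV_compose_FDERIV[OF DERIV_cos t])
  have "(p i has_derivative (\<lambda>v. \<rho> i x * (Dt v * (- sin (\<theta> i x))) + Dr v * cos (\<theta> i x))) (at x)"
    by (rule has_derivative_transform_within_open[OF has_derivative_mult[OF r c] open_U x(1)])
       (use polar_form x in auto)
  then have "dp i x = (\<lambda>v. \<rho> i x * (Dt v * (- sin (\<theta> i x))) + Dr v * cos (\<theta> i x))"
    using orbit_has_derivative U_bounds[OF x(1)] has_derivative_unique by blast
  then show "dp i x v = cos (\<theta> i x) * Dr v - \<rho> i x * sin (\<theta> i x) * Dt v" by (simp add: algebra_simps)
  have "((\<lambda>x. yc (q i x)) has_derivative (\<lambda>v. \<rho> i x * (Dt v * cos (\<theta> i x)) + Dr v * sin (\<theta> i x))) (at x)"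
    by (rule has_derivative_transform_within_open[OF has_derivative_mult[OF r s] open_U x(1)])
       (use polar_form x in auto)
  then have "(\<lambda>v. yc' (q i x) * dq i x v) = (\<lambda>v. \<rho> i x * (Dt v * cos (\<theta> i x)) + Dr v * sin (\<theta> i x))"
    using yc_q_deriv[OF x] has_derivative_unique by blast
  then show "yc' (q i x) * dq i x v = sin (\<theta> i x) * Dr v + \<rho> i x * cos (\<theta> i x) * Dt v"
    using fun_cong[of _ _ v] by (fastforce simp: algebra_simps)
qed

text \<open>Generating function of mixed type:
  \<open>dW = (A\<^sub>0 - A\<^sub>N) d\<Theta>\<^sub>N + (\<Theta>\<^sub>N - \<Theta>\<^sub>0 - j) dA\<^sub>0\<close>. It is periodic in the initial angle, because the action
  variable \<open>A\<close> is the period of \<open>M\<close>.\<close>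
definition W :: "nat \<Rightarrow> real \<times> real \<Rightarrow> real" where
  "W j x = (A (snd x) - A (\<rho> N x)) * \<Theta> (\<rho> N x) (\<theta> N x) - real j * A (snd x) - act h e N x
     + M (\<rho> N x) (\<theta> N x) - M (snd x) (fst x)"

text \<open>The action contributes \<open>(q - c) dp\<close> at the end minus the same at the start.
  The two \<open>M\<close> terms cancel these and leave \<open>\<Theta> dA\<close> at the end minus
  \<open>\<Theta> dA\<close> at the start; the former cancels against the product rule applied to
  \<open>(A\<^sub>0 - A\<^sub>N) * \<Theta>\<^sub>N\<close>.\<close>

lemma W_has_derivative:
  assumes x: "x \<in> U"
    and r: "(\<rho> N has_derivative Dr) (at x)" and t: "(\<theta> N has_derivative Dt) (at x)"
  shows "(W j has_derivative (\<lambda>v. (A (snd x) - A (\<rho> N x)) *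
        (\<Theta>\<^sub>r (\<rho> N x) (\<theta> N x) * Dr v + Y (\<rho> N x * sin (\<theta> N x)) / T (\<rho> N x) * Dt v)
      + (\<Theta> (\<rho> N x) (\<theta> N x) - \<Theta> (snd x) (fst x) - real j) * (snd x * T (snd x) * snd v))) (at x)"
proof -
  note b = U_bounds[OF x]
  have rN: "0 < \<rho> N x" "\<rho> N x < R" using orbit_in[of x N] x by (auto simp: in_U)
  have fs: "(fst has_derivative fst) (at x)" "(snd has_derivative snd) (at x)"
    by (auto intro: bounded_linear_imp_has_derivative bounded_linear_fst bounded_linear_snd)
  have A0: "((\<lambda>x. A (snd x)) has_derivative (\<lambda>v. snd v * (snd x * T (snd x)))) (at x)"
    by (rule DERIV_compose_FDERIV[OF A_deriv fs(2)]) (use b in auto)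
  have AN: "((\<lambda>x. A (\<rho> N x)) has_derivative (\<lambda>v. Dr v * (\<rho> N x * T (\<rho> N x)))) (at x)"
    by (rule DERIV_compose_FDERIV[OF A_deriv r]) (use rN in auto)
  note TN = \<Theta>_has_derivative[OF rN r t]
  note MN = M_has_derivative[OF rN r t]
  have M0: "((\<lambda>x. M (snd x) (fst x)) has_derivative
     (\<lambda>v. (snd x * \<tau> (snd x) (fst x) - cos (fst x) * (Q (snd x * sin (fst x)) - c)) * snd v
        + snd x * sin (fst x) * (Q (snd x * sin (fst x)) - c) * fst v)) (at x)"
    by (rule M_has_derivative[of snd x snd fst fst]) (use b fs in auto)
  note act = act_has_derivative[of x h e N]
  have D: "(W j has_derivative (\<lambda>v. ((A (snd x) - A (\<rho> N x)) *
        (\<Theta>\<^sub>r (\<rho> N x) (\<theta> N x) * Dr v + Y (\<rho> N x * sin (\<theta> N x)) / T (\<rho> N x) * Dt v)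
        + (snd v * (snd x * T (snd x)) - Dr v * (\<rho> N x * T (\<rho> N x))) * \<Theta> (\<rho> N x) (\<theta> N x)
        - real j * (snd v * (snd x * T (snd x)))
        - (- (q N x - c) * dp N x v + (q 0 x - c) * dp 0 x v)
        + ((\<rho> N x * \<tau> (\<rho> N x) (\<theta> N x) - cos (\<theta> N x) * (Q (\<rho> N x * sin (\<theta> N x)) - c)) * Dr v
        + \<rho> N x * sin (\<theta> N x) * (Q (\<rho> N x * sin (\<theta> N x)) - c) * Dt v)
        - ((snd x * \<tau> (snd x) (fst x) - cos (fst x) * (Q (snd x * sin (fst x)) - c)) * snd v
        + snd x * sin (fst x) * (Q (snd x * sin (fst x)) - c) * fst v)))) (at x)"
    unfolding W_def[abs_def] using b
    by (intro has_derivative_add has_derivative_diff has_derivative_mult has_derivative_mult_right A0 AN TN MN M0 act) auto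
  show ?thesis
  proof (rule has_derivative_eq_rhs[OF D], rule ext)
    fix v :: "real \<times> real"
    have dpN: "dp N x v = cos (\<theta> N x) * Dr v - \<rho> N x * sin (\<theta> N x) * Dt v"
      by (rule polar_derivatives[OF x _ r t]) simp
    have dp0: "dp 0 x v = cos (fst x) * snd v - snd x * sin (fst x) * fst v"
      by (simp add: dps_def)
    have qN: "Q (\<rho> N x * sin (\<theta> N x)) = q N x" using q_polar[OF x, of N] by simp
    have q0: "Q (snd x * sin (fst x)) = q 0 x" by (simp add: qs_0)
    have tN: "\<tau> (\<rho> N x) (\<theta> N x) = \<Theta> (\<rho> N x) (\<theta> N x) * T (\<rho> N x)"
      using T_pos[OF rN] by (simp add: \<Theta>_def)
    have t0: "\<tau> (snd x) (fst x) = \<Theta> (snd x) (fst x) * T (snd x)"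
      using T_pos[of "snd x"] b by (simp add: \<Theta>_def)
    show "(A (snd x) - A (\<rho> N x)) *
        (\<Theta>\<^sub>r (\<rho> N x) (\<theta> N x) * Dr v + Y (\<rho> N x * sin (\<theta> N x)) / T (\<rho> N x) * Dt v)
        + (snd v * (snd x * T (snd x)) - Dr v * (\<rho> N x * T (\<rho> N x))) * \<Theta> (\<rho> N x) (\<theta> N x)
        - real j * (snd v * (snd x * T (snd x)))
        - (- (q N x - c) * dp N x v + (q 0 x - c) * dp 0 x v)
        + ((\<rho> N x * \<tau> (\<rho> N x) (\<theta> N x) - cos (\<theta> N x) * (Q (\<rho> N x * sin (\<theta> N x)) - c)) * Dr v
        + \<rho> N x * sin (\<theta> N x) * (Q (\<rho> N x * sin (\<theta> N x)) - c) * Dt v)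
        - ((snd x * \<tau> (snd x) (fst x) - cos (fst x) * (Q (snd x * sin (fst x)) - c)) * snd v
        + snd x * sin (fst x) * (Q (snd x * sin (fst x)) - c) * fst v)
      = (A (snd x) - A (\<rho> N x)) *
        (\<Theta>\<^sub>r (\<rho> N x) (\<theta> N x) * Dr v + Y (\<rho> N x * sin (\<theta> N x)) / T (\<rho> N x) * Dt v)
      + (\<Theta> (\<rho> N x) (\<theta> N x) - \<Theta> (snd x) (fst x) - real j) * (snd x * T (snd x) * snd v)"
      unfolding qN q0 dpN dp0 tN t0 by (simp add: algebra_simps)
  qed
qed

lemma W_periodic:
  assumes "u\<^sub>1 < r" "r < u\<^sub>2" shows "W j (t + 2 * pi, r) = W j (t, r)"
proof -
  have x: "(t, r) \<in> U" using assms by (simp add: in_U)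
  have q: "qs h e i (t + 2 * pi, r) = qs h e i (t, r)" "ps h e i (t + 2 * pi, r) = ps h e i (t, r)" for i
    by (simp_all add: qs_def ps_def orbit_periodic)
  have rN: "0 < \<rho> N (t, r)" "\<rho> N (t, r) < R" using orbit_in[of "(t, r)" N] x by (auto simp: in_U)
  have r: "0 < r" "r < R" using U_bounds[OF x] by auto
  have a: "act h e N (t + 2 * pi, r) = act h e N (t, r)" by (simp add: act_def q)
  have "\<rho> N (t + 2 * pi, r) = \<rho> N (t, r)" by (simp add: rs_def q)
  then show ?thesis
    unfolding W_def fst_conv snd_conv a ts_periodic by (simp only: \<Theta>_periodic[OF rN] M_periodic[OF rN] M_periodic[OF r]) (simp add: algebra_simps)
qed

lemma W_continuous: "continuous_on U (W j)"
proof (rule differentiable_imp_continuous_on)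
  show "W j differentiable_on U"
    unfolding differentiable_on_def
  proof
    fix x assume x: "x \<in> U"
    obtain Dr Dt where "(\<rho> N has_derivative Dr) (at x)" "(\<theta> N has_derivative Dt) (at x)"
      using rho_differentiable[OF x, of N] theta_differentiable[OF x, of N] by auto
    from W_has_derivative[OF x this, of j] show "W j differentiable (at x within U)"
      using differentiable_at_withinI differentiable_def by blast
  qed
qed

text \<open>The angular derivative of \<open>W\<close> vanishes at a maximum even on the boundary
  circles, and \<open>twist\<close> turns this into equality of the initial and final radius. Only
  then is the radial derivative expressed through \<open>\<tau>\<close> at the initial radius, which
  is what \<open>inner\<close> and \<open>outer\<close> control.\<close>

lemma periodic_orbit_exists:
  assumes r12: "u\<^sub>1 < r\<^sub>1" "r\<^sub>1 < r\<^sub>2" "r\<^sub>2 < u\<^sub>2"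
    and twist: "\<And>(x :: real \<times> real) Dr Dt. 0 \<le> fst x \<Longrightarrow> fst x \<le> 2 * pi \<Longrightarrow> r\<^sub>1 \<le> snd x \<Longrightarrow> snd x \<le> r\<^sub>2 \<Longrightarrow>
      (\<rho> N has_derivative Dr) (at x) \<Longrightarrow> (\<theta> N has_derivative Dt) (at x) \<Longrightarrow>
      \<Theta>\<^sub>r (\<rho> N x) (\<theta> N x) * Dr (1, 0) + Y (\<rho> N x * sin (\<theta> N x)) / T (\<rho> N x) * Dt (1, 0) \<noteq> 0"
    and inner: "\<And>x. snd x = r\<^sub>1 \<Longrightarrow> \<tau> r\<^sub>1 (\<theta> N x) - \<tau> r\<^sub>1 (fst x) > real j * T r\<^sub>1"
    and outer: "\<And>x. snd x = r\<^sub>2 \<Longrightarrow> \<tau> r\<^sub>2 (\<theta> N x) - \<tau> r\<^sub>2 (fst x) < real j * T r\<^sub>2"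
  shows "\<exists>x. r\<^sub>1 \<le> snd x \<and> snd x \<le> r\<^sub>2 \<and> \<rho> N x = snd x \<and> \<theta> N x = fst x + 2 * pi * real j"
proof -
  \<comment> \<open>Three periods of the angle: a maximum can be moved by periodicity into the
    middle one, where it is interior in the angular direction.\<close>
  let ?D = "{- 2 * pi .. 4 * pi} \<times> {r\<^sub>1..r\<^sub>2}"
  have "?D \<subseteq> U" using r12 by (auto simp: U_def)
  then have "continuous_on ?D (W j)" using W_continuous continuous_on_subset by blast
  moreover have "compact ?D" by (intro compact_Times) auto
  moreover have "?D \<noteq> {}" using r12 pi_gt_zero by auto
  ultimately obtain z where z: "z \<in> ?D" "\<And>y. y \<in> ?D \<Longrightarrow> W j y \<le> W j z"
    using continuous_attains_sup[of ?D "W j"] by blast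
  obtain t\<^sub>0 r\<^sub>0 where zt: "z = (t\<^sub>0, r\<^sub>0)" by (cases z)
  have r0: "r\<^sub>1 \<le> r\<^sub>0" "r\<^sub>0 \<le> r\<^sub>2" "- 2 * pi \<le> t\<^sub>0" "t\<^sub>0 \<le> 4 * pi" using z zt by auto
  obtain t where t: "0 \<le> t" "t \<le> 2 * pi" "W j (t, r\<^sub>0) = W j z"
  proof -
    consider "t\<^sub>0 < 0" | "0 \<le> t\<^sub>0" "t\<^sub>0 \<le> 2 * pi" | "2 * pi < t\<^sub>0" by linarith
    then show ?thesis
    proof cases
      case 1
      then show ?thesis using that[of "t\<^sub>0 + 2 * pi"] W_periodic[of r\<^sub>0 j t\<^sub>0] r0 r12 zt by simp
    next
      case 2 then show ?thesis using that[of t\<^sub>0] zt by simp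
    next
      case 3
      then show ?thesis using that[of "t\<^sub>0 - 2 * pi"] W_periodic[of r\<^sub>0 j "t\<^sub>0 - 2 * pi"] r0 r12 zt by simp
    qed
  qed
  define x where "x = (t, r\<^sub>0)"
  have max: "W j y \<le> W j x" if "y \<in> ?D" for y using z(2)[OF that] t(3) by (simp add: x_def)
  have xU: "x \<in> U" using r0 r12 by (simp add: x_def in_U)
  note b = U_bounds[OF xU]
  have rN: "0 < \<rho> N x" "\<rho> N x < R" using orbit_in[of x N] xU by (auto simp: in_U)
  obtain Dr Dt where Dr: "(\<rho> N has_derivative Dr) (at x)" and Dt: "(\<theta> N has_derivative Dt) (at x)"
    using rho_differentiable[OF xU, of N] theta_differentiable[OF xU, of N] by auto
  note DW = W_has_derivative[OF xU Dr Dt, of j]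
  let ?k = "\<Theta>\<^sub>r (\<rho> N x) (\<theta> N x) * Dr (1, 0) + Y (\<rho> N x * sin (\<theta> N x)) / T (\<rho> N x) * Dt (1, 0)"
  have lin: "linear Dr" "linear Dt" using Dr Dt by (auto dest: has_derivative_linear)
  have "((\<lambda>s. (s, r\<^sub>0)) has_derivative (\<lambda>u. (u, 0))) (at t)"
    by (auto intro!: derivative_eq_intros)
  moreover have "(W j has_derivative (\<lambda>v. (A (snd x) - A (\<rho> N x)) *
        (\<Theta>\<^sub>r (\<rho> N x) (\<theta> N x) * Dr v + Y (\<rho> N x * sin (\<theta> N x)) / T (\<rho> N x) * Dt v)
      + (\<Theta> (\<rho> N x) (\<theta> N x) - \<Theta> (snd x) (fst x) - real j) * (snd x * T (snd x) * snd v))) (at ((\<lambda>s. (s, r\<^sub>0)) t))"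
    using DW by (simp add: x_def)
  ultimately have D1: "((\<lambda>s. W j (s, r\<^sub>0)) has_derivative (\<lambda>u. (A (snd x) - A (\<rho> N x)) *
        (\<Theta>\<^sub>r (\<rho> N x) (\<theta> N x) * Dr (u, 0) + Y (\<rho> N x * sin (\<theta> N x)) / T (\<rho> N x) * Dt (u, 0)))) (at t)"
    by (rule has_derivative_compose[where f = "\<lambda>s. (s, r\<^sub>0)" and g = "W j", THEN has_derivative_eq_rhs]) simp
  have hom: "Dr (u, 0) = u * Dr (1, 0)" "Dt (u, 0) = u * Dt (1, 0)" for u
    using linear_scale[OF lin(1), of u "(1, 0)"] linear_scale[OF lin(2), of u "(1, 0)"] by auto
  have "((\<lambda>s. W j (s, r\<^sub>0)) has_real_derivative (A (snd x) - A (\<rho> N x)) * ?k) (at t)"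
    unfolding has_field_derivative_def
    by (rule has_derivative_eq_rhs[OF D1], rule ext, subst (1) hom, subst (1) hom(2)) (simp add: algebra_simps)
  then have "(A (snd x) - A (\<rho> N x)) * ?k = 0"
  proof (rule DERIV_local_max[of _ _ _ "2 * pi"])
    show "\<forall>y. \<bar>t - y\<bar> < 2 * pi \<longrightarrow> W j (y, r\<^sub>0) \<le> W j (t, r\<^sub>0)"
    proof (intro allI impI)
      fix y assume "\<bar>t - y\<bar> < 2 * pi"
      then have "- 2 * pi \<le> y" "y \<le> 4 * pi" using t(1,2) by linarith+
      then show "W j (y, r\<^sub>0) \<le> W j (t, r\<^sub>0)" using max[of "(y, r\<^sub>0)"] r0 by (simp add: x_def)
    qed
  qed simp
  moreover have "?k \<noteq> 0" by (rule twist[OF _ _ _ _ Dr Dt]) (use t r0 in \<open>auto simp: x_def\<close>)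
  ultimately have "A (snd x) = A (\<rho> N x)" by simp
  then have eq: "\<rho> N x = r\<^sub>0" using A_inj[of "snd x" "\<rho> N x"] b rN by (simp add: x_def)
  have "((\<lambda>s. (t, s)) has_derivative (\<lambda>u. (0, u))) (at r\<^sub>0)"
    by (auto intro!: derivative_eq_intros)
  moreover have "(W j has_derivative (\<lambda>v. (\<Theta> (\<rho> N x) (\<theta> N x) - \<Theta> (snd x) (fst x) - real j) * (snd x * T (snd x) * snd v))) (at ((\<lambda>s. (t, s)) r\<^sub>0))"
    using DW eq by (simp add: x_def)
  ultimately have "((\<lambda>s. W j (t, s)) has_derivative (\<lambda>u. (\<Theta> (\<rho> N x) (\<theta> N x) - \<Theta> (snd x) (fst x) - real j) * (snd x * T (snd x) * u))) (at r\<^sub>0)"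
    by (rule has_derivative_compose[where f = "\<lambda>s. (t, s)" and g = "W j", THEN has_derivative_eq_rhs]) simp
  then have D2: "((\<lambda>s. W j (t, s)) has_real_derivative (\<Theta> r\<^sub>0 (\<theta> N x) - \<Theta> r\<^sub>0 t - real j) * (r\<^sub>0 * T r\<^sub>0)) (at r\<^sub>0)"
    unfolding has_field_derivative_def by (rule has_derivative_eq_rhs) (auto simp: fun_eq_iff eq[unfolded x_def] x_def)
  have rR: "0 < r\<^sub>0" "r\<^sub>0 < R" using b by (auto simp: x_def)
  have T0: "T r\<^sub>0 > 0" by (rule T_pos[OF rR])
  let ?d = "\<Theta> r\<^sub>0 (\<theta> N x) - \<Theta> r\<^sub>0 t - real j"
  have d_eq: "?d * T r\<^sub>0 = \<tau> r\<^sub>0 (\<theta> N x) - \<tau> r\<^sub>0 t - real j * T r\<^sub>0"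
    using T0 by (simp add: \<Theta>_def field_simps)
  have "?d = 0"
  proof (rule ccontr)
    assume "?d \<noteq> 0"
    then consider "?d > 0" | "?d < 0" by linarith
    then show False
    proof cases
      case 1
      then have "?d * T r\<^sub>0 > 0" using T0 by simp
      \<comment> \<open>A positive radial derivative would let \<open>W\<close> grow outwards, so
        the maximum could only sit on the outer circle, where \<open>outer\<close> gives the
        opposite sign. The inner circle is treated alike.\<close>
      then have "r\<^sub>0 \<noteq> r\<^sub>2" using outer[of x] d_eq by (auto simp: x_def)
      then have lt: "r\<^sub>0 < r\<^sub>2" using r0 by simp
      have "?d * (r\<^sub>0 * T r\<^sub>0) > 0" using 1 T0 rR by simp
      from DERIV_pos_inc_right[OF D2 this] obtain \<delta> where \<delta>: "\<delta> > 0"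
        "\<And>s. 0 < s \<Longrightarrow> s < \<delta> \<Longrightarrow> W j (t, r\<^sub>0) < W j (t, r\<^sub>0 + s)" by blast
      define s where "s = min (\<delta>/2) (r\<^sub>2 - r\<^sub>0)"
      have "0 < s" "s < \<delta>" "s \<le> r\<^sub>2 - r\<^sub>0" using \<delta> lt by (auto simp: s_def)
      then show False using \<delta>(2)[of s] max[of "(t, r\<^sub>0 + s)"] t r0 by (simp add: x_def)
    next
      case 2
      then have "?d * T r\<^sub>0 < 0" using T0 by (simp add: mult_neg_pos)
      then have "r\<^sub>0 \<noteq> r\<^sub>1" using inner[of x] d_eq by (auto simp: x_def)
      then have lt: "r\<^sub>1 < r\<^sub>0" using r0 by simp
      have "?d * (r\<^sub>0 * T r\<^sub>0) < 0" using 2 T0 rR by (simp add: mult_neg_pos)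
      from DERIV_neg_dec_left[OF D2 this] obtain \<delta> where \<delta>: "\<delta> > 0"
        "\<And>s. 0 < s \<Longrightarrow> s < \<delta> \<Longrightarrow> W j (t, r\<^sub>0) < W j (t, r\<^sub>0 - s)" by blast
      define s where "s = min (\<delta>/2) (r\<^sub>0 - r\<^sub>1)"
      have "0 < s" "s < \<delta>" "s \<le> r\<^sub>0 - r\<^sub>1" using \<delta> lt by (auto simp: s_def)
      then show False using \<delta>(2)[of s] max[of "(t, r\<^sub>0 - s)"] t r0 by (simp add: x_def)
    qed
  qed
  then have "\<tau> r\<^sub>0 (\<theta> N x) = \<tau> r\<^sub>0 (t + 2 * pi * real j)"
    using d_eq \<tau>_periodic_nat[OF rR, of t j] by simp
  then have "\<theta> N x = t + 2 * pi * real j"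
    using \<tau>_strict_mono[OF rR, of "\<theta> N x" "t + 2 * pi * real j"] \<tau>_strict_mono[OF rR, of "t + 2 * pi * real j" "\<theta> N x"]
    by (cases "\<theta> N x" "t + 2 * pi * real j" rule: linorder_cases) auto
  then show ?thesis using eq r0 by (intro exI[of _ x]) (simp add: x_def)
qed

end

section \<open>Growth of the linearised orbits\<close>

lemma discrete_gronwall:
  fixes s a b :: "nat \<Rightarrow> real"
  assumes s0: "s 0 \<le> 0" and step: "\<And>i. i < N \<Longrightarrow> s (Suc i) \<le> (1 + a i) * s i + b i"
    and a: "\<And>i. a i \<ge> 0" and b: "\<And>i. b i \<ge> 0"
  shows "n \<le> N \<Longrightarrow> s n \<le> exp (\<Sum>i<n. a i) * (\<Sum>i<n. b i)"
proof (induction n)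
  case (Suc n)
  let ?E = "exp (\<Sum>i<n. a i)" and ?B = "\<Sum>i<n. b i"
  have B: "?B \<ge> 0" using b by (intro sum_nonneg)
  have "s (Suc n) \<le> (1 + a n) * s n + b n" using step Suc by simp
  also have "\<dots> \<le> (1 + a n) * (?E * ?B) + b n"
    using Suc a[of n] by (intro add_right_mono mult_left_mono) auto
  \<comment> \<open>The factor in front of \<open>b n\<close>, which is at least 1, is inserted so
    that both terms share one exponential and the bound closes as a product.\<close>
  also have "\<dots> \<le> exp (a n) * (?E * ?B) + exp (\<Sum>i<Suc n. a i) * b n"
  proof (rule add_mono)
    show "(1 + a n) * (?E * ?B) \<le> exp (a n) * (?E * ?B)"
      using B exp_ge_add_one_self[of "a n"] by (intro mult_right_mono) auto
    have "exp (\<Sum>i<Suc n. a i) \<ge> 1" using a by (simp add: sum_nonneg del: sum.lessThan_Suc)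
    from mult_right_mono[OF this b[of n]] show "b n \<le> exp (\<Sum>i<Suc n. a i) * b n" by simp
  qed
  also have "\<dots> = exp (\<Sum>i<Suc n. a i) * (\<Sum>i<Suc n. b i)"
    by (simp add: exp_add algebra_simps)
  finally show ?case .
qed (use s0 in simp)

text \<open>One step of the linearised scheme, for the deviation of \<open>(dq, dp)\<close> from the multiple \<open>Y0 * (p, - f q)\<close> of the
  autonomous vector field, which is invariant under the linearised flow up to small errors.\<close>
lemma variation_step:
  fixes h e B C \<eta> f0 f1 F0 F1 df Y0 u dq dp dp' dq' :: real
  assumes B: "B \<ge> 1" and C: "C \<ge> 0" and h: "0 \<le> h" "h \<le> 1" "h \<le> \<eta>"
    and bd: "\<bar>f1\<bar> \<le> B" "\<bar>F1\<bar> \<le> B" "\<bar>F0\<bar> \<le> B" "\<bar>u\<bar> \<le> B" "0 \<le> Y0" "Y0 \<le> B"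
    and err: "\<bar>df - f1 * (h * u)\<bar> \<le> \<eta> * h + C * \<bar>e\<bar>"
    and dp': "dp' = dp - h * (f1 * dq) - e * (F1 * dq)" and dq': "dq' = dq + h * dp'"
  shows "\<bar>dq' - Y0 * (u - h * f0 - e * F0)\<bar> + \<bar>dp' + Y0 * (f0 + df)\<bar>
     \<le> (1 + 2 * B * (h + \<bar>e\<bar>)) * (\<bar>dq - Y0 * u\<bar> + \<bar>dp + Y0 * f0\<bar>)
       + (3 * B^3 + 3 * B + 3 * B * C + B\<^sup>2) * (\<eta> * h + \<bar>e\<bar>)"
proof -
  define \<xi> \<pi> where "\<xi> = dq - Y0 * u" and "\<pi> = dp + Y0 * f0"
  define \<pi>' where "\<pi>' = dp' + Y0 * (f0 + df)"
  \<comment> \<open>One-step error of the momentum deviation: the kick acting on the reference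
    vector, and the Taylor remainder of \<open>f\<close>.\<close>
  define X where "X = B^3 * \<bar>e\<bar> + B * (\<eta> * h + C * \<bar>e\<bar>)"
  have \<eta>: "\<eta> \<ge> 0" using h by linarith
  have B0: "B \<ge> 0" using B by simp
  have \<pi>'_eq: "\<pi>' = \<pi> - (h * f1 + e * F1) * \<xi> - e * (F1 * (Y0 * u)) + Y0 * (df - f1 * (h * u))"
    by (simp add: \<pi>'_def \<pi>_def \<xi>_def dp' algebra_simps)
  have b1: "\<bar>(h * f1 + e * F1) * \<xi>\<bar> \<le> B * (h + \<bar>e\<bar>) * \<bar>\<xi>\<bar>"
  proof -
    have "\<bar>h * f1 + e * F1\<bar> \<le> \<bar>h * f1\<bar> + \<bar>e * F1\<bar>" by (rule abs_triangle_ineq)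
    also have "\<dots> \<le> h * B + \<bar>e\<bar> * B"
      unfolding abs_mult using h bd by (intro add_mono mult_mono) auto
    finally have "\<bar>h * f1 + e * F1\<bar> \<le> B * (h + \<bar>e\<bar>)" by (simp add: algebra_simps)
    then show ?thesis unfolding abs_mult by (intro mult_right_mono) auto
  qed
  have b2: "\<bar>e * (F1 * (Y0 * u))\<bar> \<le> B^3 * \<bar>e\<bar>"
  proof -
    have "\<bar>e * (F1 * (Y0 * u))\<bar> \<le> \<bar>e\<bar> * (B * (B * B))"
      unfolding abs_mult using bd B0 by (intro mult_mono) auto
    then show ?thesis by (simp add: power3_eq_cube algebra_simps)
  qed
  have b3: "\<bar>Y0 * (df - f1 * (h * u))\<bar> \<le> B * (\<eta> * h + C * \<bar>e\<bar>)"
    unfolding abs_mult using bd err B0 by (intro mult_mono) auto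
  have \<pi>'_le: "\<bar>\<pi>'\<bar> \<le> \<bar>\<pi>\<bar> + B * (h + \<bar>e\<bar>) * \<bar>\<xi>\<bar> + X"
    unfolding \<pi>'_eq X_def using b1 b2 b3 by linarith
  have \<xi>'_eq: "dq' - Y0 * (u - h * f0 - e * F0) = \<xi> + h * \<pi>' - Y0 * (h * df) + Y0 * (e * F0)"
    by (simp add: \<pi>'_def \<xi>_def dq' algebra_simps)
  have b4: "\<bar>Y0 * (e * F0)\<bar> \<le> B\<^sup>2 * \<bar>e\<bar>"
  proof -
    have "\<bar>Y0 * (e * F0)\<bar> \<le> B * (\<bar>e\<bar> * B)"
      unfolding abs_mult using bd B0 by (intro mult_mono) auto
    then show ?thesis by (simp add: power2_eq_square algebra_simps)
  qed
  \<comment> \<open>Here the second-order term \<open>h * h\<close> is absorbed into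
    \<open>\<eta> * h\<close> by the assumption \<open>h \<le> \<eta>\<close>.\<close>
  have b5: "\<bar>Y0 * (h * df)\<bar> \<le> B^3 * (\<eta> * h) + B * (\<eta> * h) + B * C * \<bar>e\<bar>"
  proof -
    have "\<bar>f1 * (h * u)\<bar> \<le> B * (h * B)"
      unfolding abs_mult using bd B0 h by (intro mult_mono) auto
    then have "\<bar>df\<bar> \<le> B * (h * B) + \<eta> * h + C * \<bar>e\<bar>" using err by linarith
    then have "\<bar>h * df\<bar> \<le> h * (B * (h * B) + \<eta> * h + C * \<bar>e\<bar>)"
      unfolding abs_mult using h by (intro mult_mono) auto
    also have "\<dots> = B\<^sup>2 * (h * h) + h * (\<eta> * h) + h * (C * \<bar>e\<bar>)"
      by (simp add: power2_eq_square algebra_simps)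
    also have "\<dots> \<le> B\<^sup>2 * (\<eta> * h) + 1 * (\<eta> * h) + 1 * (C * \<bar>e\<bar>)"
      using h \<eta> C by (intro add_mono mult_left_mono mult_right_mono) auto
    finally have "\<bar>h * df\<bar> \<le> B\<^sup>2 * (\<eta> * h) + \<eta> * h + C * \<bar>e\<bar>" by simp
    then have "\<bar>Y0 * (h * df)\<bar> \<le> B * (B\<^sup>2 * (\<eta> * h) + \<eta> * h + C * \<bar>e\<bar>)"
      unfolding abs_mult[of Y0] using bd B0 by (intro mult_mono) auto
    then show ?thesis by (simp add: power2_eq_square power3_eq_cube algebra_simps)
  qed
  have X0: "X \<ge> 0" using B0 C h \<eta> by (simp add: X_def)
  have "\<bar>h * \<pi>'\<bar> \<le> h * (\<bar>\<pi>\<bar> + B * (h + \<bar>e\<bar>) * \<bar>\<xi>\<bar> + X)"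
    unfolding abs_mult using h \<pi>'_le by (intro mult_mono) auto
  also have "\<dots> = h * \<bar>\<pi>\<bar> + h * (B * (h + \<bar>e\<bar>) * \<bar>\<xi>\<bar> + X)" by (simp add: algebra_simps)
  also have "\<dots> \<le> (B * h) * \<bar>\<pi>\<bar> + 1 * (B * (h + \<bar>e\<bar>) * \<bar>\<xi>\<bar> + X)"
    using h B X0 mult_right_mono[of 1 B h] by (intro add_mono mult_right_mono) auto
  finally have h\<pi>': "\<bar>h * \<pi>'\<bar> \<le> B * h * \<bar>\<pi>\<bar> + B * (h + \<bar>e\<bar>) * \<bar>\<xi>\<bar> + X" by simp
  \<comment> \<open>\<open>X\<close> appears twice because the new momentum deviation also enters
    the new position, with the factor \<open>h \<le> 1\<close>.\<close>
  have "\<bar>dq' - Y0 * (u - h * f0 - e * F0)\<bar> + \<bar>\<pi>'\<bar>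
      \<le> \<bar>\<xi>\<bar> + \<bar>\<pi>\<bar> + B * h * \<bar>\<pi>\<bar> + 2 * (B * (h + \<bar>e\<bar>) * \<bar>\<xi>\<bar>) + 2 * X
        + (B^3 * (\<eta> * h) + B * (\<eta> * h) + B * C * \<bar>e\<bar>) + B\<^sup>2 * \<bar>e\<bar>"
    unfolding \<xi>'_eq using h\<pi>' \<pi>'_le b4 b5 by linarith
  also have "\<dots> \<le> (1 + 2 * B * (h + \<bar>e\<bar>)) * (\<bar>\<xi>\<bar> + \<bar>\<pi>\<bar>)
       + (3 * B^3 + 3 * B + 3 * B * C + B\<^sup>2) * (\<eta> * h + \<bar>e\<bar>)"
  proof -
    have "0 \<le> (B * h + 2 * B * \<bar>e\<bar>) * \<bar>\<pi>\<bar>" using B0 h by simp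
    moreover have "0 \<le> 2 * B^3 * (\<eta> * h) + 3 * (B * C) * (\<eta> * h) + B\<^sup>2 * (\<eta> * h) + B^3 * \<bar>e\<bar> + 3 * B * \<bar>e\<bar>"
      using B0 h \<eta> C by (intro add_nonneg_nonneg mult_nonneg_nonneg) auto
    ultimately show ?thesis by (simp add: X_def algebra_simps)
  qed
  finally show ?thesis by (simp add: \<pi>'_def \<xi>_def \<pi>_def)
qed

text \<open>Supplies a positive constant that satisfies finitely many smallness conditions at
  once.\<close>

lemma pos_lower_bound:
  "\<forall>x\<in>set xs. x > 0 \<Longrightarrow> \<exists>m>0::real. \<forall>x\<in>set xs. m \<le> x"
proof (induction xs)
  case Nil then show ?case by (intro exI[of _ 1]) auto
next
  case (Cons y xs)
  then obtain m where "m > 0" "\<forall>x\<in>set xs. m \<le> x" by auto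
  then show ?case using Cons by (intro exI[of _ "min m y"]) auto
qed

lemma signed_integral_bound:
  assumes "continuous_on UNIV k" "\<And>s. \<bar>k s\<bar> \<le> B"
  shows "\<bar>signed_integral k t\<bar> \<le> B * \<bar>t\<bar>"
proof -
  have "\<bar>integral {x..y} k\<bar> \<le> B * (y - x)" if "x \<le> y" for x y
    using integral_bound[of x y k B] that assms continuous_on_subset[OF assms(1)] by auto
  from this[of 0 t] this[of t 0] show ?thesis
    by (cases "t \<ge> 0") (auto simp: signed_integral_nonneg, auto simp: signed_integral_def)
qed

section \<open>A quantitative twist condition\<close>

context potential_well
begin

lemma polar_bounds:
  assumes "0 < \<rho>" "\<rho> < R"
  obtains Ym YM ZM where "0 < Ym" "\<And>y. \<bar>y\<bar> \<le> \<rho> \<Longrightarrow> Ym \<le> Y y \<and> Y y \<le> YM \<and> \<bar>Z y\<bar> \<le> ZM"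
proof -
  have ne: "{-\<rho>..\<rho>} \<noteq> {}" using assms by simp
  have cY: "continuous_on {-\<rho>..\<rho>} Y" and cZ: "continuous_on {-\<rho>..\<rho>} (\<lambda>y. \<bar>Z y\<bar>)"
    using assms by (auto intro!: continuous_at_imp_continuous_on Y_isCont Z_isCont continuous_intros)
  obtain y1 where y1: "y1 \<in> {-\<rho>..\<rho>}" "\<And>y. y \<in> {-\<rho>..\<rho>} \<Longrightarrow> Y y1 \<le> Y y"
    using continuous_attains_inf[OF compact_Icc ne cY] by blast
  obtain y2 where y2: "\<And>y. y \<in> {-\<rho>..\<rho>} \<Longrightarrow> Y y \<le> Y y2"
    using continuous_attains_sup[OF compact_Icc ne cY] by blast
  obtain y3 where y3: "\<And>y. y \<in> {-\<rho>..\<rho>} \<Longrightarrow> \<bar>Z y\<bar> \<le> \<bar>Z y3\<bar>"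
    using continuous_attains_sup[OF compact_Icc ne cZ] by blast
  have "Y y1 > 0" using y1 assms by (intro Y_pos) auto
  then show ?thesis using that[of "Y y1" "Y y2" "\<bar>Z y3\<bar>"] y1(2) y2 y3 by (simp add: abs_le_iff)
qed

text \<open>If the displacement were exactly \<open>Y y0\<close> times the vector field, the radius
  would not change and the angle would move by \<open>Y y0 / Y y > 0\<close>, so the angle variable
  would grow by \<open>Y y0 / T r\<close>. The margin \<open>\<kappa>\<close> keeps the sign under
  perturbation. The bound \<open>tm\<close> on the angle is needed because
  \<open>\<Theta>\<^sub>r\<close> grows with it.\<close>

lemma twist_pos:
  assumes \<rho>: "0 < \<rho>\<^sub>1" "\<rho>\<^sub>1 \<le> \<rho>\<^sub>2" "\<rho>\<^sub>2 < R" and tm: "tm \<ge> 0"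
  shows "\<exists>\<kappa>>0. \<forall>r t Dr Dt dq dp y0. \<rho>\<^sub>1 \<le> r \<longrightarrow> r \<le> \<rho>\<^sub>2 \<longrightarrow> \<bar>t\<bar> \<le> tm \<longrightarrow> \<bar>y0\<bar> \<le> \<rho>\<^sub>2 \<longrightarrow>
     dp = cos t * Dr - r * sin t * Dt \<longrightarrow> yc' (Q (r * sin t)) * dq = sin t * Dr + r * cos t * Dt \<longrightarrow>
     \<bar>dq - Y y0 * (r * cos t)\<bar> + \<bar>dp + Y y0 * f (Q (r * sin t))\<bar> \<le> \<kappa> \<longrightarrow>
     \<Theta>\<^sub>r r t * Dr + Y (r * sin t) / T r * Dt > 0"
proof -
  have \<rho>2: "0 < \<rho>\<^sub>2" using \<rho> by linarith
  obtain Ym YM ZM where Ym: "0 < Ym"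
    and bd: "\<And>y. \<bar>y\<bar> \<le> \<rho>\<^sub>2 \<Longrightarrow> Ym \<le> Y y \<and> Y y \<le> YM \<and> \<bar>Z y\<bar> \<le> ZM"
    using polar_bounds[OF \<rho>2 \<rho>(3)] by metis
  have YM: "YM > 0" using bd[of 0] \<rho>2 Ym by simp
  have ZM: "ZM \<ge> 0" using bd[of 0] \<rho>2 by (auto intro: order_trans[OF abs_ge_zero])
  define Bt where "Bt = ZM / \<rho>\<^sub>1 * tm / (2 * pi * Ym) + YM * tm * (ZM / \<rho>\<^sub>1 * (2 * pi)) / (2 * pi * Ym)\<^sup>2"
  have Bt: "Bt \<ge> 0" using ZM YM Ym tm \<rho> by (simp add: Bt_def)
  have sin_le: "\<bar>r * sin t\<bar> \<le> \<rho>\<^sub>2" if "\<rho>\<^sub>1 \<le> r" "r \<le> \<rho>\<^sub>2" for r t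
    using polar_le[of r t] that \<rho> by linarith
  have Tb: "2 * pi * Ym \<le> T r \<and> T r \<le> 2 * pi * YM" if r: "\<rho>\<^sub>1 \<le> r" "r \<le> \<rho>\<^sub>2" for r
  proof -
    have rR: "0 < r" "r < R" using r \<rho> by linarith+
    obtain z where "T r = 2 * pi * Y (r * sin z)"
      using MVT2[of 0 "2 * pi" "\<tau> r" "\<lambda>t. Y (r * sin t)"] \<tau>_deriv[OF rR] by (auto simp: T_def)
    then show ?thesis using bd[OF sin_le[OF r, of z]] by simp
  qed
  have \<tau>b: "\<bar>\<tau> r t\<bar> \<le> YM * \<bar>t\<bar>" if r: "\<rho>\<^sub>1 \<le> r" "r \<le> \<rho>\<^sub>2" for r t
  proof -
    have rR: "0 < r" "r < R" using r \<rho> by linarith+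
    have "\<bar>Y (r * sin s)\<bar> \<le> YM" for s using bd[OF sin_le[OF r, of s]] Ym by simp
    then show ?thesis unfolding \<tau>_def by (intro signed_integral_bound polar_cont_snd Y_isCont rR) auto
  qed
  have \<tau>rb: "\<bar>\<tau>\<^sub>r r t\<bar> \<le> ZM / \<rho>\<^sub>1 * \<bar>t\<bar>" if r: "\<rho>\<^sub>1 \<le> r" "r \<le> \<rho>\<^sub>2" for r t
  proof -
    have rR: "0 < r" "r < R" using r \<rho> by linarith+
    have "\<bar>Z (r * sin s) / r\<bar> \<le> ZM / \<rho>\<^sub>1" for s
      unfolding abs_divide using bd[OF sin_le[OF r, of s]] r \<rho> by (intro frac_le) auto
    then show ?thesis unfolding \<tau>\<^sub>r_def
      by (intro signed_integral_bound continuous_intros polar_cont_snd Z_isCont rR) (use rR in auto)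
  qed
  have \<Theta>b: "\<bar>\<Theta>\<^sub>r r t\<bar> \<le> Bt" if r: "\<rho>\<^sub>1 \<le> r" "r \<le> \<rho>\<^sub>2" and t: "\<bar>t\<bar> \<le> tm" for r t
  proof -
    have c: "2 * pi * Ym > 0" using Ym by simp
    have T: "2 * pi * Ym \<le> T r" "T r > 0" using Tb[OF r] c by linarith+
    have Z0: "ZM / \<rho>\<^sub>1 \<ge> 0" using ZM \<rho> by simp
    have a: "\<bar>\<tau>\<^sub>r r t\<bar> \<le> ZM / \<rho>\<^sub>1 * tm" 
      using \<tau>rb[OF r, of t] mult_left_mono[OF t Z0] by linarith
    have b: "\<bar>\<tau> r t\<bar> \<le> YM * tm"
      using \<tau>b[OF r, of t] mult_left_mono[OF t, of YM] YM by linarith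
    have c': "\<bar>\<tau>\<^sub>r r (2 * pi)\<bar> \<le> ZM / \<rho>\<^sub>1 * (2 * pi)" using \<tau>rb[OF r, of "2 * pi"] by simp
    have "\<bar>\<Theta>\<^sub>r r t\<bar> \<le> \<bar>\<tau>\<^sub>r r t / T r\<bar> + \<bar>\<tau> r t * \<tau>\<^sub>r r (2 * pi) / (T r)\<^sup>2\<bar>"
      unfolding \<Theta>\<^sub>r_def by (rule abs_triangle_ineq4)
    also have "\<dots> \<le> Bt" unfolding Bt_def
    proof (rule add_mono)
      show "\<bar>\<tau>\<^sub>r r t / T r\<bar> \<le> ZM / \<rho>\<^sub>1 * tm / (2 * pi * Ym)"
        unfolding abs_divide using a T c Z0 tm by (intro frac_le) auto
      have "\<bar>\<tau> r t * \<tau>\<^sub>r r (2 * pi)\<bar> \<le> YM * tm * (ZM / \<rho>\<^sub>1 * (2 * pi))"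
        unfolding abs_mult[of "\<tau> r t"] using b c' YM tm by (intro mult_mono) auto
      moreover have "(2 * pi * Ym)\<^sup>2 \<le> (T r)\<^sup>2" using T c by (intro power_mono) auto
      ultimately show "\<bar>\<tau> r t * \<tau>\<^sub>r r (2 * pi) / (T r)\<^sup>2\<bar> \<le> YM * tm * (ZM / \<rho>\<^sub>1 * (2 * pi)) / (2 * pi * Ym)\<^sup>2"
        unfolding abs_divide using T c YM tm Z0 by (intro frac_le) (auto simp: zero_less_power)
    qed
    finally show ?thesis .
  qed
  \<comment> \<open>Lower bound for the contribution of \<open>Dt\<close>: the smallest
    \<open>Y / T\<close> times half of the smallest unperturbed angular displacement.\<close>
  define D where "D = Ym / (2 * pi * YM) * (Ym / YM / 2)"
  have D: "D > 0" using Ym YM by (simp add: D_def)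
  \<comment> \<open>Deviations \<open>\<xi>\<close> of \<open>dq\<close> and \<open>\<pi>\<close> of
    \<open>dp\<close> change radius and scaled angle by at most
    \<open>\<bar>\<pi>\<bar> + \<bar>\<xi>\<bar> / Ym\<close>.\<close>
  define K where "K = 1 + 1 / Ym"
  have K: "K > 0" using Ym by (simp add: K_def add_pos_pos)
  \<comment> \<open>The first bound costs at most half of the angular displacement; the second keeps
    the contribution of \<open>Dr\<close>, at most \<open>Bt * \<kappa> * K\<close>, below
    \<open>D\<close>.\<close>
  define \<kappa> where "\<kappa> = min (Ym / YM * \<rho>\<^sub>1 / 2) (D / (2 * (Bt + 1))) / K"
  have \<kappa>: "\<kappa> > 0" using Ym YM \<rho> D Bt K by (simp add: \<kappa>_def)
  have \<kappa>1: "\<kappa> * K \<le> Ym / YM * \<rho>\<^sub>1 / 2" and \<kappa>2: "\<kappa> * K \<le> D / (2 * (Bt + 1))"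
    using K by (auto simp: \<kappa>_def)
  show ?thesis
  proof (intro exI[of _ \<kappa>] conjI allI impI)
    fix r t Dr Dt dq dp y0 :: real
    assume r: "\<rho>\<^sub>1 \<le> r" "r \<le> \<rho>\<^sub>2" and t: "\<bar>t\<bar> \<le> tm" and y0: "\<bar>y0\<bar> \<le> \<rho>\<^sub>2"
      and dp: "dp = cos t * Dr - r * sin t * Dt" and dq: "yc' (Q (r * sin t)) * dq = sin t * Dr + r * cos t * Dt"
      and small: "\<bar>dq - Y y0 * (r * cos t)\<bar> + \<bar>dp + Y y0 * f (Q (r * sin t))\<bar> \<le> \<kappa>"
    have r0: "r > 0" using r \<rho> by linarith
    have yR: "\<bar>r * sin t\<bar> < R" using sin_le[OF r, of t] \<rho> by linarith
    define y where "y = r * sin t"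
    have Yy: "Ym \<le> Y y" "Y y \<le> YM" using bd[OF sin_le[OF r, of t]] by (auto simp: y_def)
    have Y0: "Ym \<le> Y y0" using bd[OF y0] by simp
    have fy: "f (Q y) = y / Y y" using f_Q[OF yR] Yy Ym by (simp add: y_def field_simps)
    define \<xi> \<pi> where "\<xi> = dq - Y y0 * (r * cos t)" and "\<pi> = dp + Y y0 * f (Q y)"
    have sm: "\<bar>\<xi>\<bar> + \<bar>\<pi>\<bar> \<le> \<kappa>" using small by (simp add: \<xi>_def \<pi>_def y_def)
    have one: "(sin t)\<^sup>2 + (cos t)\<^sup>2 = 1" by simp
    have dq': "dq / Y y = sin t * Dr + r * cos t * Dt" using dq by (simp add: Y_def y_def mult.commute)
    have dq_eq: "dq / Y y = Y y0 * (r * cos t) / Y y + \<xi> / Y y" by (simp add: \<xi>_def flip: add_divide_distrib)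
    have dp_eq: "dp = \<pi> - Y y0 * (r * sin t) / Y y" using fy by (simp add: \<pi>_def y_def)
    have "Dr = cos t * dp + sin t * (dq / Y y)"
      unfolding dq' dp using one by algebra
    also have "\<dots> = cos t * \<pi> + sin t * (\<xi> / Y y)" unfolding dq_eq dp_eq by (simp add: algebra_simps)
    finally have Dr: "Dr = cos t * \<pi> + sin t * (\<xi> / Y y)" .
    have "r * Dt = cos t * (dq / Y y) - sin t * dp"
      unfolding dq' dp using one by algebra
    also have "\<dots> = Y y0 * r / Y y * ((sin t)\<^sup>2 + (cos t)\<^sup>2) + (cos t * (\<xi> / Y y) - sin t * \<pi>)"
      unfolding dq_eq dp_eq power2_eq_square
      by (simp add: algebra_simps add_divide_distrib del: sin_cos_squared_add sin_cos_squared_add2 sin_cos_squared_add3)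
    finally have rDt: "r * Dt = Y y0 * r / Y y + (cos t * (\<xi> / Y y) - sin t * \<pi>)" by simp
    have ew: "\<bar>x1 * \<pi>\<bar> + \<bar>x2 * (\<xi> / Y y)\<bar> \<le> \<kappa> * K" if "\<bar>x1\<bar> \<le> 1" "\<bar>x2\<bar> \<le> 1" for x1 x2
    proof -
      have "\<bar>x1 * \<pi>\<bar> \<le> 1 * \<kappa>" unfolding abs_mult using that sm \<kappa> by (intro mult_mono) auto
      moreover have "\<bar>\<xi> / Y y\<bar> \<le> \<kappa> / Ym" unfolding abs_divide using sm Yy Ym \<kappa> by (intro frac_le) auto
      then have "\<bar>x2 * (\<xi> / Y y)\<bar> \<le> 1 * (\<kappa> / Ym)" unfolding abs_mult[of x2] using that by (intro mult_mono) auto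
      ultimately show ?thesis by (simp add: K_def algebra_simps)
    qed
    have Dr_le: "\<bar>Dr\<bar> \<le> \<kappa> * K" using ew[of "cos t" "sin t"] abs_triangle_ineq[of "cos t * \<pi>" "sin t * (\<xi> / Y y)"] by (simp add: Dr)
    have "Ym / YM \<le> Y y0 / Y y" using Y0 Yy Ym by (intro frac_le) auto
    then have "Ym / YM * r \<le> Y y0 / Y y * r" using r0 by (intro mult_right_mono) auto
    moreover have "\<bar>cos t * (\<xi> / Y y) - sin t * \<pi>\<bar> \<le> \<kappa> * K"
      using ew[of "sin t" "cos t"] abs_triangle_ineq4[of "cos t * (\<xi> / Y y)" "sin t * \<pi>"] by simp
    moreover have "Ym / YM * \<rho>\<^sub>1 / 2 \<le> Ym / YM * r / 2" using r Ym YM by (intro divide_right_mono mult_left_mono) auto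
    ultimately have "r * Dt \<ge> Ym / YM * r / 2" using rDt \<kappa>1 by (simp add: abs_le_iff)
    then have "(Ym / YM / 2) * r \<le> Dt * r" by (simp add: mult.commute)
    then have Dt: "Dt \<ge> Ym / YM / 2" using r0 by (rule mult_right_le_imp_le)
    have Tr: "T r > 0" "T r \<le> 2 * pi * YM" using Tb[OF r] Ym pi_gt_zero by (auto intro: less_le_trans[of _ "2 * pi * Ym"])
    have "Ym / (2 * pi * YM) \<le> Y y / T r" using Yy Tr Ym by (intro frac_le) auto
    moreover have "Y y / T r \<ge> 0" using Yy Ym Tr by simp
    ultimately have "D \<le> Y y / T r * Dt" unfolding D_def using Dt Ym YM by (intro mult_mono) auto
    moreover have "\<bar>\<Theta>\<^sub>r r t * Dr\<bar> \<le> Bt * (\<kappa> * K)"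
      unfolding abs_mult using \<Theta>b[OF r t] Dr_le Bt by (intro mult_mono) auto
    moreover have "Bt * (\<kappa> * K) \<le> Bt * (D / (2 * (Bt + 1)))" using \<kappa>2 Bt by (intro mult_left_mono) auto
    moreover have "Bt * (D / (2 * (Bt + 1))) < D"
    proof -
      have "Bt * D \<ge> 0" using Bt D by simp
      then have "Bt * D < D * (2 * (Bt + 1))" using D by (simp add: algebra_simps)
      then show ?thesis using Bt by (simp add: field_simps)
    qed
    ultimately show "\<Theta>\<^sub>r r t * Dr + Y (r * sin t) / T r * Dt > 0"
      unfolding y_def[symmetric] by linarith
  qed (rule \<kappa>)
qed

end

section \<open>Closed discrete orbits, uniformly in the number of steps\<close>

context kicked_well
begin

lemma step_okD:
  assumes "step_ok \<rho>\<^sub>1 \<rho>\<^sub>2 C \<eta> \<delta>" "\<rho>\<^sub>1 \<le> r" "r \<le> \<rho>\<^sub>2" "0 < h" "h < \<delta>" "\<bar>e\<bar> < \<delta>"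
    "q = Q (r * sin t)" "p = r * cos t" "q' = kick_q h e q p" "p' = kick_p h e q p"
  shows "l < q'" "q' < b" "rot_cos t q' p' > 0"
     "\<bar>(p'\<^sup>2 + 2 * V q') - (p\<^sup>2 + 2 * V q)\<bar> \<le> \<eta> * h + C * \<bar>e\<bar>"
     "\<bar>turn t q' p' - h / Y (r * sin t)\<bar> \<le> \<eta> * h + C * \<bar>e\<bar>"
     "\<bar>f q' - f q - f' q * (h * p)\<bar> \<le> \<eta> * h + C * \<bar>e\<bar>"
  using assms unfolding step_ok_def by metis+

lemma time_okD:
  assumes "time_ok \<rho> C \<eta> \<delta>" "\<bar>r - \<rho>\<bar> < \<delta>" "0 < h" "h < \<delta>" "\<bar>e\<bar> < \<delta>"
    "q = Q (r * sin t)" "p = r * cos t" "q' = kick_q h e q p" "p' = kick_p h e q p"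
  shows "\<bar>\<tau> \<rho> (t + turn t q' p') - \<tau> \<rho> t - h\<bar> \<le> \<eta> * h + C * \<bar>e\<bar>"
  using assms unfolding time_ok_def by metis

text \<open>The square of the radius is twice the energy, and its errors over all steps add up to at
  most \<open>\<kappa>\<close>. Hence an orbit cannot leave the annulus on which the step estimates
  hold, which in turn justifies the estimate for the next step.\<close>

lemma orbit_stays:
  assumes ok: "step_ok \<rho>\<^sub>1 \<rho>\<^sub>2 C \<eta> \<delta>" and C: "C \<ge> 0" "\<eta> \<ge> 0" and \<rho>: "0 < \<rho>\<^sub>1" "\<rho>\<^sub>2 < R"
    and h: "0 < h" "h < \<delta>" and e: "\<And>i. i < N \<Longrightarrow> \<bar>e i\<bar> < \<delta>"
    and sum: "(\<Sum>i<N. \<eta> * h + C * \<bar>e i\<bar>) \<le> \<kappa>"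
    and r: "0 < snd x" "\<rho>\<^sub>1\<^sup>2 \<le> (snd x)\<^sup>2 - \<kappa>" "(snd x)\<^sup>2 + \<kappa> \<le> \<rho>\<^sub>2\<^sup>2" "0 < \<rho>\<^sub>2"
  shows "i \<le> N \<Longrightarrow> ps h e i x = rs h e i x * cos (ts h e i x) \<and> qs h e i x = Q (rs h e i x * sin (ts h e i x)) \<and>
     yc (qs h e i x) = rs h e i x * sin (ts h e i x) \<and>
     \<rho>\<^sub>1 \<le> rs h e i x \<and> rs h e i x \<le> \<rho>\<^sub>2 \<and> l < qs h e i x \<and> qs h e i x < b \<and>
     \<bar>(rs h e i x)\<^sup>2 - (snd x)\<^sup>2\<bar> \<le> (\<Sum>k<i. \<eta> * h + C * \<bar>e k\<bar>)"
proof (induction i)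
  case 0
  have \<kappa>: "\<kappa> \<ge> 0"
  proof -
    have "0 \<le> (\<Sum>i<N. \<eta> * h + C * \<bar>e i\<bar>)" using C h by (intro sum_nonneg) auto
    then show ?thesis using sum by linarith
  qed
  have "\<rho>\<^sub>1\<^sup>2 \<le> (snd x)\<^sup>2" "(snd x)\<^sup>2 \<le> \<rho>\<^sub>2\<^sup>2" using r \<kappa> by linarith+
  then have rx: "\<rho>\<^sub>1 \<le> snd x" "snd x \<le> \<rho>\<^sub>2"
    using power2_le_imp_le[of \<rho>\<^sub>1 "snd x"] power2_le_imp_le[of "snd x" \<rho>\<^sub>2] r \<rho> by auto
  have y: "\<bar>snd x * sin (fst x)\<bar> < R" by (rule polar_less_R) (use r rx \<rho> in auto)
  have "2 * V (Q (snd x * sin (fst x))) = (snd x * sin (fst x))\<^sup>2"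
    using yc_sq[of "Q (snd x * sin (fst x))"] Q_props[OF y] by simp
  then have "(ps h e 0 x)\<^sup>2 + 2 * V (qs h e 0 x) = (snd x)\<^sup>2 * ((sin (fst x))\<^sup>2 + (cos (fst x))\<^sup>2)"
    unfolding ps_0 qs_0 by (simp only: power_mult_distrib distrib_left add.commute)
  then have "rs h e 0 x = snd x" using r by (simp add: rs_def)
  then show ?case using Q_props[OF y] rx by (simp add: ps_0 qs_0)
next
  case (Suc i)
  then have i: "i < N" and IH: "ps h e i x = rs h e i x * cos (ts h e i x)" "qs h e i x = Q (rs h e i x * sin (ts h e i x))"
     "\<rho>\<^sub>1 \<le> rs h e i x" "rs h e i x \<le> \<rho>\<^sub>2" "l < qs h e i x" "qs h e i x < b"
     "\<bar>(rs h e i x)\<^sup>2 - (snd x)\<^sup>2\<bar> \<le> (\<Sum>k<i. \<eta> * h + C * \<bar>e k\<bar>)" by auto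
  note st = step_okD[OF ok IH(3,4) h e[OF i] IH(2,1) qs_Suc ps_Suc]
  have Vq: "V (qs h e i x) \<ge> 0" "V (qs h e (Suc i) x) \<ge> 0" using V_nonneg IH(5,6) st(1,2) by auto
  have sq: "(rs h e i x)\<^sup>2 = (ps h e i x)\<^sup>2 + 2 * V (qs h e i x)"
    "(rs h e (Suc i) x)\<^sup>2 = (ps h e (Suc i) x)\<^sup>2 + 2 * V (qs h e (Suc i) x)" using Vq by (simp_all add: rs_def)
  have dist: "\<bar>(rs h e (Suc i) x)\<^sup>2 - (snd x)\<^sup>2\<bar> \<le> (\<Sum>k<Suc i. \<eta> * h + C * \<bar>e k\<bar>)"
    using IH(7) st(4) unfolding sq(1)[symmetric] sq(2)[symmetric] by simp
  also have "\<dots> \<le> (\<Sum>k<N. \<eta> * h + C * \<bar>e k\<bar>)"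
    using i C h by (intro sum_mono2) auto
  also note sum
  finally have "\<rho>\<^sub>1\<^sup>2 \<le> (rs h e (Suc i) x)\<^sup>2" "(rs h e (Suc i) x)\<^sup>2 \<le> \<rho>\<^sub>2\<^sup>2" using r by linarith+
  moreover have nn: "rs h e (Suc i) x \<ge> 0" using Vq by (simp add: rs_def)
  ultimately have rx: "\<rho>\<^sub>1 \<le> rs h e (Suc i) x" "rs h e (Suc i) x \<le> \<rho>\<^sub>2"
    using power2_le_imp_le[of \<rho>\<^sub>1 "rs h e (Suc i) x"] power2_le_imp_le[of "rs h e (Suc i) x" \<rho>\<^sub>2] less_imp_le[OF r(4)] by blast+
  have rp: "rs h e (Suc i) x > 0" using rx \<rho> by linarith
  have pol: "ps h e (Suc i) x = rs h e (Suc i) x * cos (ts h e (Suc i) x) \<and> yc (qs h e (Suc i) x) = rs h e (Suc i) x * sin (ts h e (Suc i) x)"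
    using polar_step[OF st(3) st(1,2) _ rp] by (simp add: rs_def)
  have "\<bar>yc (qs h e (Suc i) x)\<bar> < R"
    unfolding pol[THEN conjunct2] by (rule polar_less_R[OF rp]) (use rx \<rho> in linarith)
  from Q_yc[OF st(1,2) this] have "qs h e (Suc i) x = Q (rs h e (Suc i) x * sin (ts h e (Suc i) x))"
    unfolding pol[THEN conjunct2] by (rule sym)
  then show ?case using pol rx st(1,2) dist by blast
qed

text \<open>The bound \<open>\<epsilon>\<close> on the kicks is fixed before the number of steps and
  the kicks themselves. The bound 1/2 on the angular increments is what later carries the winding
  number through the limit.\<close>

lemma discrete_orbits:
  assumes r12: "0 < r\<^sub>1" "r\<^sub>1 < r\<^sub>2" "r\<^sub>2 < R" and L: "L > 0"
    and T1: "real j * T r\<^sub>1 < L" and T2: "L < real j * T r\<^sub>2"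
  shows "\<exists>\<rho>\<^sub>1 \<rho>\<^sub>2 \<epsilon> N\<^sub>0. 0 < \<rho>\<^sub>1 \<and> \<rho>\<^sub>1 \<le> \<rho>\<^sub>2 \<and> \<rho>\<^sub>2 < R \<and> 0 < \<epsilon> \<and> (\<forall>N e. N\<^sub>0 \<le> N \<longrightarrow> (\<Sum>i<N. \<bar>e i\<bar>) \<le> \<epsilon> \<longrightarrow>
     N > 0 \<and> (\<exists>q p r t. (\<forall>i<N. p (Suc i) = kick_p (L / real N) (e i) (q i) (p i) \<and> q (Suc i) = q i + L / real N * p (Suc i)
          \<and> \<bar>t (Suc i) - t i\<bar> < 1/2) \<and>
       (\<forall>i\<le>N. \<rho>\<^sub>1 \<le> r i \<and> r i \<le> \<rho>\<^sub>2 \<and> p i = r i * cos (t i) \<and> q i = Q (r i * sin (t i))) \<and>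
       q N = q 0 \<and> p N = p 0 \<and> t N = t 0 + 2 * pi * real j))"
proof -
  \<comment> \<open>Nested annuli: \<open>W\<close> is maximised over \<open>r\<^sub>1\<close> to
    \<open>r\<^sub>2\<close>, orbits may start between \<open>u\<^sub>1\<close> and
    \<open>u\<^sub>2\<close>, and they remain between \<open>\<rho>\<^sub>1\<close> and
    \<open>\<rho>\<^sub>2\<close>.\<close>
  define \<rho>\<^sub>1 \<rho>\<^sub>2 u\<^sub>1 u\<^sub>2 where "\<rho>\<^sub>1 = r\<^sub>1 / 2" and "\<rho>\<^sub>2 = (r\<^sub>2 + R) / 2" and "u\<^sub>1 = 3 * r\<^sub>1 / 4" and "u\<^sub>2 = (3 * r\<^sub>2 + R) / 4"
  have \<rho>: "0 < \<rho>\<^sub>1" "\<rho>\<^sub>1 < u\<^sub>1" "u\<^sub>1 < r\<^sub>1" "r\<^sub>2 < u\<^sub>2" "u\<^sub>2 < \<rho>\<^sub>2" "\<rho>\<^sub>2 < R" "\<rho>\<^sub>1 \<le> \<rho>\<^sub>2" "0 < \<rho>\<^sub>2"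
    using r12 by (auto simp: \<rho>\<^sub>1_def \<rho>\<^sub>2_def u\<^sub>1_def u\<^sub>2_def)
  obtain C where C: "C \<ge> 0" "\<And>\<eta>. \<eta> > 0 \<Longrightarrow> \<exists>\<delta>>0. step_ok \<rho>\<^sub>1 \<rho>\<^sub>2 C \<eta> \<delta>"
    using step_bounds[OF \<rho>(1,7,6)] by blast
  obtain Ca where Ca: "Ca \<ge> 0" "\<And>\<eta>. \<eta> > 0 \<Longrightarrow> \<exists>\<delta>>0. time_ok r\<^sub>1 Ca \<eta> \<delta>"
    using step_time[of r\<^sub>1] r12 by force
  obtain Cb where Cb: "Cb \<ge> 0" "\<And>\<eta>. \<eta> > 0 \<Longrightarrow> \<exists>\<delta>>0. time_ok r\<^sub>2 Cb \<eta> \<delta>"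
    using step_time[of r\<^sub>2] r12 by force
  obtain Ym YM ZM where Ym: "0 < Ym" and Yb: "\<And>y. \<bar>y\<bar> \<le> \<rho>\<^sub>2 \<Longrightarrow> Ym \<le> Y y \<and> Y y \<le> YM \<and> \<bar>Z y\<bar> \<le> ZM"
    using polar_bounds[OF \<rho>(8,6)] by metis
  \<comment> \<open>A bound for the final angle: at most \<open>2 * pi\<close> at the start, at most
    \<open>L / Ym\<close> of unperturbed rotation, and accumulated errors below 2.\<close>
  define tm where "tm = 2 * pi + L / Ym + 2"
  have tm: "tm \<ge> 0" using L Ym by (simp add: tm_def)
  obtain \<kappa>' where \<kappa>': "\<kappa>' > 0" and twist: "\<And>r t Dr Dt dq dp y0. \<rho>\<^sub>1 \<le> r \<Longrightarrow> r \<le> \<rho>\<^sub>2 \<Longrightarrow> \<bar>t\<bar> \<le> tm \<Longrightarrow> \<bar>y0\<bar> \<le> \<rho>\<^sub>2 \<Longrightarrow>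
     dp = cos t * Dr - r * sin t * Dt \<Longrightarrow> yc' (Q (r * sin t)) * dq = sin t * Dr + r * cos t * Dt \<Longrightarrow>
     \<bar>dq - Y y0 * (r * cos t)\<bar> + \<bar>dp + Y y0 * f (Q (r * sin t))\<bar> \<le> \<kappa>' \<Longrightarrow>
     \<Theta>\<^sub>r r t * Dr + Y (r * sin t) / T r * Dt > 0"
    using twist_pos[OF \<rho>(1,7,6) tm] by meson
  have Q_in: "Q y \<in> {l..b}" if "\<bar>y\<bar> \<le> \<rho>\<^sub>2" for y using Q_props[of y] that \<rho> by simp
  obtain B where B: "B \<ge> 1" "YM \<le> B" "\<rho>\<^sub>2 \<le> B" "\<And>q. q \<in> {l..b} \<Longrightarrow> \<bar>f' q\<bar> \<le> B \<and> \<bar>F' q\<bar> \<le> B \<and> \<bar>F q\<bar> \<le> B"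
  proof -
    have bounded: "\<exists>K. \<forall>q\<in>{l..b}. \<bar>k q\<bar> \<le> K" if "continuous_on UNIV k" for k :: "real \<Rightarrow> real"
    proof -
      have "compact (k ` {l..b})" by (intro compact_continuous_image continuous_on_subset[OF that]) auto
      then show ?thesis using compact_imp_bounded bounded_iff by (metis imageI real_norm_def)
    qed
    obtain B1 B2 B3 where "\<forall>q\<in>{l..b}. \<bar>f' q\<bar> \<le> B1" "\<forall>q\<in>{l..b}. \<bar>F' q\<bar> \<le> B2" "\<forall>q\<in>{l..b}. \<bar>F q\<bar> \<le> B3"
      using bounded[OF f'_cont] bounded[OF F'_cont] bounded[OF F_cont] by blast
    then show ?thesis
      by (intro that[of "Max {1, YM, \<rho>\<^sub>2, B1, B2, B3}"]) (auto simp: le_max_iff_disj)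
  qed
  define G where "G = 3 * B^3 + 3 * B + 3 * B * C + B\<^sup>2"
  have G: "G > 0"
  proof -
    have "3 * B^3 > 0" "3 * B > 0" "3 * B * C \<ge> 0" "B\<^sup>2 > 0" using B(1) C(1) by auto
    then show ?thesis unfolding G_def by linarith
  qed
  \<comment> \<open>The Gronwall factor: the growth rates
    \<open>2 * B * (h + \<bar>e i\<bar>)\<close> sum to at most \<open>2 * B * (L + 1)\<close>
    because \<open>\<epsilon> \<le> 1\<close>.\<close>
  define EE where "EE = exp (2 * B * (L + 1))"
  have EE: "EE > 0" by (simp add: EE_def)
  define gap where "gap = min (L - real j * T r\<^sub>1) (real j * T r\<^sub>2 - L)"
  have gap: "gap > 0" "gap \<le> L - real j * T r\<^sub>1" "gap \<le> real j * T r\<^sub>2 - L" using T1 T2 by (auto simp: gap_def)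
  \<comment> \<open>The travel time then errs by at most \<open>gap / 4\<close> from the
    discretization and \<open>gap / 4\<close> from the kicks, which leaves the strict inequalities
    for the periods intact.\<close>
  define \<eta>t where "\<eta>t = gap / (4 * L)"
  have \<eta>t: "\<eta>t > 0" "\<eta>t * L = gap / 4" using gap L by (auto simp: \<eta>t_def)
  obtain \<delta>a where \<delta>a: "\<delta>a > 0" "time_ok r\<^sub>1 Ca \<eta>t \<delta>a" using Ca(2)[OF \<eta>t(1)] by blast
  obtain \<delta>b where \<delta>b: "\<delta>b > 0" "time_ok r\<^sub>2 Cb \<eta>t \<delta>b" using Cb(2)[OF \<eta>t(1)] by blast
  have sq: "\<rho>\<^sub>1\<^sup>2 < u\<^sub>1\<^sup>2" "u\<^sub>2\<^sup>2 < \<rho>\<^sub>2\<^sup>2" using \<rho> r12 by (auto intro!: power_strict_mono)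
  \<comment> \<open>The permitted drift of the squared radius: it fits between the nested annuli and
    keeps orbits from the boundary circles within the range of \<open>time_ok\<close>.\<close>
  obtain \<kappa> where \<kappa>: "\<kappa> > 0" "\<kappa> \<le> u\<^sub>1\<^sup>2 - \<rho>\<^sub>1\<^sup>2" "\<kappa> \<le> \<rho>\<^sub>2\<^sup>2 - u\<^sub>2\<^sup>2" "\<kappa> \<le> r\<^sub>1 * \<delta>a / 2" "\<kappa> \<le> r\<^sub>2 * \<delta>b / 2"
    using pos_lower_bound[of "[u\<^sub>1\<^sup>2 - \<rho>\<^sub>1\<^sup>2, \<rho>\<^sub>2\<^sup>2 - u\<^sub>2\<^sup>2, r\<^sub>1 * \<delta>a / 2, r\<^sub>2 * \<delta>b / 2]"] sq \<delta>a \<delta>b r12 by auto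
  \<comment> \<open>Half of each error budget, the drift \<open>\<kappa>\<close> and the twist
    margin \<open>\<kappa>'\<close>, goes to the discretization error; the other half is reserved
    for the kicks in the choice of \<open>\<epsilon>\<close>.\<close>
  obtain \<eta> where \<eta>: "\<eta> > 0" "\<eta> \<le> \<kappa> / (2 * L)" "\<eta> \<le> 1 / L" "\<eta> \<le> \<kappa>' / (2 * L * G * EE)" "\<eta> \<le> 1"
    using pos_lower_bound[of "[\<kappa> / (2 * L), 1 / L, \<kappa>' / (2 * L * G * EE), 1]"] \<kappa> \<kappa>' L G EE by auto
  obtain \<delta> where \<delta>: "\<delta> > 0" "step_ok \<rho>\<^sub>1 \<rho>\<^sub>2 C \<eta> \<delta>" using C(2)[OF \<eta>(1)] by blast
  obtain \<epsilon> where \<epsilon>: "\<epsilon> > 0" "\<epsilon> \<le> \<kappa> / (2 * (C + 1))" "\<epsilon> \<le> 1 / (4 * (C + 1))" "\<epsilon> \<le> gap / (4 * (Ca + 1))" "\<epsilon> \<le> gap / (4 * (Cb + 1))"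
    "\<epsilon> \<le> \<delta> / 2" "\<epsilon> \<le> \<delta>a / 2" "\<epsilon> \<le> \<delta>b / 2" "\<epsilon> \<le> \<kappa>' / (2 * G * EE)" "\<epsilon> \<le> 1"
    using pos_lower_bound[of "[\<kappa> / (2 * (C + 1)), 1 / (4 * (C + 1)), gap / (4 * (Ca + 1)), gap / (4 * (Cb + 1)),
       \<delta> / 2, \<delta>a / 2, \<delta>b / 2, \<kappa>' / (2 * G * EE), 1]"] \<kappa> \<kappa>' G EE gap C(1) Ca(1) Cb(1) \<delta> \<delta>a \<delta>b by auto
  \<comment> \<open>The bound on the step length; \<open>Ym / 8\<close> keeps the unperturbed
    rotation per step below 1/8.\<close>
  obtain \<mu> where \<mu>: "\<mu> > 0" "\<mu> \<le> \<delta>" "\<mu> \<le> \<delta>a" "\<mu> \<le> \<delta>b" "\<mu> \<le> 1/8" "\<mu> \<le> \<eta>" "\<mu> \<le> Ym / 8"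
    using pos_lower_bound[of "[\<delta>, \<delta>a, \<delta>b, 1/8, \<eta>, Ym / 8]"] \<delta> \<delta>a \<delta>b \<eta> Ym by auto
  have C\<epsilon>: "C * \<epsilon> \<le> \<kappa> / 2" "C * \<epsilon> \<le> 1/4" "Ca * \<epsilon> \<le> gap / 4" "Cb * \<epsilon> \<le> gap / 4"
  proof -
    have aux: "K * \<epsilon> \<le> z / s" if "\<epsilon> \<le> z / (s * (K + 1))" "K \<ge> 0" "s > 0" for K z s
    proof -
      have "K * \<epsilon> \<le> (K + 1) * \<epsilon>" using \<epsilon>(1) by simp
      also have "\<dots> \<le> (K + 1) * (z / (s * (K + 1)))" using that by (intro mult_left_mono) auto
      also have "\<dots> = z / s"
      proof -
        have "k * (z / (s * k)) = z / s" if "k > 0" for k using that by simp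
        from this[of "K + 1"] show ?thesis using \<open>K \<ge> 0\<close> by simp
      qed
      finally show ?thesis .
    qed
    show "C * \<epsilon> \<le> \<kappa> / 2" "C * \<epsilon> \<le> 1/4" "Ca * \<epsilon> \<le> gap / 4" "Cb * \<epsilon> \<le> gap / 4"
      using aux[OF \<epsilon>(2) C(1)] aux[OF \<epsilon>(3) C(1)] aux[OF \<epsilon>(4) Ca(1)] aux[OF \<epsilon>(5) Cb(1)] by auto
  qed
  have \<eta>L: "\<eta> * L \<le> \<kappa> / 2" "\<eta> * L \<le> 1" using \<eta> L by (auto simp: field_simps)
  have G_small: "EE * (G * (\<eta> * L + \<epsilon>)) \<le> \<kappa>'"
  proof -
    have "G * EE * (\<eta> * L) \<le> \<kappa>' / 2" using \<eta>(4) L G EE by (simp add: field_simps)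
    moreover have "G * EE * \<epsilon> \<le> \<kappa>' / 2" using \<epsilon>(9) G EE by (simp add: field_simps)
    ultimately show ?thesis by (simp add: algebra_simps)
  qed
  obtain N\<^sub>0 :: nat where N\<^sub>0: "L / \<mu> < real N\<^sub>0" using reals_Archimedean2 by blast
  have main: "N > 0 \<and> (\<exists>q p r t. (\<forall>i<N. p (Suc i) = kick_p (L / real N) (e i) (q i) (p i) \<and> q (Suc i) = q i + L / real N * p (Suc i)
          \<and> \<bar>t (Suc i) - t i\<bar> < 1/2) \<and>
       (\<forall>i\<le>N. \<rho>\<^sub>1 \<le> r i \<and> r i \<le> \<rho>\<^sub>2 \<and> p i = r i * cos (t i) \<and> q i = Q (r i * sin (t i))) \<and>
       q N = q 0 \<and> p N = p 0 \<and> t N = t 0 + 2 * pi * real j)"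
    if N: "N\<^sub>0 \<le> N" and e: "(\<Sum>i<N. \<bar>e i\<bar>) \<le> \<epsilon>" for N e
  proof -
    define h where "h = L / real N"
    have "L / \<mu> > 0" using L \<mu> by simp
    then have N0: "real N > 0" using N\<^sub>0 N by linarith
    have "L / \<mu> < real N" using N\<^sub>0 N by linarith
    then have h: "h > 0" "h < \<mu>" using L N0 \<mu>(1) by (auto simp: h_def field_simps)
    have Nh: "real N * h = L" using N0 by (simp add: h_def)
    have ei: "\<bar>e i\<bar> \<le> \<epsilon>" if "i < N" for i
      using member_le_sum[of i "{..<N}" "\<lambda>i. \<bar>e i\<bar>"] that e by simp
    have e\<delta>: "\<bar>e i\<bar> < \<delta>" "\<bar>e i\<bar> < \<delta>a" "\<bar>e i\<bar> < \<delta>b" if "i < N" for i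
      using ei[OF that] \<epsilon> \<delta> \<delta>a \<delta>b by linarith+
    have sum_eq: "(\<Sum>i<N. a * h + K * \<bar>e i\<bar>) \<le> a * L + K * \<epsilon>" if "K \<ge> 0" for a K
    proof -
      have "(\<Sum>i<N. a * h + K * \<bar>e i\<bar>) = a * (real N * h) + K * (\<Sum>i<N. \<bar>e i\<bar>)"
        by (simp add: sum.distrib sum_distrib_left algebra_simps)
      then show ?thesis using e that by (simp add: Nh mult_left_mono)
    qed
    have sum\<kappa>: "(\<Sum>i<N. \<eta> * h + C * \<bar>e i\<bar>) \<le> \<kappa>"
      using sum_eq[OF C(1), of \<eta>] \<eta>L C\<epsilon> by linarith
    have stays: "ps h e i x = rs h e i x * cos (ts h e i x) \<and> qs h e i x = Q (rs h e i x * sin (ts h e i x)) \<and>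
     yc (qs h e i x) = rs h e i x * sin (ts h e i x) \<and>
     \<rho>\<^sub>1 \<le> rs h e i x \<and> rs h e i x \<le> \<rho>\<^sub>2 \<and> l < qs h e i x \<and> qs h e i x < b \<and>
     \<bar>(rs h e i x)\<^sup>2 - (snd x)\<^sup>2\<bar> \<le> (\<Sum>k<i. \<eta> * h + C * \<bar>e k\<bar>)"
      if x: "u\<^sub>1 < snd x" "snd x < u\<^sub>2" and i: "i \<le> N" for x i
    proof (rule orbit_stays[OF \<delta>(2) C(1) _ \<rho>(1,6) h(1) _ _ sum\<kappa> _ _ _ \<rho>(8) i])
      have "u\<^sub>1\<^sup>2 < (snd x)\<^sup>2" "(snd x)\<^sup>2 < u\<^sub>2\<^sup>2" using x \<rho> by (auto intro!: power_strict_mono)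
      then show "\<rho>\<^sub>1\<^sup>2 \<le> (snd x)\<^sup>2 - \<kappa>" "(snd x)\<^sup>2 + \<kappa> \<le> \<rho>\<^sub>2\<^sup>2" using \<kappa> by linarith+
    qed (use \<eta> h \<mu> x \<rho> e\<delta> in auto)
    have step: "l < qs h e (Suc i) x" "qs h e (Suc i) x < b" "rot_cos (ts h e i x) (qs h e (Suc i) x) (ps h e (Suc i) x) > 0"
     "\<bar>turn (ts h e i x) (qs h e (Suc i) x) (ps h e (Suc i) x) - h / Y (rs h e i x * sin (ts h e i x))\<bar> \<le> \<eta> * h + C * \<bar>e i\<bar>"
     "\<bar>f (qs h e (Suc i) x) - f (qs h e i x) - f' (qs h e i x) * (h * ps h e i x)\<bar> \<le> \<eta> * h + C * \<bar>e i\<bar>"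
      if x: "u\<^sub>1 < snd x" "snd x < u\<^sub>2" and i: "i < N" for x i
    proof -
      have h\<delta>: "h < \<delta>" using h \<mu> by linarith
      from stays[OF x less_imp_le[OF i]] have s: "\<rho>\<^sub>1 \<le> rs h e i x" "rs h e i x \<le> \<rho>\<^sub>2"
        "qs h e i x = Q (rs h e i x * sin (ts h e i x))" "ps h e i x = rs h e i x * cos (ts h e i x)" by auto
      note st = step_okD[OF \<delta>(2) s(1,2) h(1) h\<delta> e\<delta>(1)[OF i] s(3,4) qs_Suc ps_Suc]
      show "l < qs h e (Suc i) x" "qs h e (Suc i) x < b" "rot_cos (ts h e i x) (qs h e (Suc i) x) (ps h e (Suc i) x) > 0"
     "\<bar>turn (ts h e i x) (qs h e (Suc i) x) (ps h e (Suc i) x) - h / Y (rs h e i x * sin (ts h e i x))\<bar> \<le> \<eta> * h + C * \<bar>e i\<bar>"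
     "\<bar>f (qs h e (Suc i) x) - f (qs h e i x) - f' (qs h e i x) * (h * ps h e i x)\<bar> \<le> \<eta> * h + C * \<bar>e i\<bar>"
        using st by auto
    qed
    have turn_le: "\<bar>ts h e (Suc i) x - ts h e i x\<bar> \<le> h / Ym + (\<eta> * h + C * \<bar>e i\<bar>)"
      if x: "u\<^sub>1 < snd x" "snd x < u\<^sub>2" and i: "i < N" for x i
    proof -
      have r: "0 < rs h e i x" "rs h e i x \<le> \<rho>\<^sub>2" using stays[OF x less_imp_le[OF i]] \<rho> by auto
      have "Ym \<le> Y (rs h e i x * sin (ts h e i x))"
        using Yb[of "rs h e i x * sin (ts h e i x)"] polar_le[OF r(1), of "ts h e i x"] r(2) by auto
      then have "\<bar>h / Y (rs h e i x * sin (ts h e i x))\<bar> \<le> h / Ym"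
        unfolding abs_divide using h Ym by (intro frac_le) auto
      then show ?thesis using step(4)[OF x i] unfolding ts.simps(2) by linarith
    qed
    interpret good_orbits f f' V l c b F F' \<Phi> h e N u\<^sub>1 u\<^sub>2
    proof unfold_locales
      show "0 < u\<^sub>1" "u\<^sub>2 < R" using \<rho> by linarith+
      show "l < qs h e i x \<and> qs h e i x < b \<and> 0 < rs h e i x \<and> rs h e i x < R"
        if "u\<^sub>1 < snd x" "snd x < u\<^sub>2" "i \<le> N" for x i
        using stays[OF that] \<rho> by linarith
      show "0 < rot_cos (ts h e i x) (qs h e (Suc i) x) (ps h e (Suc i) x)"
        if "u\<^sub>1 < snd x" "snd x < u\<^sub>2" "i < N" for x i using step(3)[OF that] .
    qed
    have time: "\<bar>\<tau> rr (ts h e N x) - \<tau> rr (fst x) - L\<bar> \<le> \<eta>t * L + K * \<epsilon>"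
      if x: "snd x = rr" "u\<^sub>1 < rr" "rr < u\<^sub>2" and ok: "time_ok rr K \<eta>t \<delta>t" and K: "K \<ge> 0"
        and \<delta>t: "\<kappa> \<le> rr * \<delta>t / 2" "\<delta>t > 0" "h < \<delta>t" "\<And>i. i < N \<Longrightarrow> \<bar>e i\<bar> < \<delta>t" for x rr K \<delta>t
    proof -
      have x': "u\<^sub>1 < snd x" "snd x < u\<^sub>2" using x by auto
      have rs0: "rr > 0" using x \<rho> by linarith
      have st: "\<bar>\<tau> rr (ts h e (Suc i) x) - \<tau> rr (ts h e i x) - h\<bar> \<le> \<eta>t * h + K * \<bar>e i\<bar>" if i: "i < N" for i
      proof -
        from stays[OF x' less_imp_le[OF i]] have s: "\<rho>\<^sub>1 \<le> rs h e i x"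
          "qs h e i x = Q (rs h e i x * sin (ts h e i x))" "ps h e i x = rs h e i x * cos (ts h e i x)"
          "\<bar>(rs h e i x)\<^sup>2 - (snd x)\<^sup>2\<bar> \<le> (\<Sum>k<i. \<eta> * h + C * \<bar>e k\<bar>)" by auto
        note s(4)
        also have "(\<Sum>k<i. \<eta> * h + C * \<bar>e k\<bar>) \<le> (\<Sum>k<N. \<eta> * h + C * \<bar>e k\<bar>)"
          using i C h \<eta> by (intro sum_mono2) auto
        also note sum\<kappa>
        finally have "\<bar>(rs h e i x)\<^sup>2 - rr\<^sup>2\<bar> \<le> \<kappa>" using x by simp
        moreover have "(rs h e i x)\<^sup>2 - rr\<^sup>2 = (rs h e i x - rr) * (rs h e i x + rr)"
          by (simp add: power2_eq_square algebra_simps)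
        \<comment> \<open>Dividing the drift of the squared radius by the sum of the two radii,
          which is at least \<open>rr\<close>, bounds the drift of the radius itself.\<close>
        moreover have "\<bar>rs h e i x - rr\<bar> * rr \<le> \<bar>rs h e i x - rr\<bar> * \<bar>rs h e i x + rr\<bar>"
          using s(1) \<rho> rs0 by (intro mult_left_mono) auto
        ultimately have "\<bar>rs h e i x - rr\<bar> * rr \<le> \<delta>t / 2 * rr" using \<delta>t(1) by (simp add: abs_mult mult.commute)
        then have "\<bar>rs h e i x - rr\<bar> < \<delta>t" using rs0 \<delta>t by simp
        from time_okD[OF ok this h(1) \<delta>t(3) \<delta>t(4)[OF i] s(2,3) qs_Suc ps_Suc] show ?thesis by simp
      qed
      have tel: "(\<Sum>i<N. \<tau> rr (ts h e (Suc i) x) - \<tau> rr (ts h e i x) - h) = \<tau> rr (ts h e N x) - \<tau> rr (fst x) - L"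
        using sum_lessThan_telescope[of "\<lambda>i. \<tau> rr (ts h e i x)" N] by (simp add: sum_subtractf Nh)
      have "\<bar>\<tau> rr (ts h e N x) - \<tau> rr (fst x) - L\<bar> \<le> (\<Sum>i<N. \<bar>\<tau> rr (ts h e (Suc i) x) - \<tau> rr (ts h e i x) - h\<bar>)"
        unfolding tel[symmetric] by (rule sum_abs)
      also have "\<dots> \<le> (\<Sum>i<N. \<eta>t * h + K * \<bar>e i\<bar>)" using st by (intro sum_mono) auto
      also have "\<dots> \<le> \<eta>t * L + K * \<epsilon>" by (rule sum_eq[OF K])
      finally show ?thesis .
    qed
    have inner: "\<tau> r\<^sub>1 (ts h e N x) - \<tau> r\<^sub>1 (fst x) > real j * T r\<^sub>1" if "snd x = r\<^sub>1" for x
    proof -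
      have "\<bar>\<tau> r\<^sub>1 (ts h e N x) - \<tau> r\<^sub>1 (fst x) - L\<bar> \<le> \<eta>t * L + Ca * \<epsilon>"
        by (rule time[OF that _ _ \<delta>a(2) Ca(1) \<kappa>(4) \<delta>a(1)]) (use \<rho> r12 h \<mu> e\<delta> in auto)
      then show ?thesis using \<eta>t(2) C\<epsilon>(3) gap by linarith
    qed
    have outer: "\<tau> r\<^sub>2 (ts h e N x) - \<tau> r\<^sub>2 (fst x) < real j * T r\<^sub>2" if "snd x = r\<^sub>2" for x
    proof -
      have "\<bar>\<tau> r\<^sub>2 (ts h e N x) - \<tau> r\<^sub>2 (fst x) - L\<bar> \<le> \<eta>t * L + Cb * \<epsilon>"
        by (rule time[OF that _ _ \<delta>b(2) Cb(1) \<kappa>(5) \<delta>b(1)]) (use \<rho> r12 h \<mu> e\<delta> in auto)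
      then show ?thesis using \<eta>t(2) C\<epsilon>(4) gap by linarith
    qed
    have tw: "\<Theta>\<^sub>r (rs h e N x) (ts h e N x) * Dr (1, 0) + Y (rs h e N x * sin (ts h e N x)) / T (rs h e N x) * Dt (1, 0) \<noteq> 0"
      if x: "0 \<le> fst x" "fst x \<le> 2 * pi" "r\<^sub>1 \<le> snd x" "snd x \<le> r\<^sub>2"
        and Dr: "(rs h e N has_derivative Dr) (at x)" and Dt: "(ts h e N has_derivative Dt) (at x)" for x Dr Dt
    proof -
      have x': "u\<^sub>1 < snd x" "snd x < u\<^sub>2" using x \<rho> by linarith+
      then have xU: "x \<in> U" by (simp add: in_U)
      define y0 where "y0 = snd x * sin (fst x)"
      have sx: "0 < snd x" "snd x \<le> \<rho>\<^sub>2" using x' \<rho> by linarith+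
      have y0: "\<bar>y0\<bar> \<le> \<rho>\<^sub>2" using polar_le[OF sx(1), of "fst x"] sx by (simp add: y0_def)
      have y0R: "\<bar>y0\<bar> < R" using y0 \<rho> by linarith
      define s where "s i = \<bar>dqs h e i x (1, 0) - Y y0 * ps h e i x\<bar> + \<bar>dps h e i x (1, 0) + Y y0 * f (qs h e i x)\<bar>" for i
      have "s N \<le> exp (\<Sum>i<N. 2 * B * (h + \<bar>e i\<bar>)) * (\<Sum>i<N. G * (\<eta> * h + \<bar>e i\<bar>))"
      proof (rule discrete_gronwall[where N = N])
        \<comment> \<open>At the start the displacement in the angular direction is exactly
          \<open>Y y0\<close> times the vector field, so the Gronwall recursion begins at 0.\<close>
        have "Y y0 * f (Q y0) = y0" by (rule f_Q[OF y0R])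
        then show "s 0 \<le> 0" by (simp add: s_def dqs_def dps_def qs_0 ps_0 y0_def)
        show "s (Suc i) \<le> (1 + 2 * B * (h + \<bar>e i\<bar>)) * s i + G * (\<eta> * h + \<bar>e i\<bar>)" if i: "i < N" for i
        proof -
          from stays[OF x' less_imp_le[OF i]] have si: "\<rho>\<^sub>1 \<le> rs h e i x" "rs h e i x \<le> \<rho>\<^sub>2" "l < qs h e i x" "qs h e i x < b"
            "ps h e i x = rs h e i x * cos (ts h e i x)" by auto
          have "\<bar>ps h e i x\<bar> \<le> rs h e i x" using si \<rho> by (simp add: abs_mult mult_left_le)
          then have pb: "\<bar>ps h e i x\<bar> \<le> B" using si B by linarith
          have qb: "\<bar>f' (qs h e i x)\<bar> \<le> B" "\<bar>F' (qs h e i x)\<bar> \<le> B" "\<bar>F (qs h e i x)\<bar> \<le> B"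
            using B(4)[of "qs h e i x"] si by auto
          have Y0: "0 \<le> Y y0" "Y y0 \<le> B" using Yb[OF y0] Ym B by linarith+
          have hs: "0 \<le> h" "h \<le> 1" "h \<le> \<eta>" using h \<mu> by linarith+
          from variation_step[OF B(1) C(1) hs qb pb Y0 step(5)[OF x' i] dps_Suc dqs_Suc, of "(1, 0)" "f (qs h e i x)"]
          show ?thesis by (simp add: s_def G_def ps_Suc kick_p_def)
        qed
      qed (use B G h \<eta> in auto)
      also have "\<dots> \<le> EE * (G * (\<eta> * L + \<epsilon>))"
      proof (rule mult_mono)
        have "(\<Sum>i<N. 2 * B * (h + \<bar>e i\<bar>)) = (\<Sum>i<N. (2 * B) * h + (2 * B) * \<bar>e i\<bar>)" by (simp add: algebra_simps)
        also have "\<dots> \<le> 2 * B * L + 2 * B * \<epsilon>" using sum_eq[of "2 * B" "2 * B"] B by simp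
        also have "\<dots> \<le> 2 * B * (L + 1)" using \<epsilon>(10) B by (simp add: algebra_simps)
        finally show "exp (\<Sum>i<N. 2 * B * (h + \<bar>e i\<bar>)) \<le> EE" by (simp add: EE_def)
        have "(\<Sum>i<N. \<eta> * h + \<bar>e i\<bar>) \<le> \<eta> * L + \<epsilon>" using sum_eq[of 1 \<eta>] by simp
        then show "(\<Sum>i<N. G * (\<eta> * h + \<bar>e i\<bar>)) \<le> G * (\<eta> * L + \<epsilon>)"
          using G by (simp flip: sum_distrib_left)
        show "0 \<le> (\<Sum>i<N. G * (\<eta> * h + \<bar>e i\<bar>))" using G h \<eta> by (intro sum_nonneg) auto
      qed (use EE in auto)
      also note G_small
      finally have small: "s N \<le> \<kappa>'" .
      from stays[OF x' order_refl] have sN: "\<rho>\<^sub>1 \<le> rs h e N x" "rs h e N x \<le> \<rho>\<^sub>2"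
        "qs h e N x = Q (rs h e N x * sin (ts h e N x))" "ps h e N x = rs h e N x * cos (ts h e N x)" by auto
      have "\<bar>ts h e N x - fst x\<bar> \<le> L / Ym + (\<eta> * L + C * \<epsilon>)"
      proof -
        have "ts h e N x - fst x = (\<Sum>i<N. ts h e (Suc i) x - ts h e i x)"
          using sum_lessThan_telescope[of "\<lambda>i. ts h e i x" N] by simp
        then have "\<bar>ts h e N x - fst x\<bar> \<le> (\<Sum>i<N. \<bar>ts h e (Suc i) x - ts h e i x\<bar>)" by (metis sum_abs)
        also have "\<dots> \<le> (\<Sum>i<N. h / Ym + (\<eta> * h + C * \<bar>e i\<bar>))" using turn_le[OF x'] by (intro sum_mono) auto
        also have "\<dots> = real N * h / Ym + (\<Sum>i<N. \<eta> * h + C * \<bar>e i\<bar>)" by (simp add: sum.distrib)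
        also have "\<dots> \<le> L / Ym + (\<eta> * L + C * \<epsilon>)" using sum_eq[OF C(1), of \<eta>] by (simp add: Nh)
        finally show ?thesis .
      qed
      then have tN: "\<bar>ts h e N x\<bar> \<le> tm" using x(1,2) \<eta>L C\<epsilon> unfolding tm_def by linarith
      have "\<Theta>\<^sub>r (rs h e N x) (ts h e N x) * Dr (1, 0) + Y (rs h e N x * sin (ts h e N x)) / T (rs h e N x) * Dt (1, 0) > 0"
      proof (rule twist[OF sN(1,2) tN y0])
        show "dps h e N x (1, 0) = cos (ts h e N x) * Dr (1, 0) - rs h e N x * sin (ts h e N x) * Dt (1, 0)"
          by (rule polar_derivatives(1)[OF xU order_refl Dr Dt])
        show "yc' (Q (rs h e N x * sin (ts h e N x))) * dqs h e N x (1, 0) = sin (ts h e N x) * Dr (1, 0) + rs h e N x * cos (ts h e N x) * Dt (1, 0)"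
          using polar_derivatives(2)[OF xU order_refl Dr Dt] sN(3) by simp
        show "\<bar>dqs h e N x (1, 0) - Y y0 * (rs h e N x * cos (ts h e N x))\<bar> + \<bar>dps h e N x (1, 0) + Y y0 * f (Q (rs h e N x * sin (ts h e N x)))\<bar> \<le> \<kappa>'"
          using small unfolding s_def sN(3)[symmetric] sN(4)[symmetric] .
      qed
      then show ?thesis by simp
    qed
    obtain x where x: "r\<^sub>1 \<le> snd x" "snd x \<le> r\<^sub>2" "rs h e N x = snd x" "ts h e N x = fst x + 2 * pi * real j"
      using periodic_orbit_exists[OF \<rho>(3) r12(2) \<rho>(4), of j] tw inner outer by blast
    have x': "u\<^sub>1 < snd x" "snd x < u\<^sub>2" using x \<rho> by linarith+
    have "cos (2 * pi * real j) = 1" "sin (2 * pi * real j) = 0"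
      using cos_2npi[of j] sin_2npi[of j] by (simp_all add: mult.commute mult.left_commute)
    then have trig: "cos (ts h e N x) = cos (fst x)" "sin (ts h e N x) = sin (fst x)"
      unfolding x(4) cos_add sin_add by simp_all
    show ?thesis
    proof (intro conjI)
      show "N > 0" using N0 by simp
      show "\<exists>q p r t. (\<forall>i<N. p (Suc i) = kick_p (L / real N) (e i) (q i) (p i) \<and> q (Suc i) = q i + L / real N * p (Suc i)
          \<and> \<bar>t (Suc i) - t i\<bar> < 1/2) \<and>
       (\<forall>i\<le>N. \<rho>\<^sub>1 \<le> r i \<and> r i \<le> \<rho>\<^sub>2 \<and> p i = r i * cos (t i) \<and> q i = Q (r i * sin (t i))) \<and>
       q N = q 0 \<and> p N = p 0 \<and> t N = t 0 + 2 * pi * real j"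
      proof (rule exI[of _ "\<lambda>i. qs h e i x"], rule exI[of _ "\<lambda>i. ps h e i x"], rule exI[of _ "\<lambda>i. rs h e i x"],
          rule exI[of _ "\<lambda>i. ts h e i x"], intro conjI allI impI)
        fix i assume i: "i < N"
        show "ps h e (Suc i) x = kick_p (L / real N) (e i) (qs h e i x) (ps h e i x)" by (simp add: ps_Suc h_def)
        show "qs h e (Suc i) x = qs h e i x + L / real N * ps h e (Suc i) x" by (simp add: ps_Suc qs_Suc kick_q_def h_def)
        have "h / Ym \<le> 1/8" using h \<mu> Ym by (simp add: field_simps)
        moreover have "\<eta> * h \<le> 1 * (1/8)" using \<eta> h \<mu> by (intro mult_mono) auto
        moreover have "C * \<bar>e i\<bar> \<le> C * \<epsilon>" using ei[OF i] C by (intro mult_left_mono) auto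
        moreover have "h / Ym < 1/8" using h \<mu> Ym by (simp add: field_simps)
        ultimately show "\<bar>ts h e (Suc i) x - ts h e i x\<bar> < 1/2" using turn_le[OF x' i] C\<epsilon>(2) by linarith
      next
        fix i assume "i \<le> N"
        from stays[OF x' this] show "\<rho>\<^sub>1 \<le> rs h e i x" "rs h e i x \<le> \<rho>\<^sub>2" "ps h e i x = rs h e i x * cos (ts h e i x)"
          "qs h e i x = Q (rs h e i x * sin (ts h e i x))" by auto
      next
        show "qs h e N x = qs h e 0 x" "ps h e N x = ps h e 0 x"
          using stays[OF x' order_refl] x(3) trig by (simp_all add: qs_0 ps_0)
        show "ts h e N x = ts h e 0 x + 2 * pi * real j" using x(4) by simp
      qed
    qed
  qed
  show ?thesis
    using \<rho>(1,6,7) \<epsilon>(1) main by (intro exI[of _ \<rho>\<^sub>1] exI[of _ \<rho>\<^sub>2] exI[of _ \<epsilon>] exI[of _ N\<^sub>0]) blast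
qed

end

section \<open>Passage to the limit\<close>

text \<open>McShane's extension: the lower envelope of the cones with slope \<open>K\<close> based
  at the data. No order of the grid points is involved.\<close>

lemma lipschitz_extension:
  fixes q :: "'a \<Rightarrow> real" and s :: "'a \<Rightarrow> real"
  assumes I: "finite I" "I \<noteq> {}" and lip: "\<And>i k. i \<in> I \<Longrightarrow> k \<in> I \<Longrightarrow> \<bar>q i - q k\<bar> \<le> K * \<bar>s i - s k\<bar>"
    and K: "K \<ge> 0"
  shows "\<exists>\<psi>. (\<forall>x y. \<bar>\<psi> x - \<psi> y\<bar> \<le> K * \<bar>x - y\<bar>) \<and> (\<forall>i\<in>I. \<psi> (s i) = q i)"
proof -
  define \<psi> where "\<psi> x = Min ((\<lambda>i. q i + K * \<bar>x - s i\<bar>) ` I)" for x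
  have le: "\<psi> x \<le> q i + K * \<bar>x - s i\<bar>" if "i \<in> I" for x i
    unfolding \<psi>_def using I that by (intro Min_le) auto
  have att: "\<exists>i\<in>I. \<psi> x = q i + K * \<bar>x - s i\<bar>" for x
  proof -
    have "\<psi> x \<in> (\<lambda>i. q i + K * \<bar>x - s i\<bar>) ` I" unfolding \<psi>_def using I by (intro Min_in) auto
    then show ?thesis by blast
  qed
  have half: "\<psi> x - \<psi> y \<le> K * \<bar>x - y\<bar>" for x y
  proof -
    obtain i where i: "i \<in> I" "\<psi> y = q i + K * \<bar>y - s i\<bar>" using att by blast
    have "\<psi> x - \<psi> y \<le> K * (\<bar>x - s i\<bar> - \<bar>y - s i\<bar>)" using le[OF i(1), of x] i(2) by (simp add: algebra_simps)
    also have "\<dots> \<le> K * \<bar>x - y\<bar>" using K by (intro mult_left_mono) auto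
    finally show ?thesis .
  qed
  have "\<psi> (s i) = q i" if "i \<in> I" for i
  proof (rule antisym)
    show "\<psi> (s i) \<le> q i" using le[OF that, of "s i"] by simp
    obtain k where k: "k \<in> I" "\<psi> (s i) = q k + K * \<bar>s i - s k\<bar>" using att by blast
    then show "q i \<le> \<psi> (s i)" using lip[OF that k(1)] by simp
  qed
  moreover have "\<bar>\<psi> x - \<psi> y\<bar> \<le> K * \<bar>x - y\<bar>" for x y
    using half[of x y] half[of y x] by (simp add: abs_le_iff abs_minus_commute)
  ultimately show ?thesis by blast
qed

lemma integral_grid:
  fixes k :: "real \<Rightarrow> real"
  assumes "\<And>x y. 0 \<le> x \<Longrightarrow> y \<le> real N * h \<Longrightarrow> k integrable_on {x..y}" "h \<ge> 0"
  shows "i \<le> N \<Longrightarrow> (\<Sum>j<i. integral {real j * h..real (Suc j) * h} k) = integral {0..real i * h} k"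
proof (induction i)
  case (Suc i)
  have le: "real (Suc i) * h \<le> real N * h" using Suc assms(2) by (intro mult_right_mono) auto
  have "integral {0..real i * h} k + integral {real i * h..real (Suc i) * h} k = integral {0..real (Suc i) * h} k"
    by (rule Henstock_Kurzweil_Integration.integral_combine) (use assms le in \<open>auto simp: mult_right_mono\<close>)
  then show ?case using Suc by simp
qed simp

lemma absolutely_integrable_mult_continuous:
  fixes n k :: "real \<Rightarrow> real"
  assumes "n absolutely_integrable_on {x..y}" "continuous_on {x..y} k"
  shows "(\<lambda>t. n t * k t) absolutely_integrable_on {x..y}"
proof -
  have "bounded (k ` {x..y})" using compact_imp_bounded compact_continuous_image[OF assms(2)] by blast
  moreover have "k \<in> borel_measurable (lebesgue_on {x..y})"
    by (rule continuous_imp_measurable_on_sets_lebesgue[OF assms(2)]) simp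
  ultimately have "(\<lambda>t. k t * n t) absolutely_integrable_on {x..y}"
    using assms(1) by (intro absolutely_integrable_bounded_measurable_product_real) auto
  then show ?thesis by (simp add: mult.commute)
qed

text \<open>Bounded momenta make the positions uniformly Lipschitz, so compactness is applied to the
  positions. For the momenta only the initial value needs a subsequence: \<open>w\<close> is defined
  by the integral equation along the limit \<open>u\<close>, and the discrete momenta converge to it
  since their increments integrate the same \<open>n\<close>.\<close>

lemma euler_limit:
  fixes n F :: "real \<Rightarrow> real" and q p :: "nat \<Rightarrow> nat \<Rightarrow> real" and Ns :: "nat \<Rightarrow> nat"
  assumes L: "L > 0" and n: "n absolutely_integrable_on {0..L}" and F: "continuous_on UNIV F"
    and Ns: "filterlim Ns at_top sequentially" "\<And>m. Ns m > 0"
    and q_rec: "\<And>m i. i < Ns m \<Longrightarrow> q m (Suc i) = q m i + L / real (Ns m) * p m (Suc i)"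
    and p_rec: "\<And>m i. i < Ns m \<Longrightarrow> p m (Suc i) = p m i + L / real (Ns m) * (g * q m i)
        - integral {real i * (L / real (Ns m))..real (Suc i) * (L / real (Ns m))} n * F (q m i)"
    and bd: "\<And>m i. i \<le> Ns m \<Longrightarrow> \<bar>p m i\<bar> \<le> K" "\<And>m i. i \<le> Ns m \<Longrightarrow> \<bar>q m i\<bar> \<le> K'"
  shows "\<exists>u w. \<exists>\<sigma> :: nat \<Rightarrow> nat. strict_mono \<sigma> \<and> continuous_on {0..L} u \<and> continuous_on {0..L} w \<and>
     (\<forall>t\<in>{0..L}. w t = w 0 + integral {0..t} (\<lambda>s. g * u s - n s * F (u s))) \<and>
     (\<forall>t\<in>{0..L}. u t = u 0 + integral {0..t} w) \<and>
     (\<forall>\<eta>>0. \<exists>M. \<forall>m\<ge>M. \<forall>i\<le>Ns (\<sigma> m). \<bar>q (\<sigma> m) i - u (real i * (L / real (Ns (\<sigma> m))))\<bar> \<le> \<eta> \<and>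
        \<bar>p (\<sigma> m) i - w (real i * (L / real (Ns (\<sigma> m))))\<bar> \<le> \<eta>)"
proof -
  define h where "h m = L / real (Ns m)" for m
  have h: "h m > 0" "real (Ns m) * h m = L" for m using L Ns(2)[of m] by (auto simp: h_def)
  have h_lim: "h \<longlonglongrightarrow> 0"
    unfolding h_def using Ns(1) filterlim_real_sequentially
    by (intro tendsto_divide_0[OF tendsto_const] filterlim_at_top_imp_at_infinity) (auto intro: filterlim_compose)
  have grid: "real i * h m \<in> {0..L}" if "i \<le> Ns m" for m i
  proof -
    have "real i * h m \<le> real (Ns m) * h m" using that h(1)[of m] by (intro mult_right_mono) auto
    then show ?thesis using h[of m] by simp
  qed
  have K: "K \<ge> 0" using bd(1)[of 0 0] by (auto intro: order_trans[OF abs_ge_zero])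
  have q_lip: "\<bar>q m i - q m k\<bar> \<le> K * \<bar>real i * h m - real k * h m\<bar>" if "i \<in> {..Ns m}" "k \<in> {..Ns m}" for m i k
  proof -
    have up: "\<bar>q m (i + d) - q m i\<bar> \<le> K * (real d * h m)" if "i + d \<le> Ns m" for i d
      using that
    proof (induction d)
      case (Suc d)
      have "q m (i + Suc d) = q m (i + d) + h m * p m (Suc (i + d))"
        using q_rec[of "i + d" m] Suc.prems by (simp add: h_def)
      moreover have "\<bar>h m * p m (Suc (i + d))\<bar> \<le> h m * K"
        unfolding abs_mult using bd(1)[of "Suc (i + d)" m] Suc.prems h(1)[of m] by (intro mult_mono) auto
      ultimately show ?case using Suc by (simp add: algebra_simps)
    qed simp
    show ?thesis
    proof (cases "i \<le> k")
      case True
      have "\<bar>real i * h m - real k * h m\<bar> = real (k - i) * h m"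
        using True h(1)[of m] by (simp add: of_nat_diff algebra_simps mult_left_mono)
      then show ?thesis using up[of i "k - i"] True that by (simp add: abs_minus_commute)
    next
      case False
      have "\<bar>real i * h m - real k * h m\<bar> = real (i - k) * h m"
        using False h(1)[of m] by (simp add: of_nat_diff algebra_simps mult_left_mono)
      then show ?thesis using up[of k "i - k"] False that by simp
    qed
  qed
  have "\<exists>\<psi>. (\<forall>x y. \<bar>\<psi> x - \<psi> y\<bar> \<le> K * \<bar>x - y\<bar>) \<and> (\<forall>i\<in>{..Ns m}. \<psi> (real i * h m) = q m i)" for m
    by (rule lipschitz_extension[OF _ _ q_lip K]) auto
  then obtain \<psi> where \<psi>: "\<And>m x y. \<bar>\<psi> m x - \<psi> m y\<bar> \<le> K * \<bar>x - y\<bar>" "\<And>m i. i \<le> Ns m \<Longrightarrow> \<psi> m (real i * h m) = q m i"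
    by (metis atMost_iff)
  have "bounded (range (\<lambda>m. p m 0))"
    using bd(1)[of 0] by (intro boundedI[of _ K]) auto
  then obtain p0 \<sigma>1 where \<sigma>1: "strict_mono \<sigma>1" "(\<lambda>m. p (\<sigma>1 m) 0) \<longlonglongrightarrow> p0"
    using bounded_imp_convergent_subsequence[of "\<lambda>m. p m 0"] by (auto simp: o_def)
  obtain u \<sigma>2 where u: "continuous_on {0..L} u" and \<sigma>2: "strict_mono (\<sigma>2 :: nat \<Rightarrow> nat)"
    and u_lim: "\<And>e. 0 < e \<Longrightarrow> \<exists>N. \<forall>n x. n \<ge> N \<and> x \<in> {0..L} \<longrightarrow> norm (\<psi> (\<sigma>1 (\<sigma>2 n)) x - u x) < e"
  proof (rule Arzela_Ascoli[of "{0..L}" "\<lambda>m. \<psi> (\<sigma>1 m)" "K' + K * L"])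
    show "norm (\<psi> (\<sigma>1 m) x) \<le> K' + K * L" if "x \<in> {0..L}" for m x
    proof -
      have "\<bar>\<psi> (\<sigma>1 m) x - \<psi> (\<sigma>1 m) 0\<bar> \<le> K * L"
        using \<psi>(1)[of "\<sigma>1 m" x 0] that K mult_left_mono[of x L K] by simp
      moreover have "\<bar>\<psi> (\<sigma>1 m) 0\<bar> \<le> K'" using \<psi>(2)[of 0 "\<sigma>1 m"] bd(2)[of 0 "\<sigma>1 m"] by simp
      ultimately show ?thesis by simp
    qed
    show "\<exists>d. 0 < d \<and> (\<forall>n y. y \<in> {0..L} \<and> norm (x - y) < d \<longrightarrow> norm (\<psi> (\<sigma>1 n) x - \<psi> (\<sigma>1 n) y) < e)"
      if "0 < e" for x e
    proof (intro exI[of _ "e / (K + 1)"] conjI allI impI)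
      fix m y assume "y \<in> {0..L} \<and> norm (x - y) < e / (K + 1)"
      then have "(K + 1) * \<bar>x - y\<bar> < e" using K by (simp add: field_simps)
      moreover have "K * \<bar>x - y\<bar> \<le> (K + 1) * \<bar>x - y\<bar>" by (simp add: algebra_simps)
      ultimately show "norm (\<psi> (\<sigma>1 m) x - \<psi> (\<sigma>1 m) y) < e" using \<psi>(1)[of "\<sigma>1 m" x y] by simp
    qed (use that K in auto)
  qed auto
  define \<sigma> where "\<sigma> = \<sigma>1 \<circ> \<sigma>2"
  have \<sigma>: "strict_mono \<sigma>" using \<sigma>1(1) \<sigma>2 by (auto simp: \<sigma>_def strict_mono_def)
  have p0_lim: "(\<lambda>m. p (\<sigma> m) 0) \<longlonglongrightarrow> p0"
    using LIMSEQ_subseq_LIMSEQ[OF \<sigma>1(2) \<sigma>2] by (simp add: \<sigma>_def o_def)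
  have h\<sigma>: "(\<lambda>m. h (\<sigma> m)) \<longlonglongrightarrow> 0"
    using LIMSEQ_subseq_LIMSEQ[OF h_lim \<sigma>] by (simp add: o_def)
  define kf where "kf s = g * u s - n s * F (u s)" for s
  have Fu: "continuous_on {0..L} (\<lambda>s. F (u s))"
    by (rule continuous_on_compose2[OF F u]) auto
  have n_sub: "n absolutely_integrable_on {x..y}" if "0 \<le> x" "y \<le> L" for x y
    by (rule absolutely_integrable_on_subinterval[OF n]) (use that in auto)
  have kf_int: "kf integrable_on {x..y}" if "0 \<le> x" "y \<le> L" for x y
  proof -
    have sub: "{x..y} \<subseteq> {0..L}" using that by auto
    have "(\<lambda>s. n s * F (u s)) absolutely_integrable_on {x..y}"
      by (rule absolutely_integrable_mult_continuous[OF n_sub[OF that] continuous_on_subset[OF Fu sub]])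
    moreover have "(\<lambda>s. g * u s) integrable_on {x..y}"
      by (intro integrable_continuous_real continuous_intros continuous_on_subset[OF u sub])
    ultimately show ?thesis unfolding kf_def
      using integrable_diff set_lebesgue_integral_eq_integral(1) by blast
  qed
  define w where "w t = p0 + integral {0..t} kf" for t
  have w_cont: "continuous_on {0..L} w"
    unfolding w_def by (intro continuous_intros indefinite_integral_continuous_1 kf_int) auto
  have w0: "w 0 = p0" by (simp add: w_def)
  define nI where "nI = integral {0..L} (\<lambda>s. \<bar>n s\<bar>)"
  have absn_int: "(\<lambda>s. \<bar>n s\<bar>) integrable_on {x..y}" if "0 \<le> x" "y \<le> L" for x y
    using n_sub[OF that] by (simp add: absolutely_integrable_on_def)
  have n_int: "n integrable_on {x..y}" if "0 \<le> x" "y \<le> L" for x y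
    using n_sub[OF that] by (simp add: absolutely_integrable_on_def)
  have nI0: "nI \<ge> 0" unfolding nI_def by (intro integral_nonneg absn_int) auto
  obtain KU where KU: "\<And>t. t \<in> {0..L} \<Longrightarrow> \<bar>u t\<bar> \<le> KU" "KU \<ge> K'"
  proof -
    have "bounded (u ` {0..L})" using compact_imp_bounded compact_continuous_image[OF u] by blast
    then obtain B where "\<forall>x\<in>u ` {0..L}. norm x \<le> B" using bounded_iff by blast
    then show ?thesis by (intro that[of "max B K'"]) (auto simp: le_max_iff_disj)
  qed
  have uF: "uniformly_continuous_on {-KU..KU} F"
    by (intro compact_uniformly_continuous continuous_on_subset[OF F]) auto
  have uu: "uniformly_continuous_on {0..L} u" and uw: "uniformly_continuous_on {0..L} w"
    by (intro compact_uniformly_continuous u w_cont; simp)+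
  have ev_h: "\<forall>\<^sub>F m in sequentially. h (\<sigma> m) < d" if "d > 0" for d
    using order_tendstoD(2)[OF h\<sigma> that] .
  have ev_u: "\<forall>\<^sub>F m in sequentially. \<forall>i\<le>Ns (\<sigma> m). \<bar>q (\<sigma> m) i - u (real i * h (\<sigma> m))\<bar> < \<eta>" if \<eta>: "\<eta> > 0" for \<eta>
  proof -
    obtain M where M: "\<And>m x. m \<ge> M \<Longrightarrow> x \<in> {0..L} \<Longrightarrow> norm (\<psi> (\<sigma>1 (\<sigma>2 m)) x - u x) < \<eta>"
      using u_lim[OF \<eta>] by blast
    show ?thesis unfolding eventually_sequentially
    proof (intro exI[of _ M] allI impI)
      fix m i assume "M \<le> m" "i \<le> Ns (\<sigma> m)"
      then show "\<bar>q (\<sigma> m) i - u (real i * h (\<sigma> m))\<bar> < \<eta>"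
        using M[of m "real i * h (\<sigma> m)"] grid[of i "\<sigma> m"] \<psi>(2)[of i "\<sigma> m"] by (simp add: \<sigma>_def)
    qed
  qed
  have cell: "s \<in> {0..L}" "\<bar>s - real i * h m\<bar> \<le> h m" if "i < Ns m" "s \<in> {real i * h m..real (Suc i) * h m}" for m i s
  proof -
    have "0 \<le> real i * h m" using h(1)[of m] by simp
    moreover have "real (Suc i) * h m \<le> L" using grid[of "Suc i" m] that(1) by simp
    moreover have "real (Suc i) * h m = real i * h m + h m" by (simp add: algebra_simps)
    ultimately show "s \<in> {0..L}" "\<bar>s - real i * h m\<bar> \<le> h m"
      using that(2) unfolding atLeastAtMost_iff by linarith+
  qed
  have ev_cell: "\<forall>\<^sub>F m in sequentially. \<forall>i<Ns (\<sigma> m). \<forall>s\<in>{real i * h (\<sigma> m)..real (Suc i) * h (\<sigma> m)}. \<bar>q (\<sigma> m) i - u s\<bar> < \<eta>" if \<eta>: "\<eta> > 0" for \<eta>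
  proof -
    obtain d where d: "d > 0" "\<And>x y. x \<in> {0..L} \<Longrightarrow> y \<in> {0..L} \<Longrightarrow> dist y x < d \<Longrightarrow> dist (u y) (u x) < \<eta>/2"
      using uu \<eta> unfolding uniformly_continuous_on_def by (metis half_gt_zero)
    have "\<eta>/2 > 0" using \<eta> by simp
    from ev_u[OF this] ev_h[OF d(1)] show ?thesis
    proof eventually_elim
      case (elim m)
      show ?case
      proof (intro allI impI ballI)
        fix i s assume i: "i < Ns (\<sigma> m)" and s: "s \<in> {real i * h (\<sigma> m)..real (Suc i) * h (\<sigma> m)}"
        have "\<bar>u s - u (real i * h (\<sigma> m))\<bar> < \<eta>/2"
          using d(2)[of "real i * h (\<sigma> m)" s] cell[OF i s] grid[of i "\<sigma> m"] i elim(2) by (simp add: dist_real_def)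
        moreover have "\<bar>q (\<sigma> m) i - u (real i * h (\<sigma> m))\<bar> < \<eta>/2" using elim(1) i by simp
        ultimately show "\<bar>q (\<sigma> m) i - u s\<bar> < \<eta>" by linarith
      qed
    qed
  qed
  have ev_w: "\<forall>\<^sub>F m in sequentially. \<forall>i\<le>Ns (\<sigma> m). \<bar>p (\<sigma> m) i - w (real i * h (\<sigma> m))\<bar> \<le> \<eta>" if \<eta>: "\<eta> > 0" for \<eta>
  proof -
    \<comment> \<open>The accumulated error is \<open>\<omega>\<close> times
      \<open>\<bar>g\<bar> * L\<close> plus the integral of \<open>\<bar>n\<bar>\<close>, hence at
      most \<open>\<eta> / 2\<close>; the other half is for the initial momentum.\<close>
    define \<omega> where "\<omega> = \<eta> / (2 * (\<bar>g\<bar> * L + nI + 1))"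
    have den: "\<bar>g\<bar> * L + nI + 1 > 0" using L nI0 by (simp add: add_nonneg_pos)
    have \<omega>: "\<omega> > 0" "\<omega> * (\<bar>g\<bar> * L + nI) \<le> \<eta> / 2"
    proof -
      show "\<omega> > 0" using \<eta> den by (simp add: \<omega>_def)
      then have "\<omega> * (\<bar>g\<bar> * L + nI) \<le> \<omega> * (\<bar>g\<bar> * L + nI + 1)" by (intro mult_left_mono) auto
      also have "\<dots> = \<eta> / 2"
      proof -
        have "\<eta> / (2 * k) * k = \<eta> / 2" if "k > 0" for k using that by simp
        from this[OF den] show ?thesis by (simp only: \<omega>_def)
      qed
      finally show "\<omega> * (\<bar>g\<bar> * L + nI) \<le> \<eta> / 2" .
    qed
    obtain d where d: "d > 0" "\<And>x y. x \<in> {-KU..KU} \<Longrightarrow> y \<in> {-KU..KU} \<Longrightarrow> dist y x < d \<Longrightarrow> dist (F y) (F x) < \<omega>"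
      using uF \<omega>(1) unfolding uniformly_continuous_on_def by metis
    have "min d \<omega> > 0" using d \<omega> by simp
    moreover have "\<forall>\<^sub>F m in sequentially. \<bar>p (\<sigma> m) 0 - p0\<bar> < \<eta> / 2"
      using tendstoD[OF p0_lim, of "\<eta>/2"] \<eta> by (simp add: dist_real_def)
    ultimately show ?thesis using ev_cell[of "min d \<omega>"]
    proof (elim eventually_elim2)
      fix m assume p0: "\<bar>p (\<sigma> m) 0 - p0\<bar> < \<eta> / 2"
        and cl: "\<forall>i<Ns (\<sigma> m). \<forall>s\<in>{real i * h (\<sigma> m)..real (Suc i) * h (\<sigma> m)}. \<bar>q (\<sigma> m) i - u s\<bar> < min d \<omega>"
      let ?m = "\<sigma> m"
      let ?I = "\<lambda>i. {real i * h ?m..real (Suc i) * h ?m}"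
      have sub: "0 \<le> real i * h ?m" "real (Suc i) * h ?m \<le> L" if "i < Ns ?m" for i
        using grid[of i ?m] grid[of "Suc i" ?m] that by auto
      \<comment> \<open>A discrete increment is the integral with the position frozen at
        \<open>q ?m i\<close>. Comparing the integrands gives a multiple of
        \<open>\<bar>g\<bar> + \<bar>n s\<bar>\<close>, so the error stays summable even where
        \<open>n\<close> is unbounded.\<close>
      have st: "\<bar>(p ?m (Suc i) - p ?m i) - integral (?I i) kf\<bar> \<le> integral (?I i) (\<lambda>s. \<omega> * (\<bar>g\<bar> + \<bar>n s\<bar>))" if i: "i < Ns ?m" for i
      proof -
        have le: "real i * h ?m \<le> real (Suc i) * h ?m" using h(1)[of ?m] by (simp add: algebra_simps)
        have ni: "n integrable_on ?I i" and ai: "(\<lambda>s. \<bar>n s\<bar>) integrable_on ?I i" and ki: "kf integrable_on ?I i"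
          using n_int absn_int kf_int sub[OF i] by auto
        have "integral (?I i) (\<lambda>s. g * q ?m i - n s * F (q ?m i)) = h ?m * (g * q ?m i) - integral (?I i) n * F (q ?m i)"
          using ni le by (subst integral_diff) (auto simp: integrable_on_mult_left algebra_simps)
        then have "p ?m (Suc i) - p ?m i = integral (?I i) (\<lambda>s. g * q ?m i - n s * F (q ?m i))"
          using p_rec[OF i] by (simp add: h_def)
        moreover have ci: "(\<lambda>s. g * q ?m i - n s * F (q ?m i)) integrable_on ?I i"
          using ni by (intro integrable_diff integrable_on_mult_left) auto
        ultimately have "(p ?m (Suc i) - p ?m i) - integral (?I i) kf = integral (?I i) (\<lambda>s. (g * q ?m i - n s * F (q ?m i)) - kf s)"
          using ki by (simp add: integral_diff)
        also have "\<bar>\<dots>\<bar> \<le> integral (?I i) (\<lambda>s. \<omega> * (\<bar>g\<bar> + \<bar>n s\<bar>))"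
        proof (rule integral_norm_bound_integral[where 'a = real, unfolded real_norm_def])
          show "(\<lambda>s. (g * q ?m i - n s * F (q ?m i)) - kf s) integrable_on ?I i" using ci ki by (rule integrable_diff)
          show "(\<lambda>s. \<omega> * (\<bar>g\<bar> + \<bar>n s\<bar>)) integrable_on ?I i"
            using ai by (intro integrable_on_mult_right integrable_add) auto
          fix s assume s: "s \<in> ?I i"
          have qs: "\<bar>q ?m i - u s\<bar> < d" "\<bar>q ?m i - u s\<bar> < \<omega>" using cl i s by auto
          have "q ?m i \<in> {-KU..KU}" "u s \<in> {-KU..KU}"
            using bd(2)[of i ?m] i KU(2) KU(1)[OF cell(1)[OF i s]] by (auto simp: abs_le_iff)
          then have Fq: "\<bar>F (q ?m i) - F (u s)\<bar> < \<omega>" using d(2)[of "u s" "q ?m i"] qs by (simp add: dist_real_def)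
          have "(g * q ?m i - n s * F (q ?m i)) - kf s = g * (q ?m i - u s) - n s * (F (q ?m i) - F (u s))"
            by (simp add: kf_def algebra_simps)
          then have "\<bar>(g * q ?m i - n s * F (q ?m i)) - kf s\<bar> \<le> \<bar>g\<bar> * \<bar>q ?m i - u s\<bar> + \<bar>n s\<bar> * \<bar>F (q ?m i) - F (u s)\<bar>"
            by (metis abs_mult abs_triangle_ineq4)
          also have "\<dots> \<le> \<bar>g\<bar> * \<omega> + \<bar>n s\<bar> * \<omega>"
            using qs Fq by (intro add_mono mult_left_mono) auto
          finally show "\<bar>(g * q ?m i - n s * F (q ?m i)) - kf s\<bar> \<le> \<omega> * (\<bar>g\<bar> + \<bar>n s\<bar>)" by (simp add: algebra_simps)
        qed
        finally show ?thesis .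
      qed
      have gi: "(\<lambda>s. \<omega> * (\<bar>g\<bar> + \<bar>n s\<bar>)) integrable_on {x..y}" if "0 \<le> x" "y \<le> L" for x y
        using absn_int[OF that] by (intro integrable_on_mult_right integrable_add) auto
      show "\<forall>i\<le>Ns ?m. \<bar>p ?m i - w (real i * h ?m)\<bar> \<le> \<eta>"
      proof (intro allI impI)
        fix i assume i: "i \<le> Ns ?m"
        have "p ?m i - p ?m 0 = (\<Sum>k<i. p ?m (Suc k) - p ?m k)"
          using sum_lessThan_telescope[of "p ?m" i] by simp
        moreover have "integral {0..real i * h ?m} kf = (\<Sum>k<i. integral (?I k) kf)"
          by (rule integral_grid[symmetric, of "Ns ?m"]) (use kf_int h i in \<open>auto simp: less_imp_le\<close>)
        ultimately have "\<bar>(p ?m i - p ?m 0) - integral {0..real i * h ?m} kf\<bar> \<le> (\<Sum>k<i. \<bar>(p ?m (Suc k) - p ?m k) - integral (?I k) kf\<bar>)"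
          by (simp only: sum_subtractf[symmetric] sum_abs)
        also have "\<dots> \<le> (\<Sum>k<i. integral (?I k) (\<lambda>s. \<omega> * (\<bar>g\<bar> + \<bar>n s\<bar>)))"
          using st i by (intro sum_mono) auto
        also have "\<dots> = integral {0..real i * h ?m} (\<lambda>s. \<omega> * (\<bar>g\<bar> + \<bar>n s\<bar>))"
          by (rule integral_grid[of "Ns ?m"]) (use gi h i in \<open>auto simp: less_imp_le\<close>)
        also have "\<dots> \<le> integral {0..L} (\<lambda>s. \<omega> * (\<bar>g\<bar> + \<bar>n s\<bar>))"
          using grid[OF i] \<omega>(1) by (intro integral_subset_le gi) auto
        also have "\<dots> = \<omega> * (\<bar>g\<bar> * L + nI)"
        proof -
          have "integral {0..L} (\<lambda>s. \<bar>g\<bar> + \<bar>n s\<bar>) = integral {0..L} (\<lambda>s. \<bar>g\<bar>) + integral {0..L} (\<lambda>s. \<bar>n s\<bar>)"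
            by (rule Henstock_Kurzweil_Integration.integral_add) (use absn_int[of 0 L] in auto)
          then show ?thesis using L by (simp add: nI_def mult.commute)
        qed
        also note \<omega>(2)
        finally show "\<bar>p ?m i - w (real i * h ?m)\<bar> \<le> \<eta>" using p0 unfolding w_def by linarith
      qed
    qed
  qed
  \<comment> \<open>The defect of \<open>u\<close> as a primitive of \<open>w\<close>; it is bounded
    at grid points by comparing the Euler sum with the integral.\<close>
  define D where "D t = u t - u 0 - integral {0..t} w" for t
  have w_int: "w integrable_on {x..y}" if "0 \<le> x" "y \<le> L" for x y
    using that by (intro integrable_continuous_real continuous_on_subset[OF w_cont]) auto
  have D_cont: "continuous_on {0..L} D"
    unfolding D_def by (intro continuous_intros u indefinite_integral_continuous_1 w_int) auto
  have uD: "uniformly_continuous_on {0..L} D" by (intro compact_uniformly_continuous D_cont) simp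
  have D0: "D t = 0" if t: "t \<in> {0..L}" for t
  proof (rule ccontr)
    assume "D t \<noteq> 0"
    \<comment> \<open>The estimates below give
      \<open>\<bar>D t\<bar> < (2 * L + 3) * \<eta>\<close>, which this choice makes at most
      \<open>\<bar>D t\<bar> / 2\<close>, a contradiction.\<close>
    define \<eta> where "\<eta> = \<bar>D t\<bar> / (2 * (2 * L + 4))"
    have \<eta>: "\<eta> > 0" using \<open>D t \<noteq> 0\<close> L by (simp add: \<eta>_def)
    obtain d1 where d1: "d1 > 0" "\<And>x y. x \<in> {0..L} \<Longrightarrow> y \<in> {0..L} \<Longrightarrow> dist y x < d1 \<Longrightarrow> dist (w y) (w x) < \<eta>"
      using uw \<eta> unfolding uniformly_continuous_on_def by metis
    obtain d2 where d2: "d2 > 0" "\<And>x y. x \<in> {0..L} \<Longrightarrow> y \<in> {0..L} \<Longrightarrow> dist y x < d2 \<Longrightarrow> dist (D y) (D x) < \<eta>"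
      using uD \<eta> unfolding uniformly_continuous_on_def by metis
    have "\<forall>\<^sub>F m in sequentially. (\<forall>i\<le>Ns (\<sigma> m). \<bar>q (\<sigma> m) i - u (real i * h (\<sigma> m))\<bar> < \<eta>) \<and>
        (\<forall>i\<le>Ns (\<sigma> m). \<bar>p (\<sigma> m) i - w (real i * h (\<sigma> m))\<bar> \<le> \<eta>) \<and> h (\<sigma> m) < d1 \<and> h (\<sigma> m) < d2"
      by (intro eventually_conj ev_u ev_w ev_h \<eta> d1 d2)
    then obtain m where m: "\<And>i. i \<le> Ns (\<sigma> m) \<Longrightarrow> \<bar>q (\<sigma> m) i - u (real i * h (\<sigma> m))\<bar> < \<eta>"
        "\<And>i. i \<le> Ns (\<sigma> m) \<Longrightarrow> \<bar>p (\<sigma> m) i - w (real i * h (\<sigma> m))\<bar> \<le> \<eta>" "h (\<sigma> m) < d1" "h (\<sigma> m) < d2"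
      by (auto dest!: eventually_happens)
    let ?m = "\<sigma> m"
    let ?I = "\<lambda>i. {real i * h ?m..real (Suc i) * h ?m}"
    define k where "k = nat \<lfloor>t / h ?m\<rfloor>"
    have k: "real k * h ?m \<le> t" "t < real (Suc k) * h ?m"
    proof -
      have "t / h ?m \<ge> 0" using t h(1)[of ?m] by simp
      then have "real k \<le> t / h ?m" "t / h ?m < real k + 1" unfolding k_def by linarith+
      then show "real k * h ?m \<le> t" "t < real (Suc k) * h ?m"
        using h(1)[of ?m] by (simp_all add: pos_le_divide_eq pos_divide_less_eq add.commute)
    qed
    have kN: "k \<le> Ns ?m"
    proof -
      have "real k * h ?m \<le> real (Ns ?m) * h ?m" using k(1) t h(2)[of ?m] by simp
      then show ?thesis using h(1)[of ?m] by simp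
    qed
    have st: "\<bar>h ?m * p ?m (Suc i) - integral (?I i) w\<bar> \<le> 2 * \<eta> * h ?m" if i: "i < Ns ?m" for i
    proof -
      have le: "real i * h ?m \<le> real (Suc i) * h ?m" using h(1)[of ?m] by (simp add: algebra_simps)
      have len: "real (Suc i) * h ?m - real i * h ?m = h ?m" by (simp add: algebra_simps)
      have wi: "w integrable_on ?I i" using w_int grid[of i ?m] grid[of "Suc i" ?m] i by auto
      have "h ?m * p ?m (Suc i) - integral (?I i) w = integral (?I i) (\<lambda>s. p ?m (Suc i) - w s)"
      proof -
        have "integral (?I i) (\<lambda>s. p ?m (Suc i) - w s) = integral (?I i) (\<lambda>s. p ?m (Suc i)) - integral (?I i) w"
          by (rule Henstock_Kurzweil_Integration.integral_diff) (use wi in auto)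
        moreover have "integral (?I i) (\<lambda>s. p ?m (Suc i)) = h ?m * p ?m (Suc i)"
          using le len by (simp del: of_nat_Suc)
        ultimately show ?thesis by presburger
      qed
      also have "\<bar>\<dots>\<bar> \<le> 2 * \<eta> * (real (Suc i) * h ?m - real i * h ?m)"
      proof (rule integral_bound[of _ _ "\<lambda>s. p ?m (Suc i) - w s" "2 * \<eta>", unfolded real_norm_def])
        show "continuous_on (?I i) (\<lambda>s. p ?m (Suc i) - w s)"
          using grid[of i ?m] grid[of "Suc i" ?m] i by (intro continuous_intros continuous_on_subset[OF w_cont]) auto
        fix s assume s: "s \<in> ?I i"
        have "\<bar>real (Suc i) * h ?m - s\<bar> < d1" using s m(3) len by (simp only: atLeastAtMost_iff) linarith
        then have "\<bar>w (real (Suc i) * h ?m) - w s\<bar> < \<eta>"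
          using d1(2)[OF cell(1)[OF i s] grid[of "Suc i" ?m]] i by (simp only: dist_real_def Suc_le_eq)
        moreover have "\<bar>p ?m (Suc i) - w (real (Suc i) * h ?m)\<bar> \<le> \<eta>" by (rule m(2)) (use i in simp)
        ultimately show "\<bar>p ?m (Suc i) - w s\<bar> \<le> 2 * \<eta>" by linarith
      qed (rule le)
      finally show ?thesis by (simp only: len)
    qed
    have "q ?m k - q ?m 0 = (\<Sum>i<k. q ?m (Suc i) - q ?m i)"
      using sum_lessThan_telescope[of "q ?m" k] by simp
    also have "\<dots> = (\<Sum>i<k. h ?m * p ?m (Suc i))"
      using q_rec kN by (intro sum.cong) (auto simp: h_def)
    finally have qk: "q ?m k - q ?m 0 = (\<Sum>i<k. h ?m * p ?m (Suc i))" .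
    have wk: "integral {0..real k * h ?m} w = (\<Sum>i<k. integral (?I i) w)"
      by (rule integral_grid[symmetric, of "Ns ?m"]) (use w_int h kN in \<open>auto simp: less_imp_le\<close>)
    have "\<bar>(q ?m k - q ?m 0) - integral {0..real k * h ?m} w\<bar> \<le> (\<Sum>i<k. \<bar>h ?m * p ?m (Suc i) - integral (?I i) w\<bar>)"
      unfolding qk wk sum_subtractf[symmetric] by (rule sum_abs)
    also have "\<dots> \<le> (\<Sum>i<k. 2 * \<eta> * h ?m)" using st kN by (intro sum_mono) auto
    also have "\<dots> = 2 * \<eta> * (real k * h ?m)" by simp
    also have "\<dots> \<le> 2 * \<eta> * L" using grid[OF kN] \<eta> by (intro mult_left_mono) auto
    finally have "\<bar>D (real k * h ?m)\<bar> \<le> 2 * \<eta> * L + 2 * \<eta>"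
      using m(1)[OF kN] m(1)[of 0] by (simp add: D_def)
    moreover have "\<bar>D t - D (real k * h ?m)\<bar> < \<eta>"
    proof -
      have "\<bar>t - real k * h ?m\<bar> < d2" using k m(4) by (simp add: algebra_simps)
      then show ?thesis using d2(2)[OF grid[OF kN] t] by (simp add: dist_real_def)
    qed
    ultimately have "\<bar>D t\<bar> < 2 * \<eta> * L + 3 * \<eta>" by linarith
    also have "\<dots> \<le> \<eta> * (2 * L + 4)" using \<eta> by (simp add: algebra_simps)
    also have "\<dots> = \<bar>D t\<bar> / 2"
    proof -
      have "a / (2 * k) * k = a / 2" if "k > 0" for a k :: real using that by simp
      from this[of "2 * L + 4" "\<bar>D t\<bar>"] show ?thesis using L by (simp only: \<eta>_def)
    qed
    finally show False by simp
  qed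
  have lim: "\<forall>\<eta>>0. \<exists>M. \<forall>m\<ge>M. \<forall>i\<le>Ns (\<sigma> m). \<bar>q (\<sigma> m) i - u (real i * (L / real (Ns (\<sigma> m))))\<bar> \<le> \<eta> \<and>
        \<bar>p (\<sigma> m) i - w (real i * (L / real (Ns (\<sigma> m))))\<bar> \<le> \<eta>"
  proof (intro allI impI)
    fix \<eta> :: real assume "\<eta> > 0"
    from eventually_conj[OF ev_u[OF this] ev_w[OF this]]
    show "\<exists>M. \<forall>m\<ge>M. \<forall>i\<le>Ns (\<sigma> m). \<bar>q (\<sigma> m) i - u (real i * (L / real (Ns (\<sigma> m))))\<bar> \<le> \<eta> \<and>
        \<bar>p (\<sigma> m) i - w (real i * (L / real (Ns (\<sigma> m))))\<bar> \<le> \<eta>"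
      unfolding eventually_sequentially h_def[symmetric] by (meson less_imp_le)
  qed
  have w_eq: "\<forall>t\<in>{0..L}. w t = w 0 + integral {0..t} (\<lambda>s. g * u s - n s * F (u s))"
    by (simp add: w0 kf_def[abs_def] flip: w_def) (simp add: w_def kf_def[abs_def])
  have u_eq: "\<forall>t\<in>{0..L}. u t = u 0 + integral {0..t} w"
  proof
    fix t assume "t \<in> {0..L}"
    from D0[OF this] show "u t = u 0 + integral {0..t} w" by (simp add: D_def)
  qed
  show ?thesis
    by (rule exI[of _ u], rule exI[of _ w], rule exI[of _ \<sigma>])
       (intro conjI \<sigma> u w_cont w_eq u_eq lim)
qed

section \<open>Winding numbers\<close>

lemma periodic_int_shift:
  fixes k :: "real \<Rightarrow> 'a"
  assumes "\<And>x. k (x + p) = k x"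
  shows "k (x + of_int z * p) = k x"
proof (induction z rule: int_induct[where k = 0])
  case (step1 i)
  then show ?case using assms[of "x + of_int i * p"] by (simp add: algebra_simps)
next
  case (step2 i)
  then show ?case using assms[of "x + of_int (i - 1) * p"] by (simp add: algebra_simps)
qed simp

text \<open>The argument is wrapped into one period by \<open>floor\<close>. At a multiple of
  \<open>L\<close> the formulas of the two adjacent cells agree because
  \<open>u 0 = u L\<close>.\<close>

lemma continuous_periodic_extension:
  fixes u :: "real \<Rightarrow> real"
  assumes L: "L > 0" and u: "continuous_on {0..L} u" and ends: "u 0 = u L"
  obtains v where "continuous_on UNIV v" "\<And>x. v (x + L) = v x" "\<And>x. x \<in> {0..L} \<Longrightarrow> v x = u x"
proof -
  define v where "v x = u (x - L * of_int \<lfloor>x / L\<rfloor>)" for x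
  have per: "v (x + L) = v x" for x
  proof -
    have "(x + L) / L = x / L + 1" using L by (simp add: add_divide_distrib)
    then have "\<lfloor>(x + L) / L\<rfloor> = \<lfloor>x / L\<rfloor> + 1" by simp
    then show ?thesis by (simp add: v_def algebra_simps)
  qed
  have cell: "v x = u (x - of_int z * L)" if "of_int z * L \<le> x" "x \<le> of_int (z + 1) * L" for x z
  proof (cases "x = of_int (z + 1) * L")
    case True
    then have "\<lfloor>x / L\<rfloor> = z + 1" using L by simp
    then have "v x = u 0" using True by (simp add: v_def mult.commute)
    moreover have "x - of_int z * L = L" using True by (simp add: algebra_simps)
    ultimately show ?thesis using ends by simp
  next
    case False
    then have "x < of_int (z + 1) * L" using that by simp
    then have "of_int z \<le> x / L" "x / L < of_int z + 1" using that L by (simp_all add: pos_le_divide_eq pos_divide_less_eq)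
    then have "\<lfloor>x / L\<rfloor> = z" by (simp add: floor_eq_iff)
    then show ?thesis by (simp add: v_def mult.commute)
  qed
  have cont_cell: "continuous_on {of_int z * L..of_int (z + 1) * L} v" for z
  proof -
    have "continuous_on {of_int z * L..of_int (z + 1) * L} (\<lambda>x. u (x - of_int z * L))"
      by (rule continuous_on_compose2[OF u]) (auto intro!: continuous_intros simp: algebra_simps)
    then show ?thesis by (rule continuous_on_eq) (use cell[of z] in auto)
  qed
  have "isCont v x" for x
  proof -
    \<comment> \<open>The integer nearest to \<open>x / L\<close>, so that \<open>x\<close> is
      interior to the union of the two cells that meet at \<open>z * L\<close>.\<close>
    define z where "z = \<lfloor>x / L + 1/2\<rfloor>"
    have z: "of_int z \<le> x / L + 1/2" "x / L + 1/2 < of_int z + 1" unfolding z_def by linarith+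
    then have "of_int (z - 1) < x / L" "x / L < of_int (z + 1)" by auto
    then have x: "of_int (z - 1) * L < x" "x < of_int (z + 1) * L" using L by (simp_all only: pos_less_divide_eq pos_divide_less_eq)
    have "continuous_on ({of_int (z - 1) * L..of_int z * L} \<union> {of_int z * L..of_int (z + 1) * L}) v"
      using cont_cell[of "z - 1"] cont_cell[of z] by (intro continuous_on_closed_Un) auto
    then have "continuous_on {of_int (z - 1) * L<..<of_int (z + 1) * L} v"
      by (rule continuous_on_subset) auto
    then show ?thesis using x by (simp add: continuous_on_eq_continuous_at)
  qed
  then have "continuous_on UNIV v" by (simp add: continuous_on_eq_continuous_at)
  moreover have "v x = u x" if "x \<in> {0..L}" for x using cell[of 0 x] that by simp
  ultimately show ?thesis using that per by blast
qed

lemma signed_integral_continuous: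
  assumes k: "\<And>x y. k integrable_on {x..y}"
  shows "continuous_on UNIV (signed_integral k)"
proof -
  have "isCont (signed_integral k) t" for t
  proof -
    define B where "B = \<bar>t\<bar> + 1"
    have "continuous_on {-B..B} (\<lambda>x. integral {-B..x} k - integral {-B..0} k)"
      by (intro continuous_intros indefinite_integral_continuous_1 k)
    then have "continuous_on {-B..B} (signed_integral k)"
      by (rule continuous_on_eq) (subst signed_integral_eq[OF k, of "-B"], auto simp: B_def)
    then have "continuous_on {-B<..<B} (signed_integral k)" by (rule continuous_on_subset) auto
    moreover have "t \<in> {-B<..<B}" by (auto simp: B_def)
    ultimately show ?thesis by (simp add: continuous_on_eq_continuous_at)
  qed
  then show ?thesis by (simp add: continuous_on_eq_continuous_at)
qed

text \<open>Lets an angular distance below \<open>pi / 2\<close> persist along a sequence: a small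
  increment keeps it below \<open>3 * pi / 2\<close>, and positivity of the cosine restores the
  sharper bound.\<close>

lemma cos_pos_imp_small:
  fixes x :: real
  assumes "cos x > 0" "\<bar>x\<bar> < 3 * pi / 2" shows "\<bar>x\<bar> < pi / 2"
proof (rule ccontr)
  assume "\<not> \<bar>x\<bar> < pi / 2"
  then have "- (pi/2) \<le> \<bar>x\<bar> - pi" "\<bar>x\<bar> - pi \<le> pi/2" using assms(2) by linarith+
  then have "cos (\<bar>x\<bar> - pi) \<ge> 0" by (intro cos_ge_zero) auto
  moreover have "cos (\<bar>x\<bar> - pi) = - cos x" by (simp add: cos_diff)
  ultimately show False using assms(1) by simp
qed

lemma continuous_multiple_of_2pi_const:
  fixes d :: "real \<Rightarrow> real"
  assumes "continuous_on UNIV d" "\<And>x. \<exists>k::int. d x = 2 * pi * of_int k"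
  obtains k :: int where "\<And>x. d x = 2 * pi * of_int k"
proof -
  have "d constant_on UNIV"
  proof (rule continuous_discrete_range_constant[OF connected_UNIV assms(1)])
    fix x
    show "\<exists>e>0. \<forall>y. y \<in> UNIV \<and> d y \<noteq> d x \<longrightarrow> e \<le> norm (d y - d x)"
    proof (intro exI[of _ "2 * pi"] conjI allI impI)
      fix y assume ne: "y \<in> UNIV \<and> d y \<noteq> d x"
      obtain k1 k2 :: int where k: "d x = 2 * pi * of_int k1" "d y = 2 * pi * of_int k2" using assms(2) by meson
      then have "k2 - k1 \<noteq> 0" using ne by auto
      then have "1 \<le> \<bar>k2 - k1\<bar>" by linarith
      then have "1 \<le> \<bar>real_of_int (k2 - k1)\<bar>" by linarith
      then have "2 * pi * 1 \<le> 2 * pi * \<bar>real_of_int (k2 - k1)\<bar>" by (intro mult_left_mono) auto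
      also have "\<dots> = norm (d y - d x)" by (simp add: k abs_mult flip: right_diff_distrib)
      finally show "2 * pi \<le> norm (d y - d x)" by simp
    qed simp
  qed
  then obtain r where "\<And>x. d x = r" by (auto simp: constant_on_def)
  then show ?thesis using that assms(2)[of 0] by metis
qed

context potential_well
begin

text \<open>A continuous angle of the curve \<open>(w, yc u)\<close>. The radius is left free at
  each point; its positivity says that the curve avoids the origin.\<close>

definition lift :: "(real \<Rightarrow> real) \<Rightarrow> (real \<Rightarrow> real) \<Rightarrow> (real \<Rightarrow> real) \<Rightarrow> bool" where
  "lift u w \<theta> \<longleftrightarrow> continuous_on UNIV \<theta> \<and> (\<forall>x. \<exists>r>0. w x = r * cos (\<theta> x) \<and> yc (u x) = r * sin (\<theta> x))"

lemma lift_unique: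
  assumes "lift u w \<theta>\<^sub>1" "lift u w \<theta>\<^sub>2"
  obtains k :: int where "\<And>x. \<theta>\<^sub>1 x - \<theta>\<^sub>2 x = 2 * pi * of_int k"
proof (rule continuous_multiple_of_2pi_const[of "\<lambda>x. \<theta>\<^sub>1 x - \<theta>\<^sub>2 x"])
  show thesis if "\<And>x. \<theta>\<^sub>1 x - \<theta>\<^sub>2 x = 2 * pi * of_int k" for k :: int using that by (rule \<open>\<And>k::int. (\<And>x. \<theta>\<^sub>1 x - \<theta>\<^sub>2 x = 2 * pi * of_int k) \<Longrightarrow> thesis\<close>)
  show "continuous_on UNIV (\<lambda>x. \<theta>\<^sub>1 x - \<theta>\<^sub>2 x)" using assms by (auto simp: lift_def intro!: continuous_intros)
  fix x
  obtain r1 where r1: "r1 > 0" "w x = r1 * cos (\<theta>\<^sub>1 x)" "yc (u x) = r1 * sin (\<theta>\<^sub>1 x)" using assms(1) by (auto simp: lift_def)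
  obtain r2 where r2: "r2 > 0" "w x = r2 * cos (\<theta>\<^sub>2 x)" "yc (u x) = r2 * sin (\<theta>\<^sub>2 x)" using assms(2) by (auto simp: lift_def)
  have sq: "(w x)\<^sup>2 + (yc (u x))\<^sup>2 = r\<^sup>2" if "w x = r * cos t" "yc (u x) = r * sin t" for r t
  proof -
    have "(w x)\<^sup>2 + (yc (u x))\<^sup>2 = r\<^sup>2 * ((sin t)\<^sup>2 + (cos t)\<^sup>2)" unfolding that by algebra
    then show ?thesis by simp
  qed
  have "r1\<^sup>2 = r2\<^sup>2" using sq[OF r1(2,3)] sq[OF r2(2,3)] by simp
  then have "r1 = r2" using r1(1) r2(1) by (simp add: power2_eq_iff)
  then have "sin (\<theta>\<^sub>1 x) = sin (\<theta>\<^sub>2 x) \<and> cos (\<theta>\<^sub>1 x) = cos (\<theta>\<^sub>2 x)" using r1 r2 by auto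
  then obtain n :: int where "\<theta>\<^sub>1 x = \<theta>\<^sub>2 x + 2 * pi * of_int n" using sin_cos_eq_iff by metis
  then show "\<exists>k::int. \<theta>\<^sub>1 x - \<theta>\<^sub>2 x = 2 * pi * of_int k" by (intro exI[of _ n]) simp
qed

lemma lift_shift: "lift u w \<theta> \<Longrightarrow> lift (\<lambda>x. u (x + s)) (\<lambda>x. w (x + s)) (\<lambda>x. \<theta> (x + s))"
  unfolding lift_def
  using continuous_on_compose2[of UNIV \<theta> UNIV "\<lambda>x. x + s", OF _ continuous_on_add[OF continuous_on_id continuous_on_const]]
  by auto

definition winds :: "real \<Rightarrow> nat \<Rightarrow> (real \<Rightarrow> real) \<Rightarrow> (real \<Rightarrow> real) \<Rightarrow> bool" where
  "winds L j u w \<longleftrightarrow> (\<exists>\<theta>. lift u w \<theta> \<and> (\<forall>x. \<theta> (x + L) = \<theta> x + 2 * pi * real j))"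

lemma winds_unique:
  assumes "winds L j u w" "winds L k u w" shows "j = k"
proof -
  obtain \<theta>\<^sub>1 \<theta>\<^sub>2 where t: "lift u w \<theta>\<^sub>1" "\<And>x. \<theta>\<^sub>1 (x + L) = \<theta>\<^sub>1 x + 2 * pi * real j"
    "lift u w \<theta>\<^sub>2" "\<And>x. \<theta>\<^sub>2 (x + L) = \<theta>\<^sub>2 x + 2 * pi * real k" using assms by (auto simp: winds_def)
  obtain i :: int where "\<And>x. \<theta>\<^sub>1 x - \<theta>\<^sub>2 x = 2 * pi * of_int i" using lift_unique[OF t(1,3)] by blast
  from this[of L] this[of 0] have "2 * pi * real j = 2 * pi * real k"
    using t(2)[of 0] t(4)[of 0] unfolding add_0 by linarith
  then show ?thesis by simp
qed

lemma winds_shift: "winds L j u w \<Longrightarrow> winds L j (\<lambda>x. u (x + s)) (\<lambda>x. w (x + s))"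
  unfolding winds_def
proof (elim exE conjE)
  fix \<theta> assume "lift u w \<theta>" "\<forall>x. \<theta> (x + L) = \<theta> x + 2 * pi * real j"
  then show "\<exists>\<theta>. lift (\<lambda>x. u (x + s)) (\<lambda>x. w (x + s)) \<theta> \<and> (\<forall>x. \<theta> (x + L) = \<theta> x + 2 * pi * real j)"
    by (intro exI[of _ "\<lambda>x. \<theta> (x + s)"] conjI lift_shift allI) (auto simp: add.assoc add.commute[of L s], metis add.assoc)
qed

text \<open>A shift by \<open>i * p\<close> preserves the curve, so it changes the lift by
  \<open>2 * pi * k\<close> for an integer \<open>k\<close>. Applying it \<open>m\<close> times, or
  the shift by \<open>m * p\<close> in turn \<open>i\<close> times, reaches the same point; hence
  \<open>m * k = i * j\<close>, and coprimality gives the divisibility.\<close>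

lemma winds_minimal_period:
  assumes w: "winds (real m * p) j u w" and per: "\<And>x. u (x + real i * p) = u x" "\<And>x. w (x + real i * p) = w x"
    and cop: "coprime j m"
  shows "m dvd i"
proof -
  obtain \<theta> where t: "lift u w \<theta>" "\<And>x. \<theta> (x + real m * p) = \<theta> x + 2 * pi * real j" using w by (auto simp: winds_def)
  have "lift u w (\<lambda>x. \<theta> (x + real i * p))" using lift_shift[OF t(1), of "real i * p"] per by simp
  then obtain k :: int where k: "\<And>x. \<theta> (x + real i * p) - \<theta> x = 2 * pi * of_int k" using lift_unique[OF _ t(1)] by blast
  have a: "\<theta> (x + real n * (real i * p)) = \<theta> x + real n * (2 * pi * of_int k)" for n x
  proof (induction n)
    case (Suc n)
    then show ?case using k[of "x + real n * (real i * p)"] by (simp add: algebra_simps)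
  qed simp
  have b: "\<theta> (x + real n * (real m * p)) = \<theta> x + real n * (2 * pi * real j)" for n x
  proof (induction n)
    case (Suc n)
    then show ?case using t(2)[of "x + real n * (real m * p)"] by (simp add: algebra_simps)
  qed simp
  have "real m * (2 * pi * of_int k) = real i * (2 * pi * real j)"
    using a[of 0 m] b[of 0 i] by (simp add: algebra_simps)
  then have "2 * pi * (real_of_int (int m * k) - real_of_int (int i * int j)) = 0" by (simp add: algebra_simps)
  then have "real_of_int (int m * k) = real_of_int (int i * int j)" by simp
  then have "int m * k = int i * int j" by (rule of_int_eq_iff[THEN iffD1])
  then have "int m dvd int (i * j)" by (metis dvd_triv_left of_nat_mult)
  then have "m dvd i * j" by (simp only: int_dvd_int_iff)
  then show ?thesis using cop by (simp add: coprime_commute coprime_dvd_mult_left_iff)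
qed

end

section \<open>Periodic solutions with prescribed winding number\<close>

context kicked_well
begin

text \<open>By \<open>fF\<close>, the term \<open>h * f q + e * F q\<close> with \<open>e\<close>
  the integral of \<open>n - \<nu>\<close> over a cell equals the integral of \<open>n\<close> times
  \<open>F q\<close> minus \<open>h * g * q\<close>, so the kicked scheme is the Euler scheme for
  the weight \<open>n\<close>. For every grid the kicks sum to at most the integral of
  \<open>\<bar>n - \<nu>\<bar>\<close> over \<open>{0..L}\<close>.\<close>

lemma winding_solution_exists:
  assumes fF: "\<And>q. f q = \<nu> * F q - g * q"
    and r12: "0 < r\<^sub>1" "r\<^sub>1 < r\<^sub>2" "r\<^sub>2 < R" and L: "L > 0"
    and T12: "real j * T r\<^sub>1 < L" "L < real j * T r\<^sub>2"
  shows "\<exists>\<epsilon>>0. \<forall>n. (\<forall>x y. n absolutely_integrable_on {x..y}) \<longrightarrow> (\<forall>x. n (x + L) = n x) \<longrightarrow>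
     integral {0..L} (\<lambda>x. \<bar>n x - \<nu>\<bar>) \<le> \<epsilon> \<longrightarrow>
     (\<exists>u w. (\<forall>x. (u has_real_derivative w x) (at x)) \<and>
        (\<forall>x y. x \<le> y \<longrightarrow> ((\<lambda>t. g * u t - n t * F (u t)) has_integral (w y - w x)) {x..y}) \<and>
        (\<forall>x. u (x + L) = u x) \<and> (\<forall>x. w (x + L) = w x) \<and> (\<forall>x. l < u x \<and> u x < b) \<and> winds L j u w)"
proof -
  obtain \<rho>\<^sub>1 \<rho>\<^sub>2 \<epsilon> N\<^sub>0 where \<rho>: "0 < \<rho>\<^sub>1" "\<rho>\<^sub>1 \<le> \<rho>\<^sub>2" "\<rho>\<^sub>2 < R" and \<epsilon>: "0 < \<epsilon>"
    and orb': "\<forall>N e. N\<^sub>0 \<le> N \<longrightarrow> (\<Sum>i<N. \<bar>e i\<bar>) \<le> \<epsilon> \<longrightarrow>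
     N > 0 \<and> (\<exists>q p r t. (\<forall>i<N. p (Suc i) = kick_p (L / real N) (e i) (q i) (p i) \<and> q (Suc i) = q i + L / real N * p (Suc i)
          \<and> \<bar>t (Suc i) - t i\<bar> < 1/2) \<and>
       (\<forall>i\<le>N. \<rho>\<^sub>1 \<le> r i \<and> r i \<le> \<rho>\<^sub>2 \<and> p i = r i * cos (t i) \<and> q i = Q (r i * sin (t i))) \<and>
       q N = q 0 \<and> p N = p 0 \<and> t N = t 0 + 2 * pi * real j)"
    using discrete_orbits[OF r12 L T12] by (elim exE conjE)
  note orb = orb'[THEN spec, THEN spec, THEN mp, THEN mp]
  have \<rho>2: "0 < \<rho>\<^sub>2" using \<rho> by linarith
  have "\<exists>u w. (\<forall>x. (u has_real_derivative w x) (at x)) \<and>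
        (\<forall>x y. x \<le> y \<longrightarrow> ((\<lambda>t. g * u t - n t * F (u t)) has_integral (w y - w x)) {x..y}) \<and>
        (\<forall>x. u (x + L) = u x) \<and> (\<forall>x. w (x + L) = w x) \<and> (\<forall>x. l < u x \<and> u x < b) \<and> winds L j u w"
    if n: "\<And>x y. n absolutely_integrable_on {x..y}" and n_per: "\<And>x. n (x + L) = n x"
      and n_small: "integral {0..L} (\<lambda>x. \<bar>n x - \<nu>\<bar>) \<le> \<epsilon>" for n
  proof -
    define e where "e N i = integral {real i * (L / real N)..real (Suc i) * (L / real N)} (\<lambda>s. n s - \<nu>)" for N i
    have n\<nu>: "(\<lambda>s. n s - \<nu>) absolutely_integrable_on {x..y}" for x y
      by (intro set_integral_diff(1) n absolutely_integrable_continuous_real) auto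
    have n_i: "n integrable_on {x..y}" and n\<nu>_i: "(\<lambda>s. n s - \<nu>) integrable_on {x..y}"
      and n\<nu>_a: "(\<lambda>s. \<bar>n s - \<nu>\<bar>) integrable_on {x..y}" for x y
      using n[of x y] n\<nu>[of x y] by (auto simp: absolutely_integrable_on_def)
    have e_sum: "(\<Sum>i<N. \<bar>e N i\<bar>) \<le> \<epsilon>" for N
    proof (cases "N = 0")
      case False
      have "(\<Sum>i<N. \<bar>e N i\<bar>) \<le> (\<Sum>i<N. integral {real i * (L / real N)..real (Suc i) * (L / real N)} (\<lambda>s. \<bar>n s - \<nu>\<bar>))"
        unfolding e_def
        by (intro sum_mono integral_norm_bound_integral[where 'a = real, unfolded real_norm_def] n\<nu>_i n\<nu>_a) auto
      also have "\<dots> = integral {0..real N * (L / real N)} (\<lambda>s. \<bar>n s - \<nu>\<bar>)"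
        by (rule integral_grid[of N]) (use n\<nu>_a L in auto)
      also have "\<dots> \<le> \<epsilon>" using False n_small by simp
      finally show ?thesis .
    qed (use \<epsilon> in simp)
    have "\<forall>N. \<exists>q p r t. N\<^sub>0 \<le> N \<longrightarrow> (\<forall>i<N. p (Suc i) = kick_p (L / real N) (e N i) (q i) (p i) \<and> q (Suc i) = q i + L / real N * p (Suc i)
          \<and> \<bar>t (Suc i) - t i\<bar> < 1/2) \<and>
       (\<forall>i\<le>N. \<rho>\<^sub>1 \<le> r i \<and> r i \<le> \<rho>\<^sub>2 \<and> p i = r i * cos (t i) \<and> q i = Q (r i * sin (t i))) \<and>
       q N = q 0 \<and> p N = p 0 \<and> t N = t 0 + 2 * pi * real j"
      using orb[OF _ e_sum] by blast
    then obtain q p r t where all: "\<And>N. N\<^sub>0 \<le> N \<Longrightarrow> (\<forall>i<N. p N (Suc i) = kick_p (L / real N) (e N i) (q N i) (p N i)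
          \<and> q N (Suc i) = q N i + L / real N * p N (Suc i) \<and> \<bar>t N (Suc i) - t N i\<bar> < 1/2) \<and>
       (\<forall>i\<le>N. \<rho>\<^sub>1 \<le> r N i \<and> r N i \<le> \<rho>\<^sub>2 \<and> p N i = r N i * cos (t N i) \<and> q N i = Q (r N i * sin (t N i))) \<and>
       q N N = q N 0 \<and> p N N = p N 0 \<and> t N N = t N 0 + 2 * pi * real j"
      by metis
    have step: "p N (Suc i) = kick_p (L / real N) (e N i) (q N i) (p N i)" "q N (Suc i) = q N i + L / real N * p N (Suc i)"
        "\<bar>t N (Suc i) - t N i\<bar> < 1/2" if "N\<^sub>0 \<le> N" "i < N" for N i using all[OF that(1)] that(2) by auto
    have pt: "\<rho>\<^sub>1 \<le> r N i" "r N i \<le> \<rho>\<^sub>2" "p N i = r N i * cos (t N i)" "q N i = Q (r N i * sin (t N i))"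
      if "N\<^sub>0 \<le> N" "i \<le> N" for N i using all[OF that(1)] that(2) by auto
    have clos: "q N N = q N 0" "p N N = p N 0" "t N N = t N 0 + 2 * pi * real j" if "N\<^sub>0 \<le> N" for N using all[OF that] by auto
    define lo hi where "lo = Q (- \<rho>\<^sub>2)" and "hi = Q \<rho>\<^sub>2"
    have lohi: "l < lo" "hi < b" using Q_props[of "- \<rho>\<^sub>2"] Q_props[of \<rho>\<^sub>2] \<rho> \<rho>2 by (auto simp: lo_def hi_def)
    have good: "q N i \<in> {lo..hi}" "\<bar>p N i\<bar> \<le> \<rho>\<^sub>2" "yc (q N i) = r N i * sin (t N i)" "(p N i)\<^sup>2 + (yc (q N i))\<^sup>2 = (r N i)\<^sup>2"
      if N: "N\<^sub>0 \<le> N" "i \<le> N" for N i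
    proof -
      note P = pt[OF N]
      have r0: "r N i > 0" using P(1) \<rho> by linarith
      have y: "\<bar>r N i * sin (t N i)\<bar> \<le> \<rho>\<^sub>2" using polar_le[OF r0, of "t N i"] P(2) by linarith
      then have yR: "\<bar>r N i * sin (t N i)\<bar> < R" using \<rho> by linarith
      show "q N i \<in> {lo..hi}" unfolding P(4) lo_def hi_def using y yR \<rho> \<rho>2 by (auto intro!: Q_mono)
      have "\<bar>p N i\<bar> \<le> r N i" unfolding P(3) using r0 by (simp add: abs_mult mult_left_le)
      then show "\<bar>p N i\<bar> \<le> \<rho>\<^sub>2" using P(2) by linarith
      show yq: "yc (q N i) = r N i * sin (t N i)" unfolding P(4) by (rule yc_Q[OF yR])
      have "(p N i)\<^sup>2 + (yc (q N i))\<^sup>2 = (r N i)\<^sup>2 * ((sin (t N i))\<^sup>2 + (cos (t N i))\<^sup>2)" unfolding yq P(3) by algebra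
      then show "(p N i)\<^sup>2 + (yc (q N i))\<^sup>2 = (r N i)\<^sup>2" by simp
    qed
    \<comment> \<open>Starting the sequence of grids at \<open>N\<^sub>0\<close> makes a closed
      orbit available for every index.\<close>
    define Ns where "Ns m = N\<^sub>0 + m" for m
    have Ns: "N\<^sub>0 \<le> Ns m" "Ns m > 0" for m using orb[OF _ e_sum[of "N\<^sub>0 + m"]] by (auto simp: Ns_def)
    have "\<exists>u w. \<exists>\<sigma> :: nat \<Rightarrow> nat. strict_mono \<sigma> \<and> continuous_on {0..L} u \<and> continuous_on {0..L} w \<and>
     (\<forall>t\<in>{0..L}. w t = w 0 + integral {0..t} (\<lambda>s. g * u s - n s * F (u s))) \<and>
     (\<forall>t\<in>{0..L}. u t = u 0 + integral {0..t} w) \<and>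
     (\<forall>\<eta>>0. \<exists>M. \<forall>m\<ge>M. \<forall>i\<le>Ns (\<sigma> m). \<bar>q (Ns (\<sigma> m)) i - u (real i * (L / real (Ns (\<sigma> m))))\<bar> \<le> \<eta> \<and>
        \<bar>p (Ns (\<sigma> m)) i - w (real i * (L / real (Ns (\<sigma> m))))\<bar> \<le> \<eta>)"
    proof (rule euler_limit[where K = \<rho>\<^sub>2 and K' = "\<bar>lo\<bar> + \<bar>hi\<bar>"])
      show "filterlim Ns at_top sequentially" unfolding Ns_def[abs_def] by (rule filterlim_add_const_nat_at_top[where c = N\<^sub>0, unfolded add.commute[of _ N\<^sub>0]])
      show "q (Ns m) (Suc i) = q (Ns m) i + L / real (Ns m) * p (Ns m) (Suc i)" if "i < Ns m" for m i
        by (rule step(2)[OF Ns(1) that])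
      show "p (Ns m) (Suc i) = p (Ns m) i + L / real (Ns m) * (g * q (Ns m) i)
        - integral {real i * (L / real (Ns m))..real (Suc i) * (L / real (Ns m))} n * F (q (Ns m) i)" if i: "i < Ns m" for m i
      proof -
        define h where "h = L / real (Ns m)"
        have le: "real i * h \<le> real (Suc i) * h" and len: "real (Suc i) * h - real i * h = h"
        proof -
          have "h > 0" using L Ns(2)[of m] by (simp add: h_def)
          then show "real i * h \<le> real (Suc i) * h" "real (Suc i) * h - real i * h = h" by (simp_all add: algebra_simps)
        qed
        have "e (Ns m) i = integral {real i * h..real (Suc i) * h} n - integral {real i * h..real (Suc i) * h} (\<lambda>_. \<nu>)"
          unfolding e_def h_def[symmetric] by (rule Henstock_Kurzweil_Integration.integral_diff) (use n_i in auto)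
        also have "integral {real i * h..real (Suc i) * h} (\<lambda>_. \<nu>) = h * \<nu>"
          using le len by (simp del: of_nat_Suc)
        finally have e: "e (Ns m) i = integral {real i * h..real (Suc i) * h} n - h * \<nu>" .
        show ?thesis
          unfolding step(1)[OF Ns(1) i] kick_p_def h_def[symmetric] e fF by (simp add: algebra_simps)
      qed
      show "\<bar>p (Ns m) i\<bar> \<le> \<rho>\<^sub>2" if "i \<le> Ns m" for m i by (rule good(2)[OF Ns(1) that])
      show "\<bar>q (Ns m) i\<bar> \<le> \<bar>lo\<bar> + \<bar>hi\<bar>" if "i \<le> Ns m" for m i using good(1)[OF Ns(1) that] by auto
    qed (use L n F_cont Ns in auto)
    then obtain u0 w0 and \<sigma> :: "nat \<Rightarrow> nat" where \<sigma>: "strict_mono \<sigma>" and u0: "continuous_on {0..L} u0" and w0: "continuous_on {0..L} w0"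
      and w_eq: "\<And>t. t \<in> {0..L} \<Longrightarrow> w0 t = w0 0 + integral {0..t} (\<lambda>s. g * u0 s - n s * F (u0 s))"
      and u_eq: "\<And>t. t \<in> {0..L} \<Longrightarrow> u0 t = u0 0 + integral {0..t} w0"
      and lim: "\<And>\<eta>. \<eta> > 0 \<Longrightarrow> \<exists>M. \<forall>m\<ge>M. \<forall>i\<le>Ns (\<sigma> m). \<bar>q (Ns (\<sigma> m)) i - u0 (real i * (L / real (Ns (\<sigma> m))))\<bar> \<le> \<eta> \<and>
        \<bar>p (Ns (\<sigma> m)) i - w0 (real i * (L / real (Ns (\<sigma> m))))\<bar> \<le> \<eta>" by blast
    have approx: "\<exists>N\<ge>N\<^sub>0. N > 0 \<and> L / real N < d \<and> (\<forall>i\<le>N. \<bar>q N i - u0 (real i * (L / real N))\<bar> \<le> \<eta> \<and> \<bar>p N i - w0 (real i * (L / real N))\<bar> \<le> \<eta>)"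
      if \<eta>: "\<eta> > 0" and d: "d > 0" for \<eta> d
    proof -
      obtain M where M: "\<And>m. m \<ge> M \<Longrightarrow> \<forall>i\<le>Ns (\<sigma> m). \<bar>q (Ns (\<sigma> m)) i - u0 (real i * (L / real (Ns (\<sigma> m))))\<bar> \<le> \<eta> \<and>
        \<bar>p (Ns (\<sigma> m)) i - w0 (real i * (L / real (Ns (\<sigma> m))))\<bar> \<le> \<eta>" using lim[OF \<eta>] by blast
      obtain M' :: nat where M': "L / d < real M'" using reals_Archimedean2 by blast
      define m where "m = max M M'"
      have "m \<le> \<sigma> m" using \<sigma> by (rule seq_suble)
      then have "real M' \<le> real (Ns (\<sigma> m))" by (simp add: Ns_def m_def)
      then have "L / d < real (Ns (\<sigma> m))" using M' by linarith
      then have "L / real (Ns (\<sigma> m)) < d" using d Ns(2)[of "\<sigma> m"] by (simp add: field_simps)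
      then show ?thesis using M[of m] Ns[of "\<sigma> m"] by (intro exI[of _ "Ns (\<sigma> m)"]) (simp add: m_def)
    qed
    have gridL: "real i * (L / real N) \<in> {0..L}" if "i \<le> N" "N > 0" for i N
    proof -
      have "real i * (L / real N) \<le> real N * (L / real N)" using that L by (intro mult_right_mono) auto
      then show ?thesis using that L by simp
    qed
    have uu: "uniformly_continuous_on {0..L} u0" and uw: "uniformly_continuous_on {0..L} w0"
      by (intro compact_uniformly_continuous u0 w0; simp)+
    \<comment> \<open>Every point of the limit curve is a limit of points of discrete orbits, so the
      closed conditions that confine those orbits to an annulus are inherited.\<close>
    have dense: "\<exists>N i. N\<^sub>0 \<le> N \<and> i \<le> N \<and> \<bar>q N i - u0 s\<bar> < \<eta> \<and> \<bar>p N i - w0 s\<bar> < \<eta>" if s: "s \<in> {0..L}" and \<eta>: "\<eta> > 0" for s \<eta>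
    proof -
      obtain d1 where d1: "d1 > 0" "\<And>x y. x \<in> {0..L} \<Longrightarrow> y \<in> {0..L} \<Longrightarrow> dist y x < d1 \<Longrightarrow> dist (u0 y) (u0 x) < \<eta>/2"
        using uu \<eta> unfolding uniformly_continuous_on_def by (metis half_gt_zero)
      obtain d2 where d2: "d2 > 0" "\<And>x y. x \<in> {0..L} \<Longrightarrow> y \<in> {0..L} \<Longrightarrow> dist y x < d2 \<Longrightarrow> dist (w0 y) (w0 x) < \<eta>/2"
        using uw \<eta> unfolding uniformly_continuous_on_def by (metis half_gt_zero)
      have "\<eta>/3 > 0" "min d1 d2 > 0" using \<eta> d1 d2 by auto
      from approx[OF this] obtain N where N: "N\<^sub>0 \<le> N" "N > 0" "L / real N < min d1 d2"
        "\<And>i. i \<le> N \<Longrightarrow> \<bar>q N i - u0 (real i * (L / real N))\<bar> \<le> \<eta>/3 \<and> \<bar>p N i - w0 (real i * (L / real N))\<bar> \<le> \<eta>/3" by blast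
      define h where "h = L / real N"
      have h: "h > 0" "real N * h = L" using L N by (auto simp: h_def)
      define k where "k = nat \<lfloor>s / h\<rfloor>"
      have "s / h \<ge> 0" using s h by simp
      then have "real k \<le> s / h" "s / h < real k + 1" unfolding k_def by linarith+
      then have k: "real k * h \<le> s" "s < (real k + 1) * h" using h(1) by (simp_all add: pos_le_divide_eq pos_divide_less_eq)
      have "real k * h \<le> real N * h" using k(1) s h(2) by simp
      then have kN: "k \<le> N" using h(1) by simp
      have "\<bar>real k * h - s\<bar> < d1" "\<bar>real k * h - s\<bar> < d2" using k N(3) by (auto simp: h_def[symmetric] algebra_simps)
      then have "\<bar>u0 (real k * h) - u0 s\<bar> < \<eta>/2" "\<bar>w0 (real k * h) - w0 s\<bar> < \<eta>/2"
        using d1(2)[OF s gridL[OF kN N(2)]] d2(2)[OF s gridL[OF kN N(2)]] by (auto simp: dist_real_def h_def)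
      moreover have "\<bar>q N k - u0 (real k * h)\<bar> \<le> \<eta>/3" "\<bar>p N k - w0 (real k * h)\<bar> \<le> \<eta>/3" using N(4)[OF kN] by (auto simp: h_def)
      ultimately have "\<bar>q N k - u0 s\<bar> < \<eta>" "\<bar>p N k - w0 s\<bar> < \<eta>" using \<eta> by linarith+
      then show ?thesis using N(1) kN by blast
    qed
    have in_annulus: "u0 s \<in> {lo..hi} \<and> \<rho>\<^sub>1\<^sup>2 \<le> (w0 s)\<^sup>2 + (yc (u0 s))\<^sup>2 \<and> (w0 s)\<^sup>2 + (yc (u0 s))\<^sup>2 \<le> \<rho>\<^sub>2\<^sup>2" if s: "s \<in> {0..L}" for s
    proof -
      have "\<forall>m. \<exists>N i. N\<^sub>0 \<le> N \<and> i \<le> N \<and> \<bar>q N i - u0 s\<bar> < inverse (real (Suc m)) \<and> \<bar>p N i - w0 s\<bar> < inverse (real (Suc m))"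
        using dense[OF s] by simp
      then obtain Nm im where a: "\<And>m. N\<^sub>0 \<le> Nm m" "\<And>m. im m \<le> Nm m"
        "\<And>m. \<bar>q (Nm m) (im m) - u0 s\<bar> < inverse (real (Suc m))" "\<And>m. \<bar>p (Nm m) (im m) - w0 s\<bar> < inverse (real (Suc m))" by metis
      have qs: "(\<lambda>m. q (Nm m) (im m)) \<longlonglongrightarrow> u0 s"
        by (rule LIM_zero_cancel, rule Lim_null_comparison[OF _ LIMSEQ_inverse_real_of_nat]) (use a(3) in \<open>auto intro!: always_eventually less_imp_le\<close>)
      have ps: "(\<lambda>m. p (Nm m) (im m)) \<longlonglongrightarrow> w0 s"
        by (rule LIM_zero_cancel, rule Lim_null_comparison[OF _ LIMSEQ_inverse_real_of_nat]) (use a(4) in \<open>auto intro!: always_eventually less_imp_le\<close>)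
      have us: "u0 s \<in> {lo..hi}"
        by (rule closed_sequentially[OF closed_atLeastAtMost _ qs]) (use good(1) a in auto)
      have "isCont yc (u0 s)" using us lohi by (intro yc_isCont) auto
      then have "(\<lambda>m. yc (q (Nm m) (im m))) \<longlonglongrightarrow> yc (u0 s)" using qs by (rule isCont_tendsto_compose)
      then have lm: "(\<lambda>m. (p (Nm m) (im m))\<^sup>2 + (yc (q (Nm m) (im m)))\<^sup>2) \<longlonglongrightarrow> (w0 s)\<^sup>2 + (yc (u0 s))\<^sup>2"
        using ps by (intro tendsto_intros)
      have bnds: "\<rho>\<^sub>1\<^sup>2 \<le> (p (Nm m) (im m))\<^sup>2 + (yc (q (Nm m) (im m)))\<^sup>2" "(p (Nm m) (im m))\<^sup>2 + (yc (q (Nm m) (im m)))\<^sup>2 \<le> \<rho>\<^sub>2\<^sup>2" for m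
        unfolding good(4)[OF a(1,2)] using pt(1,2)[OF a(1,2)[of m]] \<rho> by (auto intro!: power_mono)
      show ?thesis using us LIMSEQ_le_const[OF lm, of "\<rho>\<^sub>1\<^sup>2"] LIMSEQ_le_const2[OF lm, of "\<rho>\<^sub>2\<^sup>2"] bnds by blast
    qed
    have ends: "u0 0 = u0 L" "w0 0 = w0 L"
    proof -
      have "\<bar>u0 0 - u0 L\<bar> \<le> \<eta> \<and> \<bar>w0 0 - w0 L\<bar> \<le> \<eta>" if "\<eta> > 0" for \<eta>
      proof -
        have "\<eta>/2 > 0" "(1::real) > 0" using that by auto
        from approx[OF this] obtain N where N: "N\<^sub>0 \<le> N" "N > 0"
        "\<And>i. i \<le> N \<Longrightarrow> \<bar>q N i - u0 (real i * (L / real N))\<bar> \<le> \<eta>/2 \<and> \<bar>p N i - w0 (real i * (L / real N))\<bar> \<le> \<eta>/2" by blast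
        have "real N * (L / real N) = L" using N(2) by simp
        then have "\<bar>q N 0 - u0 L\<bar> \<le> \<eta>/2" "\<bar>p N 0 - w0 L\<bar> \<le> \<eta>/2"
          using N(3)[of N] clos(1,2)[OF N(1)] by auto
        moreover have "\<bar>q N 0 - u0 0\<bar> \<le> \<eta>/2" "\<bar>p N 0 - w0 0\<bar> \<le> \<eta>/2" using N(3)[of 0] by auto
        ultimately show ?thesis by (intro conjI) linarith+
      qed
      then have "\<bar>u0 0 - u0 L\<bar> \<le> 0 \<and> \<bar>w0 0 - w0 L\<bar> \<le> 0" using field_le_epsilon[of "\<bar>u0 0 - u0 L\<bar>" 0] field_le_epsilon[of "\<bar>w0 0 - w0 L\<bar>" 0] by auto
      then show "u0 0 = u0 L" "w0 0 = w0 L" by auto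
    qed
    obtain u where u: "continuous_on UNIV u" "\<And>x. u (x + L) = u x" "\<And>x. x \<in> {0..L} \<Longrightarrow> u x = u0 x"
      using continuous_periodic_extension[OF L u0 ends(1)] by blast
    define kf where "kf s = g * u s - n s * F (u s)" for s
    have kf_int: "kf integrable_on {x..y}" for x y
    proof -
      have "continuous_on {x..y} (\<lambda>s. F (u s))"
        by (rule continuous_on_compose2[OF F_cont continuous_on_subset[OF u(1)]]) auto
      then have "(\<lambda>s. n s * F (u s)) absolutely_integrable_on {x..y}"
        by (rule absolutely_integrable_mult_continuous[OF n])
      moreover have "(\<lambda>s. g * u s) integrable_on {x..y}"
        by (intro integrable_continuous_real continuous_intros continuous_on_subset[OF u(1)]) auto
      ultimately show ?thesis unfolding kf_def
        using integrable_diff set_lebesgue_integral_eq_integral(1) by blast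
    qed
    define w where "w s = w0 0 + signed_integral kf s" for s
    have w_w0: "w s = w0 s" if s: "s \<in> {0..L}" for s
    proof -
      have "integral {0..s} kf = integral {0..s} (\<lambda>s. g * u0 s - n s * F (u0 s))"
        by (rule integral_cong) (use u(3) s in \<open>auto simp: kf_def\<close>)
      then show ?thesis using w_eq[OF s] s by (simp add: w_def signed_integral_nonneg)
    qed
    have w_cont: "continuous_on UNIV w" unfolding w_def by (intro continuous_intros signed_integral_continuous kf_int)
    have w_per: "w (x + L) = w x" for x
    proof -
      have "signed_integral kf L = 0" using w_w0[of L] ends(2) L by (simp add: w_def)
      moreover have "signed_integral kf (x + L) = signed_integral kf x + signed_integral kf L"
        by (rule signed_integral_periodic[OF kf_int]) (simp add: kf_def u(2) n_per)
      ultimately show ?thesis by (simp add: w_def)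
    qed
    have w_int: "w integrable_on {x..y}" for x y
      by (rule integrable_continuous_real[OF continuous_on_subset[OF w_cont]]) simp
    have u_w: "u s = u 0 + signed_integral w s" if s: "s \<in> {0..L}" for s
    proof -
      have "integral {0..s} w = integral {0..s} w0" by (rule integral_cong) (use w_w0 s in auto)
      then show ?thesis using u_eq[OF s] s u(3)[of s] u(3)[of 0] L by (simp add: signed_integral_nonneg)
    qed
    have period: "\<exists>y\<in>{0..L}. \<exists>z::int. x = y + of_int z * L" for x
    proof (intro bexI exI)
      show "x = (x - of_int \<lfloor>x / L\<rfloor> * L) + of_int \<lfloor>x / L\<rfloor> * L" by simp
      have "of_int \<lfloor>x / L\<rfloor> \<le> x / L" "x / L < of_int \<lfloor>x / L\<rfloor> + 1" by linarith+
      then have "of_int \<lfloor>x / L\<rfloor> * L \<le> x" "x < (of_int \<lfloor>x / L\<rfloor> + 1) * L"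
        using pos_le_divide_eq[OF L] pos_divide_less_eq[OF L] by blast+
      then show "x - of_int \<lfloor>x / L\<rfloor> * L \<in> {0..L}" by (simp add: algebra_simps)
    qed
    \<comment> \<open>The identity is known on one period. It extends because the integral of
      \<open>w\<close> over a period vanishes, which makes the defect \<open>D\<close>
      periodic.\<close>
    have u_eq_all: "u x = u 0 + signed_integral w x" for x
    proof -
      define D where "D s = u s - u 0 - signed_integral w s" for s
      have "signed_integral w L = 0" using u_w[of L] u(3)[of L] u(3)[of 0] ends(1) L by simp
      then have "D (s + L) = D s" for s
        using signed_integral_periodic[OF w_int w_per] by (simp add: D_def u(2))
      note per = periodic_int_shift[of D, OF this]
      obtain y z where y: "y \<in> {0..L}" "x = y + of_int z * L" using period by blast
      then have "D x = D y" using per by simp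
      also have "\<dots> = 0" using u_w[OF y(1)] by (simp add: D_def)
      finally show ?thesis by (simp add: D_def)
    qed
    have u_deriv: "(u has_real_derivative w x) (at x)" for x
    proof -
      have "((\<lambda>x. u 0 + signed_integral w x) has_real_derivative 0 + w x) (at x)"
        by (intro DERIV_add DERIV_const signed_integral_deriv w_cont)
      moreover have "(\<lambda>x. u 0 + signed_integral w x) = u" by (rule ext) (rule u_eq_all[symmetric])
      ultimately show ?thesis by simp
    qed
    have w_sol: "((\<lambda>t. g * u t - n t * F (u t)) has_integral (w y - w x)) {x..y}" if "x \<le> y" for x y
      using integrable_integral[OF kf_int[of x y]] signed_integral_diff[OF kf_int that] by (simp add: w_def kf_def[abs_def])
    have reduce: "\<exists>y\<in>{0..L}. u x = u0 y \<and> w x = w0 y" for x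
    proof -
      obtain y z where y: "y \<in> {0..L}" "x = y + of_int z * L" using period by blast
      then have "u x = u y" "w x = w y" using periodic_int_shift[of u, OF u(2)] periodic_int_shift[of w, OF w_per] by auto
      then show ?thesis using y u(3)[OF y(1)] w_w0[OF y(1)] by auto
    qed
    have ann: "u x \<in> {lo..hi} \<and> \<rho>\<^sub>1\<^sup>2 \<le> (w x)\<^sup>2 + (yc (u x))\<^sup>2 \<and> (w x)\<^sup>2 + (yc (u x))\<^sup>2 \<le> \<rho>\<^sub>2\<^sup>2" for x
      using reduce[of x] in_annulus by metis
    have ub: "l < u x" "u x < b" for x using ann[of x] lohi by auto
    have ycu_cont: "continuous_on UNIV (\<lambda>x. yc (u x))"
    proof (rule continuous_on_compose2[of "{lo..hi}" yc])
      show "continuous_on {lo..hi} yc" using lohi by (intro continuous_at_imp_continuous_on) (auto intro!: yc_isCont)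
    qed (use u(1) ann in auto)
    \<comment> \<open>The curve read as a nonvanishing complex function on the line; the imaginary
      part of a continuous logarithm is the lifted angle.\<close>
    define \<zeta> where "\<zeta> x = Complex (w x) (yc (u x))" for x
    have "continuous_on UNIV \<zeta>"
      unfolding \<zeta>_def Complex_eq by (intro continuous_intros w_cont ycu_cont)
    moreover have "\<zeta> x \<noteq> 0" for x
    proof
      assume "\<zeta> x = 0"
      then have "w x = 0" "yc (u x) = 0" by (auto simp: \<zeta>_def complex_eq_iff)
      then show False using ann[of x] \<rho> by simp
    qed
    ultimately obtain lg where lg: "continuous_on UNIV lg" "\<And>x. \<zeta> x = exp (lg x)"
      using continuous_logarithm_on_contractible[of UNIV \<zeta>] convex_imp_contractible[OF convex_UNIV] by auto
    define \<theta> where "\<theta> x = Im (lg x)" for x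
    have lift: "lift u w \<theta>"
      unfolding lift_def
    proof (intro conjI allI)
      show "continuous_on UNIV \<theta>" unfolding \<theta>_def by (intro continuous_intros lg(1))
      show "\<exists>r>0. w x = r * cos (\<theta> x) \<and> yc (u x) = r * sin (\<theta> x)" for x
      proof (intro exI[of _ "exp (Re (lg x))"] conjI)
        have "w x = Re (\<zeta> x)" "yc (u x) = Im (\<zeta> x)" by (auto simp: \<zeta>_def)
        then show "w x = exp (Re (lg x)) * cos (\<theta> x)" "yc (u x) = exp (Re (lg x)) * sin (\<theta> x)"
          unfolding lg(2) \<theta>_def by (simp_all add: Re_exp Im_exp)
      qed simp
    qed
    have "lift u w (\<lambda>x. \<theta> (x + L))" using lift_shift[OF lift, of L] by (simp add: u(2) w_per)
    then obtain k :: int where k: "\<And>x. \<theta> (x + L) - \<theta> x = 2 * pi * of_int k" using lift_unique[OF _ lift] by blast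
    \<comment> \<open>The discrete lifted angles stay within \<open>pi / 2\<close> of the lift of the limit.\<close>
    have kj: "k = int j"
    proof -
      \<comment> \<open>Small enough that the inner product of a discrete point and the
        corresponding limit point remains positive: the latter has squared norm at least
        \<open>\<rho>\<^sub>1^2\<close>, and the errors amount to at most
        \<open>2 * (\<eta> * \<rho>\<^sub>2)\<close>.\<close>
      define \<eta> where "\<eta> = \<rho>\<^sub>1\<^sup>2 / (4 * (\<rho>\<^sub>2 + 1))"
      have \<eta>: "\<eta> > 0" using \<rho> \<rho>2 by (simp add: \<eta>_def)
      have \<eta>2: "2 * (\<eta> * \<rho>\<^sub>2) < \<rho>\<^sub>1\<^sup>2"
      proof -
        have "2 * (\<eta> * \<rho>\<^sub>2) \<le> 2 * (\<eta> * (\<rho>\<^sub>2 + 1))" using \<eta> by simp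
        also have "\<dots> = \<rho>\<^sub>1\<^sup>2 / 2" 
        proof -
          have "2 * (a / (4 * x) * x) = a / 2" if "x > 0" for a x :: real using that by simp
          from this[of "\<rho>\<^sub>2 + 1" "\<rho>\<^sub>1\<^sup>2"] show ?thesis using \<rho>2 by (simp only: \<eta>_def)
        qed
        also have "\<dots> < \<rho>\<^sub>1\<^sup>2" using \<rho> by simp
        finally show ?thesis .
      qed
      have "uniformly_continuous_on {0..L} \<theta>"
        using lift by (intro compact_uniformly_continuous) (auto simp: lift_def intro: continuous_on_subset)
      moreover have "(1/2 :: real) > 0" by simp
      ultimately obtain d1 where d1: "d1 > 0" "\<And>x y. x \<in> {0..L} \<Longrightarrow> y \<in> {0..L} \<Longrightarrow> dist y x < d1 \<Longrightarrow> dist (\<theta> y) (\<theta> x) < 1/2"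
        unfolding uniformly_continuous_on_def by metis
      have "uniformly_continuous_on {lo..hi} yc"
        using lohi by (intro compact_uniformly_continuous continuous_at_imp_continuous_on) (auto intro!: yc_isCont)
      then obtain d2 where d2: "d2 > 0" "\<And>x y. x \<in> {lo..hi} \<Longrightarrow> y \<in> {lo..hi} \<Longrightarrow> dist y x < d2 \<Longrightarrow> dist (yc y) (yc x) < \<eta>"
        using \<eta> unfolding uniformly_continuous_on_def by metis
      have "min \<eta> (d2/2) > 0" using \<eta> d2 by simp
      from approx[OF this d1(1)] obtain N where N: "N\<^sub>0 \<le> N" "N > 0" "L / real N < d1"
        "\<And>i. i \<le> N \<Longrightarrow> \<bar>q N i - u0 (real i * (L / real N))\<bar> \<le> min \<eta> (d2/2) \<and> \<bar>p N i - w0 (real i * (L / real N))\<bar> \<le> min \<eta> (d2/2)"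
        by blast
      define s where "s i = real i * (L / real N)" for i
      have s: "s i \<in> {0..L}" if "i \<le> N" for i unfolding s_def by (rule gridL[OF that N(2)])
      define dd where "dd i = t N i - \<theta> (s i)" for i
      have cos_pos: "cos (dd i) > 0" if i: "i \<le> N" for i
      proof -
        obtain r' where r': "r' > 0" "w (s i) = r' * cos (\<theta> (s i))" "yc (u (s i)) = r' * sin (\<theta> (s i))"
          using lift by (auto simp: lift_def)
        note P = pt[OF N(1) i] and G = good[OF N(1) i]
        have us: "u (s i) = u0 (s i)" "w (s i) = w0 (s i)" using u(3)[OF s[OF i]] w_w0[OF s[OF i]] by auto
        have pw: "\<bar>p N i - w (s i)\<bar> \<le> \<eta>" using N(4)[OF i] us by (simp add: s_def)
        have "\<bar>q N i - u (s i)\<bar> \<le> d2/2" using N(4)[OF i] us by (simp add: s_def)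
        then have "\<bar>q N i - u (s i)\<bar> < d2" using d2(1) by linarith
        then have yw: "\<bar>yc (q N i) - yc (u (s i))\<bar> \<le> \<eta>"
          using d2(2)[of "u (s i)" "q N i"] ann[of "s i"] G(1) by (simp add: dist_real_def)
        have sq: "(w (s i))\<^sup>2 \<le> \<rho>\<^sub>2\<^sup>2" "(yc (u (s i)))\<^sup>2 \<le> \<rho>\<^sub>2\<^sup>2"
          using ann[of "s i"] by (auto intro: order_trans[rotated])
        have wb: "\<bar>w (s i)\<bar> \<le> \<rho>\<^sub>2" "\<bar>yc (u (s i))\<bar> \<le> \<rho>\<^sub>2"
          using sq \<rho>2 by (auto simp: abs_le_square_iff[of _ \<rho>\<^sub>2, symmetric])
        have "\<bar>(p N i - w (s i)) * w (s i)\<bar> \<le> \<eta> * \<rho>\<^sub>2" "\<bar>(yc (q N i) - yc (u (s i))) * yc (u (s i))\<bar> \<le> \<eta> * \<rho>\<^sub>2"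
          unfolding abs_mult using pw yw wb \<eta> by (auto intro!: mult_mono)
        moreover have "p N i * w (s i) + yc (q N i) * yc (u (s i)) = (w (s i))\<^sup>2 + (yc (u (s i)))\<^sup>2
            + (p N i - w (s i)) * w (s i) + (yc (q N i) - yc (u (s i))) * yc (u (s i))"
          by (simp add: power2_eq_square algebra_simps)
        ultimately have "p N i * w (s i) + yc (q N i) * yc (u (s i)) > 0"
          using ann[of "s i"] \<eta>2 by linarith
        moreover have "p N i * w (s i) + yc (q N i) * yc (u (s i)) = r N i * r' * cos (dd i)"
          unfolding r'(2,3) P(3) G(3) dd_def cos_diff by (simp add: algebra_simps)
        moreover have "r N i * r' > 0" using P(1) \<rho> r'(1) by simp
        ultimately show ?thesis using zero_less_mult_pos[of "r N i * r'" "cos (dd i)"] by simp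
      qed
      \<comment> \<open>The initial discrepancy is reduced by a multiple of \<open>2 * pi\<close> to
        at most \<open>pi\<close>. Positivity of the cosine then improves this to
        \<open>pi / 2\<close>, and the bound propagates because the discrepancy changes by less than
        1 per step.\<close>
      define a where "a = round (dd 0 / (2 * pi))"
      have cos_a: "cos (dd i - 2 * pi * of_int a) = cos (dd i)" for i
        by (simp add: cos_diff sin_int_2pin cos_int_2pin)
      have small: "\<bar>dd i - 2 * pi * of_int a\<bar> < pi / 2" if "i \<le> N" for i
        using that
      proof (induction i)
        case 0
        have "\<bar>dd 0 / (2 * pi) - of_int a\<bar> \<le> 1/2" unfolding a_def using of_int_round_abs_le[of "dd 0 / (2 * pi)"] by (simp add: abs_minus_commute)
        then have "2 * pi * \<bar>dd 0 / (2 * pi) - of_int a\<bar> \<le> 2 * pi * (1/2)" by (intro mult_left_mono) auto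
        moreover have "2 * pi * \<bar>dd 0 / (2 * pi) - of_int a\<bar> = \<bar>2 * pi * (dd 0 / (2 * pi) - of_int a)\<bar>" by (simp add: abs_mult)
        moreover have "2 * pi * (dd 0 / (2 * pi) - of_int a) = dd 0 - 2 * pi * of_int a" by (simp add: right_diff_distrib)
        ultimately have "\<bar>dd 0 - 2 * pi * of_int a\<bar> \<le> pi" by simp
        then have "\<bar>dd 0 - 2 * pi * of_int a\<bar> < 3 * pi / 2" using pi_gt_zero by linarith
        then show ?case using cos_pos[of 0] cos_a[of 0] by (intro cos_pos_imp_small) auto
      next
        case (Suc i)
        then have i: "i < N" by simp
        have "\<bar>s (Suc i) - s i\<bar> < d1" using N(2,3) L by (simp add: s_def algebra_simps add_divide_distrib)
        then have "\<bar>\<theta> (s (Suc i)) - \<theta> (s i)\<bar> < 1/2" using d1(2)[OF s[of i] s[of "Suc i"]] i by (simp add: dist_real_def)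
        then have "\<bar>dd (Suc i) - dd i\<bar> < 1" using step(3)[OF N(1) i] unfolding dd_def by linarith
        moreover have "\<bar>dd i - 2 * pi * of_int a\<bar> < pi / 2" using Suc.IH i by simp
        ultimately have "\<bar>dd (Suc i) - 2 * pi * of_int a\<bar> < 3 * pi / 2" using pi_gt3 by linarith
        then show ?case using cos_pos[of "Suc i"] cos_a[of "Suc i"] Suc.prems by (intro cos_pos_imp_small) auto
      qed
      have "s 0 = 0" "s N = L" using N(2) by (auto simp: s_def)
      then have "dd N - dd 0 = 2 * pi * (real j - of_int k)"
        using clos(3)[OF N(1)] k[of 0] by (simp add: dd_def algebra_simps)
      moreover have "\<bar>dd N - dd 0\<bar> < pi" using small[of 0] small[of N] by linarith
      \<comment> \<open>The total change of the discrepancy is a multiple of \<open>2 * pi\<close>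
        with absolute value below \<open>pi\<close>, hence zero.\<close>
      ultimately have "2 * pi * \<bar>real j - of_int k\<bar> < 2 * pi * (1/2)" by (simp add: abs_mult)
      then have "\<bar>real j - of_int k\<bar> < 1/2" by (rule mult_left_less_imp_less) simp
      then show ?thesis by linarith
    qed
    have "winds L j u w"
      unfolding winds_def using lift k kj by (intro exI[of _ \<theta>]) (auto simp: algebra_simps)
    then show ?thesis using u_deriv w_sol u(2) w_per ub by blast
  qed
  then show ?thesis using \<epsilon> by blast
qed

end

section \<open>Subharmonics near a constant weight\<close>

lemma exists_center_and_saddle:
  fixes F F' f :: "real \<Rightarrow> real"
  assumes F_deriv: "\<And>s. (F has_real_derivative F' s) (at s)"
    and a: "0 < a" "0 < \<delta>" "a + \<delta> < 1" and g: "g > 0"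
    and F0: "F a = 0" "F 1 = 0" and F_neg: "\<And>s. 0 < s \<Longrightarrow> s < a \<Longrightarrow> F s < 0"
    and \<kappa>: "\<And>s. a \<le> s \<Longrightarrow> s \<le> a + \<delta> \<Longrightarrow> \<kappa> \<le> F' s"
    and \<nu>: "\<nu> > 0" "g < \<nu> * \<kappa>" "g * (a + \<delta>) < \<nu> * F (a + \<delta>)"
    and f: "\<And>q. f q = \<nu> * F q - g * q"
  obtains c b where "0 < c" "c < b" "b < 1" "\<And>x. 0 < x \<Longrightarrow> x < c \<Longrightarrow> f x < 0" "\<And>x. c < x \<Longrightarrow> x < b \<Longrightarrow> f x > 0"
    "f c = 0" "f b = 0" "a \<le> c" "c \<le> a + \<delta>"
proof -
  have f_deriv: "(f has_real_derivative \<nu> * F' x - g) (at x)" for x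
    unfolding f[abs_def] by (auto intro!: derivative_eq_intros F_deriv)
  have f_cont: "continuous_on S f" for S
    by (rule DERIV_continuous_on[OF has_field_derivative_at_within[OF f_deriv]])
  have f_mono: "f x < f y" if "a \<le> x" "x < y" "y \<le> a + \<delta>" for x y
  proof (rule DERIV_pos_imp_increasing[OF that(2)])
    fix z assume z: "x \<le> z" "z \<le> y"
    have "\<nu> * \<kappa> \<le> \<nu> * F' z" using \<kappa>[of z] that z \<nu> by (intro mult_left_mono) auto
    then have "\<nu> * F' z - g > 0" using \<nu>(2) by linarith
    then show "\<exists>d. (f has_real_derivative d) (at z) \<and> d > 0" using f_deriv[of z] by blast
  qed
  have fa: "f a < 0" using F0 a g by (simp add: f)
  have fd: "f (a + \<delta>) > 0" using \<nu> by (simp add: f)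
  \<comment> \<open>On this interval the slope \<open>\<nu> * F' - g\<close> is positive while
    \<open>f\<close> changes sign, so its zero \<open>c\<close> is a center of the constant-weight
    equation.\<close>
  obtain c where c: "a \<le> c" "c \<le> a + \<delta>" "f c = 0"
    using IVT'[of f a 0 "a + \<delta>"] fa fd f_cont a by auto
  have f1: "f 1 < 0" using F0 g by (simp add: f)
  \<comment> \<open>The least zero of \<open>f\<close> beyond \<open>a + \<delta>\<close> is taken
    as the saddle \<open>b\<close>, so that \<open>f\<close> stays positive between \<open>c\<close>
    and \<open>b\<close>. It lies below 1 because \<open>f 1 = - g\<close>.\<close>
  define S where "S = {a + \<delta>..1} \<inter> f -` {0}"
  have "closed S" unfolding S_def by (rule continuous_closed_preimage[OF f_cont]) auto
  moreover have "bounded S" by (rule bounded_subset[OF bounded_closed_interval[of "a + \<delta>" 1]]) (auto simp: S_def)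
  ultimately have S: "compact S" by (simp add: compact_eq_bounded_closed)
  obtain x\<^sub>0 where "a + \<delta> \<le> x\<^sub>0" "x\<^sub>0 \<le> 1" "f x\<^sub>0 = 0"
    using IVT2'[of f 1 0 "a + \<delta>"] fd f1 f_cont a by (auto simp: less_imp_le)
  then have "S \<noteq> {}" by (auto simp: S_def)
  with S obtain b where b: "b \<in> S" "\<And>x. x \<in> S \<Longrightarrow> b \<le> x"
    using compact_attains_inf[of S] by blast
  have b': "a + \<delta> < b" "b < 1" "f b = 0" using b(1) fd f1 by (auto simp: S_def less_le)
  show ?thesis
  proof (rule that[of c b])
    show "f x < 0" if "0 < x" "x < c" for x
    proof (cases "x \<le> a")
      case True
      then have "F x \<le> 0" using F_neg[of x] F0 that by (cases "x = a") auto
      then have "\<nu> * F x \<le> 0" using \<nu> by (simp add: mult_nonneg_nonpos)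
      moreover have "g * x > 0" using g that by simp
      ultimately show ?thesis by (simp add: f)
    next
      case False
      then show ?thesis using f_mono[of x c] that c by simp
    qed
    show "f x > 0" if x: "c < x" "x < b" for x
    proof (cases "x \<le> a + \<delta>")
      case True
      then show ?thesis using f_mono[of c x] x c by simp
    next
      case False
      show ?thesis
      proof (rule ccontr)
        assume "\<not> f x > 0"
        then obtain y where "a + \<delta> \<le> y" "y \<le> x" "f y = 0"
          using IVT2'[of f x 0 "a + \<delta>"] fd f_cont False by (auto simp: less_imp_le not_less)
        then show False using b(2)[of y] x b' by (auto simp: S_def)
      qed
    qed
    show "c < b" using b' c by simp
  qed (use b' c a in auto)
qed

lemma periodic_fun_mult: "periodic_fun p k \<Longrightarrow> k (x + real i * p) = k x"
proof (induction i)
  case (Suc i)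
  then show ?case using Suc.prems[unfolded periodic_fun_def, rule_format, of "x + real i * p"] by (simp add: algebra_simps)
qed simp

text \<open>Winding numbers belong to the pair of a solution and its derivative, so a shift relation
  between solutions must be passed on to the derivatives.\<close>

lemma derivative_shift:
  assumes "\<And>x. (u has_real_derivative w x) (at x)" "\<And>x. (v has_real_derivative z x) (at x)" "v = (\<lambda>x. u (x + s))"
  shows "z x = w (x + s)"
proof -
  have "((\<lambda>x. u (x + s)) has_real_derivative w (x + s)) (at x)" using DERIV_shift[THEN iffD1, OF assms(1)] .
  then show ?thesis using assms(2)[of x] assms(3) DERIV_unique by blast
qed

text \<open>The second condition on \<open>\<nu>\<close> makes the period at the center smaller than
  \<open>\<beta> / (2 * K) = m * \<beta> / (2 * K * m)\<close>. One inner radius of short period and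
  one outer radius of period above \<open>m * \<beta>\<close> then serve all prescribed winding
  numbers.\<close>

lemma subharmonics_near_constant:
  fixes g a \<beta> \<nu> \<kappa> \<delta> :: real and F F' :: "real \<Rightarrow> real" and m K :: nat
  assumes F_deriv: "\<And>s. (F has_real_derivative F' s) (at s)" and F'_cont: "continuous_on UNIV F'"
    and a: "0 < a" "0 < \<delta>" "a + \<delta> < 1" and g: "g > 0"
    and F0: "F 0 = 0" "F a = 0" "F 1 = 0" and F_neg: "\<And>s. 0 < s \<Longrightarrow> s < a \<Longrightarrow> F s < 0"
    and \<kappa>: "\<And>s. a \<le> s \<Longrightarrow> s \<le> a + \<delta> \<Longrightarrow> \<kappa> \<le> F' s"
    and \<beta>: "\<beta> > 0" and m: "m \<ge> 2" and K: "K \<ge> 1"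
    and \<nu>: "\<nu> > 0" "g + (2 * pi * (2 * real K) / \<beta>)\<^sup>2 < \<nu> * \<kappa>" "g * (a + \<delta>) < \<nu> * F (a + \<delta>)"
  shows "\<exists>\<epsilon>>0. \<forall>n. (\<forall>x y. n absolutely_integrable_on {x..y}) \<longrightarrow> periodic_fun \<beta> n \<longrightarrow>
     integral {0..real m * \<beta>} (\<lambda>x. \<bar>n x - \<nu>\<bar>) \<le> \<epsilon> \<longrightarrow>
     (\<exists>u :: nat \<Rightarrow> real \<Rightarrow> real.
        (\<forall>k < 2 * K. caratheodory_sol g n F (u k) \<and> periodic_fun (real m * \<beta>) (u k) \<and>
           (\<forall>x. 0 < u k x \<and> u k x < 1) \<and> (\<forall>i\<in>{1..m-1}. \<not> periodic_fun (real i * \<beta>) (u k))) \<and>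
        (\<forall>k < 2 * K. \<forall>l < 2 * K. k \<noteq> l \<longrightarrow> \<not> same_periodicity_class \<beta> m (u k) (u l)))"
proof -
  define f where "f q = \<nu> * F q - g * q" for q
  define L where "L = real m * \<beta>"
  have L: "L > 0" using m \<beta> by (simp add: L_def)
  have "0 \<le> (2 * pi * (2 * real K) / \<beta>)\<^sup>2" by simp
  then have gk: "g < \<nu> * \<kappa>" using \<nu> by linarith
  obtain c b where cb: "0 < c" "c < b" "b < 1" "\<And>x. 0 < x \<Longrightarrow> x < c \<Longrightarrow> f x < 0" "\<And>x. c < x \<Longrightarrow> x < b \<Longrightarrow> f x > 0"
    "f c = 0" "f b = 0" "a \<le> c" "c \<le> a + \<delta>"
    using exists_center_and_saddle[OF F_deriv a g F0(2,3) F_neg \<kappa> \<nu>(1) gk \<nu>(3) f_def] by blast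
  have F_cont: "continuous_on UNIV F"
    by (rule DERIV_continuous_on[OF has_field_derivative_at_within[OF F_deriv]])
  have f_cont: "continuous_on UNIV f" unfolding f_def by (intro continuous_intros F_cont)
  have f'c: "\<nu> * F' c - g > (2 * pi * (2 * real K) / \<beta>)\<^sup>2"
  proof -
    have "\<nu> * \<kappa> \<le> \<nu> * F' c" using \<kappa>[OF cb(8,9)] \<nu> by (intro mult_left_mono) auto
    then show ?thesis using \<nu> by linarith
  qed
  \<comment> \<open>The well reaches from the equilibrium 0 to the saddle \<open>b\<close> below 1,
    which confines the solutions to the required range; the potential is shifted to vanish at
    \<open>c\<close>.\<close>
  interpret kicked_well f "\<lambda>q. \<nu> * F' q - g" "\<lambda>q. signed_integral f q - signed_integral f c" 0 c b F F' "signed_integral F"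
  proof
    show "(f has_real_derivative \<nu> * F' x - g) (at x)" for x
      unfolding f_def[abs_def] by (auto intro!: derivative_eq_intros F_deriv)
    show "continuous_on UNIV (\<lambda>q. \<nu> * F' q - g)" by (intro continuous_intros F'_cont)
    show "((\<lambda>q. signed_integral f q - signed_integral f c) has_real_derivative f x) (at x)" for x
      using DERIV_diff[OF signed_integral_deriv[OF f_cont] DERIV_const] by simp
    show "0 < \<nu> * F' c - g" using f'c \<open>0 \<le> (2 * pi * (2 * real K) / \<beta>)\<^sup>2\<close> by linarith
  qed (use cb F_deriv F'_cont signed_integral_deriv[OF F_cont] in auto)
  \<comment> \<open>An upper bound for the winding numbers \<open>1 + m * k\<close> with
    \<open>k < 2 * K\<close>; the lower bound 1 is what matters at the outer radius.\<close>
  define J where "J = 2 * K * m"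
  have J: "real J > 0" using m K by (simp add: J_def)
  have "2 * pi / sqrt (\<nu> * F' c - g) < L / real J"
  proof -
    define A where "A = 2 * pi * (2 * real K) / \<beta>"
    have A: "A > 0" using \<beta> K by (simp add: A_def)
    have "A < sqrt (\<nu> * F' c - g)" using f'c A by (intro real_less_rsqrt) (simp add: A_def)
    then have "2 * pi / sqrt (\<nu> * F' c - g) < 2 * pi / A" using A by (intro divide_strict_left_mono) (auto intro!: mult_pos_pos simp del: real_sqrt_gt_0_iff)
    also have "2 * pi / A = L / real J" using \<beta> K m by (simp add: A_def L_def J_def)
    finally show ?thesis .
  qed
  from T_near_center[OF this] obtain r\<^sub>1 where r1: "0 < r\<^sub>1" "r\<^sub>1 < R" "T r\<^sub>1 < L / real J" by blast
  have f0: "f 0 = 0" using F0 by (simp add: f_def)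
  from T_near_separatrix[OF f0 cb(7) r1(2), of L] obtain r\<^sub>2 where r2: "r\<^sub>1 < r\<^sub>2" "0 < r\<^sub>2" "r\<^sub>2 < R" "T r\<^sub>2 > L" by blast
  \<comment> \<open>These winding numbers are coprime to \<open>m\<close>, which makes \<open>L\<close> the minimal period.\<close>
  define w\<^sub>k where "w\<^sub>k k = 1 + m * k" for k
  define H where "H k n u w \<longleftrightarrow> (\<forall>x. (u has_real_derivative w x) (at x)) \<and>
        (\<forall>x y. x \<le> y \<longrightarrow> ((\<lambda>t. g * u t - n t * F (u t)) has_integral (w y - w x)) {x..y}) \<and>
        (\<forall>x. u (x + L) = u x) \<and> (\<forall>x. w (x + L) = w x) \<and> (\<forall>x. 0 < u x \<and> u x < b) \<and> winds L (w\<^sub>k k) u w" for k n u w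
  have "\<exists>\<epsilon>>0. \<forall>n. (\<forall>x y. n absolutely_integrable_on {x..y}) \<longrightarrow> (\<forall>x. n (x + L) = n x) \<longrightarrow>
     integral {0..L} (\<lambda>x. \<bar>n x - \<nu>\<bar>) \<le> \<epsilon> \<longrightarrow>
     (\<exists>u w. H k n u w)"
    if k: "k < 2 * K" for k
    unfolding H_def
  proof (rule winding_solution_exists[OF f_def r1(1) r2(1,3) L])
    have "w\<^sub>k k \<le> m * (k + 1)" using m by (simp add: w\<^sub>k_def)
    also have "\<dots> \<le> m * (2 * K)" using k by (intro mult_le_mono) auto
    also have "\<dots> = J" by (simp add: J_def)
    finally have "real (w\<^sub>k k) \<le> real J" by (rule of_nat_mono)
    then have "real (w\<^sub>k k) * T r\<^sub>1 \<le> real J * T r\<^sub>1" using T_pos[OF r1(1,2)] by (intro mult_right_mono) auto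
    also have "\<dots> < L" using r1(3) J by (simp add: field_simps)
    finally show "real (w\<^sub>k k) * T r\<^sub>1 < L" .
    have "1 * T r\<^sub>2 \<le> real (w\<^sub>k k) * T r\<^sub>2" using T_pos[OF r2(2,3)] by (intro mult_right_mono) (auto simp: w\<^sub>k_def)
    then show "L < real (w\<^sub>k k) * T r\<^sub>2" using r2(4) by simp
  qed
  then obtain \<epsilon>\<^sub>k where \<epsilon>k: "\<And>k. k < 2 * K \<Longrightarrow> \<epsilon>\<^sub>k k > 0"
    and sol: "\<And>k n. k < 2 * K \<Longrightarrow> (\<forall>x y. n absolutely_integrable_on {x..y}) \<longrightarrow> (\<forall>x. n (x + L) = n x) \<longrightarrow>
     integral {0..L} (\<lambda>x. \<bar>n x - \<nu>\<bar>) \<le> \<epsilon>\<^sub>k k \<longrightarrow>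
     (\<exists>u w. H k n u w)"
    by metis
  obtain \<epsilon> where \<epsilon>: "\<epsilon> > 0" "\<And>k. k < 2 * K \<Longrightarrow> \<epsilon> \<le> \<epsilon>\<^sub>k k"
    using pos_lower_bound[of "map \<epsilon>\<^sub>k [0..<2 * K]"] \<epsilon>k by auto
  have "\<exists>u :: nat \<Rightarrow> real \<Rightarrow> real.
        (\<forall>k < 2 * K. caratheodory_sol g n F (u k) \<and> periodic_fun (real m * \<beta>) (u k) \<and>
           (\<forall>x. 0 < u k x \<and> u k x < 1) \<and> (\<forall>i\<in>{1..m-1}. \<not> periodic_fun (real i * \<beta>) (u k))) \<and>
        (\<forall>k < 2 * K. \<forall>l < 2 * K. k \<noteq> l \<longrightarrow> \<not> same_periodicity_class \<beta> m (u k) (u l))"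
    if n: "\<forall>x y. n absolutely_integrable_on {x..y}" "periodic_fun \<beta> n" "integral {0..real m * \<beta>} (\<lambda>x. \<bar>n x - \<nu>\<bar>) \<le> \<epsilon>" for n
  proof -
    have nL: "\<forall>x. n (x + L) = n x" using periodic_fun_mult[OF n(2)] by (simp add: L_def)
    have "\<exists>u w. H k n u w" if "k < 2 * K" for k
      using sol[OF that, of n] n nL \<epsilon>(2)[OF that] by (simp add: L_def)
    then obtain u w where H: "\<And>k. k < 2 * K \<Longrightarrow> H k n (u k) (w k)" by metis
    have uw: "\<And>k x. k < 2 * K \<Longrightarrow> (u k has_real_derivative w k x) (at x)"
        "\<And>k x y. k < 2 * K \<Longrightarrow> x \<le> y \<Longrightarrow> ((\<lambda>t. g * u k t - n t * F (u k t)) has_integral (w k y - w k x)) {x..y}"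
        "\<And>k x. k < 2 * K \<Longrightarrow> u k (x + L) = u k x" "\<And>k x. k < 2 * K \<Longrightarrow> 0 < u k x \<and> u k x < b"
        "\<And>k. k < 2 * K \<Longrightarrow> winds L (w\<^sub>k k) (u k) (w k)"
      using H unfolding H_def by blast+
    show ?thesis
    proof (intro exI[of _ u] conjI allI impI ballI)
      fix k assume k: "k < 2 * K"
      show "caratheodory_sol g n F (u k)" unfolding caratheodory_sol_def using uw(1,2)[OF k] by (intro exI[of _ "w k"]) auto
      show "periodic_fun (real m * \<beta>) (u k)" using uw(3)[OF k] by (simp add: periodic_fun_def L_def)
      show "0 < u k x" "u k x < 1" for x using uw(4)[OF k, of x] cb(3) by auto
      fix i assume i: "i \<in> {1..m-1}"
      show "\<not> periodic_fun (real i * \<beta>) (u k)"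
      proof
        assume "periodic_fun (real i * \<beta>) (u k)"
        then have up: "u k (x + real i * \<beta>) = u k x" for x by (simp add: periodic_fun_def)
        have wp: "w k (x + real i * \<beta>) = w k x" for x
          using derivative_shift[OF uw(1)[OF k] uw(1)[OF k], of "real i * \<beta>" x] up by auto
        have "coprime (w\<^sub>k k) m"
        proof (rule coprimeI)
          fix d assume "d dvd w\<^sub>k k" "d dvd m"
          then show "is_unit d" using dvd_add_left_iff[of d "m * k" 1] by (simp add: w\<^sub>k_def)
        qed
        then have "m dvd i" using winds_minimal_period[of m \<beta>, OF uw(5)[OF k, unfolded L_def] up wp] by blast
        then show False using i by (auto dest: dvd_imp_le)
      qed
    next
      fix k l assume k: "k < 2 * K" and l: "l < 2 * K" and ne: "k \<noteq> l"
      show "\<not> same_periodicity_class \<beta> m (u k) (u l)"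
      proof
        assume "same_periodicity_class \<beta> m (u k) (u l)"
        then obtain i where i: "u l = (\<lambda>x. u k (x + real i * \<beta>))" by (auto simp: same_periodicity_class_def)
        have "w l = (\<lambda>x. w k (x + real i * \<beta>))"
          using derivative_shift[OF uw(1)[OF k] uw(1)[OF l] i] by auto
        then have "winds L (w\<^sub>k k) (u l) (w l)" using winds_shift[OF uw(5)[OF k], of "real i * \<beta>"] i by simp
        then have "w\<^sub>k k = w\<^sub>k l" using winds_unique uw(5)[OF l] by blast
        then show False using ne m by (simp add: w\<^sub>k_def)
      qed
    qed
  qed
  then show ?thesis using \<epsilon>(1) by blast
qed

lemma integral_periods:
  assumes "\<And>x y. k integrable_on {x..y}" "periodic_fun p k" "p > 0"
  shows "integral {0..real m * p} k = real m * integral {0..p} k"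
proof -
  have "signed_integral k (real m * p) = real m * signed_integral k p"
  proof (induction m)
    case (Suc m)
    have "signed_integral k (real m * p + p) = signed_integral k (real m * p) + signed_integral k p"
      by (rule signed_integral_periodic[OF assms(1)]) (use assms(2) in \<open>auto simp: periodic_fun_def\<close>)
    then show ?case using Suc by (simp add: algebra_simps)
  qed simp
  then show ?thesis using assms(3) by (simp add: signed_integral_nonneg)
qed

theorem theorem3:
  fixes g a \<beta> :: real and F F' :: "real \<Rightarrow> real"
  assumes g_pos: "g > 0"
    and F_deriv: "\<And>s. (F has_real_derivative F' s) (at s)"
    and F'_cont: "continuous_on UNIV F'"
    and a_in: "0 < a" "a < 1"
    and F_zeros: "F 0 = 0" "F a = 0" "F 1 = 0"
    and F_pos: "\<And>s. s < 0 \<or> (a < s \<and> s < 1) \<Longrightarrow> F s > 0"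
    and F_neg: "\<And>s. (0 < s \<and> s < a) \<or> s > 1 \<Longrightarrow> F s < 0"
    and F'_a: "F' a > 0"
    and beta_pos: "\<beta> > 0"
  shows "\<forall>m::nat. m \<ge> 2 \<longrightarrow> (\<forall>K::nat. K \<ge> 1 \<longrightarrow>
     (\<exists>\<mu>>0. \<forall>\<mu>\<^sub>1 \<mu>\<^sub>2. \<mu> < \<mu>\<^sub>1 \<and> \<mu>\<^sub>1 \<le> \<mu>\<^sub>2 \<longrightarrow>
       (\<exists>\<epsilon>>0. \<forall>(n::real \<Rightarrow> real) (nbar::real) (ntilde::real \<Rightarrow> real).
          periodic_fun \<beta> n \<and>
          (\<forall>x y. n absolutely_integrable_on {x..y}) \<and>
          (\<forall>x. n x \<ge> 0) \<and>
          (\<forall>x. n x = nbar + ntilde x) \<and>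
          periodic_fun \<beta> ntilde \<and>
          \<mu>\<^sub>1 \<le> nbar \<and> nbar \<le> \<mu>\<^sub>2 \<and>
          integral {0..\<beta>} (\<lambda>x. \<bar>ntilde x\<bar>) < \<epsilon>
          \<longrightarrow>
          (\<exists>u :: nat \<Rightarrow> real \<Rightarrow> real.
             (\<forall>k < 2 * K.
                caratheodory_sol g n F (u k) \<and>
                periodic_fun (real m * \<beta>) (u k) \<and>
                (\<forall>x. 0 < u k x \<and> u k x < 1) \<and>
                (\<forall>i\<in>{1..m-1}. \<not> periodic_fun (real i * \<beta>) (u k))) \<and>
             (\<forall>k < 2 * K. \<forall>l < 2 * K. k \<noteq> l \<longrightarrow>
                \<not> same_periodicity_class \<beta> m (u k) (u l))))))"
proof (intro allI impI)
  fix m K :: nat assume m: "m \<ge> 2" and K: "K \<ge> 1"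
  \<comment> \<open>Half of the slope at \<open>a\<close> persists on an interval to the right of
    \<open>a\<close>, where the center is located.\<close>
  define \<kappa> where "\<kappa> = F' a / 2"
  have \<kappa>: "\<kappa> > 0" using F'_a by (simp add: \<kappa>_def)
  have "(F' \<longlongrightarrow> F' a) (nhds a)"
    using F'_cont by (simp add: continuous_on_eq_continuous_at isCont_def tendsto_nhds_iff)
  then have "\<forall>\<^sub>F s in nhds a. \<kappa> < F' s" using F'_a by (intro order_tendstoD) (auto simp: \<kappa>_def)
  then obtain e where e: "e > 0" "\<And>s. \<bar>s - a\<bar> < e \<Longrightarrow> \<kappa> < F' s"
    by (auto simp: eventually_nhds_metric dist_real_def)
  define \<delta> where "\<delta> = min (e / 2) ((1 - a) / 2)"
  have "\<delta> \<le> e / 2 \<and> \<delta> \<le> (1 - a) / 2" unfolding \<delta>_def by linarith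
  moreover have "\<delta> > 0" using e a_in by (simp add: \<delta>_def)
  ultimately have \<delta>: "0 < \<delta>" "a + \<delta> < 1" "\<delta> < e" using a_in e(1) by auto
  have F'_ge: "\<kappa> \<le> F' s" if "a \<le> s" "s \<le> a + \<delta>" for s using e(2)[of s] that \<delta> by simp
  have Fd: "F (a + \<delta>) > 0" using F_pos[of "a + \<delta>"] \<delta> by simp
  define X where "X = g + (2 * pi * (2 * real K) / \<beta>)\<^sup>2"
  have X: "X > 0" using g_pos by (simp add: X_def add_pos_nonneg)
  \<comment> \<open>The sum of two positive thresholds: one for the slope at the center, the other
    for \<open>f\<close> to be positive at \<open>a + \<delta>\<close>.\<close>
  define \<mu> where "\<mu> = X / \<kappa> + g * (a + \<delta>) / F (a + \<delta>)"
  have q2: "g * (a + \<delta>) / F (a + \<delta>) > 0" using g_pos a_in \<delta> Fd by simp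
  have q1: "X / \<kappa> > 0" using X \<kappa> by simp
  define P where "P n \<longleftrightarrow> (\<exists>u :: nat \<Rightarrow> real \<Rightarrow> real.
        (\<forall>k < 2 * K. caratheodory_sol g n F (u k) \<and> periodic_fun (real m * \<beta>) (u k) \<and>
           (\<forall>x. 0 < u k x \<and> u k x < 1) \<and> (\<forall>i\<in>{1..m-1}. \<not> periodic_fun (real i * \<beta>) (u k))) \<and>
        (\<forall>k < 2 * K. \<forall>l < 2 * K. k \<noteq> l \<longrightarrow> \<not> same_periodicity_class \<beta> m (u k) (u l)))" for n
  have near: "\<exists>\<epsilon>>0. \<forall>n. (\<forall>x y. n absolutely_integrable_on {x..y}) \<longrightarrow> periodic_fun \<beta> n \<longrightarrow>
     integral {0..real m * \<beta>} (\<lambda>x. \<bar>n x - \<nu>\<bar>) \<le> \<epsilon> \<longrightarrow>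
     P n"
    if \<nu>: "\<nu> > \<mu>" for \<nu>
    unfolding P_def
  proof (rule subharmonics_near_constant[OF F_deriv F'_cont a_in(1) \<delta>(1,2) g_pos F_zeros _ F'_ge beta_pos m K])
    show "\<nu> > 0" using \<nu> q1 q2 by (simp add: \<mu>_def)
    have "X / \<kappa> < \<nu>" "g * (a + \<delta>) / F (a + \<delta>) < \<nu>" using \<nu> q1 q2 by (simp_all add: \<mu>_def)
    then show "g + (2 * pi * (2 * real K) / \<beta>)\<^sup>2 < \<nu> * \<kappa>" "g * (a + \<delta>) < \<nu> * F (a + \<delta>)"
      using \<kappa> Fd by (simp_all add: X_def pos_divide_less_eq)
  qed (use F_neg in auto)
  have "\<exists>\<mu>>0. \<forall>\<mu>\<^sub>1 \<mu>\<^sub>2. \<mu> < \<mu>\<^sub>1 \<and> \<mu>\<^sub>1 \<le> \<mu>\<^sub>2 \<longrightarrow>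
       (\<exists>\<epsilon>>0. \<forall>(n::real \<Rightarrow> real) (nbar::real) (ntilde::real \<Rightarrow> real).
          periodic_fun \<beta> n \<and>
          (\<forall>x y. n absolutely_integrable_on {x..y}) \<and>
          (\<forall>x. n x \<ge> 0) \<and>
          (\<forall>x. n x = nbar + ntilde x) \<and>
          periodic_fun \<beta> ntilde \<and>
          \<mu>\<^sub>1 \<le> nbar \<and> nbar \<le> \<mu>\<^sub>2 \<and>
          integral {0..\<beta>} (\<lambda>x. \<bar>ntilde x\<bar>) < \<epsilon>
          \<longrightarrow> P n)"
  proof (rule exI[of _ \<mu>], rule conjI)
    show "\<mu> > 0" using q1 q2 by (simp add: \<mu>_def)
    show "\<forall>\<mu>\<^sub>1 \<mu>\<^sub>2. \<mu> < \<mu>\<^sub>1 \<and> \<mu>\<^sub>1 \<le> \<mu>\<^sub>2 \<longrightarrow>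
       (\<exists>\<epsilon>>0. \<forall>(n::real \<Rightarrow> real) (nbar::real) (ntilde::real \<Rightarrow> real).
          periodic_fun \<beta> n \<and>
          (\<forall>x y. n absolutely_integrable_on {x..y}) \<and>
          (\<forall>x. n x \<ge> 0) \<and>
          (\<forall>x. n x = nbar + ntilde x) \<and>
          periodic_fun \<beta> ntilde \<and>
          \<mu>\<^sub>1 \<le> nbar \<and> nbar \<le> \<mu>\<^sub>2 \<and>
          integral {0..\<beta>} (\<lambda>x. \<bar>ntilde x\<bar>) < \<epsilon>
          \<longrightarrow> P n)"
    proof (intro allI impI)
      fix \<mu>\<^sub>1 \<mu>\<^sub>2 assume \<mu>12: "\<mu> < \<mu>\<^sub>1 \<and> \<mu>\<^sub>1 \<le> \<mu>\<^sub>2"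
      have "\<forall>\<nu>. \<exists>\<epsilon>. \<nu> > \<mu> \<longrightarrow> \<epsilon> > 0 \<and> (\<forall>n. (\<forall>x y. n absolutely_integrable_on {x..y}) \<longrightarrow> periodic_fun \<beta> n \<longrightarrow>
         integral {0..real m * \<beta>} (\<lambda>x. \<bar>n x - \<nu>\<bar>) \<le> \<epsilon> \<longrightarrow> P n)"
        using near by blast
      then obtain E where E: "\<And>\<nu>. \<nu> > \<mu> \<Longrightarrow> E \<nu> > 0" "\<And>\<nu> n. \<nu> > \<mu> \<Longrightarrow> \<forall>x y. n absolutely_integrable_on {x..y} \<Longrightarrow>
         periodic_fun \<beta> n \<Longrightarrow> integral {0..real m * \<beta>} (\<lambda>x. \<bar>n x - \<nu>\<bar>) \<le> E \<nu> \<Longrightarrow> P n"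
        by metis
      \<comment> \<open>A change of the mean value is absorbed into the perturbation, so compactness makes \<open>\<epsilon>\<close> uniform.\<close>
      have m0: "real m > 0" using m by simp
      \<comment> \<open>Over \<open>m\<close> periods the shift of the mean then costs at most
        \<open>E \<nu> / 2\<close>, and the bound on \<open>\<epsilon>\<close> below reserves the
        other half for the oscillating part.\<close>
      define \<rho> where "\<rho> \<nu> = E \<nu> / (2 * real m * \<beta>)" for \<nu>
      have \<rho>: "\<rho> \<nu> > 0" if "\<nu> > \<mu>" for \<nu> using E(1)[OF that] m0 beta_pos by (simp add: \<rho>_def)
      have "{\<mu>\<^sub>1..\<mu>\<^sub>2} \<subseteq> (\<Union>\<nu>\<in>{\<mu>\<^sub>1..\<mu>\<^sub>2}. ball \<nu> (\<rho> \<nu>))" 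
      proof
        fix \<nu> assume "\<nu> \<in> {\<mu>\<^sub>1..\<mu>\<^sub>2}"
        moreover from this have "\<nu> > \<mu>" using \<mu>12 by simp
        ultimately show "\<nu> \<in> (\<Union>\<nu>\<in>{\<mu>\<^sub>1..\<mu>\<^sub>2}. ball \<nu> (\<rho> \<nu>))" using \<rho>[of \<nu>] by (intro UN_I[of \<nu>]) auto
      qed
      from compactE_image[OF compact_Icc _ this] obtain D where D: "D \<subseteq> {\<mu>\<^sub>1..\<mu>\<^sub>2}" "finite D"
        "{\<mu>\<^sub>1..\<mu>\<^sub>2} \<subseteq> (\<Union>\<nu>\<in>D. ball \<nu> (\<rho> \<nu>))" by auto
      have D\<mu>: "\<nu> > \<mu>" if "\<nu> \<in> D" for \<nu> using D(1) that \<mu>12 by force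
      obtain xs where xs: "set xs = D" using finite_list[OF D(2)] by blast
      obtain \<epsilon> where \<epsilon>: "\<epsilon> > 0" "\<And>\<nu>. \<nu> \<in> D \<Longrightarrow> \<epsilon> \<le> E \<nu> / (2 * real m)"
        using pos_lower_bound[of "map (\<lambda>\<nu>. E \<nu> / (2 * real m)) xs"] xs E(1) D\<mu> m0 by auto
      show "\<exists>\<epsilon>>0. \<forall>(n::real \<Rightarrow> real) (nbar::real) (ntilde::real \<Rightarrow> real).
          periodic_fun \<beta> n \<and>
          (\<forall>x y. n absolutely_integrable_on {x..y}) \<and>
          (\<forall>x. n x \<ge> 0) \<and>
          (\<forall>x. n x = nbar + ntilde x) \<and>
          periodic_fun \<beta> ntilde \<and>
          \<mu>\<^sub>1 \<le> nbar \<and> nbar \<le> \<mu>\<^sub>2 \<and>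
          integral {0..\<beta>} (\<lambda>x. \<bar>ntilde x\<bar>) < \<epsilon>
          \<longrightarrow> P n"
      proof (rule exI[of _ \<epsilon>], intro conjI allI impI; (elim conjE)?)
        fix n nbar ntilde
        assume n: "periodic_fun \<beta> n" "\<forall>x y. n absolutely_integrable_on {x..y}" "\<forall>x. n x = nbar + ntilde x"
          and nbar: "\<mu>\<^sub>1 \<le> nbar" "nbar \<le> \<mu>\<^sub>2" and small: "integral {0..\<beta>} (\<lambda>x. \<bar>ntilde x\<bar>) < \<epsilon>"
        obtain \<nu> where \<nu>: "\<nu> \<in> D" "\<bar>nbar - \<nu>\<bar> < \<rho> \<nu>"
          using D(3) nbar by (force simp: dist_real_def abs_minus_commute)
        have ai: "(\<lambda>x. \<bar>n x - s\<bar>) integrable_on {x..y}" for s x y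
        proof -
          have "(\<lambda>x. n x - s) absolutely_integrable_on {x..y}"
            using n(2) absolutely_integrable_continuous_real[OF continuous_on_const, of x y s]
            by (intro set_integral_diff(1)) auto
          then show ?thesis by (simp add: absolutely_integrable_on_def)
        qed
        have nt: "ntilde x = n x - nbar" for x using n(3) by simp
        have "integral {0..\<beta>} (\<lambda>x. \<bar>n x - \<nu>\<bar>) \<le> integral {0..\<beta>} (\<lambda>x. \<bar>ntilde x\<bar> + \<bar>nbar - \<nu>\<bar>)"
        proof (rule integral_le[OF ai])
          show "(\<lambda>x. \<bar>ntilde x\<bar> + \<bar>nbar - \<nu>\<bar>) integrable_on {0..\<beta>}"
            unfolding nt by (rule integrable_add[OF ai]) auto
          show "\<bar>n x - \<nu>\<bar> \<le> \<bar>ntilde x\<bar> + \<bar>nbar - \<nu>\<bar>" for x unfolding nt by linarith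
        qed
        also have "\<dots> = integral {0..\<beta>} (\<lambda>x. \<bar>ntilde x\<bar>) + integral {0..\<beta>} (\<lambda>x. \<bar>nbar - \<nu>\<bar>)"
          unfolding nt by (rule Henstock_Kurzweil_Integration.integral_add[OF ai]) auto
        also have "integral {0..\<beta>} (\<lambda>x. \<bar>nbar - \<nu>\<bar>) = \<beta> * \<bar>nbar - \<nu>\<bar>" using beta_pos by simp
        finally have le: "integral {0..\<beta>} (\<lambda>x. \<bar>n x - \<nu>\<bar>) \<le> \<epsilon> + \<beta> * \<rho> \<nu>"
          using small mult_left_mono[of "\<bar>nbar - \<nu>\<bar>" "\<rho> \<nu>" \<beta>] \<nu>(2) beta_pos by linarith
        have "integral {0..real m * \<beta>} (\<lambda>x. \<bar>n x - \<nu>\<bar>) = real m * integral {0..\<beta>} (\<lambda>x. \<bar>n x - \<nu>\<bar>)"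
          by (rule integral_periods[OF ai _ beta_pos]) (use n(1) in \<open>auto simp: periodic_fun_def\<close>)
        also have "\<dots> \<le> real m * (\<epsilon> + \<beta> * \<rho> \<nu>)" using le m0 by (intro mult_left_mono) auto
        also have "\<dots> \<le> real m * (E \<nu> / (2 * real m) + \<beta> * \<rho> \<nu>)" using \<epsilon>(2)[OF \<nu>(1)] m0 by (intro mult_left_mono add_right_mono) auto
        also have "\<dots> = E \<nu>" using m0 beta_pos by (simp add: \<rho>_def field_simps)
        finally show "P n" by (rule E(2)[OF D\<mu>[OF \<nu>(1)] n(2,1)])
      qed (rule \<epsilon>(1))
    qed
  qed
  then show "\<exists>\<mu>>0. \<forall>\<mu>\<^sub>1 \<mu>\<^sub>2. \<mu> < \<mu>\<^sub>1 \<and> \<mu>\<^sub>1 \<le> \<mu>\<^sub>2 \<longrightarrow>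
       (\<exists>\<epsilon>>0. \<forall>(n::real \<Rightarrow> real) (nbar::real) (ntilde::real \<Rightarrow> real).
          periodic_fun \<beta> n \<and>
          (\<forall>x y. n absolutely_integrable_on {x..y}) \<and>
          (\<forall>x. n x \<ge> 0) \<and>
          (\<forall>x. n x = nbar + ntilde x) \<and>
          periodic_fun \<beta> ntilde \<and>
          \<mu>\<^sub>1 \<le> nbar \<and> nbar \<le> \<mu>\<^sub>2 \<and>
          integral {0..\<beta>} (\<lambda>x. \<bar>ntilde x\<bar>) < \<epsilon>
          \<longrightarrow>
          (\<exists>u :: nat \<Rightarrow> real \<Rightarrow> real.
             (\<forall>k < 2 * K.
                caratheodory_sol g n F (u k) \<and>
                periodic_fun (real m * \<beta>) (u k) \<and>
                (\<forall>x. 0 < u k x \<and> u k x < 1) \<and>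
                (\<forall>i\<in>{1..m-1}. \<not> periodic_fun (real i * \<beta>) (u k))) \<and>
             (\<forall>k < 2 * K. \<forall>l < 2 * K. k \<noteq> l \<longrightarrow>
                \<not> same_periodicity_class \<beta> m (u k) (u l))))"
    unfolding P_def .
qed

end
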